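(* Let $\Omega\subseteq[0,1]^d$ be Peano–Jordan measurable with $\mu(\Omega)>0$. The map $\mathcal S^\Omega:\mathcal G_d^\Omega/\mathcal Z\to\mathcal M_\Omega$, sending the class of a reduced GLT sequence (with respect to $\Omega$) to its reduced GLT symbol, is an isomorphism of algebras.
   Context: Fix $d\ge1$ and a sequence of $d$-indices $\mathbf n=\mathbf n(n)=(n_1,\dots,n_d)\in\mathbb N^d$, with $\min_jn_j\to\infty$ as $n\to\infty$; $N(\mathbf n)=\prod_jn_j$. Operations on multi-indices are componentwise, $\mathbf 1=(1,\dots,1)$. Matrices of size $N(\mathbf n)$ have rows and columns indexed by the $d$-indices $\mathbf 1\le\mathbf i\le\mathbf n$ in lexicographic order. $\mu$ is Lebesgue measure. $\Omega$ is Peano–Jordan measurable iff $\chi_\Omega$ is a.e. continuous, i.e. $\mu(\partial\Omega)=0$. a.c.s. convergence. For matrices of size $d_n$, $\{B_{n,m}\}_n\xrightarrow{\text{a.c.s.}}\{A_n\}_n$ as $m\to\infty$ means: for every $m$ there is $n_m$ such that for $n>n_m$ one can write $A_n=B_{n,m}+N_{n,m}+R_{n,m}$ with spectral norm $\|N_{n,m}\|\le\omega(m)$ and $\mathrm{rank}(R_{n,m})\le c(m)d_n$, where $\omega(m),c(m)\to0$. GLT sequences. For $f\in L^1([-\pi,\pi]^d)$, $T_{\mathbf n}(f)=[f_{\mathbf i-\mathbf j}]_{\mathbf i,\mathbf j=\mathbf 1}^{\mathbf n}$ with $f_{\mathbf k}=(2\pi)^{-d}\int_{[-\pi,\pi]^d}f(\theta)e^{-\mathrm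 i\,\mathbf k\cdot\theta}d\theta$; for $a:[0,1]^d\to\mathbb C$, $D_{\mathbf n}(a)=\mathrm{diag}(a(\mathbf i/\mathbf n))_{\mathbf i=\mathbf 1}^{\mathbf n}$. A sequence $\{A_{\mathbf n}\}_n$ with $A_{\mathbf n}$ of size $N(\mathbf n)$ is a ($d$-level) GLT sequence with symbol the measurable function $k:[0,1]^d\times[-\pi,\pi]^d\to\mathbb C$, written $\{A_{\mathbf n}\}_n\sim_{GLT}k$, iff there are finitely many (for each $m$) $a_{i,m}\in C^\infty([0,1]^d)$ and trigonometric polynomials $f_{i,m}$ in $d$ variables such that $\sum_ia_{i,m}(x)f_{i,m}(\theta)\to k$ in measure and $\{\sum_iD_{\mathbf n}(a_{i,m})T_{\mathbf n}(f_{i,m})\}_n\xrightarrow{\text{a.c.s.}}\{A_{\mathbf n}\}_n$ as $m\to\infty$ (a standard characterization of GLT sequences). The symbol is unique a.e. Reduced GLT. $d_n^\Omega$ is the number of $\mathbf 1\le\mathbf i\le\mathbf n$ with $\mathbf i/(\mathbf n+\mathbf 1)\in\Omega$; $R_\Omega$ sends a matrix of size $N(\mathbf n)$ to its $d_n^\Omega\times d_n^\Omega$ principal submatrix on those indices (kept in lexicographic order), applied to sequences termwise. A sequence $\{S^\Omega_{\mathbf n}\}_n$ is a reduced GLT sequence with respect to $\Omega$ if it equals $R_\Omega(\{A_{\mathbf n}\}_n)$ for some GLT sequence $\{A_{\mathbf n}\}_n\sim_{GLT}k$; its reduced GLT symbol is $k|_{\Omega\times[-\pi,\pi]^d}$ (well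 defined a.e.). $\mathcal G_d^\Omega$ is the set of reduced GLT sequences with respect to $\Omega$, with termwise linear combinations and products; $\mathcal Z$ is the set of zero-distributed sequences $\{Z^\Omega_{\mathbf n}\}_n$ of matrices of size $d_n^\Omega$, i.e. $\frac1{d_n^\Omega}\sum_{i=1}^{d_n^\Omega}F(\sigma_i(Z^\Omega_{\mathbf n}))\to F(0)$ for all $F\in C_c(\mathbb R)$ ($\sigma_i$ singular values); $\mathcal M_\Omega$ is the algebra of measurable functions $\Omega\times[-\pi,\pi]^d\to\mathbb C$ (identified when equal a.e.) with pointwise operations. *)

theory Defs
  imports
    "HOL-Analysis.Analysis"
    "HOL-Algebra.QuotRing"
    "Jordan_Normal_Form.DL_Rank_Submatrix"
    "Jordan_Normal_Form.Schur_Decomposition"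
begin

no_notation Matrix.vec_index (infixl \<open>$\<close> 100)
no_notation Matrix.scalar_prod (infix \<open>\<bullet>\<close> 70)

section \<open>Multi-indices\<close>

text \<open>
  The number of levels d is \<open>CARD('d)\<close>; the linear order on \<open>'d\<close> is the order of the
  coordinates, used only for the lexicographic order. Since the order on \<open>nat ^ 'd\<close> is
  componentwise, the d-indices between 1 and \<open>n\<close> are \<open>{1..n}\<close>.
\<close>

definition N_of :: "nat ^ 'd \<Rightarrow> nat" where
  "N_of n = (\<Prod>j\<in>UNIV. n $ j)"

definition lex_less :: "nat ^ 'd::{finite,linorder} \<Rightarrow> nat ^ 'd::{finite,linorder} \<Rightarrow> bool" where
  "lex_less i j \<longleftrightarrow> (\<exists>r. i $ r < j $ r \<and> (\<forall>s<r. i $ s = j $ s))"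

text \<open>The matrices below are indexed from 0: row \<open>p < N_of n\<close> belongs to the d-index \<open>midx n p\<close>.\<close>

definition midx :: "nat ^ 'd::{finite,linorder} \<Rightarrow> nat \<Rightarrow> nat ^ 'd::{finite,linorder}" where
  "midx n p = (THE i. i \<in> {1..n} \<and> card {j \<in> {1..n}. lex_less j i} = p)"

definition idx_div :: "nat ^ 'd \<Rightarrow> nat ^ 'd \<Rightarrow> real ^ 'd" where
  "idx_div i n = (\<chi> j. real (i $ j) / real (n $ j))"

section \<open>Spectral norm, singular values, a.c.s. convergence\<close>

definition vnorm :: "complex Matrix.vec \<Rightarrow> real" where
  "vnorm v = sqrt (\<Sum>p<dim_vec v. (cmod (Matrix.vec_index v p))\<^sup>2)"

definition spectral_norm :: "complex mat \<Rightarrow> real" where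
  "spectral_norm A = (SUP v\<in>{v \<in> carrier_vec (dim_col A). vnorm v \<le> 1}. vnorm (A *\<^sub>v v))"

definition singular_values :: "complex mat \<Rightarrow> real multiset" where
  "singular_values A = image_mset (\<lambda>z. sqrt (Re z)) (proots (char_poly (mat_adjoint A * A)))"

definition acs :: "(nat \<Rightarrow> nat) \<Rightarrow> (nat \<Rightarrow> nat \<Rightarrow> complex mat) \<Rightarrow> (nat \<Rightarrow> complex mat) \<Rightarrow> bool" where
  "acs d B A \<longleftrightarrow>
    (\<exists>\<omega> c :: nat \<Rightarrow> real. \<omega> \<longlonglongrightarrow> 0 \<and> c \<longlonglongrightarrow> 0 \<and>
      (\<forall>m. \<exists>n0. \<forall>n>n0. \<exists>N R.
         N \<in> carrier_mat (d n) (d n) \<and> R \<in> carrier_mat (d n) (d n) \<and>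
         A n = B n m + N + R \<and>
         spectral_norm N \<le> \<omega> m \<and>
         real (vec_space.rank (d n) R) \<le> c m * real (d n)))"

section \<open>GLT sequences\<close>

abbreviation freq_cube :: "(real ^ 'd) set" where
  "freq_cube \<equiv> cbox (\<chi> j. - pi) (\<chi> j. pi)"

text \<open>
  \<open>C_k_on\<close> uses derivatives relative to \<open>S\<close>, hence one-sided ones at the boundary of a closed
  cube; \<open>g j\<close> is the partial derivative in the j-th coordinate.
\<close>

primrec C_k_on :: "nat \<Rightarrow> (real ^ 'd) set \<Rightarrow> (real ^ 'd \<Rightarrow> complex) \<Rightarrow> bool" where
  "C_k_on 0 S a \<longleftrightarrow> continuous_on S a"
| "C_k_on (Suc k) S a \<longleftrightarrow>
    (\<exists>g. (\<forall>j. C_k_on k S (g j)) \<and>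
         (\<forall>x\<in>S. (a has_derivative (\<lambda>h. \<Sum>j\<in>UNIV. (h $ j) *\<^sub>R g j x)) (at x within S)))"

definition C_inf_on :: "(real ^ 'd) set \<Rightarrow> (real ^ 'd \<Rightarrow> complex) \<Rightarrow> bool" where
  "C_inf_on S a \<longleftrightarrow> (\<forall>k. C_k_on k S a)"

definition char_fun :: "int ^ 'd \<Rightarrow> real ^ 'd \<Rightarrow> complex" where
  "char_fun k \<theta> = exp (\<i> * of_real (\<Sum>j\<in>UNIV. of_int (k $ j) * \<theta> $ j))"

definition trig_poly :: "(real ^ 'd \<Rightarrow> complex) \<Rightarrow> bool" where
  "trig_poly f \<longleftrightarrow> (\<exists>K c. finite K \<and> f = (\<lambda>\<theta>. \<Sum>k\<in>K. c k * char_fun k \<theta>))"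

definition fourier_coeff :: "(real ^ 'd \<Rightarrow> complex) \<Rightarrow> int ^ 'd \<Rightarrow> complex" where
  "fourier_coeff f k =
    (LINT \<theta>:freq_cube|lebesgue. f \<theta> * char_fun (- k) \<theta>) / of_real ((2 * pi) ^ CARD('d))"

definition toeplitz :: "nat ^ 'd::{finite,linorder} \<Rightarrow> (real ^ 'd::{finite,linorder} \<Rightarrow> complex) \<Rightarrow> complex mat" where
  "toeplitz n f = mat (N_of n) (N_of n)
    (\<lambda>(p, q). fourier_coeff f (\<chi> j. int (midx n p $ j) - int (midx n q $ j)))"

definition diag_sampling :: "nat ^ 'd::{finite,linorder} \<Rightarrow> (real ^ 'd::{finite,linorder} \<Rightarrow> complex) \<Rightarrow> complex mat" where
  "diag_sampling n a = mat_diag (N_of n) (\<lambda>p. a (idx_div (midx n p) n))"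

definition conv_in_measure ::
  "('a::euclidean_space) set \<Rightarrow> (nat \<Rightarrow> 'a \<Rightarrow> complex) \<Rightarrow> ('a \<Rightarrow> complex) \<Rightarrow> bool" where
  "conv_in_measure D f g \<longleftrightarrow>
    (\<forall>\<epsilon>>0. (\<lambda>m. emeasure lebesgue {z \<in> D. cmod (f m z - g z) > \<epsilon>}) \<longlonglongrightarrow> 0)"

definition glt ::
  "(nat \<Rightarrow> nat ^ 'd::{finite,linorder}) \<Rightarrow> (nat \<Rightarrow> complex mat) \<Rightarrow>
    ((real ^ 'd::{finite,linorder}) \<times> (real ^ 'd::{finite,linorder}) \<Rightarrow> complex) \<Rightarrow> bool" where
  "glt \<nn> A k \<longleftrightarrow>
    (\<forall>n. A n \<in> carrier_mat (N_of (\<nn> n)) (N_of (\<nn> n))) \<and>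
    k \<in> borel_measurable (lebesgue_on (cbox 0 1 \<times> freq_cube)) \<and>
    (\<exists>(r :: nat \<Rightarrow> nat) a f.
       (\<forall>m. \<forall>i<r m. C_inf_on (cbox 0 1) (a i m) \<and> trig_poly (f i m)) \<and>
       conv_in_measure (cbox 0 1 \<times> freq_cube) (\<lambda>m (x, \<theta>). \<Sum>i<r m. a i m x * f i m \<theta>) k \<and>
       acs (\<lambda>n. N_of (\<nn> n))
         (\<lambda>n m. mat (N_of (\<nn> n)) (N_of (\<nn> n))
            (\<lambda>pq. \<Sum>i<r m. (diag_sampling (\<nn> n) (a i m) * toeplitz (\<nn> n) (f i m)) $$ pq))
         A)"

section \<open>Reduced GLT sequences\<close>

text \<open>A null boundary means that the indicator function of \<open>\<Omega>\<close> is continuous almost everywhere.\<close>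

definition peano_jordan :: "(real ^ 'd) set \<Rightarrow> bool" where
  "peano_jordan \<Omega> \<longleftrightarrow> frontier \<Omega> \<in> null_sets lebesgue"

definition d_red :: "nat ^ 'd \<Rightarrow> (real ^ 'd) set \<Rightarrow> nat" where
  "d_red n \<Omega> = card {i \<in> {1..n}. idx_div i (n + 1) \<in> \<Omega>}"

definition restr_mat ::
  "nat ^ 'd::{finite,linorder} \<Rightarrow> (real ^ 'd::{finite,linorder}) set \<Rightarrow> complex mat \<Rightarrow> complex mat" where
  "restr_mat n \<Omega> A =
    (let I = {p. p < N_of n \<and> idx_div (midx n p) (n + 1) \<in> \<Omega>} in submatrix A I I)"

text \<open>
  \<open>k\<close> is defined on the whole cube; as a reduced symbol it only matters almost everywhere
  on \<open>\<Omega> \<times> freq_cube\<close>, and its class in \<open>M_alg \<Omega>\<close> below depends on nothing else.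
\<close>

definition reduced_glt ::
  "(nat \<Rightarrow> nat ^ 'd::{finite,linorder}) \<Rightarrow> (real ^ 'd::{finite,linorder}) set \<Rightarrow> (nat \<Rightarrow> complex mat) \<Rightarrow>
    ((real ^ 'd::{finite,linorder}) \<times> (real ^ 'd::{finite,linorder}) \<Rightarrow> complex) \<Rightarrow> bool" where
  "reduced_glt \<nn> \<Omega> S k \<longleftrightarrow> (\<exists>A. glt \<nn> A k \<and> S = (\<lambda>n. restr_mat (\<nn> n) \<Omega> (A n)))"

definition zero_distributed ::
  "(nat \<Rightarrow> nat ^ 'd) \<Rightarrow> (real ^ 'd) set \<Rightarrow> (nat \<Rightarrow> complex mat) \<Rightarrow> bool" where
  "zero_distributed \<nn> \<Omega> Z \<longleftrightarrow>
    (\<forall>n. Z n \<in> carrier_mat (d_red (\<nn> n) \<Omega>) (d_red (\<nn> n) \<Omega>)) \<and>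
    (\<forall>F :: real \<Rightarrow> complex. continuous_on UNIV F \<longrightarrow> compact (closure {x. F x \<noteq> 0}) \<longrightarrow>
      (\<lambda>n. (\<Sum>\<sigma>\<in>#singular_values (Z n). F \<sigma>) / of_nat (d_red (\<nn> n) \<Omega>)) \<longlonglongrightarrow> F 0)"

section \<open>Associative unital algebras and their quotients\<close>

text \<open>The library's \<^locale>\<open>algebra\<close> is restricted to commutative algebras.\<close>

locale assoc_algebra = module R A + ring A for R (structure) and A (structure) +
  assumes smult_mult_left:
      "\<lbrakk>c \<in> carrier R; x \<in> carrier A; y \<in> carrier A\<rbrakk> \<Longrightarrow>
        (c \<odot>\<^bsub>A\<^esub> x) \<otimes>\<^bsub>A\<^esub> y = c \<odot>\<^bsub>A\<^esub> (x \<otimes>\<^bsub>A\<^esub> y)"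
    and smult_mult_right:
      "\<lbrakk>c \<in> carrier R; x \<in> carrier A; y \<in> carrier A\<rbrakk> \<Longrightarrow>
        x \<otimes>\<^bsub>A\<^esub> (c \<odot>\<^bsub>A\<^esub> y) = c \<odot>\<^bsub>A\<^esub> (x \<otimes>\<^bsub>A\<^esub> y)"

definition FactAlg :: "('c, 'a) module \<Rightarrow> 'a set \<Rightarrow> ('c, 'a set) module" where
  "FactAlg A I = ring.extend (A Quot I)
     (module.fields (\<lambda>c X. \<Union>x\<in>X. I +>\<^bsub>A\<^esub> (c \<odot>\<^bsub>A\<^esub> x)))"

definition alg_iso ::
  "'c ring \<Rightarrow> ('c, 'a) module \<Rightarrow> ('c, 'b) module \<Rightarrow> ('a \<Rightarrow> 'b) set" where
  "alg_iso R A B = {h \<in> ring_iso A B.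
     \<forall>c\<in>carrier R. \<forall>x\<in>carrier A. h (c \<odot>\<^bsub>A\<^esub> x) = c \<odot>\<^bsub>B\<^esub> h x}"

section \<open>The algebras and the symbol map\<close>

definition G_alg ::
  "(nat \<Rightarrow> nat ^ 'd::{finite,linorder}) \<Rightarrow> (real ^ 'd::{finite,linorder}) set \<Rightarrow> (complex, nat \<Rightarrow> complex mat) module"
where
  "G_alg \<nn> \<Omega> = \<lparr>
     carrier = {S. \<exists>k. reduced_glt \<nn> \<Omega> S k},
     mult = (\<lambda>S T n. S n * T n),
     one = (\<lambda>n. 1\<^sub>m (d_red (\<nn> n) \<Omega>)),
     zero = (\<lambda>n. 0\<^sub>m (d_red (\<nn> n) \<Omega>) (d_red (\<nn> n) \<Omega>)),
     add = (\<lambda>S T n. S n + T n),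
     smult = (\<lambda>c S n. c \<cdot>\<^sub>m S n)\<rparr>"

definition Z_ideal :: "(nat \<Rightarrow> nat ^ 'd) \<Rightarrow> (real ^ 'd) set \<Rightarrow> (nat \<Rightarrow> complex mat) set" where
  "Z_ideal \<nn> \<Omega> = {Z. zero_distributed \<nn> \<Omega> Z}"

definition meas_alg ::
  "'a::euclidean_space set \<Rightarrow> (complex, 'a \<Rightarrow> complex) module" where
  "meas_alg D = \<lparr>
     carrier = borel_measurable (lebesgue_on D),
     mult = (\<lambda>f g z. f z * g z),
     one = (\<lambda>z. 1),
     zero = (\<lambda>z. 0),
     add = (\<lambda>f g z. f z + g z),
     smult = (\<lambda>c f z. c * f z)\<rparr>"

definition null_funs :: "'a::euclidean_space set \<Rightarrow> ('a \<Rightarrow> complex) set" where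
  "null_funs D = {f \<in> borel_measurable (lebesgue_on D). AE z in lebesgue_on D. f z = 0}"

text \<open>
  Functions on \<open>D\<close> are represented by total functions with arbitrary values outside \<open>D\<close>; the
  quotient by \<open>null_funs D\<close> identifies exactly those that agree almost everywhere on \<open>D\<close>.
\<close>

definition M_alg ::
  "(real ^ 'd) set \<Rightarrow> (complex, ((real ^ 'd) \<times> (real ^ 'd) \<Rightarrow> complex) set) module" where
  "M_alg \<Omega> = FactAlg (meas_alg (\<Omega> \<times> freq_cube)) (null_funs (\<Omega> \<times> freq_cube))"

definition ae_class ::
  "(real ^ 'd) set \<Rightarrow> ((real ^ 'd) \<times> (real ^ 'd) \<Rightarrow> complex) \<Rightarrow> ((real ^ 'd) \<times> (real ^ 'd) \<Rightarrow> complex) set"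
where
  "ae_class \<Omega> k = null_funs (\<Omega> \<times> freq_cube) +>\<^bsub>meas_alg (\<Omega> \<times> freq_cube)\<^esub> k"

text \<open>
  The union runs over all reduced symbols of all members of the class \<open>X\<close>; it is a single
  element of \<open>M_alg \<Omega>\<close> exactly when these symbols agree almost everywhere.
\<close>

definition symbol_map ::
  "(nat \<Rightarrow> nat ^ 'd::{finite,linorder}) \<Rightarrow> (real ^ 'd::{finite,linorder}) set \<Rightarrow> (nat \<Rightarrow> complex mat) set \<Rightarrow>
    ((real ^ 'd::{finite,linorder}) \<times> (real ^ 'd::{finite,linorder}) \<Rightarrow> complex) set" where
  "symbol_map \<nn> \<Omega> X = (\<Union>S\<in>X. \<Union>k\<in>{k. reduced_glt \<nn> \<Omega> S k}. ae_class \<Omega> k)"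

end

theory Submission
  imports Defs
begin

text \<open>
  Call a matrix sequence small if, for every \<open>\<epsilon>\<close>, it eventually splits into a part of norm at most
  \<open>\<epsilon>\<close> and a part of rank at most \<open>\<epsilon>\<close> times the size. GLT sequences are the limits, modulo small
  sequences, of the explicit matrices of trigonometric symbols \<open>\<Sum>k. c k x * char_fun k \<theta>\<close>. Up to
  terms of small Frobenius norm these matrices multiply like their symbols, so normalised traces
  of powers converge to integrals and, by Weierstrass, a sequence of such matrices is small iff
  the symbols are small in measure. Hence symbols add and multiply, a sequence is small iff its
  symbol vanishes almost everywhere, and completeness gives every measurable symbol. The
  projection onto the indices in \<open>\<Omega>\<close> is itself a GLT sequence with symbol \<open>indicator \<Omega>\<close>, because
  the frontier of \<open>\<Omega>\<close> is null; compression by it transfers all this to principal submatrices.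
\<close>

text \<open>Smallness is measured by the number of singular values above a threshold: a square
  matrix is a part of norm at most \<open>\<epsilon>\<close> plus a part of rank at most
  \<open>r\<close> exactly when at most \<open>r\<close> of its singular values exceed
  \<open>\<epsilon>\<close>. This turns the existential splitting in \<open>acs\<close> and the test
  functions in \<open>zero_distributed\<close> into one quantity, which traces of powers of
  \<open>mat_adjoint A * A\<close> control. The calculus runs with continuous coefficients;
  trigonometric ones, which are smooth, enter by approximation. Restriction to the indices in
  \<open>\<Omega>\<close> is not multiplicative: with \<open>P\<close> the projection, the product
  of the restrictions of \<open>A\<close> and \<open>B\<close> is the restriction of
  \<open>A * P * B\<close>. The symbol of this product is right only on \<open>\<Omega>\<close>, so
  the proof works with a relation \<open>rho\<close> between sequences and functions that looks only
  at \<open>\<Omega> \<times> freq_cube\<close>; the algebra follows from its closure properties and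
  its kernel. Reduced and full sizes are comparable because positive measure and a null frontier
  give \<open>\<Omega>\<close> an interior point, hence eventually a positive proportion of the
  indices.\<close>

notation Matrix.vec_index (infixl \<open>$v\<close> 100)

section \<open>Complex matrices: adjoint, norms, rank\<close>

lemma mat_mult_index:
  assumes "A \<in> carrier_mat n m" "B \<in> carrier_mat m k" "i < n" "j < k"
  shows "(A * B) $$ (i, j) = (\<Sum>l<m. A $$ (i, l) * B $$ (l, j))"
  using assms by (auto simp: scalar_prod_def atLeast0LessThan intro!: sum.cong)

lemma mat_vec_index:
  assumes "A \<in> carrier_mat n m" "v \<in> carrier_vec m" "i < n"
  shows "(A *\<^sub>v v) $v i = (\<Sum>l<m. A $$ (i, l) * v $v l)"
  using assms by (auto simp: scalar_prod_def atLeast0LessThan intro!: sum.cong)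

lemma mat_adjoint_dim [simp]:
  "dim_row (mat_adjoint A) = dim_col A" "dim_col (mat_adjoint A) = dim_row A"
  by (auto simp: mat_adjoint_def)

lemma mat_adjoint_carrier [simp]:
  "A \<in> carrier_mat n m \<Longrightarrow> mat_adjoint A \<in> carrier_mat m n"
  by (auto simp: mat_adjoint_def)

lemma mat_adjoint_index [simp]:
  fixes A :: "complex mat"
  assumes "i < dim_col A" "j < dim_row A"
  shows "mat_adjoint A $$ (i, j) = cnj (A $$ (j, i))"
  using assms by (simp add: mat_adjoint_def mat_of_rows_index)

lemma mat_adjoint_adjoint [simp]: "mat_adjoint (mat_adjoint A) = (A :: complex mat)"
  by (rule eq_matI) auto

lemma mat_adjoint_mult:
  fixes A B :: "complex mat"
  assumes "A \<in> carrier_mat n m" "B \<in> carrier_mat m k"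
  shows "mat_adjoint (A * B) = mat_adjoint B * mat_adjoint A"
proof (rule eq_matI)
  fix i j assume ij: "i < dim_row (mat_adjoint B * mat_adjoint A)" "j < dim_col (mat_adjoint B * mat_adjoint A)"
  then have ij: "i < k" "j < n" using assms by auto
  have "(mat_adjoint B * mat_adjoint A) $$ (i, j) = (\<Sum>l<m. mat_adjoint B $$ (i, l) * mat_adjoint A $$ (l, j))"
    using assms ij by (intro mat_mult_index) auto
  also have "\<dots> = (\<Sum>l<m. cnj (A $$ (j, l) * B $$ (l, i)))"
    using assms ij by (intro sum.cong) auto
  also have "\<dots> = mat_adjoint (A * B) $$ (i, j)"
    using assms ij by (subst mat_adjoint_index) (auto simp: mat_mult_index[OF assms] simp del: index_mult_mat(1))
  finally show "mat_adjoint (A * B) $$ (i, j) = (mat_adjoint B * mat_adjoint A) $$ (i, j)" ..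
qed (use assms in auto)

definition ip :: "complex Matrix.vec \<Rightarrow> complex Matrix.vec \<Rightarrow> complex" where
  "ip v w = (\<Sum>i<dim_vec v. v $v i * cnj (w $v i))"

lemma ip_self: "ip v v = of_real ((vnorm v)\<^sup>2)"
  by (simp add: ip_def vnorm_def sum_nonneg complex_norm_square[symmetric])

lemma ip_adjoint:
  assumes "A \<in> carrier_mat n m" "v \<in> carrier_vec m" "w \<in> carrier_vec n"
  shows "ip (A *\<^sub>v v) w = ip v (mat_adjoint A *\<^sub>v w)"
proof -
  have "ip (A *\<^sub>v v) w = (\<Sum>i<n. \<Sum>l<m. A $$ (i, l) * v $v l * cnj (w $v i))"
    using assms by (auto simp: ip_def mat_vec_index[OF assms(1,2)] sum_distrib_right simp del: index_mult_mat_vec)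
  also have "\<dots> = (\<Sum>l<m. \<Sum>i<n. A $$ (i, l) * v $v l * cnj (w $v i))"
    by (rule sum.swap)
  also have "\<dots> = ip v (mat_adjoint A *\<^sub>v w)"
    using assms by (auto simp: ip_def mat_vec_index[of "mat_adjoint A" m n] sum_distrib_left mult_ac
        intro!: sum.cong simp del: index_mult_mat_vec)
  finally show ?thesis .
qed

lemma vnorm_nonneg [simp]: "vnorm v \<ge> 0"
  by (simp add: vnorm_def sum_nonneg)

lemma vnorm_sq: "(vnorm v)\<^sup>2 = (\<Sum>i<dim_vec v. (cmod (v $v i))\<^sup>2)"
  by (simp add: vnorm_def sum_nonneg)

lemma vnorm_L2: "vnorm v = L2_set (\<lambda>i. cmod (v $v i)) {..<dim_vec v}"
  by (simp add: vnorm_def L2_set_def)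

lemma vnorm_add:
  assumes "dim_vec v = dim_vec w" shows "vnorm (v + w) \<le> vnorm v + vnorm w"
proof -
  have "vnorm (v + w) \<le> L2_set (\<lambda>i. cmod (v $v i) + cmod (w $v i)) {..<dim_vec w}"
    unfolding vnorm_L2 by (simp, rule L2_set_mono) (simp_all add: norm_triangle_ineq)
  also have "\<dots> \<le> vnorm v + vnorm w"
    unfolding vnorm_L2 assms by (rule L2_set_triangle_ineq)
  finally show ?thesis .
qed

lemma vnorm_smult: "vnorm (c \<cdot>\<^sub>v v) = cmod c * vnorm v"
  by (simp add: vnorm_def norm_mult power_mult_distrib real_sqrt_mult flip: sum_distrib_left)

lemma vnorm_zero [simp]: "vnorm (0\<^sub>v n) = 0"
  by (simp add: vnorm_def)

lemma vnorm_eq_0: "v \<in> carrier_vec n \<Longrightarrow> vnorm v = 0 \<longleftrightarrow> v = 0\<^sub>v n"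
  by (auto simp: vnorm_def sum_nonneg_eq_0_iff)

lemma cmod_ip_le: "dim_vec v = dim_vec w \<Longrightarrow> cmod (ip v w) \<le> vnorm v * vnorm w"
  unfolding vnorm_L2 ip_def
  using L2_set_mult_ineq[of "\<lambda>i. cmod (v $v i)" "\<lambda>i. cmod (w $v i)" "{..<dim_vec v}"]
  by (intro order_trans[OF sum_norm_le[OF order_refl]]) (auto simp: norm_mult)

text \<open>An upper bound for the operator norm that involves no supremum;
  \<open>spectral_norm_le_iff\<close> makes the link to \<open>spectral_norm\<close> for
  \<open>M \<ge> 0\<close>.\<close>

definition nbound :: "complex mat \<Rightarrow> real \<Rightarrow> bool" where
  "nbound A M \<longleftrightarrow> (\<forall>v\<in>carrier_vec (dim_col A). vnorm (A *\<^sub>v v) \<le> M * vnorm v)"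

lemma nboundD: "nbound A M \<Longrightarrow> v \<in> carrier_vec (dim_col A) \<Longrightarrow> vnorm (A *\<^sub>v v) \<le> M * vnorm v"
  by (simp add: nbound_def)

lemma nbound_mono: "nbound A M \<Longrightarrow> M \<le> M' \<Longrightarrow> nbound A M'"
  unfolding nbound_def by (meson mult_right_mono order_trans vnorm_nonneg)

lemma nbound_add:
  assumes "A \<in> carrier_mat n m" "B \<in> carrier_mat n m" "nbound A M" "nbound B M'"
  shows "nbound (A + B) (M + M')"
  unfolding nbound_def
proof
  fix v :: "complex Matrix.vec" assume "v \<in> carrier_vec (dim_col (A + B))"
  then have v: "v \<in> carrier_vec m" using assms by auto
  have "vnorm ((A + B) *\<^sub>v v) \<le> vnorm (A *\<^sub>v v) + vnorm (B *\<^sub>v v)"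
    using assms v by (subst add_mult_distrib_mat_vec) (auto intro!: vnorm_add)
  also have "\<dots> \<le> M * vnorm v + M' * vnorm v"
    using assms v by (intro add_mono nboundD) auto
  finally show "vnorm ((A + B) *\<^sub>v v) \<le> (M + M') * vnorm v" by (simp add: algebra_simps)
qed

lemma nbound_mult:
  assumes "A \<in> carrier_mat n m" "B \<in> carrier_mat m k" "nbound A M" "nbound B M'" "M \<ge> 0"
  shows "nbound (A * B) (M * M')"
  unfolding nbound_def
proof
  fix v :: "complex Matrix.vec" assume "v \<in> carrier_vec (dim_col (A * B))"
  then have v: "v \<in> carrier_vec k" using assms by auto
  have "vnorm ((A * B) *\<^sub>v v) = vnorm (A *\<^sub>v (B *\<^sub>v v))"
    using assms v by (subst assoc_mult_mat_vec) auto
  also have "\<dots> \<le> M * vnorm (B *\<^sub>v v)"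
    using assms v by (intro nboundD) auto
  also have "\<dots> \<le> M * (M' * vnorm v)"
    using assms v by (intro mult_left_mono nboundD) auto
  finally show "vnorm ((A * B) *\<^sub>v v) \<le> (M * M') * vnorm v" by (simp add: algebra_simps)
qed

lemma nbound_smult:
  assumes "nbound A M" shows "nbound (c \<cdot>\<^sub>m A) (cmod c * M)"
  unfolding nbound_def
proof
  fix v :: "complex Matrix.vec" assume "v \<in> carrier_vec (dim_col (c \<cdot>\<^sub>m A))"
  then have v: "v \<in> carrier_vec (dim_col A)" by auto
  have "(c \<cdot>\<^sub>m A) *\<^sub>v v = c \<cdot>\<^sub>v (A *\<^sub>v v)"
    using v by (intro eq_vecI) auto
  then show "vnorm ((c \<cdot>\<^sub>m A) *\<^sub>v v) \<le> (cmod c * M) * vnorm v"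
    using nboundD[OF assms v] by (auto simp: vnorm_smult mult.assoc intro!: mult_left_mono)
qed

lemma nbound_zero [simp]: "M \<ge> 0 \<Longrightarrow> nbound (0\<^sub>m n m) M"
proof -
  have "vnorm (0\<^sub>m n m *\<^sub>v v) = 0" if "v \<in> carrier_vec m" for v
    using that by (auto simp: vnorm_def)
  then show "M \<ge> 0 \<Longrightarrow> nbound (0\<^sub>m n m) M" by (auto simp: nbound_def)
qed

text \<open>Let \<open>u\<close> be the image of \<open>w\<close> under the adjoint. Moving
  \<open>A\<close> across \<open>ip\<close> and applying Cauchy-Schwarz bounds the square of the
  norm of \<open>u\<close> by \<open>M * vnorm u * vnorm w\<close>, and one factor
  \<open>vnorm u\<close> cancels.\<close>

lemma nbound_adjoint:
  assumes "nbound A M" "M \<ge> 0" shows "nbound (mat_adjoint A) M"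
  unfolding nbound_def
proof
  fix w :: "complex Matrix.vec" assume "w \<in> carrier_vec (dim_col (mat_adjoint A))"
  then have w: "w \<in> carrier_vec (dim_row A)" by simp
  define u where "u = mat_adjoint A *\<^sub>v w"
  have u: "u \<in> carrier_vec (dim_col A)" unfolding u_def using w by (intro mult_mat_vec_carrier[of _ _ "dim_row A"] mat_adjoint_carrier carrier_matI) auto
  have "complex_of_real ((vnorm u)\<^sup>2) = ip u (mat_adjoint A *\<^sub>v w)" by (fold u_def) (simp only: ip_self)
  also have "\<dots> = ip (A *\<^sub>v u) w" by (rule ip_adjoint[symmetric, of A "dim_row A" "dim_col A"]) (use u w in auto)
  finally have "(vnorm u)\<^sup>2 = cmod (ip (A *\<^sub>v u) w)"
    by (metis norm_of_real abs_power2)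
  also have "\<dots> \<le> vnorm (A *\<^sub>v u) * vnorm w" using u w by (intro cmod_ip_le) auto
  also have "\<dots> \<le> (M * vnorm u) * vnorm w" using nboundD[OF assms(1) u] by (intro mult_right_mono) auto
  finally have "vnorm u * vnorm u \<le> vnorm u * (M * vnorm w)" by (simp add: power2_eq_square mult_ac)
  then show "vnorm u \<le> M * vnorm w" unfolding u_def
    by (cases "vnorm u = 0") (use assms(2) vnorm_nonneg[of u] in \<open>auto simp: u_def[symmetric] mult_le_cancel_left\<close>)
qed

text \<open>The square of the Frobenius norm.\<close>

definition frob :: "complex mat \<Rightarrow> real" where
  "frob A = (\<Sum>i<dim_row A. \<Sum>j<dim_col A. (cmod (A $$ (i, j)))\<^sup>2)"

lemma frob_nonneg: "frob A \<ge> 0"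
  by (auto simp: frob_def intro!: sum_nonneg)

lemma frob_adjoint: "frob (mat_adjoint A) = frob A"
  unfolding frob_def by (subst sum.swap) auto

lemma frob_add_le:
  assumes "A \<in> carrier_mat n m" "B \<in> carrier_mat n m"
  shows "frob (A + B) \<le> 2 * (frob A + frob B)"
proof -
  have *: "(cmod (a + b))\<^sup>2 \<le> 2 * ((cmod a)\<^sup>2 + (cmod b)\<^sup>2)" for a b
  proof -
    have "(cmod (a + b))\<^sup>2 \<le> (cmod a + cmod b)\<^sup>2" by (intro power_mono norm_triangle_ineq) auto
    also have "\<dots> \<le> 2 * ((cmod a)\<^sup>2 + (cmod b)\<^sup>2)"
      using sum_squares_bound[of "cmod a" "cmod b"] by (simp add: power2_sum)
    finally show ?thesis .
  qed
  have "frob (A + B) = (\<Sum>i<n. \<Sum>j<m. (cmod (A $$ (i, j) + B $$ (i, j)))\<^sup>2)"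
    using assms by (auto simp: frob_def)
  also have "\<dots> \<le> (\<Sum>i<n. \<Sum>j<m. 2 * ((cmod (A $$ (i, j)))\<^sup>2 + (cmod (B $$ (i, j)))\<^sup>2))"
    by (intro sum_mono *)
  also have "\<dots> = 2 * (frob A + frob B)"
    using assms by (auto simp: frob_def sum.distrib simp flip: sum_distrib_left)
  finally show ?thesis .
qed

text \<open>\<open>frob\<close> is the sum of the squared norms of the columns, and the columns of
  \<open>B * X\<close> are the images under \<open>B\<close> of those of \<open>X\<close>.\<close>

lemma frob_mult_left:
  assumes "B \<in> carrier_mat k n" "X \<in> carrier_mat n m" "nbound B C" "C \<ge> 0"
  shows "frob (B * X) \<le> C\<^sup>2 * frob X"
proof -
  have frob_cols: "frob Y = (\<Sum>j<dim_col Y. (vnorm (Matrix.col Y j))\<^sup>2)" for Y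
    unfolding frob_def vnorm_sq by (subst sum.swap) simp
  have "frob (B * X) = (\<Sum>j<m. (vnorm (B *\<^sub>v Matrix.col X j))\<^sup>2)"
    unfolding frob_cols using assms(2) by (intro sum.cong) (simp_all only: index_mult_mat carrier_matD col_mult2[OF assms(1,2)] lessThan_iff)
  also have "\<dots> \<le> (\<Sum>j<m. (C * vnorm (Matrix.col X j))\<^sup>2)"
    using assms by (intro sum_mono power_mono nboundD) auto
  also have "\<dots> = C\<^sup>2 * frob X"
    using assms unfolding frob_cols by (auto simp: power_mult_distrib sum_distrib_left)
  finally show ?thesis .
qed

lemma frob_mult_right:
  assumes "X \<in> carrier_mat k n" "B \<in> carrier_mat n m" "nbound B C" "C \<ge> 0"
  shows "frob (X * B) \<le> C\<^sup>2 * frob X"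
proof -
  have "frob (X * B) = frob (mat_adjoint B * mat_adjoint X)"
    using assms by (simp add: frob_adjoint flip: mat_adjoint_mult)
  also have "\<dots> \<le> C\<^sup>2 * frob (mat_adjoint X)"
    using assms by (intro frob_mult_left nbound_adjoint) auto
  finally show ?thesis by (simp add: frob_adjoint)
qed

text \<open>Cauchy-Schwarz in every row. The bound is crude, but it gives every matrix some
  \<open>nbound\<close>.\<close>

lemma nbound_frob: "nbound A (sqrt (frob A))"
  unfolding nbound_def
proof
  fix v :: "complex Matrix.vec" assume v: "v \<in> carrier_vec (dim_col A)"
  have "(vnorm (A *\<^sub>v v))\<^sup>2 = (\<Sum>i<dim_row A. (cmod (\<Sum>l<dim_col A. A $$ (i, l) * v $v l))\<^sup>2)"
    using v by (auto simp: vnorm_sq mat_vec_index[of A "dim_row A" "dim_col A"] simp del: index_mult_mat_vec)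
  also have "\<dots> \<le> (\<Sum>i<dim_row A. (\<Sum>l<dim_col A. (cmod (A $$ (i, l)))\<^sup>2) * (vnorm v)\<^sup>2)"
  proof (rule sum_mono)
    fix i
    have "cmod (\<Sum>l<dim_col A. A $$ (i, l) * v $v l) \<le> (\<Sum>l<dim_col A. \<bar>cmod (A $$ (i, l))\<bar> * \<bar>cmod (v $v l)\<bar>)"
      by (rule sum_norm_le) (simp add: norm_mult)
    also have "\<dots> \<le> L2_set (\<lambda>l. cmod (A $$ (i, l))) {..<dim_col A} * L2_set (\<lambda>l. cmod (v $v l)) {..<dim_col A}"
      by (rule L2_set_mult_ineq)
    finally have "(cmod (\<Sum>l<dim_col A. A $$ (i, l) * v $v l))\<^sup>2
      \<le> (L2_set (\<lambda>l. cmod (A $$ (i, l))) {..<dim_col A} * L2_set (\<lambda>l. cmod (v $v l)) {..<dim_col A})\<^sup>2"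
      by (rule power_mono) auto
    then show "(cmod (\<Sum>l<dim_col A. A $$ (i, l) * v $v l))\<^sup>2 \<le> (\<Sum>l<dim_col A. (cmod (A $$ (i, l)))\<^sup>2) * (vnorm v)\<^sup>2"
      using v by (simp add: power_mult_distrib L2_set_def vnorm_sq sum_nonneg)
  qed
  also have "\<dots> = (sqrt (frob A) * vnorm v)\<^sup>2"
    by (simp add: frob_def power_mult_distrib sum_nonneg flip: sum_distrib_right)
  finally show "vnorm (A *\<^sub>v v) \<le> sqrt (frob A) * vnorm v"
    by (rule power2_le_imp_le) (simp add: frob_nonneg)
qed

text \<open>A supremum of reals can be compared with \<open>M\<close> once the set is known to be
  nonempty and bounded above; the zero vector and \<open>nbound_frob\<close> provide this. Scaling
  by the inverse norm passes from the unit ball to all vectors.\<close>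

lemma spectral_norm_le_iff:
  assumes "M \<ge> 0" shows "spectral_norm A \<le> M \<longleftrightarrow> nbound A M"
proof -
  let ?S = "{v \<in> carrier_vec (dim_col A). vnorm v \<le> 1}"
  have "0\<^sub>v (dim_col A) \<in> ?S" by simp
  then have ne: "?S \<noteq> {}" by (rule ex_in_conv[THEN iffD1, OF exI])
  have bdd: "bdd_above ((\<lambda>v. vnorm (A *\<^sub>v v)) ` ?S)"
    unfolding bdd_above_def
  proof (intro exI[of _ "sqrt (frob A)"] ballI)
    fix y assume "y \<in> (\<lambda>v. vnorm (A *\<^sub>v v)) ` ?S"
    then obtain v where v: "v \<in> carrier_vec (dim_col A)" "vnorm v \<le> 1" "y = vnorm (A *\<^sub>v v)" by auto
    have "y \<le> sqrt (frob A) * vnorm v" using nboundD[OF nbound_frob v(1)] v(3) by simp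
    also have "\<dots> \<le> sqrt (frob A) * 1" using v(2) by (intro mult_left_mono) (auto simp: frob_nonneg)
    finally show "y \<le> sqrt (frob A)" by simp
  qed
  have "spectral_norm A \<le> M \<longleftrightarrow> (\<forall>v\<in>?S. vnorm (A *\<^sub>v v) \<le> M)"
    unfolding spectral_norm_def by (rule cSUP_le_iff[OF ne bdd])
  also have "\<dots> \<longleftrightarrow> nbound A M"
  proof
    assume *: "\<forall>v\<in>?S. vnorm (A *\<^sub>v v) \<le> M"
    show "nbound A M" unfolding nbound_def
    proof
      fix v :: "complex Matrix.vec" assume v: "v \<in> carrier_vec (dim_col A)"
      show "vnorm (A *\<^sub>v v) \<le> M * vnorm v"
      proof (cases "vnorm v = 0")
        case True
        then have "v = 0\<^sub>v (dim_col A)" using v vnorm_eq_0 by blast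
        then have "A *\<^sub>v v = 0\<^sub>v (dim_row A)" by (intro eq_vecI) (auto simp: scalar_prod_def)
        then show ?thesis using assms by simp
      next
        case False
        define w where "w = complex_of_real (inverse (vnorm v)) \<cdot>\<^sub>v v"
        have "w \<in> ?S" unfolding w_def using v False by (auto simp: vnorm_smult norm_inverse)
        with * have "vnorm (A *\<^sub>v w) \<le> M" by blast
        moreover have "A *\<^sub>v w = complex_of_real (inverse (vnorm v)) \<cdot>\<^sub>v (A *\<^sub>v v)"
          unfolding w_def using v by (intro mult_mat_vec[of A "dim_row A" "dim_col A"]) auto
        ultimately have "inverse (vnorm v) * vnorm (A *\<^sub>v v) \<le> M"
          by (simp add: vnorm_smult norm_inverse)
        then show ?thesis using False vnorm_nonneg[of v] by (simp add: field_simps)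
      qed
    qed
  next
    assume *: "nbound A M"
    show "\<forall>v\<in>?S. vnorm (A *\<^sub>v v) \<le> M"
    proof
      fix v assume v: "v \<in> ?S"
      then have "vnorm (A *\<^sub>v v) \<le> M * vnorm v" using * by (auto intro: nboundD)
      also have "\<dots> \<le> M * 1" using v assms by (intro mult_left_mono) auto
      finally show "vnorm (A *\<^sub>v v) \<le> M" by simp
    qed
  qed
  finally show ?thesis .
qed

text \<open>Encodes rank at most \<open>r\<close> as a sum of \<open>r\<close> products of a column
  and a row. Sums, products and adjoints of such matrices are then immediate, without any argument
  about column spaces.\<close>

definition rank_le :: "complex mat \<Rightarrow> nat \<Rightarrow> bool" where
  "rank_le R r \<longleftrightarrow> (\<exists>f g. \<forall>i<dim_row R. \<forall>j<dim_col R. R $$ (i, j) = (\<Sum>t<r. f t i * g t j))"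

lemma rank_le_mono:
  assumes "rank_le R r" "r \<le> s" shows "rank_le R s"
proof -
  obtain f g where fg: "\<And>i j. i < dim_row R \<Longrightarrow> j < dim_col R \<Longrightarrow> R $$ (i, j) = (\<Sum>t<r. f t i * g t j)"
    using assms(1) unfolding rank_le_def by blast
  have "R $$ (i, j) = (\<Sum>t<s. (if t < r then f t i else 0) * g t j)"
    if "i < dim_row R" "j < dim_col R" for i j
    unfolding fg[OF that] by (rule sum.mono_neutral_cong_left) (use assms(2) in auto)
  then show ?thesis
    unfolding rank_le_def by (intro exI[of _ "\<lambda>t i. if t < r then f t i else 0"] exI[of _ g] allI impI)
qed

lemma rank_le_zero: "rank_le (0\<^sub>m n m) r"
  by (rule rank_le_mono[of _ 0]) (auto simp: rank_le_def)

lemma rank_le_add: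
  assumes "A \<in> carrier_mat n m" "B \<in> carrier_mat n m" "rank_le A r" "rank_le B s"
  shows "rank_le (A + B) (r + s)"
proof -
  obtain f g where fg: "\<And>i j. i < n \<Longrightarrow> j < m \<Longrightarrow> A $$ (i, j) = (\<Sum>t<r. f t i * g t j)"
    using assms(1,3) unfolding rank_le_def by auto
  obtain f' g' where fg': "\<And>i j. i < n \<Longrightarrow> j < m \<Longrightarrow> B $$ (i, j) = (\<Sum>t<s. f' t i * g' t j)"
    using assms(2,4) unfolding rank_le_def by auto
  let ?F = "\<lambda>t i. if t < r then f t i else f' (t - r) i"
  let ?G = "\<lambda>t i. if t < r then g t i else g' (t - r) i"
  have "(A + B) $$ (i, j) = (\<Sum>t<r + s. ?F t i * ?G t j)" if "i < n" "j < m" for i j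
  proof -
    have "(\<Sum>t<r + s. ?F t i * ?G t j) = (\<Sum>t<r. ?F t i * ?G t j) + (\<Sum>t\<in>{r..<r+s}. ?F t i * ?G t j)"
      by (metis (no_types, lifting) atLeast0LessThan le_add1 sum.atLeastLessThan_concat zero_le)
    also have "(\<Sum>t\<in>{r..<r+s}. ?F t i * ?G t j) = (\<Sum>t<s. f' t i * g' t j)"
      by (rule sum.reindex_bij_witness[of _ "\<lambda>t. t + r" "\<lambda>t. t - r"]) auto
    finally show ?thesis using fg[OF that] fg'[OF that] assms that by auto
  qed
  then show ?thesis using assms(1,2) unfolding rank_le_def
    by (intro exI[of _ ?F] exI[of _ ?G]) auto
qed

lemma rank_le_mult_left:
  assumes "A \<in> carrier_mat k n" "R \<in> carrier_mat n m" "rank_le R r"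
  shows "rank_le (A * R) r"
proof -
  obtain f g where fg: "\<And>i j. i < n \<Longrightarrow> j < m \<Longrightarrow> R $$ (i, j) = (\<Sum>t<r. f t i * g t j)"
    using assms(2,3) unfolding rank_le_def by auto
  have "(A * R) $$ (i, j) = (\<Sum>t<r. (\<Sum>l<n. A $$ (i, l) * f t l) * g t j)" if "i < k" "j < m" for i j
  proof -
    have "(A * R) $$ (i, j) = (\<Sum>l<n. \<Sum>t<r. A $$ (i, l) * f t l * g t j)"
      using that by (simp add: mat_mult_index[OF assms(1,2)] fg sum_distrib_left mult.assoc del: index_mult_mat(1))
    also have "\<dots> = (\<Sum>t<r. \<Sum>l<n. A $$ (i, l) * f t l * g t j)" by (rule sum.swap)
    finally show ?thesis by (simp add: sum_distrib_right)
  qed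
  then show ?thesis using assms(1,2) unfolding rank_le_def
    by (intro exI[of _ "\<lambda>t i. \<Sum>l<n. A $$ (i, l) * f t l"] exI[of _ g]) simp
qed

lemma rank_le_adjoint:
  assumes "rank_le R r" shows "rank_le (mat_adjoint R) r"
proof -
  obtain f g where fg: "\<And>i j. i < dim_row R \<Longrightarrow> j < dim_col R \<Longrightarrow> R $$ (i, j) = (\<Sum>t<r. f t i * g t j)"
    using assms unfolding rank_le_def by auto
  show ?thesis unfolding rank_le_def
    by (intro exI[of _ "\<lambda>t i. cnj (g t i)"] exI[of _ "\<lambda>t i. cnj (f t i)"]) (auto simp: fg mult.commute)
qed

lemma rank_le_mult_right:
  assumes "R \<in> carrier_mat k n" "A \<in> carrier_mat n m" "rank_le R r"
  shows "rank_le (R * A) r"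
proof -
  have "rank_le (mat_adjoint A * mat_adjoint R) r"
    using assms by (intro rank_le_mult_left rank_le_adjoint) auto
  then have "rank_le (mat_adjoint (mat_adjoint A * mat_adjoint R)) r" by (rule rank_le_adjoint)
  then show ?thesis using assms by (simp flip: mat_adjoint_mult)
qed

lemma rank_le_smult:
  assumes "rank_le R r" shows "rank_le (c \<cdot>\<^sub>m R) r"
proof -
  obtain f g where "\<And>i j. i < dim_row R \<Longrightarrow> j < dim_col R \<Longrightarrow> R $$ (i, j) = (\<Sum>t<r. f t i * g t j)"
    using assms unfolding rank_le_def by auto
  then show ?thesis unfolding rank_le_def
    by (intro exI[of _ "\<lambda>t i. c * f t i"] exI[of _ g]) (auto simp: sum_distrib_left mult.assoc)
qed

text \<open>Each summand \<open>f t i * g t j\<close> is a matrix of rank at most 1, and the rank is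
  subadditive.\<close>

lemma rank_le_imp_rank:
  assumes "R \<in> carrier_mat n n" "rank_le R r"
  shows "vec_space.rank n R \<le> r"
proof -
  obtain f g where fg: "\<And>i j. i < n \<Longrightarrow> j < n \<Longrightarrow> R $$ (i, j) = (\<Sum>t<r. f t i * g t j)"
    using assms unfolding rank_le_def by auto
  let ?R = "\<lambda>k. mat n n (\<lambda>(i, j). \<Sum>t<k. f t i * g t j)"
  have le: "vec_space.rank n (?R k) \<le> k" for k
  proof (induction k)
    case 0
    have "?R 0 = 0\<^sub>m n n" by (rule eq_matI) auto
    then show ?case by (simp only: vec_space.rank_0I)
  next
    case (Suc k)
    let ?O = "mat n n (\<lambda>(i, j). f k i * g k j)"
    have "?R (Suc k) = ?R k + ?O" by (rule eq_matI) auto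
    moreover have "vec_space.rank n (?R k + ?O) \<le> vec_space.rank n (?R k) + vec_space.rank n ?O"
      by (rule vec_space.rank_subadditive[of _ _ n]) auto
    ultimately have "vec_space.rank n (?R (Suc k)) \<le> vec_space.rank n (?R k) + vec_space.rank n ?O"
      by (simp only:)
    also have "vec_space.rank n ?O \<le> 1"
      by (rule vec_space.rank_le_1_product_entries[of _ _ n "f k" "g k"]) auto
    finally show ?case using Suc by simp
  qed
  have "R = ?R r" using assms(1) by (intro eq_matI) (auto simp: fg)
  then show ?thesis using le[of r] by (simp only:)
qed

text \<open>Every column is a combination of a maximal independent set \<open>S\<close> of columns,
  whose size is the rank. The vectors of \<open>S\<close> and the coefficients are the two factors
  of the required sum.\<close>

lemma rank_le_rank:
  assumes R: "R \<in> carrier_mat n m"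
  shows "rank_le R (vec_space.rank n R)"
proof -
  interpret vec_space "TYPE(complex)" n .
  let ?C = "set (cols R)"
  have C: "?C \<subseteq> carrier_vec n" using R cols_dim by blast
  have "\<not> lin_dep {}" by (simp add: lin_dep_def)
  then obtain S where S: "finite S" "maximal S (\<lambda>T. T \<subseteq> ?C \<and> lin_indpt T)"
    using maximal_exists_superset[of ?C "\<lambda>T. T \<subseteq> ?C \<and> lin_indpt T" "{}"] by blast
  have SC: "S \<subseteq> ?C" "lin_indpt S" using S(2) by (auto simp: maximal_def)
  have Sc: "S \<subseteq> carrier_vec n" using SC(1) C by blast
  have rk: "rank R = card S" by (rule rank_card_indpt[OF R S(2)])
  \<comment> \<open>A column outside the span could be added to \<open>S\<close>, against its
    maximality.\<close>
  have span: "x \<in> span S" if "x \<in> ?C" for x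
  proof (rule ccontr)
    assume x: "x \<notin> span S"
    have xS: "x \<notin> S" using x in_own_span[of S] Sc by auto
    moreover have "lin_indpt (S \<union> {x})"
      using lin_dep_iff_in_span[OF _ SC(2) _ xS] x that C Sc by auto
    ultimately show False using S(2) that SC(1) unfolding maximal_def by blast
  qed
  have "\<exists>a. \<forall>i<n. R $$ (i, j) = (\<Sum>x\<in>S. x $v i * a x)" if j: "j < m" for j
  proof -
    have "col R j \<in> ?C" using j R by (auto simp: cols_def)
    from finite_in_span[OF S(1) _ span[OF this]] Sc obtain a where a: "lincomb a S = col R j" by auto
    have "R $$ (i, j) = (\<Sum>x\<in>S. x $v i * a x)" if "i < n" for i
      using lincomb_index[OF that Sc, of a] a R j that by (simp add: mult.commute)
    then show ?thesis by blast
  qed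
  then obtain a where a: "\<And>i j. i < n \<Longrightarrow> j < m \<Longrightarrow> R $$ (i, j) = (\<Sum>x\<in>S. x $v i * a j x)" by metis
  obtain h where h: "bij_betw h {0..<card S} S" using ex_bij_betw_nat_finite[OF S(1)] by blast
  have "R $$ (i, j) = (\<Sum>t<card S. h t $v i * a j (h t))" if "i < n" "j < m" for i j
    unfolding a[OF that] using sum.reindex_bij_betw[OF h, of "\<lambda>x. x $v i * a j x"]
    by (simp add: atLeast0LessThan)
  then show ?thesis unfolding rk rank_le_def using R
    by (intro exI[of _ "\<lambda>t i. h t $v i"] exI[of _ "\<lambda>t j. a j (h t)"]) auto
qed

section \<open>Spectral theorem and singular values\<close>

text \<open>Complete \<open>v\<close> to a basis, orthogonalise by Gram-Schmidt and divide each
  vector by its norm. Gram-Schmidt keeps the first vector, so the unit vector \<open>v\<close>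
  survives as column 0.\<close>

lemma unitary_completion:
  assumes v: "v \<in> carrier_vec n" "vnorm v = 1"
  shows "\<exists>U\<in>carrier_mat n n. mat_adjoint U * U = (1\<^sub>m n :: complex mat) \<and> col U 0 = v \<and> n > 0"
proof -
  interpret cof_vec_space n "TYPE(complex)" .
  have v0: "v \<noteq> 0\<^sub>v n" using v by auto
  have n: "n > 0" using v by (cases n) (auto simp: vnorm_def)
  define b where "b = basis_completion v"
  define ws where "ws = gram_schmidt n b"
  note bc = basis_completion[OF v(1) v0, folded b_def]
  obtain vs where bv: "b = v # vs" using bc(6,7) n by (cases b) auto
  have ws: "set ws \<subseteq> carrier_vec n" "corthogonal ws" "length ws = n"
    using gram_schmidt_result[OF bc(2,4,5) refl, folded ws_def] bc(6) by auto
  have hd: "ws ! 0 = v" using gram_schmidt_hd[OF v(1), of vs, folded bv, folded ws_def] ws(3) n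
    by (metis hd_conv_nth length_greater_0_conv)
  have wc: "ws ! i \<in> carrier_vec n" if "i < n" for i using ws that by auto
  have wd: "dim_vec (ws ! i) = n" if "i < n" for i using wc[OF that] by simp
  have ipw: "ip (ws ! i) (ws ! j) = 0 \<longleftrightarrow> i \<noteq> j" if "i < n" "j < n" for i j
  proof -
    have "ip (ws ! i) (ws ! j) = ws ! i \<bullet>c ws ! j"
      using carrier_vecD[OF wc[OF that(1)]] carrier_vecD[OF wc[OF that(2)]]
      by (auto simp: ip_def scalar_prod_def atLeast0LessThan intro!: sum.cong)
    then show ?thesis using corthogonalD[OF ws(2)] ws(3) that by auto
  qed
  have nz: "vnorm (ws ! i) \<noteq> 0" if "i < n" for i using ipw[OF that that] by (simp add: ip_self)
  define U where "U = mat n n (\<lambda>(i, j). (ws ! j) $v i / of_real (vnorm (ws ! j)))"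
  have U: "U \<in> carrier_mat n n" by (simp add: U_def)
  have "mat_adjoint U * U = 1\<^sub>m n"
  proof (rule eq_matI)
    fix i j assume "i < dim_row (1\<^sub>m n :: complex mat)" "j < dim_col (1\<^sub>m n :: complex mat)"
    then have ij: "i < n" "j < n" by auto
    have "(mat_adjoint U * U) $$ (i, j) = (\<Sum>l<n. mat_adjoint U $$ (i, l) * U $$ (l, j))"
      by (rule mat_mult_index[of _ n n _ n]) (use U ij in auto)
    also have "\<dots> = ip (ws ! j) (ws ! i) / (of_real (vnorm (ws ! i)) * of_real (vnorm (ws ! j)))"
      using ij wd U by (auto simp: U_def ip_def sum_divide_distrib intro!: sum.cong)
    also have "\<dots> = (if i = j then 1 else 0)"
      using ipw[of j i] nz ij by (auto simp: ip_self power2_eq_square)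
    finally show "(mat_adjoint U * U) $$ (i, j) = 1\<^sub>m n $$ (i, j)" using ij by simp
  qed (use U in auto)
  moreover have "col U 0 = v"
    using n v hd by (intro eq_vecI) (auto simp: U_def)
  ultimately show ?thesis using U n by blast
qed

text \<open>Induction on the size: conjugation by a unitary matrix whose first column is a unit
  eigenvector splits off a real eigenvalue and leaves a smaller Hermitian block.\<close>

lemma hermitian_diagonalization:
  assumes "H \<in> carrier_mat n n" "mat_adjoint H = (H :: complex mat)"
  shows "\<exists>U\<in>carrier_mat n n. \<exists>l :: nat \<Rightarrow> real. mat_adjoint U * U = 1\<^sub>m n \<and>
    H * U = U * mat_diag n (\<lambda>i. of_real (l i))"
  using assms
proof (induction n arbitrary: H)
  case 0
  then show ?case by (intro bexI[of _ "1\<^sub>m 0"] exI[of _ "\<lambda>_. 0"]) (auto simp: mat_diag_def intro!: eq_matI)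
next
  case (Suc n H)
  note H = Suc.prems(1)
  have "degree (char_poly H) = Suc n" using degree_monic_char_poly[OF H] by simp
  then have "\<not> constant (poly (char_poly H))" by (simp add: constant_degree)
  then obtain e where "poly (char_poly H) e = 0" using fundamental_theorem_of_algebra by blast
  then have "eigenvalue H e" using eigenvalue_root_char_poly[OF H] by simp
  from find_eigenvector[OF H this] obtain u where
    u: "u \<in> carrier_vec (Suc n)" "u \<noteq> 0\<^sub>v (Suc n)" "H *\<^sub>v u = e \<cdot>\<^sub>v u"
    using H unfolding eigenvector_def by auto
  define v where "v = complex_of_real (inverse (vnorm u)) \<cdot>\<^sub>v u"
  have v: "v \<in> carrier_vec (Suc n)" using u by (simp add: v_def)
  have v1: "vnorm v = 1" using u vnorm_eq_0[OF u(1)] by (simp add: v_def vnorm_smult norm_inverse)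
  have Hv: "H *\<^sub>v v = e \<cdot>\<^sub>v v" unfolding v_def using u H
    by (simp add: mult_mat_vec[OF H u(1)] smult_smult_assoc mult.commute)
  \<comment> \<open>Moving \<open>H\<close> across the inner product of the eigenvector with itself
    shows that the eigenvalue equals its conjugate.\<close>
  have "ip (H *\<^sub>v v) v = ip v (H *\<^sub>v v)"
    using ip_adjoint[OF H v v] Suc.prems(2) by simp
  moreover have "ip (e \<cdot>\<^sub>v v) v = e * ip v v" "ip v (e \<cdot>\<^sub>v v) = cnj e * ip v v"
    by (auto simp: ip_def sum_distrib_left mult_ac)
  ultimately have ecnj: "cnj e = e" using v1 by (simp add: Hv ip_self)
  then obtain x where ex: "e = of_real x" by (metis Reals_cnj_iff Reals_cases)
  obtain U0 where U0: "U0 \<in> carrier_mat (Suc n) (Suc n)" "mat_adjoint U0 * U0 = 1\<^sub>m (Suc n)" "col U0 0 = v"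
    using unitary_completion[OF v v1] by blast
  have U0': "U0 * mat_adjoint U0 = 1\<^sub>m (Suc n)"
    using U0 by (intro mat_mult_left_right_inverse[of "mat_adjoint U0"]) auto
  \<comment> \<open>Conjugation by \<open>U0\<close> moves the eigenvector to the first unit vector,
    so the first column of \<open>K\<close> is \<open>e\<close> times that vector. As
    \<open>K\<close> is Hermitian and \<open>e\<close> real, its first row has the same
    shape.\<close>
  define K where "K = mat_adjoint U0 * H * U0"
  have K: "K \<in> carrier_mat (Suc n) (Suc n)" using U0 H by (auto simp: K_def)
  have Kh: "mat_adjoint K = K"
  proof -
    have c: "mat_adjoint U0 \<in> carrier_mat (Suc n) (Suc n)" "mat_adjoint U0 * H \<in> carrier_mat (Suc n) (Suc n)"
      using U0 H mult_carrier_mat[of "mat_adjoint U0" "Suc n" "Suc n"] by auto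
    have "mat_adjoint K = mat_adjoint U0 * (mat_adjoint H * U0)"
      unfolding K_def mat_adjoint_mult[OF c(2) U0(1)] mat_adjoint_mult[OF c(1) H] by simp
    also have "\<dots> = K" unfolding K_def Suc.prems(2) using U0 H by (subst assoc_mult_mat[of _ "Suc n" "Suc n" _ "Suc n" _ "Suc n"]) auto
    finally show ?thesis .
  qed
  have K0: "K $$ (i, 0) = (if i = 0 then e else 0)" if i: "i < Suc n" for i
  proof -
    have "col K 0 = mat_adjoint U0 *\<^sub>v (H *\<^sub>v v)"
      unfolding K_def using U0 H v
      by (subst col_mult2[of _ "Suc n" "Suc n" _ "Suc n"]) (auto simp: assoc_mult_mat_vec[of _ "Suc n" "Suc n" _ "Suc n"])
    also have "\<dots> = e \<cdot>\<^sub>v (mat_adjoint U0 *\<^sub>v col U0 0)"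
      unfolding Hv U0(3) using v U0 by (intro mult_mat_vec[of _ "Suc n" "Suc n"]) auto
    also have "mat_adjoint U0 *\<^sub>v col U0 0 = col (mat_adjoint U0 * U0) 0"
      using U0(1) by (subst col_mult2[of _ "Suc n" "Suc n" _ "Suc n"]) auto
    finally have "col K 0 = e \<cdot>\<^sub>v col (1\<^sub>m (Suc n)) 0" unfolding U0(2) .
    then have "col K 0 $v i = (e \<cdot>\<^sub>v col (1\<^sub>m (Suc n)) 0) $v i" by simp
    then show ?thesis using K i by auto
  qed
  have Kij: "K $$ (i, j) = cnj (K $$ (j, i))" if "i < Suc n" "j < Suc n" for i j
    using arg_cong[OF Kh, of "\<lambda>M. M $$ (i, j)"] K that by simp
  have K0': "K $$ (0, j) = (if j = 0 then e else 0)" if "j < Suc n" for j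
    using Kij[of 0 j] K0[OF that] that ecnj by (auto split: if_splits)
  define H' where "H' = mat n n (\<lambda>(i, j). K $$ (Suc i, Suc j))"
  have H': "H' \<in> carrier_mat n n" by (simp add: H'_def)
  have H'h: "mat_adjoint H' = H'"
  proof (rule eq_matI)
    fix i j assume "i < dim_row H'" "j < dim_col H'"
    then have "i < n" "j < n" using H' by auto
    then show "mat_adjoint H' $$ (i, j) = H' $$ (i, j)"
      using Kij[of "Suc i" "Suc j"] by (simp add: H'_def)
  qed (use H' in auto)
  obtain U' l where U': "U' \<in> carrier_mat n n" "mat_adjoint U' * U' = 1\<^sub>m n"
    "H' * U' = U' * mat_diag n (\<lambda>i. complex_of_real (l i))" using Suc.IH[OF H' H'h] by blast
  have U'e: "(\<Sum>k<n. cnj (U' $$ (k, i)) * U' $$ (k, j)) = (if i = j then 1 else 0)" if "i < n" "j < n" for i j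
    using arg_cong[OF U'(2), of "\<lambda>M. M $$ (i, j)"] that U'(1)
    by (subst (asm) mat_mult_index[of _ n n _ n]) auto
  have H'e: "(\<Sum>k<n. K $$ (Suc i, Suc k) * U' $$ (k, j)) = U' $$ (i, j) * of_real (l j)" if "i < n" "j < n" for i j
    using arg_cong[OF U'(3), of "\<lambda>M. M $$ (i, j)"] that U'(1) H'
    by (subst (asm) mat_mult_index[of _ n n _ n]) (auto simp: mat_diag_mult_right[of _ n n] H'_def)
  \<comment> \<open>The block sum of 1 and \<open>U'\<close>; it diagonalises
    \<open>K\<close>.\<close>
  define U1 where "U1 = mat (Suc n) (Suc n) (\<lambda>(i, j). if i = 0 \<and> j = 0 then 1
     else if i = 0 \<or> j = 0 then 0 else U' $$ (i - 1, j - 1))"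
  define l1 where "l1 = (\<lambda>i. if i = 0 then x else l (i - 1))"
  let ?D = "mat_diag (Suc n) (\<lambda>i. complex_of_real (l1 i))"
  have U1: "U1 \<in> carrier_mat (Suc n) (Suc n)" by (simp add: U1_def)
  have U11: "mat_adjoint U1 * U1 = 1\<^sub>m (Suc n)"
  proof (rule eq_matI)
    fix i j assume "i < dim_row (1\<^sub>m (Suc n) :: complex mat)" "j < dim_col (1\<^sub>m (Suc n) :: complex mat)"
    then have ij: "i < Suc n" "j < Suc n" by auto
    have "(mat_adjoint U1 * U1) $$ (i, j) = (\<Sum>k<Suc n. cnj (U1 $$ (k, i)) * U1 $$ (k, j))"
      using U1 ij by (subst mat_mult_index[of _ "Suc n" "Suc n" _ "Suc n"]) auto
    also have "\<dots> = (if i = j then 1 else 0)"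
      using ij U'e[of "i - 1" "j - 1"]
      by (cases i; cases j) (auto simp: sum.lessThan_Suc_shift U1_def simp del: sum.lessThan_Suc)
    finally show "(mat_adjoint U1 * U1) $$ (i, j) = 1\<^sub>m (Suc n) $$ (i, j)" using ij by simp
  qed (use U1 in auto)
  have KU: "K * U1 = U1 * ?D"
  proof (rule eq_matI)
    fix i j assume "i < dim_row (U1 * ?D)" "j < dim_col (U1 * ?D)"
    then have ij: "i < Suc n" "j < Suc n" using U1 by (auto simp: mat_diag_def)
    have "(K * U1) $$ (i, j) = (\<Sum>k<Suc n. K $$ (i, k) * U1 $$ (k, j))"
      using U1 K ij by (subst mat_mult_index[of _ "Suc n" "Suc n" _ "Suc n"]) auto
    also have "\<dots> = U1 $$ (i, j) * of_real (l1 j)"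
      using ij H'e[of "i - 1" "j - 1"] K0[of i] K0'
      by (cases i; cases j) (auto simp: sum.lessThan_Suc_shift U1_def l1_def ex simp del: sum.lessThan_Suc)
    finally show "(K * U1) $$ (i, j) = (U1 * ?D) $$ (i, j)"
      using ij U1 by (simp add: mat_diag_mult_right[of _ "Suc n" "Suc n"])
  qed (use U1 K in \<open>auto simp: mat_diag_def\<close>)
  define U where "U = U0 * U1"
  note assoc = assoc_mult_mat[of _ "Suc n" "Suc n" _ "Suc n" _ "Suc n"]
  have U: "U \<in> carrier_mat (Suc n) (Suc n)" using U0 U1 by (simp add: U_def)
  have D: "?D \<in> carrier_mat (Suc n) (Suc n)" by simp
  have aU0: "mat_adjoint U0 \<in> carrier_mat (Suc n) (Suc n)" and aU1: "mat_adjoint U1 \<in> carrier_mat (Suc n) (Suc n)"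
    using U0 U1 by auto
  have "mat_adjoint U * U = mat_adjoint U1 * mat_adjoint U0 * (U0 * U1)"
    unfolding U_def by (subst mat_adjoint_mult[OF U0(1) U1]) simp
  also have "\<dots> = mat_adjoint U1 * (mat_adjoint U0 * (U0 * U1))"
    using U0(1) U1 aU0 aU1 by (intro assoc) auto
  also have "mat_adjoint U0 * (U0 * U1) = mat_adjoint U0 * U0 * U1"
    using U0(1) U1 aU0 by (intro assoc[symmetric]) auto
  also have "\<dots> = U1" using U0(2) U1 by simp
  finally have UU: "mat_adjoint U * U = 1\<^sub>m (Suc n)" using U11 by simp
  have "H * U0 = U0 * K"
  proof -
    have "U0 * K = U0 * (mat_adjoint U0 * (H * U0))" unfolding K_def using aU0 U0(1) H by (subst assoc) auto
    also have "\<dots> = U0 * mat_adjoint U0 * (H * U0)" using aU0 U0(1) H by (intro assoc[symmetric]) auto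
    finally show ?thesis using U0' H U0(1) by simp
  qed
  then have "H * U = U0 * K * U1" unfolding U_def using H U0(1) U1 by (subst assoc[symmetric]) auto
  also have "\<dots> = U0 * (K * U1)" using K U0(1) U1 by (intro assoc) auto
  also have "\<dots> = U * ?D" unfolding KU U_def using U0(1) U1 D by (intro assoc[symmetric]) auto
  finally show ?case using U UU by blast
qed

lemma proots_prod_linear: "proots (\<Prod>a\<leftarrow>xs. [:- a, 1:]) = mset (xs :: complex list)"
proof (induction xs)
  case (Cons a xs)
  have "(\<Prod>a\<leftarrow>xs. [:- a, 1:]) \<noteq> 0" by (auto simp: prod_list_zero_iff)
  then have "proots ([:- a, 1:] * (\<Prod>a\<leftarrow>xs. [:- a, 1:])) = proots [:- a, 1:] + proots (\<Prod>a\<leftarrow>xs. [:- a, 1:])"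
    by (intro proots_mult) auto
  then show ?case using Cons by simp
qed simp

text \<open>\<open>U\<close> diagonalises \<open>mat_adjoint A * A\<close> with eigenvalues
  \<open>l j\<close>. Only this right unitary factor is constructed: the identity for the norm of
  \<open>A\<close> applied to \<open>U w\<close> takes the place of the left one, and it also shows
  \<open>l j \<ge> 0\<close>.\<close>

lemma singular_value_decomposition:
  assumes A: "A \<in> carrier_mat n n"
  obtains U l where "U \<in> carrier_mat n n" "mat_adjoint U * U = 1\<^sub>m n" "U * mat_adjoint U = 1\<^sub>m n"
    "(mat_adjoint A * A) * U = U * mat_diag n (\<lambda>i. complex_of_real (l i))"
    "\<And>w. w \<in> carrier_vec n \<Longrightarrow> (vnorm (A *\<^sub>v (U *\<^sub>v w)))\<^sup>2 = (\<Sum>j<n. l j * (cmod (w $v j))\<^sup>2)"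
    "\<And>w. w \<in> carrier_vec n \<Longrightarrow> vnorm (U *\<^sub>v w) = vnorm w"
    "\<And>w. w \<in> carrier_vec n \<Longrightarrow> vnorm (mat_adjoint U *\<^sub>v w) = vnorm w"
    "\<And>j. j < n \<Longrightarrow> l j \<ge> 0"
    "singular_values A = image_mset (\<lambda>j. sqrt (l j)) (mset_set {..<n})"
proof -
  define H where "H = mat_adjoint A * A"
  have aA: "mat_adjoint A \<in> carrier_mat n n" using A by simp
  have H: "H \<in> carrier_mat n n" unfolding H_def by (rule mult_carrier_mat[OF aA A])
  have "mat_adjoint H = H" unfolding H_def by (subst mat_adjoint_mult[OF aA A]) simp
  from hermitian_diagonalization[OF H this] obtain U and l :: "nat \<Rightarrow> real" where
    U: "U \<in> carrier_mat n n" "mat_adjoint U * U = 1\<^sub>m n"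
    and HU: "H * U = U * mat_diag n (\<lambda>i. complex_of_real (l i))" by blast
  let ?D = "mat_diag n (\<lambda>i. complex_of_real (l i))"
  have aU: "mat_adjoint U \<in> carrier_mat n n" using U by simp
  have UU: "U * mat_adjoint U = 1\<^sub>m n" by (rule mat_mult_left_right_inverse[OF aU U])
  have iso: "vnorm (V *\<^sub>v w) = vnorm w"
    if V: "V \<in> carrier_mat n n" "mat_adjoint V * V = 1\<^sub>m n" and w: "w \<in> carrier_vec n" for V w
  proof -
    have "ip (V *\<^sub>v w) (V *\<^sub>v w) = ip w (mat_adjoint V *\<^sub>v (V *\<^sub>v w))"
      using V w by (intro ip_adjoint) auto
    also have "mat_adjoint V *\<^sub>v (V *\<^sub>v w) = (mat_adjoint V * V) *\<^sub>v w"
      using V w by (intro assoc_mult_mat_vec[symmetric]) auto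
    finally have "ip (V *\<^sub>v w) (V *\<^sub>v w) = ip w w" using V w by simp
    then have "(vnorm (V *\<^sub>v w))\<^sup>2 = (vnorm w)\<^sup>2" unfolding ip_self of_real_eq_iff .
    then show ?thesis by (simp add: power2_eq_iff_nonneg)
  qed
  have quad: "(vnorm (A *\<^sub>v (U *\<^sub>v w)))\<^sup>2 = (\<Sum>j<n. l j * (cmod (w $v j))\<^sup>2)" if w: "w \<in> carrier_vec n" for w
  proof -
    have Uw: "U *\<^sub>v w \<in> carrier_vec n" using U w by simp
    have "complex_of_real ((vnorm (A *\<^sub>v (U *\<^sub>v w)))\<^sup>2) = ip (A *\<^sub>v (U *\<^sub>v w)) (A *\<^sub>v (U *\<^sub>v w))"
      by (simp only: ip_self)
    also have "\<dots> = cnj (ip (H *\<^sub>v (U *\<^sub>v w)) (U *\<^sub>v w))"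
    proof -
      have "ip (A *\<^sub>v (U *\<^sub>v w)) (A *\<^sub>v (U *\<^sub>v w)) = ip (U *\<^sub>v w) (H *\<^sub>v (U *\<^sub>v w))"
        unfolding H_def using A aA Uw by (subst ip_adjoint[of _ n n]) (auto simp: assoc_mult_mat_vec[of _ n n _ n])
      also have "\<dots> = cnj (ip (H *\<^sub>v (U *\<^sub>v w)) (U *\<^sub>v w))"
        using H U w by (auto simp: ip_def mult.commute intro!: sum.cong)
      finally show ?thesis .
    qed
    also have "H *\<^sub>v (U *\<^sub>v w) = U *\<^sub>v (?D *\<^sub>v w)"
    proof -
      have "H *\<^sub>v (U *\<^sub>v w) = (H * U) *\<^sub>v w" using H U w by (intro assoc_mult_mat_vec[symmetric]) auto
      also have "\<dots> = U *\<^sub>v (?D *\<^sub>v w)" unfolding HU using U w by (intro assoc_mult_mat_vec) auto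
      finally show ?thesis .
    qed
    also have "ip (U *\<^sub>v (?D *\<^sub>v w)) (U *\<^sub>v w) = ip (?D *\<^sub>v w) w"
    proof -
      have Dw: "?D *\<^sub>v w \<in> carrier_vec n" using w by (intro mult_mat_vec_carrier[of _ n n]) auto
      have "ip (U *\<^sub>v (?D *\<^sub>v w)) (U *\<^sub>v w) = ip (?D *\<^sub>v w) (mat_adjoint U *\<^sub>v (U *\<^sub>v w))"
        by (rule ip_adjoint[OF U(1) Dw Uw])
      also have "mat_adjoint U *\<^sub>v (U *\<^sub>v w) = (mat_adjoint U * U) *\<^sub>v w"
        using aU U w by (intro assoc_mult_mat_vec[symmetric]) auto
      finally show ?thesis using U w by simp
    qed
    also have "ip (?D *\<^sub>v w) w = of_real (\<Sum>j<n. l j * (cmod (w $v j))\<^sup>2)"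
    proof -
      have Dwi: "(?D *\<^sub>v w) $v i = of_real (l i) * w $v i" if "i < n" for i
      proof -
        have "(?D *\<^sub>v w) $v i = (\<Sum>k<n. ?D $$ (i, k) * w $v k)"
          using w that by (intro mat_vec_index[of _ n n]) auto
        also have "\<dots> = (\<Sum>k<n. if i = k then of_real (l i) * w $v i else 0)"
          using that by (intro sum.cong) (auto simp: mat_diag_def)
        finally show ?thesis using that by simp
      qed
      have "dim_vec (?D *\<^sub>v w) = n" by (simp add: mat_diag_def)
      then show ?thesis unfolding ip_def using Dwi
        by (simp add: mult.assoc complex_norm_square[symmetric] del: index_mult_mat_vec)
    qed
    finally show ?thesis by (metis complex_cnj_complex_of_real of_real_eq_iff)
  qed
  have lnn: "l j \<ge> 0" if j: "j < n" for j
  proof -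
    have "(\<Sum>k<n. l k * (cmod (unit_vec n j $v k))\<^sup>2) = (\<Sum>k<n. if k = j then l j else 0)"
      using j by (intro sum.cong) auto
    also have "\<dots> = l j" using j by simp
    finally show ?thesis using quad[of "unit_vec n j"] by (metis unit_vec_carrier zero_le_power2)
  qed
  have sv: "singular_values A = image_mset (\<lambda>j. sqrt (l j)) (mset_set {..<n})"
  proof -
    \<comment> \<open>Similar matrices have equal characteristic polynomials, so the roots counted
      in \<open>singular_values\<close> are the \<open>l j\<close> with multiplicity.\<close>
    have "H = U * ?D * mat_adjoint U"
    proof -
      have "U * ?D * mat_adjoint U = H * U * mat_adjoint U" by (simp only: HU)
      also have "\<dots> = H * (U * mat_adjoint U)" using H U aU by (intro assoc_mult_mat) auto
      finally show ?thesis using UU H by simp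
    qed
    then have "similar_mat_wit H ?D U (mat_adjoint U)"
      using H U aU UU by (intro similar_mat_witI[of _ _ n]) auto
    then have "char_poly H = char_poly ?D" by (intro char_poly_similar) (auto simp: similar_mat_def)
    also have "\<dots> = (\<Prod>a\<leftarrow>diag_mat ?D. [:- a, 1:])"
      by (rule char_poly_upper_triangular[of _ n]) (auto simp: mat_diag_def)
    also have "diag_mat ?D = map (\<lambda>j. complex_of_real (l j)) [0..<n]"
      by (auto simp: diag_mat_def mat_diag_def)
    finally have "proots (char_poly H) = mset (map (\<lambda>j. complex_of_real (l j)) [0..<n])"
      by (simp only: proots_prod_linear)
    then show ?thesis unfolding singular_values_def H_def[symmetric]
      by (simp add: image_mset.compositionality o_def mset_upt atLeast0LessThan)
  qed
  have "mat_adjoint (mat_adjoint U) * mat_adjoint U = 1\<^sub>m n" using UU by simp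
  then show ?thesis
    using that[OF U UU HU[unfolded H_def] quad iso[OF U] iso[OF aU] lnn sv] by blast
qed

text \<open>The conclusion of \<open>singular_value_decomposition\<close> as a predicate, so that
  \<open>U\<close> and \<open>l\<close> can be obtained by a plain existential.\<close>

definition is_svd :: "nat \<Rightarrow> complex mat \<Rightarrow> complex mat \<Rightarrow> (nat \<Rightarrow> real) \<Rightarrow> bool" where
  "is_svd n A U l \<longleftrightarrow> U \<in> carrier_mat n n \<and> mat_adjoint U * U = 1\<^sub>m n \<and> U * mat_adjoint U = 1\<^sub>m n \<and>
    (mat_adjoint A * A) * U = U * mat_diag n (\<lambda>i. complex_of_real (l i)) \<and>
    (\<forall>w\<in>carrier_vec n. (vnorm (A *\<^sub>v (U *\<^sub>v w)))\<^sup>2 = (\<Sum>j<n. l j * (cmod (w $v j))\<^sup>2)) \<and>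
    (\<forall>w\<in>carrier_vec n. vnorm (U *\<^sub>v w) = vnorm w) \<and>
    (\<forall>w\<in>carrier_vec n. vnorm (mat_adjoint U *\<^sub>v w) = vnorm w) \<and>
    (\<forall>j<n. l j \<ge> 0) \<and>
    singular_values A = image_mset (\<lambda>j. sqrt (l j)) (mset_set {..<n})"

lemma is_svdD:
  assumes "is_svd n A U l"
  shows "U \<in> carrier_mat n n" "mat_adjoint U * U = 1\<^sub>m n" "U * mat_adjoint U = 1\<^sub>m n"
    "(mat_adjoint A * A) * U = U * mat_diag n (\<lambda>i. complex_of_real (l i))"
    "\<And>w. w \<in> carrier_vec n \<Longrightarrow> (vnorm (A *\<^sub>v (U *\<^sub>v w)))\<^sup>2 = (\<Sum>j<n. l j * (cmod (w $v j))\<^sup>2)"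
    "\<And>w. w \<in> carrier_vec n \<Longrightarrow> vnorm (U *\<^sub>v w) = vnorm w"
    "\<And>w. w \<in> carrier_vec n \<Longrightarrow> vnorm (mat_adjoint U *\<^sub>v w) = vnorm w"
    "\<And>j. j < n \<Longrightarrow> l j \<ge> 0"
    "singular_values A = image_mset (\<lambda>j. sqrt (l j)) (mset_set {..<n})"
  using assms unfolding is_svd_def by blast+

lemma svd_exists:
  assumes "A \<in> carrier_mat n n" shows "\<exists>U l. is_svd n A U l"
proof (rule singular_value_decomposition[OF assms], goal_cases)
  case (1 U l)
  show ?case unfolding is_svd_def by (intro exI[of _ U] exI[of _ l] conjI ballI allI impI) (fact 1)+
qed

definition sv_count :: "complex mat \<Rightarrow> real \<Rightarrow> nat" where
  "sv_count A \<epsilon> = size (filter_mset (\<lambda>s. \<epsilon> < s) (singular_values A))"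

text \<open>Pad the \<open>r\<close> equations with zero rows to a square system of size
  \<open>s\<close>. Row \<open>r\<close> vanishes, so the determinant is 0 and the kernel is
  nontrivial.\<close>

lemma underdetermined_kernel:
  fixes M :: "nat \<Rightarrow> nat \<Rightarrow> complex"
  assumes "r < s"
  shows "\<exists>w. (\<exists>j<s. w j \<noteq> 0) \<and> (\<forall>t<r. (\<Sum>j<s. M t j * w j) = 0)"
proof -
  define B where "B = mat s s (\<lambda>(t, j). if t < r then M t j else 0)"
  have B: "B \<in> carrier_mat s s" by (simp add: B_def)
  have BT: "transpose_mat B \<in> carrier_mat s s" using B by simp
  have "(transpose_mat B *\<^sub>v unit_vec s r) = 0\<^sub>v s"
  proof (rule eq_vecI)
    fix i assume "i < dim_vec (0\<^sub>v s :: complex Matrix.vec)"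
    then have i: "i < s" by simp
    have "(transpose_mat B *\<^sub>v unit_vec s r) $v i = (\<Sum>l<s. transpose_mat B $$ (i, l) * unit_vec s r $v l)"
      using i by (intro mat_vec_index[OF BT]) auto
    also have "\<dots> = 0" using i assms by (intro sum.neutral) (auto simp: B_def)
    finally show "(transpose_mat B *\<^sub>v unit_vec s r) $v i = 0\<^sub>v s $v i" using i by simp
  qed (use B in auto)
  moreover have "unit_vec s r \<noteq> (0\<^sub>v s :: complex Matrix.vec)"
  proof
    assume "unit_vec s r = (0\<^sub>v s :: complex Matrix.vec)"
    then have "unit_vec s r $v r = (0\<^sub>v s :: complex Matrix.vec) $v r" by simp
    then show False using assms by simp
  qed
  ultimately have "det (transpose_mat B) = 0"
    unfolding det_0_iff_vec_prod_zero_field[OF BT] by (intro exI[of _ "unit_vec s r"]) auto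
  then have "det B = 0" using det_transpose[OF B] by simp
  then obtain v where v: "v \<in> carrier_vec s" "v \<noteq> 0\<^sub>v s" "B *\<^sub>v v = 0\<^sub>v s"
    unfolding det_0_iff_vec_prod_zero_field[OF B] by blast
  have "\<exists>j<s. v $v j \<noteq> 0"
  proof (rule ccontr)
    assume "\<not> (\<exists>j<s. v $v j \<noteq> 0)"
    then have "v = 0\<^sub>v s" using v(1) by (intro eq_vecI) auto
    then show False using v(2) by simp
  qed
  moreover have "(\<Sum>j<s. M t j * v $v j) = 0" if t: "t < r" for t
  proof -
    have "(B *\<^sub>v v) $v t = (\<Sum>l<s. B $$ (t, l) * v $v l)"
      using t assms by (intro mat_vec_index[OF B v(1)]) auto
    also have "\<dots> = (\<Sum>j<s. M t j * v $v j)"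
      using t assms by (intro sum.cong) (auto simp: B_def)
    finally show ?thesis using v(3) t assms by simp
  qed
  ultimately show ?thesis by (intro exI[of _ "\<lambda>j. v $v j"]) auto
qed

text \<open>The decomposition is truncated: the columns \<open>j\<close> of \<open>A * U\<close>
  with \<open>sqrt (l j) > \<epsilon>\<close> go to \<open>R\<close>, whose rank is at most their
  number, and the others to \<open>N\<close>. In the formula for the squared norm only
  \<open>l j\<close> up to the square of \<open>\<epsilon>\<close> then remain for
  \<open>N\<close>.\<close>

lemma sv_count_le_imp_split:
  assumes A: "A \<in> carrier_mat n n" and e: "\<epsilon> \<ge> 0" and r: "sv_count A \<epsilon> \<le> r"
  shows "\<exists>N\<in>carrier_mat n n. \<exists>R\<in>carrier_mat n n. A = N + R \<and> nbound N \<epsilon> \<and> rank_le R r"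
proof -
  obtain U l where svd: "is_svd n A U l" using svd_exists[OF A] by blast
  note U = is_svdD(1,3)[OF svd]
  note quad = is_svdD(5)[OF svd]
  note iso = is_svdD(7)[OF svd]
  note l = is_svdD(8)[OF svd]
  note sv = is_svdD(9)[OF svd]
  define J where "J = {j\<in>{..<n}. \<epsilon> < sqrt (l j)}"
  have cJ: "card J \<le> r" using r by (simp add: sv_count_def sv filter_mset_image_mset J_def)
  define q q' :: "nat \<Rightarrow> complex" where "q = (\<lambda>j. if j \<in> J then 1 else 0)" and "q' = (\<lambda>j. if j \<in> J then 0 else 1)"
  have aU: "mat_adjoint U \<in> carrier_mat n n" using U by simp
  have Dq: "mat_diag n q \<in> carrier_mat n n" "mat_diag n q' \<in> carrier_mat n n" by auto
  define V where "V = A * U"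
  have V: "V \<in> carrier_mat n n" unfolding V_def using A U(1) by (rule mult_carrier_mat)
  define N R where "N = V * mat_diag n q' * mat_adjoint U" and "R = V * mat_diag n q * mat_adjoint U"
  have VD: "V * mat_diag n q \<in> carrier_mat n n" "V * mat_diag n q' \<in> carrier_mat n n"
    using mult_carrier_mat[OF V Dq(1)] mult_carrier_mat[OF V Dq(2)] by auto
  have N: "N \<in> carrier_mat n n" and R: "R \<in> carrier_mat n n"
    unfolding N_def R_def using mult_carrier_mat[OF _ aU] VD by auto
  have "N + R = (V * mat_diag n q' + V * mat_diag n q) * mat_adjoint U"
    unfolding N_def R_def by (rule add_mult_distrib_mat[symmetric, OF VD(2,1) aU])
  also have "V * mat_diag n q' + V * mat_diag n q = V"
    using V by (intro eq_matI) (auto simp: mat_diag_mult_right[of _ n n] q_def q'_def)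
  also have "V * mat_adjoint U = A * (U * mat_adjoint U)"
    unfolding V_def by (rule assoc_mult_mat[OF A U(1) aU])
  finally have ANR: "A = N + R" using U(2) A by simp
  have "nbound N \<epsilon>"
    unfolding nbound_def
  proof
    fix v :: "complex Matrix.vec" assume "v \<in> carrier_vec (dim_col N)"
    then have v: "v \<in> carrier_vec n" using N by simp
    define w where "w = mat_adjoint U *\<^sub>v v"
    have w: "w \<in> carrier_vec n" unfolding w_def by (rule mult_mat_vec_carrier[OF aU v])
    have Dw: "mat_diag n q' *\<^sub>v w \<in> carrier_vec n" by (rule mult_mat_vec_carrier[OF Dq(2) w])
    have Dwi: "(mat_diag n q' *\<^sub>v w) $v i = q' i * w $v i" if "i < n" for i
    proof -
      have "(mat_diag n q' *\<^sub>v w) $v i = (\<Sum>k<n. mat_diag n q' $$ (i, k) * w $v k)"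
        by (rule mat_vec_index[OF Dq(2) w that])
      also have "\<dots> = (\<Sum>k<n. if i = k then q' i * w $v i else 0)"
        using that by (intro sum.cong) (auto simp: mat_diag_def)
      finally show ?thesis using that by simp
    qed
    have "N *\<^sub>v v = V * mat_diag n q' *\<^sub>v w"
      unfolding N_def w_def by (rule assoc_mult_mat_vec[OF VD(2) aU v])
    also have "\<dots> = V *\<^sub>v (mat_diag n q' *\<^sub>v w)" by (rule assoc_mult_mat_vec[OF V Dq(2) w])
    also have "\<dots> = A *\<^sub>v (U *\<^sub>v (mat_diag n q' *\<^sub>v w))"
      unfolding V_def by (rule assoc_mult_mat_vec[OF A U(1) Dw])
    finally have "(vnorm (N *\<^sub>v v))\<^sup>2 = (\<Sum>j<n. l j * (cmod (q' j * w $v j))\<^sup>2)"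
      using quad[OF Dw] Dwi by simp
    also have "\<dots> \<le> (\<Sum>j<n. \<epsilon>\<^sup>2 * (cmod (w $v j))\<^sup>2)"
    proof (rule sum_mono)
      fix j assume "j \<in> {..<n}"
      then have j: "j < n" by simp
      show "l j * (cmod (q' j * w $v j))\<^sup>2 \<le> \<epsilon>\<^sup>2 * (cmod (w $v j))\<^sup>2"
      proof (cases "j \<in> J")
        case False
        then have "sqrt (l j) \<le> \<epsilon>" using j by (simp add: J_def)
        then have "l j \<le> \<epsilon>\<^sup>2" using l[OF j] by (simp add: sqrt_le_D)
        then show ?thesis using False by (simp add: q'_def mult_right_mono)
      qed (simp add: q'_def)
    qed
    also have "\<dots> = (\<epsilon> * vnorm w)\<^sup>2"
      using w by (simp add: vnorm_sq power_mult_distrib sum_distrib_left)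
    finally have "vnorm (N *\<^sub>v v) \<le> \<epsilon> * vnorm w"
      by (rule power2_le_imp_le) (simp add: e)
    then show "vnorm (N *\<^sub>v v) \<le> \<epsilon> * vnorm v" using iso[OF v] by (simp add: w_def)
  qed
  moreover have "rank_le R r"
  proof -
    have "rank_le (mat_diag n q) (card J)"
    proof -
      have fJ: "finite J" by (simp add: J_def)
      obtain h where h: "bij_betw h {0..<card J} J" using ex_bij_betw_nat_finite[OF fJ] by blast
      have "mat_diag n q $$ (i, j) = (\<Sum>t<card J. (if h t = i then 1 else 0) * (if h t = j then 1 else 0))"
        if "i < n" "j < n" for i j
      proof -
        have "(\<Sum>t<card J. (if h t = i then 1 else 0) * (if h t = j then 1 else (0::complex)))
          = (\<Sum>x\<in>J. (if x = i then 1 else 0) * (if x = j then 1 else 0))"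
          using sum.reindex_bij_betw[OF h, of "\<lambda>x. (if x = i then 1 else 0) * (if x = j then 1 else (0::complex))"]
          by (simp add: atLeast0LessThan)
        also have "\<dots> = (\<Sum>x\<in>J. if x = i then (if i = j then 1 else 0) else 0)"
          by (intro sum.cong) auto
        also have "\<dots> = mat_diag n q $$ (i, j)" using that fJ by (simp add: mat_diag_def q_def)
        finally show ?thesis by simp
      qed
      then show ?thesis unfolding rank_le_def
        by (intro exI[of _ "\<lambda>t i. if h t = i then 1 else 0"]) (simp add: mat_diag_def)
    qed
    then have "rank_le (mat_diag n q) r" using cJ by (rule rank_le_mono)
    then show ?thesis unfolding R_def
      by (intro rank_le_mult_right[OF VD(1) aU] rank_le_mult_left[OF V Dq(1)])
  qed
  ultimately show ?thesis using N R ANR by blast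
qed

text \<open>If more than \<open>r\<close> singular values exceeded \<open>\<epsilon>\<close>, the
  span of their singular vectors would contain a nonzero vector killed by \<open>R\<close>. There
  \<open>A\<close> acts as \<open>N\<close> and stretches by at most \<open>\<epsilon>\<close>,
  while every \<open>l j\<close> that contributes exceeds the square of
  \<open>\<epsilon>\<close>.\<close>

lemma split_imp_sv_count_le:
  assumes NR: "N \<in> carrier_mat n n" "R \<in> carrier_mat n n" and bd: "nbound N \<epsilon>" "rank_le R r" and e: "\<epsilon> \<ge> 0"
  shows "sv_count (N + R) \<epsilon> \<le> r"
proof (rule ccontr)
  define A where "A = N + R"
  have A: "A \<in> carrier_mat n n" using NR by (simp add: A_def)
  obtain U l where svd: "is_svd n A U l" using svd_exists[OF A] by blast
  note U = is_svdD(1,3)[OF svd]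
  note quad = is_svdD(5)[OF svd]
  note iso = is_svdD(6)[OF svd]
  note l = is_svdD(8)[OF svd]
  note sv = is_svdD(9)[OF svd]
  define J where "J = {j\<in>{..<n}. \<epsilon> < sqrt (l j)}"
  assume "\<not> sv_count (N + R) \<epsilon> \<le> r"
  then have cJ: "r < card J"
    by (simp add: sv_count_def sv filter_mset_image_mset J_def flip: A_def)
  obtain f g where fg: "\<And>i j. i < n \<Longrightarrow> j < n \<Longrightarrow> R $$ (i, j) = (\<Sum>t<r. f t i * g t j)"
    using NR(2) bd(2) unfolding rank_le_def by auto
  have fJ: "finite J" by (simp add: J_def)
  obtain h where h: "bij_betw h {0..<card J} J" using ex_bij_betw_nat_finite[OF fJ] by blast
  \<comment> \<open>The \<open>r\<close> equations say that the row factors of \<open>R\<close>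
    vanish on \<open>U w\<close>; the unknowns are the coefficients of \<open>w\<close> at the
    \<open>card J > r\<close> indices of \<open>J\<close>.\<close>
  obtain w0 where w0: "\<exists>j<card J. w0 j \<noteq> 0"
    "\<And>t. t < r \<Longrightarrow> (\<Sum>j<card J. (\<Sum>k<n. g t k * U $$ (k, h j)) * w0 j) = 0"
    using underdetermined_kernel[OF cJ, of "\<lambda>t j. \<Sum>k<n. g t k * U $$ (k, h j)"] by blast
  define w where "w = Matrix.vec n (\<lambda>j. if j \<in> J then w0 (the_inv_into {0..<card J} h j) else 0)"
  have w: "w \<in> carrier_vec n" by (simp add: w_def)
  have hJ: "h t \<in> J" if "t < card J" for t using h that by (auto simp: bij_betw_def)
  have wh: "w $v (h t) = w0 t" if "t < card J" for t
    using hJ[OF that] h that by (simp add: w_def J_def the_inv_into_f_f bij_betw_def)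
  have w0': "w $v j = 0" if "j < n" "j \<notin> J" for j using that by (simp add: w_def)
  have Uw: "U *\<^sub>v w \<in> carrier_vec n" by (rule mult_mat_vec_carrier[OF U(1) w])
  have ker: "(\<Sum>k<n. g t k * (U *\<^sub>v w) $v k) = 0" if t: "t < r" for t
  proof -
    have "(\<Sum>k<n. g t k * (U *\<^sub>v w) $v k) = (\<Sum>k<n. \<Sum>j<n. g t k * U $$ (k, j) * w $v j)"
      by (intro sum.cong refl) (simp add: mat_vec_index[OF U(1) w] sum_distrib_left mult.assoc del: index_mult_mat_vec)
    also have "\<dots> = (\<Sum>j<n. (\<Sum>k<n. g t k * U $$ (k, j)) * w $v j)"
      by (subst sum.swap) (simp add: sum_distrib_right)
    also have "\<dots> = (\<Sum>j\<in>J. (\<Sum>k<n. g t k * U $$ (k, j)) * w $v j)"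
      by (rule sum.mono_neutral_right) (auto simp: w0' J_def)
    also have "\<dots> = (\<Sum>j<card J. (\<Sum>k<n. g t k * U $$ (k, h j)) * w0 j)"
      using sum.reindex_bij_betw[OF h, of "\<lambda>j. (\<Sum>k<n. g t k * U $$ (k, j)) * w $v j"]
      by (simp add: atLeast0LessThan wh)
    finally show ?thesis using w0(2)[OF t] by simp
  qed
  have "R *\<^sub>v (U *\<^sub>v w) = 0\<^sub>v n"
  proof (rule eq_vecI)
    fix i assume "i < dim_vec (0\<^sub>v n :: complex Matrix.vec)"
    then have i: "i < n" by simp
    have "(R *\<^sub>v (U *\<^sub>v w)) $v i = (\<Sum>k<n. \<Sum>t<r. f t i * (g t k * (U *\<^sub>v w) $v k))"
      using i by (subst mat_vec_index[OF NR(2) Uw i]) (simp add: fg sum_distrib_right mult.assoc del: index_mult_mat_vec)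
    also have "\<dots> = (\<Sum>t<r. f t i * (\<Sum>k<n. g t k * (U *\<^sub>v w) $v k))"
      by (subst sum.swap) (simp add: sum_distrib_left)
    also have "\<dots> = 0" by (rule sum.neutral) (simp add: ker)
    finally show "(R *\<^sub>v (U *\<^sub>v w)) $v i = 0\<^sub>v n $v i" using i by simp
  qed (use NR in auto)
  then have "A *\<^sub>v (U *\<^sub>v w) = N *\<^sub>v (U *\<^sub>v w)"
    unfolding A_def using add_mult_distrib_mat_vec[OF NR Uw] mult_mat_vec_carrier[OF NR(1) Uw] by simp
  then have "vnorm (A *\<^sub>v (U *\<^sub>v w)) \<le> \<epsilon> * vnorm w"
    using nboundD[OF bd(1), of "U *\<^sub>v w"] Uw NR iso[OF w] by simp
  then have "(vnorm (A *\<^sub>v (U *\<^sub>v w)))\<^sup>2 \<le> (\<epsilon> * vnorm w)\<^sup>2" by (intro power_mono) auto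
  then have "(\<Sum>j<n. l j * (cmod (w $v j))\<^sup>2) \<le> (\<Sum>j<n. \<epsilon>\<^sup>2 * (cmod (w $v j))\<^sup>2)"
    unfolding quad[OF w] using w by (simp add: power_mult_distrib vnorm_sq sum_distrib_left)
  moreover have "(\<Sum>j<n. \<epsilon>\<^sup>2 * (cmod (w $v j))\<^sup>2) < (\<Sum>j<n. l j * (cmod (w $v j))\<^sup>2)"
  proof (rule sum_strict_mono_ex1)
    have big: "\<epsilon>\<^sup>2 < l j" if "j \<in> J" for j
    proof -
      have "\<epsilon> < sqrt (l j)" "j < n" using that by (auto simp: J_def)
      then have "\<epsilon>\<^sup>2 < (sqrt (l j))\<^sup>2" using e by (intro power_strict_mono) auto
      then show ?thesis using l[OF \<open>j < n\<close>] by simp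
    qed
    show "\<forall>j\<in>{..<n}. \<epsilon>\<^sup>2 * (cmod (w $v j))\<^sup>2 \<le> l j * (cmod (w $v j))\<^sup>2"
      using big w0' by (metis lessThan_iff less_imp_le mult_right_mono mult_zero_right norm_zero zero_eq_power2 zero_le_power2 order_refl)
    obtain t where t: "t < card J" "w0 t \<noteq> 0" using w0(1) by blast
    show "\<exists>j\<in>{..<n}. \<epsilon>\<^sup>2 * (cmod (w $v j))\<^sup>2 < l j * (cmod (w $v j))\<^sup>2"
      using hJ[OF t(1)] wh[OF t(1)] t(2) big[OF hJ[OF t(1)]] by (intro bexI[of _ "h t"]) (auto simp: J_def)
  qed simp
  ultimately show False by simp
qed

text \<open>Chebyshev's inequality for the squared singular values, whose sum is the squared
  Frobenius norm of \<open>A * U\<close> and hence at most that of \<open>A\<close>. This is how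
  small Frobenius norm becomes a splitting into small norm and small rank.\<close>

lemma sv_count_frob:
  assumes A: "A \<in> carrier_mat n n" and e: "\<epsilon> \<ge> 0"
  shows "\<epsilon>\<^sup>2 * sv_count A \<epsilon> \<le> frob A"
proof -
  obtain U l where svd: "is_svd n A U l" using svd_exists[OF A] by blast
  note U = is_svdD(1)[OF svd]
  note quad = is_svdD(5)[OF svd]
  note iso = is_svdD(6)[OF svd]
  note l = is_svdD(8)[OF svd]
  note sv = is_svdD(9)[OF svd]
  define J where "J = {j\<in>{..<n}. \<epsilon> < sqrt (l j)}"
  have "sv_count A \<epsilon> = card J" by (simp add: sv_count_def sv filter_mset_image_mset J_def)
  then have "\<epsilon>\<^sup>2 * sv_count A \<epsilon> = (\<Sum>j\<in>J. \<epsilon>\<^sup>2)" by simp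
  also have "\<dots> \<le> (\<Sum>j\<in>J. l j)"
  proof (rule sum_mono)
    fix j assume "j \<in> J"
    then have "\<epsilon> < sqrt (l j)" "j < n" by (auto simp: J_def)
    then have "\<epsilon>\<^sup>2 \<le> (sqrt (l j))\<^sup>2" using e by (intro power_mono) auto
    then show "\<epsilon>\<^sup>2 \<le> l j" using l[OF \<open>j < n\<close>] by simp
  qed
  also have "\<dots> \<le> (\<Sum>j<n. l j)" using l by (intro sum_mono2) (auto simp: J_def)
  also have "\<dots> = (\<Sum>j<n. (vnorm (col (A * U) j))\<^sup>2)"
  proof (rule sum.cong)
    fix j assume "j \<in> {..<n}"
    then have j: "j < n" by simp
    have "col (A * U) j = A *\<^sub>v col U j" by (rule col_mult2[OF A U j])
    also have "col U j = U *\<^sub>v unit_vec n j" using U j by (intro eq_vecI) auto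
    finally have "(vnorm (col (A * U) j))\<^sup>2 = (\<Sum>k<n. l k * (cmod (unit_vec n j $v k))\<^sup>2)"
      using quad[of "unit_vec n j"] by simp
    also have "\<dots> = (\<Sum>k<n. if k = j then l j else 0)" using j by (intro sum.cong) auto
    finally show "l j = (vnorm (col (A * U) j))\<^sup>2" using j by simp
  qed simp
  also have "\<dots> = frob (A * U)"
  proof -
    have "frob Y = (\<Sum>j<dim_col Y. (vnorm (col Y j))\<^sup>2)" for Y
      unfolding frob_def vnorm_sq by (subst sum.swap) simp
    then show ?thesis using U by simp
  qed
  also have "\<dots> \<le> 1\<^sup>2 * frob A"
    using iso U by (intro frob_mult_right[OF A U]) (auto simp: nbound_def)
  finally show ?thesis by simp
qed

text \<open>The bridge from entries to singular values: the unitary \<open>U\<close> turns the power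
  into the diagonal matrix of the \<open>l j ^ k\<close> and preserves the trace.\<close>

lemma trace_power_singular_values:
  assumes A: "A \<in> carrier_mat n n"
  shows "(\<Sum>i<n. ((mat_adjoint A * A) ^\<^sub>m k) $$ (i, i)) = of_real (\<Sum>\<sigma>\<in>#singular_values A. (\<sigma>\<^sup>2) ^ k)"
proof -
  obtain U l where svd: "is_svd n A U l" using svd_exists[OF A] by blast
  note U = is_svdD(1,2,3)[OF svd]
  note HU = is_svdD(4)[OF svd]
  note l = is_svdD(8)[OF svd]
  note sv = is_svdD(9)[OF svd]
  define H where "H = mat_adjoint A * A"
  have H: "H \<in> carrier_mat n n" unfolding H_def using A by (intro mult_carrier_mat[of _ n n]) auto
  have aU: "mat_adjoint U \<in> carrier_mat n n" using U by simp
  have Hk: "H ^\<^sub>m k \<in> carrier_mat n n" for k using H by simp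
  let ?D = "\<lambda>k. mat_diag n (\<lambda>i. complex_of_real (l i) ^ k)"
  have HkU: "H ^\<^sub>m k * U = U * ?D k" for k
  proof (induction k)
    case 0
    then show ?case using H U by simp
  next
    case (Suc k)
    have "H ^\<^sub>m Suc k * U = H ^\<^sub>m k * (H * U)" using assoc_mult_mat[OF Hk H U(1)] by simp
    also have "\<dots> = H ^\<^sub>m k * U * mat_diag n (\<lambda>i. complex_of_real (l i))"
      unfolding HU[folded H_def] by (rule assoc_mult_mat[symmetric, OF Hk U(1) mat_diag_dim])
    also have "\<dots> = U * (?D k * mat_diag n (\<lambda>i. complex_of_real (l i)))"
      unfolding Suc by (rule assoc_mult_mat[OF U(1) mat_diag_dim mat_diag_dim])
    finally show ?case by (simp add: mult.commute)
  qed
  have UD: "U * ?D k \<in> carrier_mat n n" using mult_carrier_mat[OF U(1), of "?D k" n] by simp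
  have "H ^\<^sub>m k = H ^\<^sub>m k * (U * mat_adjoint U)" using U(3) H by simp
  also have "\<dots> = U * ?D k * mat_adjoint U"
    unfolding HkU[symmetric] by (rule assoc_mult_mat[symmetric, OF Hk U(1) aU])
  finally have Heq: "H ^\<^sub>m k = U * ?D k * mat_adjoint U" .
  have "(\<Sum>i<n. (H ^\<^sub>m k) $$ (i, i)) = (\<Sum>i<n. \<Sum>j<n. U $$ (i, j) * of_real (l j) ^ k * cnj (U $$ (i, j)))"
    unfolding Heq
    by (intro sum.cong refl, subst mat_mult_index[OF UD aU])
       (use U in \<open>auto simp: mat_diag_mult_right[of _ n n] intro!: sum.cong\<close>)
  also have "\<dots> = (\<Sum>j<n. of_real (l j) ^ k * (\<Sum>i<n. cnj (U $$ (i, j)) * U $$ (i, j)))"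
    by (subst sum.swap) (simp add: sum_distrib_left mult_ac)
  also have "\<dots> = (\<Sum>j<n. of_real (l j) ^ k)"
  proof (rule sum.cong)
    fix j assume "j \<in> {..<n}"
    then have j: "j < n" by simp
    have "(mat_adjoint U * U) $$ (j, j) = (\<Sum>i<n. mat_adjoint U $$ (j, i) * U $$ (i, j))"
      by (rule mat_mult_index[OF aU U(1) j j])
    then have "(\<Sum>i<n. cnj (U $$ (i, j)) * U $$ (i, j)) = 1" using U j by simp
    then show "of_real (l j) ^ k * (\<Sum>i<n. cnj (U $$ (i, j)) * U $$ (i, j)) = complex_of_real (l j) ^ k" by simp
  qed simp
  also have "\<dots> = of_real (\<Sum>\<sigma>\<in>#singular_values A. (\<sigma>\<^sup>2) ^ k)"
    using l by (simp add: sv image_mset.compositionality o_def sum_unfold_sum_mset[symmetric])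
  finally show ?thesis by (simp add: H_def)
qed

lemma size_singular_values:
  assumes "A \<in> carrier_mat n n" shows "size (singular_values A) = n"
proof -
  obtain U l where "is_svd n A U l" using svd_exists[OF assms] by blast
  from is_svdD(9)[OF this] show ?thesis by simp
qed

text \<open>The upper bound is the case of rank 0: with \<open>R = 0\<close>, no singular value can
  exceed the norm bound.\<close>

lemma singular_values_bounds:
  assumes A: "A \<in> carrier_mat n n" and C: "nbound A C" "C \<ge> 0" and s: "\<sigma> \<in># singular_values A"
  shows "0 \<le> \<sigma>" "\<sigma> \<le> C"
proof -
  obtain U l where svd: "is_svd n A U l" using svd_exists[OF A] by blast
  show "0 \<le> \<sigma>" using s is_svdD(8)[OF svd] by (auto simp: is_svdD(9)[OF svd])
  have "sv_count (A + 0\<^sub>m n n) C \<le> 0"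
    using A C by (intro split_imp_sv_count_le rank_le_zero) auto
  then have "filter_mset (\<lambda>s. C < s) (singular_values A) = {#}"
    using A by (simp add: sv_count_def)
  moreover have "\<sigma> \<in># filter_mset (\<lambda>s. C < s) (singular_values A)" if "C < \<sigma>"
    using s that by simp
  ultimately show "\<sigma> \<le> C" by force
qed

section \<open>Multi-indices and Riemann sums\<close>

lemma bij_betw_vec_nth_PiE:
  "bij_betw vec_nth {i :: 'a ^ 'd. \<forall>j. i $ j \<in> F j} (Pi\<^sub>E UNIV F)"
  by (rule bij_betw_byWitness[of _ vec_lambda]) (auto simp: vec_nth_inverse)

lemma card_vec_box:
  fixes F :: "'d::finite \<Rightarrow> 'a set"
  shows "card {i :: 'a ^ 'd. \<forall>j. i $ j \<in> F j} = (\<Prod>j\<in>UNIV. card (F j))"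
  using bij_betw_same_card[OF bij_betw_vec_nth_PiE[of F]] by (simp add: card_PiE)

lemma finite_vec_box:
  fixes F :: "'d::finite \<Rightarrow> 'a set"
  assumes "\<And>j. finite (F j)"
  shows "finite {i :: 'a ^ 'd. \<forall>j. i $ j \<in> F j}"
  using bij_betw_finite[OF bij_betw_vec_nth_PiE[of F]] assms by (simp add: finite_PiE)

lemma index_set_eq: "{1..n :: nat ^ 'd} = {i. \<forall>j. i $ j \<in> {1..n $ j}}"
  by (auto simp: Finite_Cartesian_Product.less_eq_vec_def)

lemma finite_index_set [simp]: "finite {1..n :: nat ^ 'd}"
  unfolding index_set_eq by (rule finite_vec_box) simp

lemma card_index_set [simp]: "card {1..n :: nat ^ 'd} = N_of n"
  unfolding index_set_eq card_vec_box N_of_def by simp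

lemma lex_less_irrefl: "\<not> lex_less i i"
  by (simp add: lex_less_def)

lemma lex_less_trans:
  assumes "lex_less i j" "lex_less j k" shows "lex_less i k"
proof -
  obtain r where r: "i $ r < j $ r" "\<And>s. s < r \<Longrightarrow> i $ s = j $ s" using assms(1) by (auto simp: lex_less_def)
  obtain q where q: "j $ q < k $ q" "\<And>s. s < q \<Longrightarrow> j $ s = k $ s" using assms(2) by (auto simp: lex_less_def)
  show ?thesis unfolding lex_less_def
  proof (intro exI[of _ "min r q"] conjI allI impI)
    show "i $ min r q < k $ min r q"
      using r q by (cases r q rule: linorder_cases) (auto simp: min_def)
  qed (use r q in auto)
qed

lemma lex_less_total:
  fixes i j :: "nat ^ 'd::{finite,linorder}"
  assumes "i \<noteq> j" shows "lex_less i j \<or> lex_less j i"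
proof -
  let ?S = "{r. i $ r \<noteq> j $ r}"
  have ne: "?S \<noteq> {}" using assms by (auto simp: Finite_Cartesian_Product.vec_eq_iff)
  define r where "r = Min ?S"
  have r: "i $ r \<noteq> j $ r" using Min_in[OF _ ne] by (simp add: r_def)
  have "i $ s = j $ s" if "s < r" for s
  proof (rule ccontr)
    assume "i $ s \<noteq> j $ s"
    then have "r \<le> s" unfolding r_def by (intro Min_le) auto
    then show False using that by simp
  qed
  then show ?thesis using r unfolding lex_less_def by (metis linorder_neqE_nat)
qed

text \<open>Counting predecessors in a strict total order is strictly monotone, hence injective; its
  values lie below \<open>N_of n\<close>, and equal cardinalities make it onto.
  \<open>midx n\<close> is the inverse of this ranking.\<close>

lemma bij_betw_midx:
  fixes n :: "nat ^ 'd::{finite,linorder}"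
  shows "bij_betw (midx n) {..<N_of n} {1..n}"
proof -
  let ?S = "{1..n}"
  define rk where "rk i = card {j \<in> ?S. lex_less j i}" for i
  have less: "rk i < rk k" if "i \<in> ?S" "k \<in> ?S" "lex_less i k" for i k
    unfolding rk_def
  proof (rule psubset_card_mono)
    show "{j \<in> ?S. lex_less j i} \<subset> {j \<in> ?S. lex_less j k}"
      using that lex_less_irrefl lex_less_trans[OF _ that(3)] by blast
  qed (rule finite_subset[OF _ finite_index_set[of n]], blast)
  have inj: "inj_on rk ?S"
  proof (rule inj_onI, rule ccontr)
    fix i k assume ik: "i \<in> ?S" "k \<in> ?S" "rk i = rk k" "i \<noteq> k"
    show False using lex_less_total[OF ik(4)] less ik by (metis less_irrefl)
  qed
  have "rk i < N_of n" if "i \<in> ?S" for i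
  proof -
    have "card {j \<in> ?S. lex_less j i} < card ?S"
      by (rule psubset_card_mono[OF finite_index_set]) (use that lex_less_irrefl[of i] in blast)
    then show ?thesis by (simp add: rk_def)
  qed
  then have "rk ` ?S \<subseteq> {..<N_of n}" by auto
  moreover have "card (rk ` ?S) = card {..<N_of n}" using card_image[OF inj] by simp
  ultimately have "rk ` ?S = {..<N_of n}" by (intro card_subset_eq) auto
  then have bij: "bij_betw rk ?S {..<N_of n}" using inj by (simp add: bij_betw_def)
  have "midx n p = the_inv_into ?S rk p" for p
    unfolding midx_def the_inv_into_def rk_def ..
  then show ?thesis using bij_betw_the_inv_into[OF bij] by (simp cong: bij_betw_cong)
qed

lemma midx_in: "p < N_of n \<Longrightarrow> midx n p \<in> {1..n}"
  using bij_betw_midx[of n] by (metis bij_betwE lessThan_iff)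

lemma midx_eq_iff: "p < N_of n \<Longrightarrow> q < N_of n \<Longrightarrow> midx n p = midx n q \<longleftrightarrow> p = q"
  using bij_betw_midx[of n] by (auto simp: bij_betw_def inj_on_eq_iff)

lemma sum_midx: "(\<Sum>p<N_of n. f (midx n p)) = (\<Sum>i\<in>{1..n}. f i)"
  by (rule sum.reindex_bij_betw[OF bij_betw_midx])

lemma card_midx: "card {p. p < N_of n \<and> P (midx n p)} = card {i \<in> {1..n}. P i}"
proof -
  have "{i \<in> {1..n}. P i} = midx n ` {p. p < N_of n \<and> P (midx n p)}"
    unfolding bij_betw_imp_surj_on[OF bij_betw_midx, symmetric] by auto
  moreover have "inj_on (midx n) {p. p < N_of n \<and> P (midx n p)}"
    by (rule inj_on_subset[OF bij_betw_imp_inj_on[OF bij_betw_midx]]) auto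
  ultimately show ?thesis by (simp add: card_image)
qed

text \<open>At most a fraction \<open>card T / n $ j\<close> of the multi-indices has its j-th
  coordinate in \<open>T\<close>. Stated without division, so that the case \<open>n $ j = 0\<close>
  is covered.\<close>

lemma card_coordinate_le:
  fixes n :: "nat ^ 'd"
  assumes "finite T"
  shows "card {i \<in> {1..n}. i $ j \<in> T} * n $ j \<le> card T * N_of n"
proof -
  let ?F = "\<lambda>k. if k = j then T \<inter> {1..n $ k} else {1..n $ k}"
  have eq: "{i \<in> {1..n}. i $ j \<in> T} = {i. \<forall>k. i $ k \<in> ?F k}"
    unfolding index_set_eq by (auto split: if_splits)
  have "card {i \<in> {1..n}. i $ j \<in> T} = card (T \<inter> {1..n $ j}) * (\<Prod>k\<in>UNIV - {j}. n $ k)"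
    unfolding eq card_vec_box by (subst prod.remove[of _ j]) (auto intro!: prod.cong)
  moreover have "N_of n = n $ j * (\<Prod>k\<in>UNIV - {j}. n $ k)"
    unfolding N_of_def by (subst prod.remove[of _ j]) auto
  moreover have "card (T \<inter> {1..n $ j}) \<le> card T" using assms by (intro card_mono) auto
  ultimately show ?thesis by simp
qed

text \<open>The indices that stay in \<open>{1..n}\<close> under every shift with entries at most
  \<open>L\<close> in absolute value; at these a row of bandwidth \<open>L\<close> is
  complete.\<close>

definition far_from_boundary :: "nat \<Rightarrow> nat ^ 'd \<Rightarrow> nat ^ 'd \<Rightarrow> bool" where
  "far_from_boundary L n i \<longleftrightarrow> (\<forall>j. L < i $ j \<and> i $ j + L \<le> n $ j)"

text \<open>Each coordinate rules out at most \<open>2 * L\<close> of its values, and there are at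
  least \<open>M\<close> values; the rest is a union bound over the coordinates.\<close>

lemma card_near_boundary:
  fixes n :: "nat ^ 'd"
  assumes M: "\<And>j. n $ j \<ge> M" and "M > 0"
  shows "real (card {i \<in> {1..n}. \<not> far_from_boundary L n i}) \<le> 2 * L * CARD('d) / M * N_of n"
proof -
  let ?A = "\<lambda>j. {i \<in> {1..n}. i $ j \<in> {1..L} \<union> {n $ j - L<..n $ j}}"
  have sub: "{i \<in> {1..n}. \<not> far_from_boundary L n i} \<subseteq> (\<Union>j. ?A j)"
  proof
    fix i assume i: "i \<in> {i \<in> {1..n}. \<not> far_from_boundary L n i}"
    then obtain j where "i $ j \<le> L \<or> n $ j < i $ j + L"
      by (auto simp: far_from_boundary_def not_less not_le)
    moreover have "1 \<le> i $ j" "i $ j \<le> n $ j" using i by (auto simp: index_set_eq)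
    ultimately have "i \<in> ?A j" using i by auto
    then show "i \<in> (\<Union>j. ?A j)" by blast
  qed
  have "real (card (?A j)) \<le> 2 * L / M * N_of n" for j
  proof -
    have "card ({1..L} \<union> {n $ j - L<..n $ j}) \<le> card {1..L} + card {n $ j - L<..n $ j}" by (rule card_Un_le)
    also have "\<dots> \<le> 2 * L" by simp
    finally have c: "card ({1..L} \<union> {n $ j - L<..n $ j}) \<le> 2 * L" .
    have "card (?A j) * M \<le> card (?A j) * n $ j" using M by simp
    also have "\<dots> \<le> card ({1..L} \<union> {n $ j - L<..n $ j}) * N_of n" by (rule card_coordinate_le) simp
    also have "\<dots> \<le> 2 * L * N_of n" using c by (rule mult_right_mono) simp
    finally have "real (card (?A j) * M) \<le> real (2 * L * N_of n)" using of_nat_le_iff by blast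
    then show ?thesis using assms(2) by (simp add: field_simps)
  qed
  then have "(\<Sum>j\<in>UNIV. real (card (?A j))) \<le> (\<Sum>j\<in>(UNIV :: 'd set). 2 * L / M * N_of n)" by (rule sum_mono)
  moreover have "real (card {i \<in> {1..n}. \<not> far_from_boundary L n i}) \<le> (\<Sum>j\<in>UNIV. real (card (?A j)))"
  proof -
    have "card {i \<in> {1..n}. \<not> far_from_boundary L n i} \<le> card (\<Union>j. ?A j)" using sub finite_subset[of "\<Union>j. ?A j", OF _ finite_index_set[of n]]
      by (intro card_mono) blast+
    also have "\<dots> \<le> (\<Sum>j\<in>UNIV. card (?A j))" by (rule card_UN_le) simp
    finally show ?thesis by (simp flip: of_nat_sum)
  qed
  ultimately show ?thesis by (simp add: mult_ac)
qed

lemma idx_div_in_cube: "i \<in> {1..n} \<Longrightarrow> idx_div i n \<in> cbox 0 (1 :: real ^ 'd)"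
  by (auto simp: idx_div_def mem_box_cart Finite_Cartesian_Product.less_eq_vec_def divide_simps)

text \<open>The cells with upper corner \<open>idx_div i n\<close> cover the unit cube, have volume
  \<open>1 / N_of n\<close> and overlap in null sets. On each cell \<open>g\<close> differs from its
  value at that corner by at most \<open>\<epsilon>\<close>.\<close>

lemma riemann_sum_estimate:
  fixes g :: "real ^ 'd \<Rightarrow> complex" and n :: "nat ^ 'd"
  assumes g: "continuous_on (cbox 0 1) g" and n: "\<And>j. n $ j > 0"
    and osc: "\<And>x y. x \<in> cbox 0 1 \<Longrightarrow> y \<in> cbox 0 1 \<Longrightarrow> (\<And>j. \<bar>x $ j - y $ j\<bar> \<le> 1 / n $ j) \<Longrightarrow> norm (g x - g y) \<le> \<epsilon>"
    and e: "\<epsilon> \<ge> 0"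
  shows "norm ((\<Sum>i\<in>{1..n}. g (idx_div i n)) / N_of n - integral (cbox 0 1) g) \<le> \<epsilon>"
proof -
  define lo :: "nat ^ 'd \<Rightarrow> real ^ 'd" where "lo i = (\<chi> j. (real (i $ j) - 1) / n $ j)" for i
  define T where "T i = cbox (lo i) (idx_div i n)" for i
  have N0: "N_of n > 0" using n by (simp add: N_of_def prod_pos)
  have cont: "measure lborel (T i) = 1 / N_of n" for i
  proof -
    have "lo i $ j \<le> idx_div i n $ j" for j using n[of j] by (simp add: lo_def idx_div_def divide_simps)
    then have "measure lborel (T i) = (\<Prod>j\<in>UNIV. idx_div i n $ j - lo i $ j)"
      unfolding T_def by (intro content_cbox_cart) (auto simp: interval_ne_empty_cart)
    also have "\<dots> = (\<Prod>j\<in>UNIV. inverse (real (n $ j)))"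
      using n by (intro prod.cong) (auto simp: lo_def idx_div_def field_simps)
    also have "\<dots> = 1 / N_of n" by (simp add: N_of_def prod_dividef inverse_eq_divide)
    finally show ?thesis .
  qed
  have sub: "T i \<subseteq> cbox 0 1" if "i \<in> {1..n}" for i
  proof -
    have *: "1 \<le> i $ j" "i $ j \<le> n $ j" for j using that by (auto simp: index_set_eq)
    have b: "0 \<le> lo i $ j" "idx_div i n $ j \<le> 1" for j
      using *[of j] n[of j] by (auto simp: lo_def idx_div_def divide_simps)
    show ?thesis
    proof
      fix x assume "x \<in> T i"
      then have "lo i $ j \<le> x $ j" "x $ j \<le> idx_div i n $ j" for j by (auto simp: T_def mem_box_cart)
      then have "0 \<le> x $ j" "x $ j \<le> 1" for j using b[of j] order_trans by blast+
      then show "x \<in> cbox 0 1" by (simp add: mem_box_cart)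
    qed
  qed
  have un: "(\<Union>i\<in>{1..n}. T i) = cbox 0 1"
  proof
    show "cbox 0 1 \<subseteq> (\<Union>i\<in>{1..n}. T i)"
    proof
      fix x :: "real ^ 'd" assume "x \<in> cbox 0 1"
      then have x: "0 \<le> x $ j" "x $ j \<le> 1" for j by (auto simp: mem_box_cart)
      \<comment> \<open>The maximum with 1 takes care of \<open>x $ j = 0\<close>, where the ceiling
        is 0 and no index.\<close>
      define i :: "nat ^ 'd" where "i = (\<chi> j. max 1 (nat \<lceil>n $ j * x $ j\<rceil>))"
      have ij: "1 \<le> i $ j \<and> i $ j \<le> n $ j \<and> lo i $ j \<le> x $ j \<and> x $ j \<le> idx_div i n $ j" for j
      proof -
        have a: "real (n $ j) * x $ j \<le> n $ j" using x[of j] by (simp add: mult_left_le)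
        have b: "0 \<le> real (n $ j) * x $ j" using x[of j] by simp
        define m where "m = max 1 (nat \<lceil>n $ j * x $ j\<rceil>)"
        have ceil: "real (nat \<lceil>n $ j * x $ j\<rceil>) \<ge> n $ j * x $ j"
          "real (nat \<lceil>n $ j * x $ j\<rceil>) - 1 \<le> n $ j * x $ j" using b by linarith+
        have m: "1 \<le> m" "m \<le> n $ j" "real m - 1 \<le> n $ j * x $ j"
          using n[of j] a b ceil(2) by (auto simp: m_def max_def ceiling_le_iff nat_le_iff)
        have "real (nat \<lceil>n $ j * x $ j\<rceil>) \<le> real m" unfolding m_def of_nat_le_iff by (rule max.cobounded2)
        with ceil(1) have m': "n $ j * x $ j \<le> real m" by (rule order_trans)
        have "i $ j = m" by (simp add: i_def m_def)
        then show ?thesis using n[of j] m m' by (auto simp: lo_def idx_div_def divide_simps mult.commute)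
      qed
      then have "i \<in> {1..n}" "x \<in> T i" by (auto simp: index_set_eq T_def mem_box_cart)
      then show "x \<in> (\<Union>i\<in>{1..n}. T i)" by blast
    qed
  qed (use sub in blast)
  \<comment> \<open>Different cells are separated in some coordinate, so they share at most a piece
    of a hyperplane.\<close>
  have neg: "negligible (T i \<inter> T k)" if ik: "i \<noteq> k" for i k
  proof -
    have *: "negligible (T i \<inter> T k)" if j: "i $ j < k $ j" for i k j
    proof (rule negligible_subset)
      show "negligible {x :: real ^ 'd. x $ j = i $ j / n $ j}"
      proof -
        have "axis j 1 \<in> (Basis :: (real ^ 'd) set)" by (auto simp: Basis_vec_def)
        from negligible_standard_hyperplane[OF this, of "i $ j / n $ j"]
        show ?thesis by (simp add: cart_eq_inner_axis)
      qed
      show "T i \<inter> T k \<subseteq> {x. x $ j = i $ j / n $ j}"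
      proof
        fix x assume x: "x \<in> T i \<inter> T k"
        then have "x $ j \<le> i $ j / n $ j" "(real (k $ j) - 1) / n $ j \<le> x $ j"
          by (auto simp: T_def mem_box_cart idx_div_def lo_def)
        moreover have "i $ j / n $ j \<le> (real (k $ j) - 1) / n $ j"
          using j by (intro divide_right_mono) auto
        ultimately show "x \<in> {x. x $ j = i $ j / n $ j}" by auto
      qed
    qed
    obtain j where "i $ j \<noteq> k $ j" using ik by (auto simp: Finite_Cartesian_Product.vec_eq_iff)
    then show ?thesis using *[of i j k] *[of k j i] by (auto simp: Int_commute neq_iff)
  qed
  have int: "(g has_integral integral (T i) g) (T i)" if "i \<in> {1..n}" for i
    using continuous_on_subset[OF g sub[OF that]] unfolding T_def
    by (intro integrable_integral integrable_continuous)
  have "(g has_integral (\<Sum>i\<in>{1..n}. integral (T i) g)) (\<Union>i\<in>{1..n}. T i)"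
    using int neg by (intro has_integral_UN) (auto simp: pairwise_def)
  then have I: "integral (cbox 0 1) g = (\<Sum>i\<in>{1..n}. integral (T i) g)"
    unfolding un by (rule integral_unique)
  have bd: "norm (g (idx_div i n) / N_of n - integral (T i) g) \<le> \<epsilon> / N_of n" if i: "i \<in> {1..n}" for i
  proof -
    have "((\<lambda>x. g (idx_div i n) - g x) has_integral (measure lborel (T i) *\<^sub>R g (idx_div i n) - integral (T i) g)) (T i)"
      by (intro has_integral_diff int[OF i]) (auto simp: T_def)
    then have "norm (measure lborel (T i) *\<^sub>R g (idx_div i n) - integral (T i) g) \<le> \<epsilon> * measure lborel (T i)"
      unfolding T_def
    proof (rule has_integral_bound[OF e])
      fix x assume x: "x \<in> cbox (lo i) (idx_div i n)"
      show "norm (g (idx_div i n) - g x) \<le> \<epsilon>"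
      proof (rule osc)
        fix j
        have "lo i $ j \<le> x $ j" "x $ j \<le> idx_div i n $ j" using x by (auto simp: mem_box_cart)
        then show "\<bar>idx_div i n $ j - x $ j\<bar> \<le> 1 / n $ j"
          using n[of j] by (auto simp: lo_def idx_div_def diff_divide_distrib)
      qed (use idx_div_in_cube[OF i] sub[OF i] x in \<open>auto simp: T_def\<close>)
    qed
    then show ?thesis by (simp add: cont scaleR_conv_of_real)
  qed
  have "norm ((\<Sum>i\<in>{1..n}. g (idx_div i n)) / N_of n - integral (cbox 0 1) g)
     = norm (\<Sum>i\<in>{1..n}. g (idx_div i n) / N_of n - integral (T i) g)"
    unfolding I by (simp add: sum_subtractf sum_divide_distrib)
  also have "\<dots> \<le> (\<Sum>i\<in>{1..n}. \<epsilon> / N_of n)" by (rule sum_norm_le) (use bd in auto)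
  also have "\<dots> = \<epsilon>" using N0 by simp
  finally show ?thesis .
qed

lemma norm_vec_le: "norm (x :: real ^ 'd) \<le> (\<Sum>j\<in>UNIV. \<bar>x $ j\<bar>)"
  by (rule norm_le_l1_cart)

lemma uniform_oscillation:
  fixes g :: "real ^ 'd \<Rightarrow> complex"
  assumes g: "continuous_on (cbox 0 1) g" and e: "\<epsilon> > 0"
  shows "\<exists>\<delta>>0. \<forall>x\<in>cbox 0 1. \<forall>y\<in>cbox 0 1. (\<forall>j. \<bar>x $ j - y $ j\<bar> \<le> \<delta>) \<longrightarrow> norm (g x - g y) \<le> \<epsilon>"
proof -
  have "uniformly_continuous_on (cbox 0 1) g" using g by (intro compact_uniformly_continuous) auto
  then obtain d where d: "d > 0" "\<And>x y. x \<in> cbox 0 1 \<Longrightarrow> y \<in> cbox 0 1 \<Longrightarrow> dist y x < d \<Longrightarrow> dist (g y) (g x) < \<epsilon>"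
    unfolding uniformly_continuous_on_def using e by meson
  show ?thesis
  proof (intro exI[of _ "d / (2 * CARD('d))"] conjI ballI impI)
    fix x y :: "real ^ 'd" assume xy: "x \<in> cbox 0 1" "y \<in> cbox 0 1" "\<forall>j. \<bar>x $ j - y $ j\<bar> \<le> d / (2 * CARD('d))"
    have "dist x y \<le> (\<Sum>j\<in>UNIV. \<bar>(x - y) $ j\<bar>)" unfolding dist_norm by (rule norm_vec_le)
    also have "\<dots> \<le> (\<Sum>j\<in>(UNIV :: 'd set). d / (2 * CARD('d)))" using xy(3) by (intro sum_mono) auto
    also have "\<dots> < d" using d(1) by simp
    finally show "norm (g x - g y) \<le> \<epsilon>" using d(2)[OF xy(2,1)] by (simp add: dist_norm)
  qed (use d in auto)
qed

section \<open>Asymptotics along a sequence of grids\<close>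

locale grid =
  fixes \<nn> :: "nat \<Rightarrow> nat ^ 'd::{finite,linorder}"
  assumes min_at_top: "filterlim (\<lambda>n. Min (range (\<lambda>j. \<nn> n $ j))) at_top sequentially"
begin

lemma eventually_ge: "\<forall>\<^sub>F n in sequentially. \<forall>j. \<nn> n $ j \<ge> L"
  using min_at_top unfolding filterlim_at_top by (auto elim!: eventually_mono)

lemma eventually_small: "\<delta> > 0 \<Longrightarrow> \<forall>\<^sub>F n in sequentially. \<forall>j. C / \<nn> n $ j \<le> \<delta> \<and> \<nn> n $ j > 0"
proof -
  assume d: "\<delta> > 0"
  show ?thesis using eventually_ge[of "max 1 (nat \<lceil>C / \<delta>\<rceil>)"]
  proof eventually_elim
    case (elim n)
    show ?case
    proof
      fix j
      have "real (\<nn> n $ j) \<ge> C / \<delta>" "\<nn> n $ j \<ge> 1" using elim[rule_format, of j] by (auto simp: max_def split: if_splits) linarith+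
      then show "C / \<nn> n $ j \<le> \<delta> \<and> \<nn> n $ j > 0" using d by (auto simp: field_simps)
    qed
  qed
qed

lemma eventually_N_pos: "\<forall>\<^sub>F n in sequentially. N_of (\<nn> n) > 0"
  using eventually_ge[of 1] by eventually_elim (auto simp: N_of_def intro!: prod_pos Suc_le_lessD)

lemma riemann_sums:
  fixes g :: "real ^ 'd::{finite,linorder} \<Rightarrow> complex"
  assumes g: "continuous_on (cbox 0 1) g"
  shows "(\<lambda>n. (\<Sum>p<N_of (\<nn> n). g (idx_div (midx (\<nn> n) p) (\<nn> n))) / N_of (\<nn> n)) \<longlonglongrightarrow> integral (cbox 0 1) g"
proof (rule tendstoI, unfold dist_norm)
  fix e :: real assume e: "e > 0"
  obtain \<delta> where d: "\<delta> > 0" "\<And>x y. x \<in> cbox 0 1 \<Longrightarrow> y \<in> cbox 0 1 \<Longrightarrow> (\<And>j. \<bar>x $ j - y $ j\<bar> \<le> \<delta>) \<Longrightarrow> norm (g x - g y) \<le> e / 2"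
    using uniform_oscillation[OF g, of "e / 2"] e by auto
  show "\<forall>\<^sub>F n in sequentially. norm ((\<Sum>p<N_of (\<nn> n). g (idx_div (midx (\<nn> n) p) (\<nn> n))) / N_of (\<nn> n) - integral (cbox 0 1) g) < e"
    using eventually_small[OF d(1), of 1]
  proof eventually_elim
    case (elim n)
    have "norm ((\<Sum>i\<in>{1..\<nn> n}. g (idx_div i (\<nn> n))) / N_of (\<nn> n) - integral (cbox 0 1) g) \<le> e / 2"
    proof (rule riemann_sum_estimate[OF g])
      fix x y :: "real ^ 'd::{finite,linorder}" assume xy: "x \<in> cbox 0 1" "y \<in> cbox 0 1" "\<And>j. \<bar>x $ j - y $ j\<bar> \<le> 1 / \<nn> n $ j"
      show "norm (g x - g y) \<le> e / 2"
        by (rule d(2)[OF xy(1,2)]) (use elim xy(3) in \<open>meson order_trans\<close>)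
    qed (use elim e in auto)
    then show ?case using e sum_midx[of "\<lambda>i. g (idx_div i (\<nn> n))" "\<nn> n"] by simp
  qed
qed

lemma near_boundary_null:
  "(\<lambda>n. real (card {i \<in> {1..\<nn> n}. \<not> far_from_boundary L (\<nn> n) i}) / N_of (\<nn> n)) \<longlonglongrightarrow> 0"
proof (rule tendstoI, unfold dist_norm)
  fix e :: real assume e: "e > 0"
  \<comment> \<open>With all \<open>\<nn> n $ j\<close> at least \<open>M\<close>, the bound of
    \<open>card_near_boundary\<close> is below the proportion \<open>e\<close>.\<close>
  define M where "M = Suc (nat \<lceil>2 * L * CARD('d) / e\<rceil>)"
  have "2 * L * CARD('d) / e < M" unfolding M_def by linarith
  moreover have "real M > 0" by (simp add: M_def)
  ultimately have M: "2 * L * CARD('d) / M < e" using e by (simp add: pos_divide_less_eq mult.commute)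
  show "\<forall>\<^sub>F n in sequentially. norm (real (card {i \<in> {1..\<nn> n}. \<not> far_from_boundary L (\<nn> n) i}) / N_of (\<nn> n) - 0) < e"
    using eventually_ge[of M] eventually_N_pos
  proof eventually_elim
    case (elim n)
    have "real (card {i \<in> {1..\<nn> n}. \<not> far_from_boundary L (\<nn> n) i}) \<le> 2 * L * CARD('d) / M * N_of (\<nn> n)"
      using elim by (intro card_near_boundary) (auto simp: M_def)
    also have "\<dots> < e * N_of (\<nn> n)" using M elim(2) by (intro mult_strict_right_mono) auto
    finally show ?case using elim(2) by (simp add: field_simps)
  qed
qed

end

section \<open>Fourier coefficients of trigonometric polynomials\<close>

text \<open>Fubini in coordinates: \<open>lborel\<close> is the image of the product measure over
  the basis.\<close>

lemma integral_lborel_prod_Basis: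
  fixes f :: "'a::euclidean_space \<Rightarrow> real \<Rightarrow> complex"
  assumes f: "\<And>b. b \<in> Basis \<Longrightarrow> integrable lborel (f b)"
  shows "(\<integral>x. (\<Prod>b\<in>Basis. f b (x \<bullet> b)) \<partial>(lborel :: 'a measure)) = (\<Prod>b\<in>Basis. integral\<^sup>L lborel (f b))"
proof -
  interpret product_sigma_finite "\<lambda>_ :: 'a. lborel :: real measure" ..
  have [measurable]: "f b \<in> borel_measurable borel" if "b \<in> Basis" for b
    using borel_measurable_integrable[OF f[OF that]] by simp
  have "(\<integral>x. (\<Prod>b\<in>Basis. f b (x \<bullet> b)) \<partial>(lborel :: 'a measure))
    = (\<integral>y. (\<Prod>b\<in>Basis. f b ((\<Sum>c\<in>Basis. y c *\<^sub>R c) \<bullet> b)) \<partial>(\<Pi>\<^sub>M b\<in>(Basis :: 'a set). lborel))"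
    by (subst lborel_eq, subst integral_distr) auto
  also have "\<dots> = (\<integral>y. (\<Prod>b\<in>Basis. f b (y b)) \<partial>(\<Pi>\<^sub>M b\<in>(Basis :: 'a set). lborel))"
    by (intro Bochner_Integration.integral_cong refl prod.cong) (auto simp: inner_sum_left_Basis)
  also have "\<dots> = (\<Prod>b\<in>Basis. integral\<^sup>L lborel (f b))"
    by (rule product_integral_prod) (use f in auto)
  finally show ?thesis .
qed

lemma exp_int_integral:
  fixes m :: int
  shows "has_bochner_integral lborel (\<lambda>t. indicator {- pi..pi} t *\<^sub>R exp (\<i> * of_real (m * t))) (if m = 0 then of_real (2 * pi) else 0 :: complex)"
proof (cases "m = 0")
  case True
  have "has_bochner_integral lborel (\<lambda>t. indicator {- pi..pi} t *\<^sub>R (1 :: complex)) (of_real pi - of_real (- pi))"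
    by (rule has_bochner_integral_FTC_Icc) (auto intro!: derivative_eq_intros simp: has_vector_derivative_def scaleR_conv_of_real)
  then show ?thesis using True by simp
next
  case False
  let ?F = "\<lambda>t :: real. exp (\<i> * of_real (m * t)) / (\<i> * of_int m)"
  have "has_bochner_integral lborel (\<lambda>t. indicator {- pi..pi} t *\<^sub>R exp (\<i> * of_real (m * t))) (?F pi - ?F (- pi))"
  proof (rule has_bochner_integral_FTC_Icc)
    fix x :: real
    have "((\<lambda>t. exp (\<i> * of_int m * t) / (\<i> * of_int m)) has_field_derivative exp (\<i> * of_int m * of_real x)) (at (of_real x))"
      using False by (auto intro!: derivative_eq_intros)
    from has_vector_derivative_real_field[OF this]
    show "(?F has_vector_derivative exp (\<i> * of_real (m * x))) (at x within {- pi..pi})"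
      by (simp add: mult.assoc o_def)
  qed (auto intro!: continuous_intros)
  also have "exp (\<i> * of_real (m * pi)) = exp (\<i> * of_real (m * - pi))"
  proof -
    have "exp (\<i> * of_real (m * - pi)) = exp (\<i> * of_real (m * - pi) + 2 * of_int m * of_real pi * \<i>)"
      using exp_plus_2pin[of "\<i> * of_real (m * - pi)" m] by (simp add: mult_ac)
    then show ?thesis by (simp add: algebra_simps)
  qed
  finally show ?thesis using False by simp
qed

lemma char_fun_mult: "char_fun k \<theta> * char_fun l \<theta> = char_fun (k + l) \<theta>"
  by (simp add: char_fun_def exp_add[symmetric] algebra_simps sum.distrib)

lemma cmod_char_fun [simp]: "cmod (char_fun k \<theta>) = 1"
  by (simp add: char_fun_def)

lemma cnj_char_fun: "cnj (char_fun k \<theta>) = char_fun (- k) \<theta>"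
  by (simp add: char_fun_def exp_cnj sum_negf)

lemma char_fun_0 [simp]: "char_fun 0 \<theta> = 1"
  by (simp add: char_fun_def)

lemma continuous_on_char_fun [continuous_intros]: "continuous_on S (char_fun k)"
  unfolding char_fun_def by (intro continuous_intros)

lemma borel_measurable_char_fun [measurable]: "char_fun k \<in> borel_measurable borel"
  by (rule borel_measurable_continuous_onI) (rule continuous_on_char_fun)

text \<open>Orthogonality of the characters, reduced to the one-dimensional integrals of
  \<open>exp_int_integral\<close>: one nonzero frequency coordinate is enough to make the product
  vanish.\<close>

lemma integral_char_fun:
  fixes k :: "int ^ 'd"
  shows "(LINT \<theta>:freq_cube|lborel. char_fun k \<theta>) = (if k = 0 then of_real ((2 * pi) ^ CARD('d)) else 0)"
proof -
  define K :: "real ^ 'd" where "K = (\<chi> j. of_int (k $ j))"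
  define f where "f b t = indicator {- pi..pi} t *\<^sub>R exp (\<i> * of_real ((K \<bullet> b) * t))" for b :: "real ^ 'd" and t
  have B: "\<exists>j. b = axis j 1" if "b \<in> Basis" for b :: "real ^ 'd"
    using that by (auto simp: Basis_vec_def)
  have fb: "has_bochner_integral lborel (f b) (if K \<bullet> b = 0 then of_real (2 * pi) else 0)" if b: "b \<in> Basis" for b
  proof -
    obtain j where "b = axis j 1" using B[OF b] by blast
    then have "K \<bullet> b = of_int (k $ j)" by (simp add: K_def inner_axis)
    then show ?thesis unfolding f_def using exp_int_integral[of "k $ j"] by simp
  qed
  \<comment> \<open>Both the indicator of the cube and the exponential are products over the
    coordinates.\<close>
  have "indicator freq_cube \<theta> *\<^sub>R char_fun k \<theta> = (\<Prod>b\<in>Basis. f b (\<theta> \<bullet> b))" for \<theta> :: "real ^ 'd"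
  proof -
    have c: "(\<chi> j :: 'd. - pi) \<bullet> b = - pi \<and> (\<chi> j :: 'd. pi) \<bullet> b = pi" if b: "b \<in> Basis" for b
    proof -
      obtain j where "b = axis j 1" using B[OF b] by blast
      then show ?thesis by (simp add: inner_axis)
    qed
    have ind: "(\<Prod>b\<in>Basis. indicator {- pi..pi} (\<theta> \<bullet> b)) = (indicator freq_cube \<theta> :: real)"
      using c by (auto simp: indicator_def mem_box prod_zero_iff intro!: prod.neutral)
    have "char_fun k \<theta> = exp (\<i> * of_real (K \<bullet> \<theta>))"
      by (simp add: char_fun_def K_def inner_vec_def)
    also have "K \<bullet> \<theta> = (\<Sum>b\<in>Basis. (K \<bullet> b) * (\<theta> \<bullet> b))" by (rule euclidean_inner)
    also have "exp (\<i> * of_real (\<Sum>b\<in>Basis. (K \<bullet> b) * (\<theta> \<bullet> b))) = (\<Prod>b\<in>Basis. exp (\<i> * of_real ((K \<bullet> b) * (\<theta> \<bullet> b))))"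
      by (simp add: sum_distrib_left exp_sum)
    finally show ?thesis
      unfolding f_def scaleR_conv_of_real prod.distrib ind[symmetric] by simp
  qed
  then have "(LINT \<theta>:freq_cube|lborel. char_fun k \<theta>) = (\<integral>\<theta>. (\<Prod>b\<in>Basis. f b (\<theta> \<bullet> b)) \<partial>lborel)"
    by (simp add: set_lebesgue_integral_def)
  also have "\<dots> = (\<Prod>b\<in>Basis. if K \<bullet> b = 0 then of_real (2 * pi) else 0)"
    using fb by (subst integral_lborel_prod_Basis) (auto simp: has_bochner_integral_iff intro!: prod.cong)
  also have "\<dots> = (if k = 0 then of_real ((2 * pi) ^ CARD('d)) else 0)"
  proof (cases "k = 0")
    case True
    then have "K = 0" by (simp add: K_def Finite_Cartesian_Product.vec_eq_iff)
    then show ?thesis using True by simp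
  next
    case False
    then obtain j where "k $ j \<noteq> 0" by (auto simp: Finite_Cartesian_Product.vec_eq_iff)
    then have "K \<bullet> axis j 1 \<noteq> 0" by (simp add: K_def inner_axis)
    moreover have "axis j 1 \<in> (Basis :: (real ^ 'd) set)" by (auto simp: Basis_vec_def)
    ultimately show ?thesis using False by (auto simp: prod_zero_iff)
  qed
  finally show ?thesis .
qed

lemma set_integrable_freq_cube:
  fixes f :: "real ^ 'd \<Rightarrow> complex"
  assumes "continuous_on freq_cube f" shows "set_integrable lborel freq_cube f"
  unfolding set_integrable_def by (rule borel_integrable_compact) (use assms in auto)

lemma set_integral_lebesgue_lborel:
  fixes f :: "real ^ 'd \<Rightarrow> complex"
  assumes "f \<in> borel_measurable borel"
  shows "(LINT \<theta>:freq_cube|lebesgue. f \<theta>) = (LINT \<theta>:freq_cube|lborel. f \<theta>)"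
  unfolding set_lebesgue_integral_def using assms by (intro integral_completion) measurable

text \<open>By orthogonality the representation of a trigonometric polynomial is recovered from its
  Fourier coefficients, so its Toeplitz matrix is banded with known entries.\<close>

lemma fourier_coeff_trig_sum:
  fixes K :: "(int ^ 'd) set"
  assumes K: "finite K"
  shows "fourier_coeff (\<lambda>\<theta>. \<Sum>k\<in>K. c k * char_fun k \<theta>) l = (if l \<in> K then c l else 0)"
proof -
  have "(\<Sum>k\<in>K. c k * char_fun k \<theta>) * char_fun (- l) \<theta> = (\<Sum>k\<in>K. c k * char_fun (k - l) \<theta>)" for \<theta>
    by (simp add: sum_distrib_right mult.assoc char_fun_mult)
  then have "fourier_coeff (\<lambda>\<theta>. \<Sum>k\<in>K. c k * char_fun k \<theta>) l
    = (LINT \<theta>:freq_cube|lborel. (\<Sum>k\<in>K. c k * char_fun (k - l) \<theta>)) / of_real ((2 * pi) ^ CARD('d))"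
    unfolding fourier_coeff_def by (simp add: set_integral_lebesgue_lborel)
  also have "(LINT \<theta>:freq_cube|lborel. (\<Sum>k\<in>K. c k * char_fun (k - l) \<theta>)) = (\<Sum>k\<in>K. c k * (LINT \<theta>:freq_cube|lborel. char_fun (k - l) \<theta>))"
    unfolding set_lebesgue_integral_def
  proof (simp add: scaleR_sum_right, subst Bochner_Integration.integral_sum)
    fix k assume "k \<in> K"
    have "set_integrable lborel freq_cube (\<lambda>\<theta>. c k * char_fun (k - l) \<theta>)"
      by (rule set_integrable_freq_cube) (intro continuous_intros)
    then show "integrable lborel (\<lambda>\<theta>. indicat_real freq_cube \<theta> *\<^sub>R (c k * char_fun (k - l) \<theta>))"
      by (simp add: set_integrable_def)
  qed (auto simp flip: mult_scaleR_right)
  also have "\<dots> = (\<Sum>k\<in>K. if k = l then c k * of_real ((2 * pi) ^ CARD('d)) else 0)"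
    by (intro sum.cong refl) (simp add: integral_char_fun)
  also have "\<dots> = (if l \<in> K then c l else 0) * of_real ((2 * pi) ^ CARD('d))" using K by simp
  finally show ?thesis by simp
qed

section \<open>Elementary symbols and their matrices\<close>

text \<open>
  A coefficient function \<open>c\<close> with finite support stands for the symbol
  \<open>\<Sum>k. c k x * char_fun k \<theta>\<close>; \<open>Op n c\<close> is the matrix \<open>\<Sum>k. D\<^sub>n(c k) T\<^sub>n(char_fun k)\<close>
  with its entries written out.
\<close>

definition elem :: "(int ^ 'd \<Rightarrow> real ^ 'd \<Rightarrow> complex) \<Rightarrow> bool" where
  "elem c \<longleftrightarrow> finite {k. c k \<noteq> (\<lambda>x. 0)} \<and> (\<forall>k. continuous_on (cbox 0 1) (c k))"

definition symb :: "(int ^ 'd \<Rightarrow> real ^ 'd \<Rightarrow> complex) \<Rightarrow> (real ^ 'd) \<times> (real ^ 'd) \<Rightarrow> complex" where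
  "symb c = (\<lambda>(x, \<theta>). \<Sum>k | c k \<noteq> (\<lambda>x. 0). c k x * char_fun k \<theta>)"

definition idiff :: "nat ^ 'd::{finite,linorder} \<Rightarrow> nat \<Rightarrow> nat \<Rightarrow> int ^ 'd::{finite,linorder}" where
  "idiff n p q = (\<chi> j. int (midx n p $ j) - int (midx n q $ j))"

definition gpt :: "nat ^ 'd::{finite,linorder} \<Rightarrow> nat \<Rightarrow> real ^ 'd::{finite,linorder}" where
  "gpt n p = idx_div (midx n p) n"

definition Op :: "nat ^ 'd::{finite,linorder} \<Rightarrow> (int ^ 'd::{finite,linorder} \<Rightarrow> real ^ 'd::{finite,linorder} \<Rightarrow> complex) \<Rightarrow> complex mat" where
  "Op n c = mat (N_of n) (N_of n) (\<lambda>(p, q). c (idiff n p q) (gpt n p))"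

lemma Op_carrier [simp]: "Op n c \<in> carrier_mat (N_of n) (N_of n)"
  by (simp add: Op_def)

lemma Op_dim [simp]: "dim_row (Op n c) = N_of n" "dim_col (Op n c) = N_of n"
  by (auto simp: Op_def)

lemma Op_index: "p < N_of n \<Longrightarrow> q < N_of n \<Longrightarrow> Op n c $$ (p, q) = c (idiff n p q) (gpt n p)"
  by (simp add: Op_def)

lemma gpt_in: "p < N_of n \<Longrightarrow> gpt n p \<in> cbox 0 1"
  unfolding gpt_def by (rule idx_div_in_cube[OF midx_in])

text \<open>Measures bandwidth: if the coefficients vanish outside \<open>ibox L\<close>, the
  entries of \<open>Op n c\<close> vanish unless \<open>idiff n p q\<close> lies in
  \<open>ibox L\<close>.\<close>

definition ibox :: "nat \<Rightarrow> (int ^ 'd) set" where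
  "ibox L = {k. \<forall>j. k $ j \<in> {- int L..int L}}"

lemma finite_ibox [simp]: "finite (ibox L)"
  unfolding ibox_def by (rule finite_vec_box) simp

lemma idiff_add: "idiff n p l + idiff n l q = idiff n p q"
  by (simp add: idiff_def Finite_Cartesian_Product.vec_eq_iff)

lemma idiff_swap: "idiff n q p = - idiff n p q"
  by (simp add: idiff_def Finite_Cartesian_Product.vec_eq_iff)

lemma idiff_self [simp]: "idiff n p p = 0"
  by (simp add: idiff_def Finite_Cartesian_Product.vec_eq_iff)

lemma inj_idiff: "inj_on (idiff n p) {..<N_of n}"
proof (rule inj_onI)
  fix q l assume ql: "q \<in> {..<N_of n}" "l \<in> {..<N_of n}" "idiff n p q = idiff n p l"
  have "midx n q $ j = midx n l $ j" for j
    using arg_cong[OF ql(3), of "\<lambda>k. k $ j"] by (simp add: idiff_def)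
  then have "midx n q = midx n l" by (simp add: Finite_Cartesian_Product.vec_eq_iff)
  then show "q = l" using ql midx_eq_iff[of q n l] by simp
qed

text \<open>For a fixed row the difference determines the column, so the number of entries in the
  band is bounded independently of \<open>n\<close>.\<close>

lemma card_row_band:
  fixes n :: "nat ^ 'd::{finite,linorder}"
  shows "card {q. q < N_of n \<and> idiff n p q \<in> ibox L} \<le> card (ibox L :: (int ^ 'd::{finite,linorder}) set)"
  by (rule card_inj_on_le[of "idiff n p"]) (auto intro: inj_on_subset[OF inj_idiff])

lemma ibox_minus: "- k \<in> ibox L \<longleftrightarrow> k \<in> ibox L"
  unfolding ibox_def by (auto simp: minus_le_iff)

lemma card_col_band:
  fixes n :: "nat ^ 'd::{finite,linorder}"
  shows "card {p. p < N_of n \<and> idiff n p q \<in> ibox L} \<le> card (ibox L :: (int ^ 'd::{finite,linorder}) set)"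
proof -
  have "idiff n p q \<in> ibox L \<longleftrightarrow> idiff n q p \<in> ibox L" for p
    using ibox_minus[of "idiff n p q" L] by (simp only: idiff_swap[of n q p])
  then show ?thesis using card_row_band[of n q L] by simp
qed

lemma elem_box:
  assumes "elem c" shows "\<exists>L. \<forall>k. k \<notin> ibox L \<longrightarrow> c k = (\<lambda>x. 0)"
proof -
  let ?S = "{k. c k \<noteq> (\<lambda>x. 0)}"
  have fin: "finite ?S" using assms by (simp add: elem_def)
  \<comment> \<open>A sum instead of a maximum, so that an empty support needs no separate
    case.\<close>
  define L where "L = (\<Sum>k\<in>?S. \<Sum>j\<in>UNIV. nat \<bar>k $ j\<bar>)"
  have "k \<in> ibox L" if k: "c k \<noteq> (\<lambda>x. 0)" for k
  proof -
    have "nat \<bar>k $ j\<bar> \<le> L" for j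
    proof -
      have "nat \<bar>k $ j\<bar> \<le> (\<Sum>j\<in>UNIV. nat \<bar>k $ j\<bar>)" by (rule member_le_sum) auto
      also have "\<dots> \<le> L" unfolding L_def using k fin by (intro member_le_sum[of k ?S "\<lambda>k. \<Sum>j\<in>UNIV. nat \<bar>k $ j\<bar>"]) auto
      finally show ?thesis .
    qed
    then have "\<bar>k $ j\<bar> \<le> int L" for j by (simp add: nat_le_iff)
    then show ?thesis unfolding ibox_def by (auto simp: abs_le_iff minus_le_iff)
  qed
  then show ?thesis by blast
qed

lemma elem_bounded:
  assumes "elem c" shows "\<exists>M>0. \<forall>k. \<forall>x\<in>cbox 0 1. cmod (c k x) \<le> M"
proof -
  let ?S = "{k. c k \<noteq> (\<lambda>x. 0)}"
  have fin: "finite ?S" and cont: "\<And>k. continuous_on (cbox 0 1) (c k)" using assms by (auto simp: elem_def)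
  have "\<exists>M. \<forall>x\<in>cbox 0 1. cmod (c k x) \<le> M" for k
    using compact_imp_bounded[OF compact_continuous_image[OF cont compact_cbox]] unfolding bounded_iff by blast
  then obtain M where M: "\<And>k x. x \<in> cbox 0 1 \<Longrightarrow> cmod (c k x) \<le> M k" by metis
  have "cmod (c k x) \<le> 1 + (\<Sum>k\<in>?S. \<bar>M k\<bar>)" if x: "x \<in> cbox 0 1" for k x
  proof (cases "k \<in> ?S")
    case True
    have "cmod (c k x) \<le> \<bar>M k\<bar>" using M[OF x, of k] by linarith
    also have "\<dots> \<le> (\<Sum>k\<in>?S. \<bar>M k\<bar>)" using True fin by (intro member_le_sum[of k ?S "\<lambda>k. \<bar>M k\<bar>"]) auto
    finally show ?thesis by simp
  next
    case False
    moreover have "0 \<le> (\<Sum>k\<in>?S. \<bar>M k\<bar>)" by (rule sum_nonneg) simp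
    ultimately show ?thesis by (simp add: add_nonneg_nonneg)
  qed
  moreover have "0 < 1 + (\<Sum>k\<in>?S. \<bar>M k\<bar>)" by (intro add_pos_nonneg sum_nonneg) auto
  ultimately show ?thesis by blast
qed

lemma elem_oscillation:
  assumes "elem c" and e: "\<epsilon> > 0"
  shows "\<exists>\<delta>>0. \<forall>k. \<forall>x\<in>cbox 0 1. \<forall>y\<in>cbox 0 1. (\<forall>j. \<bar>x $ j - y $ j\<bar> \<le> \<delta>) \<longrightarrow> cmod (c k x - c k y) \<le> \<epsilon>"
proof -
  let ?S = "{k. c k \<noteq> (\<lambda>x. 0)}"
  have fin: "finite ?S" and cont: "\<And>k. continuous_on (cbox 0 1) (c k)" using assms by (auto simp: elem_def)
  obtain d where d: "\<And>k. d k > 0"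
    "\<And>k x y. x \<in> cbox 0 1 \<Longrightarrow> y \<in> cbox 0 1 \<Longrightarrow> (\<forall>j. \<bar>x $ j - y $ j\<bar> \<le> d k) \<Longrightarrow> cmod (c k x - c k y) \<le> \<epsilon>"
    using uniform_oscillation[OF cont e] by metis
  define \<delta> where "\<delta> = Min (insert 1 (d ` ?S))"
  have "\<delta> > 0" unfolding \<delta>_def using fin d(1) by (subst Min_gr_iff) auto
  moreover have "cmod (c k x - c k y) \<le> \<epsilon>"
    if "x \<in> cbox 0 1" "y \<in> cbox 0 1" "\<forall>j. \<bar>x $ j - y $ j\<bar> \<le> \<delta>" for k x y
  proof (cases "k \<in> ?S")
    case True
    then have "\<delta> \<le> d k" unfolding \<delta>_def using fin by (intro Min_le) auto
    then show ?thesis using that by (intro d(2)) (auto intro: order_trans)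
  qed (use e in simp)
  ultimately show ?thesis by blast
qed

lemma symb_eq:
  assumes "finite K" "\<forall>k. k \<notin> K \<longrightarrow> c k = (\<lambda>x. 0)"
  shows "symb c (x, \<theta>) = (\<Sum>k\<in>K. c k x * char_fun k \<theta>)"
  unfolding symb_def prod.case by (rule sum.mono_neutral_left) (use assms in auto)

text \<open>Convolution in the frequency, pointwise in \<open>x\<close>: the coefficients of the
  product of two symbols.\<close>

definition cconv :: "(int ^ 'd \<Rightarrow> real ^ 'd \<Rightarrow> complex) \<Rightarrow> (int ^ 'd \<Rightarrow> real ^ 'd \<Rightarrow> complex) \<Rightarrow> int ^ 'd \<Rightarrow> real ^ 'd \<Rightarrow> complex" where
  "cconv c c' m x = (\<Sum>k | c k \<noteq> (\<lambda>x. 0). c k x * c' (m - k) x)"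

text \<open>The coefficients of the complex conjugate symbol.\<close>

definition cstar :: "(int ^ 'd \<Rightarrow> real ^ 'd \<Rightarrow> complex) \<Rightarrow> int ^ 'd \<Rightarrow> real ^ 'd \<Rightarrow> complex" where
  "cstar c k x = cnj (c (- k) x)"

definition cadd :: "(int ^ 'd \<Rightarrow> real ^ 'd \<Rightarrow> complex) \<Rightarrow> (int ^ 'd \<Rightarrow> real ^ 'd \<Rightarrow> complex) \<Rightarrow> int ^ 'd \<Rightarrow> real ^ 'd \<Rightarrow> complex" where
  "cadd c c' k x = c k x + c' k x"

definition cscale :: "complex \<Rightarrow> (int ^ 'd \<Rightarrow> real ^ 'd \<Rightarrow> complex) \<Rightarrow> int ^ 'd \<Rightarrow> real ^ 'd \<Rightarrow> complex" where
  "cscale a c k x = a * c k x"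

text \<open>The coefficients of the separated symbol
  \<open>a x * char_fun l \<theta>\<close>.\<close>

definition cmono :: "int ^ 'd \<Rightarrow> (real ^ 'd \<Rightarrow> complex) \<Rightarrow> int ^ 'd \<Rightarrow> real ^ 'd \<Rightarrow> complex" where
  "cmono l a k = (if k = l then a else (\<lambda>x. 0))"

lemma cconv_eq:
  assumes "finite K" "\<forall>k. k \<notin> K \<longrightarrow> c k = (\<lambda>x. 0)"
  shows "cconv c c' m x = (\<Sum>k\<in>K. c k x * c' (m - k) x)"
  unfolding cconv_def by (rule sum.mono_neutral_left) (use assms in auto)

lemma ibox_add:
  assumes "k \<in> ibox L" "l \<in> ibox L'" shows "k + l \<in> ibox (L + L')"
proof -
  have "- int L \<le> k $ j" "k $ j \<le> int L" "- int L' \<le> l $ j" "l $ j \<le> int L'" for j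
    using assms by (auto simp: ibox_def)
  then have "(k + l) $ j \<in> {- int (L + L')..int (L + L')}" for j
    using add_mono[of "- int L" "k $ j" "- int L'" "l $ j"] add_mono[of "k $ j" "int L" "l $ j" "int L'"] by simp
  then show ?thesis by (simp add: ibox_def)
qed

lemma cconv_outside:
  fixes c :: "int ^ 'd \<Rightarrow> real ^ 'd \<Rightarrow> complex"
  assumes "\<forall>k. k \<notin> ibox L \<longrightarrow> c k = (\<lambda>x. 0)" "\<forall>k. k \<notin> ibox L' \<longrightarrow> c' k = (\<lambda>x. 0)"
  shows "\<forall>m. m \<notin> ibox (L + L') \<longrightarrow> cconv c c' m = (\<lambda>x. 0)"
proof (intro allI impI ext)
  fix m :: "int ^ 'd" and x assume m: "m \<notin> ibox (L + L')"
  have "c' (m - k) = (\<lambda>x. 0)" if "k \<in> ibox L" for k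
    using ibox_add[OF that, of "m - k" L'] assms(2) m by auto
  then show "cconv c c' m x = 0" using assms(1) by (subst cconv_eq[of "ibox L"]) auto
qed

lemma elem_intro:
  assumes "\<forall>k. k \<notin> ibox L \<longrightarrow> c k = (\<lambda>x. 0)" "\<And>k. continuous_on (cbox 0 1) (c k)"
  shows "elem c"
  unfolding elem_def using assms finite_subset[of "{k. c k \<noteq> (\<lambda>x. 0)}" "ibox L"] by auto

lemma elem_cont: "elem c \<Longrightarrow> continuous_on (cbox 0 1) (c k)"
  by (simp add: elem_def)

lemma elem_cconv: assumes "elem c" "elem c'" shows "elem (cconv c c')"
proof -
  obtain L where L: "\<forall>k. k \<notin> ibox L \<longrightarrow> c k = (\<lambda>x. 0)" using elem_box[OF assms(1)] by blast
  obtain L' where L': "\<forall>k. k \<notin> ibox L' \<longrightarrow> c' k = (\<lambda>x. 0)" using elem_box[OF assms(2)] by blast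
  show ?thesis
  proof (rule elem_intro[of "L + L'"])
    show "continuous_on (cbox 0 1) (cconv c c' m)" for m
      unfolding cconv_def[abs_def]
      by (intro continuous_on_sum continuous_on_mult elem_cont[OF assms(1)] elem_cont[OF assms(2)])
  qed (rule cconv_outside[OF L L'])
qed

text \<open>Substitution of \<open>m = k + l\<close> in the double sum; the box
  \<open>ibox (L + L')\<close> contains every such \<open>m\<close>, and its other elements
  contribute 0.\<close>

lemma symb_cconv:
  fixes c c' :: "int ^ 'd \<Rightarrow> real ^ 'd \<Rightarrow> complex"
  assumes "elem c" "elem c'" shows "symb (cconv c c') z = symb c z * symb c' z"
proof -
  obtain x \<theta> where z: "z = (x, \<theta>)" by (cases z)
  obtain L where L: "\<forall>k. k \<notin> ibox L \<longrightarrow> c k = (\<lambda>x. 0)" using elem_box[OF assms(1)] by blast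
  obtain L' where L': "\<forall>k. k \<notin> ibox L' \<longrightarrow> c' k = (\<lambda>x. 0)" using elem_box[OF assms(2)] by blast
  have "symb (cconv c c') z = (\<Sum>m\<in>ibox (L + L'). \<Sum>k\<in>ibox L. c k x * c' (m - k) x * char_fun m \<theta>)"
    unfolding z by (subst symb_eq[OF finite_ibox cconv_outside[OF L L']])
      (auto simp: cconv_eq[OF finite_ibox L] sum_distrib_right)
  also have "\<dots> = (\<Sum>k\<in>ibox L. \<Sum>m\<in>ibox (L + L'). c k x * c' (m - k) x * char_fun m \<theta>)" by (rule sum.swap)
  also have "\<dots> = (\<Sum>k\<in>ibox L. \<Sum>l\<in>ibox L'. c k x * char_fun k \<theta> * (c' l x * char_fun l \<theta>))"
  proof (rule sum.cong)
    fix k :: "int ^ 'd" assume k: "k \<in> ibox L"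
    have "(\<Sum>m\<in>ibox (L + L'). c k x * c' (m - k) x * char_fun m \<theta>)
      = (\<Sum>m\<in>(\<lambda>l. l + k) ` ibox L'. c k x * c' (m - k) x * char_fun m \<theta>)"
    proof (rule sum.mono_neutral_right)
      show "(\<lambda>l. l + k) ` ibox L' \<subseteq> ibox (L + L')" using ibox_add[OF k] by (auto simp: add.commute)
      show "\<forall>m\<in>ibox (L + L') - (\<lambda>l. l + k) ` ibox L'. c k x * c' (m - k) x * char_fun m \<theta> = 0"
      proof
        fix m assume "m \<in> ibox (L + L') - (\<lambda>l. l + k) ` ibox L'"
        then have "m - k \<notin> ibox L'" by (metis DiffD2 diff_add_cancel imageI)
        then show "c k x * c' (m - k) x * char_fun m \<theta> = 0" using L' by simp
      qed
    qed simp
    also have "\<dots> = (\<Sum>l\<in>ibox L'. c k x * c' l x * char_fun (l + k) \<theta>)"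
      by (subst sum.reindex) (auto simp: inj_on_def)
    also have "\<dots> = (\<Sum>l\<in>ibox L'. c k x * char_fun k \<theta> * (c' l x * char_fun l \<theta>))"
      by (intro sum.cong refl) (simp add: char_fun_mult[symmetric] mult_ac)
    finally show "(\<Sum>m\<in>ibox (L + L'). c k x * c' (m - k) x * char_fun m \<theta>)
      = (\<Sum>l\<in>ibox L'. c k x * char_fun k \<theta> * (c' l x * char_fun l \<theta>))" .
  qed simp
  also have "\<dots> = symb c z * symb c' z"
    unfolding z by (simp add: symb_eq[OF finite_ibox L] symb_eq[OF finite_ibox L'] sum_product)
  finally show ?thesis .
qed

lemma cstar_outside:
  "\<forall>k. k \<notin> ibox L \<longrightarrow> c k = (\<lambda>x. 0) \<Longrightarrow> \<forall>k. k \<notin> ibox L \<longrightarrow> cstar c k = (\<lambda>x. 0)"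
  by (auto simp: cstar_def ibox_minus intro!: ext)

lemma elem_cstar: assumes "elem c" shows "elem (cstar c)"
proof -
  obtain L where L: "\<forall>k. k \<notin> ibox L \<longrightarrow> c k = (\<lambda>x. 0)" using elem_box[OF assms(1)] by blast
  have "continuous_on (cbox 0 1) (cstar c k)" for k
    unfolding cstar_def[abs_def] by (rule continuous_on_cnj[OF elem_cont[OF assms]])
  then show ?thesis by (rule elem_intro[OF cstar_outside[OF L]])
qed

lemma symb_cstar: assumes "elem c" shows "symb (cstar c) z = cnj (symb c z)"
proof -
  obtain x \<theta> where z: "z = (x, \<theta>)" by (cases z)
  obtain L where L: "\<forall>k. k \<notin> ibox L \<longrightarrow> c k = (\<lambda>x. 0)" using elem_box[OF assms(1)] by blast
  have "symb (cstar c) z = (\<Sum>k\<in>ibox L. cnj (c (- k) x) * char_fun k \<theta>)"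
    unfolding z by (subst symb_eq[OF finite_ibox cstar_outside[OF L]]) (auto simp: cstar_def)
  also have "\<dots> = (\<Sum>k\<in>ibox L. cnj (c k x) * char_fun (- k) \<theta>)"
    by (rule sum.reindex_bij_witness[of _ uminus uminus]) (auto simp: ibox_minus)
  also have "\<dots> = cnj (symb c z)"
    unfolding z by (simp add: symb_eq[OF finite_ibox L] cnj_char_fun)
  finally show ?thesis .
qed

lemma elem_cadd: assumes "elem c" "elem c'" shows "elem (cadd c c')"
proof -
  have "{k. cadd c c' k \<noteq> (\<lambda>x. 0)} \<subseteq> {k. c k \<noteq> (\<lambda>x. 0)} \<union> {k. c' k \<noteq> (\<lambda>x. 0)}"
    by (auto simp: cadd_def[abs_def])
  then have "finite {k. cadd c c' k \<noteq> (\<lambda>x. 0)}"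
    using assms by (auto simp: elem_def intro: finite_subset)
  then show ?thesis using assms by (auto simp: elem_def cadd_def[abs_def] intro!: continuous_on_add)
qed

lemma symb_cadd: assumes "elem c" "elem c'" shows "symb (cadd c c') z = symb c z + symb c' z"
proof -
  obtain x \<theta> where z: "z = (x, \<theta>)" by (cases z)
  let ?K = "{k. c k \<noteq> (\<lambda>x. 0)} \<union> {k. c' k \<noteq> (\<lambda>x. 0)}"
  have K: "finite ?K" using assms by (simp add: elem_def)
  show ?thesis unfolding z
    by (subst symb_eq[OF K], force simp: cadd_def[abs_def], subst symb_eq[OF K, of c], force, subst symb_eq[OF K, of c'], force)
       (simp add: cadd_def distrib_right sum.distrib)
qed

lemma elem_cscale: assumes "elem c" shows "elem (cscale a c)"
proof -
  have "{k. cscale a c k \<noteq> (\<lambda>x. 0)} \<subseteq> {k. c k \<noteq> (\<lambda>x. 0)}"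
    by (auto simp: cscale_def[abs_def])
  then have "finite {k. cscale a c k \<noteq> (\<lambda>x. 0)}"
    using assms by (auto simp: elem_def intro: finite_subset)
  then show ?thesis using assms by (auto simp: elem_def cscale_def[abs_def] intro!: continuous_on_mult continuous_on_const)
qed

lemma symb_cscale: assumes "elem c" shows "symb (cscale a c) z = a * symb c z"
proof -
  obtain x \<theta> where z: "z = (x, \<theta>)" by (cases z)
  let ?K = "{k. c k \<noteq> (\<lambda>x. 0)}"
  have K: "finite ?K" using assms by (simp add: elem_def)
  show ?thesis unfolding z
    by (subst symb_eq[OF K], force simp: cscale_def[abs_def], subst symb_eq[OF K, of c], force)
       (simp add: cscale_def sum_distrib_left mult.assoc)
qed

lemma elem_cmono: assumes "continuous_on (cbox 0 1) a" shows "elem (cmono l a)"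
  unfolding elem_def using assms by (auto simp: cmono_def intro: finite_subset[of _ "{l}"])

lemma symb_cmono: "symb (cmono l a) (x, \<theta>) = a x * char_fun l \<theta>"
  by (subst symb_eq[of "{l}"]) (auto simp: cmono_def)

lemma Op_cadd: "Op n (cadd c c') = Op n c + Op n c'"
  by (rule eq_matI) (auto simp: Op_def cadd_def)

lemma Op_cscale: "Op n (cscale a c) = a \<cdot>\<^sub>m Op n c"
  by (rule eq_matI) (auto simp: Op_def cscale_def)

lemma continuous_on_symb:
  assumes "elem c" shows "continuous_on (cbox 0 1 \<times> S) (symb c)"
proof -
  have "continuous_on (cbox 0 1 \<times> S) (\<lambda>z. c k (fst z) * char_fun k (snd z))" for k
    by (intro continuous_intros continuous_on_compose2[OF elem_cont[OF assms, of k]]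
        continuous_on_compose2[OF continuous_on_char_fun[of UNIV k]]) auto
  then show ?thesis unfolding symb_def case_prod_unfold by (intro continuous_on_sum) auto
qed

lemma symb_bounded:
  fixes c :: "int ^ 'd \<Rightarrow> real ^ 'd \<Rightarrow> complex"
  assumes "elem c" shows "\<exists>B>0. \<forall>x\<in>cbox 0 1. \<forall>\<theta>. cmod (symb c (x, \<theta>)) \<le> B"
proof -
  obtain L where L: "\<forall>k. k \<notin> ibox L \<longrightarrow> c k = (\<lambda>x. 0)" using elem_box[OF assms(1)] by blast
  obtain M where M: "M > 0" "\<And>k x. x \<in> cbox 0 1 \<Longrightarrow> cmod (c k x) \<le> M" using elem_bounded[OF assms] by blast
  have "cmod (symb c (x, \<theta>)) \<le> (\<Sum>k\<in>(ibox L :: (int ^ 'd) set). M)" if "x \<in> cbox 0 1" for x \<theta>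
    unfolding symb_eq[OF finite_ibox L] using M(2)[OF that] by (intro sum_norm_le) (auto simp: norm_mult)
  then have "cmod (symb c (x, \<theta>)) \<le> (\<Sum>k\<in>(ibox L :: (int ^ 'd) set). M) + 1" if "x \<in> cbox 0 1" for x \<theta>
    using that by (meson add_increasing2 zero_le_one)
  moreover have "0 < (\<Sum>k\<in>(ibox L :: (int ^ 'd) set). M) + 1"
    using M(1) by (intro add_nonneg_pos sum_nonneg) auto
  ultimately show ?thesis by blast
qed

lemma integral_char_fun_HK:
  fixes k :: "int ^ 'd"
  shows "(char_fun k has_integral (if k = 0 then of_real ((2 * pi) ^ CARD('d)) else 0)) freq_cube"
proof -
  have "set_integrable lborel freq_cube (char_fun k)"
    by (rule set_integrable_freq_cube) (rule continuous_on_char_fun)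
  note I = set_borel_integral_eq_integral[OF this]
  from integrable_integral[OF I(1)] show ?thesis unfolding I(2)[symmetric] integral_char_fun .
qed

text \<open>All characters but the constant one integrate to 0, so only \<open>c 0\<close> is left.
  It is also the coefficient on the diagonal of \<open>Op n c\<close>, which is why traces converge
  to integrals of symbols.\<close>

lemma integral_symb:
  fixes c :: "int ^ 'd \<Rightarrow> real ^ 'd \<Rightarrow> complex"
  assumes "elem c"
  shows "integral (cbox 0 1 \<times> freq_cube) (symb c) = of_real ((2 * pi) ^ CARD('d)) * integral (cbox 0 1) (c 0)"
proof -
  let ?K = "insert 0 {k. c k \<noteq> (\<lambda>x. 0)}"
  have K: "finite ?K" using assms by (simp add: elem_def)
  have "continuous_on (cbox (0, \<chi> j. - pi) (1, \<chi> j. pi)) (symb c)"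
    using continuous_on_symb[OF assms, of freq_cube] by (simp add: cbox_Pair_eq)
  from integral_prod_continuous[OF this]
  have "integral (cbox 0 1 \<times> freq_cube) (symb c) = integral (cbox 0 1) (\<lambda>x. integral freq_cube (\<lambda>\<theta>. symb c (x, \<theta>)))"
    by (simp add: cbox_Pair_eq)
  moreover have "integral freq_cube (\<lambda>\<theta>. symb c (x, \<theta>)) = of_real ((2 * pi) ^ CARD('d)) * c 0 x" for x
  proof -
    have "((\<lambda>\<theta>. \<Sum>k\<in>?K. c k x * char_fun k \<theta>) has_integral
      (\<Sum>k\<in>?K. c k x * (if k = 0 then of_real ((2 * pi) ^ CARD('d)) else 0))) freq_cube"
      using K by (intro has_integral_sum has_integral_mult_right integral_char_fun_HK)
    also have "(\<lambda>\<theta>. \<Sum>k\<in>?K. c k x * char_fun k \<theta>) = (\<lambda>\<theta>. symb c (x, \<theta>))"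
      by (rule ext, rule symb_eq[symmetric, OF K]) simp
    also have "(\<Sum>k\<in>?K. c k x * (if k = 0 then of_real ((2 * pi) ^ CARD('d)) else 0))
      = (\<Sum>k\<in>?K. if k = 0 then of_real ((2 * pi) ^ CARD('d)) * c 0 x else 0)"
      by (intro sum.cong) auto
    finally show ?thesis using K by (simp add: integral_unique)
  qed
  ultimately show ?thesis by simp
qed

section \<open>Banded matrices\<close>

text \<open>The entry bound \<open>b\<close> may depend on the row, since rows near the boundary of
  the index set satisfy only a weaker one.\<close>

lemma frob_banded:
  fixes n :: "nat ^ 'd::{finite,linorder}" and b :: "nat \<Rightarrow> real"
  assumes X: "X \<in> carrier_mat (N_of n) (N_of n)"
    and band: "\<And>p q. p < N_of n \<Longrightarrow> q < N_of n \<Longrightarrow> idiff n p q \<notin> ibox L \<Longrightarrow> X $$ (p, q) = 0"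
    and bd: "\<And>p q. p < N_of n \<Longrightarrow> q < N_of n \<Longrightarrow> idiff n p q \<in> ibox L \<Longrightarrow> cmod (X $$ (p, q)) \<le> b p"
  shows "frob X \<le> card (ibox L :: (int ^ 'd::{finite,linorder}) set) * (\<Sum>p<N_of n. (b p)\<^sup>2)"
proof -
  have "(\<Sum>q<N_of n. (cmod (X $$ (p, q)))\<^sup>2) \<le> card (ibox L :: (int ^ 'd::{finite,linorder}) set) * (b p)\<^sup>2" if p: "p < N_of n" for p
  proof -
    let ?Q = "{q. q < N_of n \<and> idiff n p q \<in> ibox L}"
    have "(\<Sum>q<N_of n. (cmod (X $$ (p, q)))\<^sup>2) = (\<Sum>q\<in>?Q. (cmod (X $$ (p, q)))\<^sup>2)"
      by (rule sum.mono_neutral_right) (use band p in auto)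
    also have "\<dots> \<le> (\<Sum>q\<in>?Q. (b p)\<^sup>2)" using bd p by (intro sum_mono power_mono) auto
    also have "\<dots> = card ?Q * (b p)\<^sup>2" by simp
    also have "\<dots> \<le> card (ibox L :: (int ^ 'd::{finite,linorder}) set) * (b p)\<^sup>2"
      using card_row_band[of n p L] by (intro mult_right_mono) auto
    finally show ?thesis .
  qed
  then have "(\<Sum>p<N_of n. \<Sum>q<N_of n. (cmod (X $$ (p, q)))\<^sup>2) \<le> (\<Sum>p<N_of n. card (ibox L :: (int ^ 'd::{finite,linorder}) set) * (b p)\<^sup>2)"
    by (intro sum_mono) simp
  then show ?thesis using X by (simp add: frob_def sum_distrib_left)
qed

text \<open>Cauchy-Schwarz in each row costs one factor \<open>card (ibox L)\<close> in the squared
  norm; a second one arises because each column meets at most that many rows. The resulting bound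
  does not depend on \<open>n\<close>.\<close>

lemma nbound_banded:
  fixes n :: "nat ^ 'd::{finite,linorder}" and M :: real
  assumes X: "X \<in> carrier_mat (N_of n) (N_of n)"
    and band: "\<And>p q. p < N_of n \<Longrightarrow> q < N_of n \<Longrightarrow> idiff n p q \<notin> ibox L \<Longrightarrow> X $$ (p, q) = 0"
    and bd: "\<And>p q. p < N_of n \<Longrightarrow> q < N_of n \<Longrightarrow> cmod (X $$ (p, q)) \<le> M" and M: "M \<ge> 0"
  shows "nbound X (card (ibox L :: (int ^ 'd::{finite,linorder}) set) * M)"
  unfolding nbound_def
proof
  let ?K = "real (card (ibox L :: (int ^ 'd::{finite,linorder}) set))"
  fix v :: "complex Matrix.vec" assume "v \<in> carrier_vec (dim_col X)"
  then have v: "v \<in> carrier_vec (N_of n)" using X by simp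
  let ?Q = "\<lambda>p. {q. q < N_of n \<and> idiff n p q \<in> ibox L}"
  have row: "(cmod ((X *\<^sub>v v) $v p))\<^sup>2 \<le> ?K * M\<^sup>2 * (\<Sum>q<N_of n. if idiff n p q \<in> ibox L then (cmod (v $v q))\<^sup>2 else 0)"
    if p: "p < N_of n" for p
  proof -
    have "(X *\<^sub>v v) $v p = (\<Sum>q<N_of n. X $$ (p, q) * v $v q)" by (rule mat_vec_index[OF X v p])
    also have "\<dots> = (\<Sum>q\<in>?Q p. X $$ (p, q) * v $v q)"
      by (rule sum.mono_neutral_right) (use band p in auto)
    finally have "cmod ((X *\<^sub>v v) $v p) \<le> (\<Sum>q\<in>?Q p. M * cmod (v $v q))"
      using bd p by (simp only:) (intro sum_norm_le, auto simp: norm_mult intro!: mult_right_mono)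
    then have "(cmod ((X *\<^sub>v v) $v p))\<^sup>2 \<le> (\<Sum>q\<in>?Q p. M * cmod (v $v q))\<^sup>2" by (rule power_mono) simp
    also have "\<dots> \<le> (\<Sum>q\<in>?Q p. (M * cmod (v $v q))\<^sup>2) * card (?Q p)"
      by (rule sum_squared_le_sum_of_squares)
    also have "\<dots> \<le> (\<Sum>q\<in>?Q p. (M * cmod (v $v q))\<^sup>2) * ?K"
      using card_row_band[of n p L] by (intro mult_left_mono sum_nonneg) auto
    also have "(\<Sum>q\<in>?Q p. (M * cmod (v $v q))\<^sup>2) = M\<^sup>2 * (\<Sum>q<N_of n. if idiff n p q \<in> ibox L then (cmod (v $v q))\<^sup>2 else 0)"
      by (simp add: sum_distrib_left power_mult_distrib sum.If_cases Int_def)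
    finally show ?thesis by (simp add: mult_ac)
  qed
  have "(vnorm (X *\<^sub>v v))\<^sup>2 = (\<Sum>p<N_of n. (cmod ((X *\<^sub>v v) $v p))\<^sup>2)"
    using X by (simp add: vnorm_sq del: index_mult_mat_vec)
  also have "\<dots> \<le> (\<Sum>p<N_of n. ?K * M\<^sup>2 * (\<Sum>q<N_of n. if idiff n p q \<in> ibox L then (cmod (v $v q))\<^sup>2 else 0))"
    using row by (intro sum_mono) simp
  also have "\<dots> = ?K * M\<^sup>2 * (\<Sum>q<N_of n. \<Sum>p<N_of n. if idiff n p q \<in> ibox L then (cmod (v $v q))\<^sup>2 else 0)"
    by (subst sum.swap) (simp add: sum_distrib_left)
  also have "\<dots> \<le> ?K * M\<^sup>2 * (\<Sum>q<N_of n. ?K * (cmod (v $v q))\<^sup>2)"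
  proof (intro mult_left_mono sum_mono)
    fix q
    have "(\<Sum>p<N_of n. if idiff n p q \<in> ibox L then (cmod (v $v q))\<^sup>2 else 0) = card {p. p < N_of n \<and> idiff n p q \<in> ibox L} * (cmod (v $v q))\<^sup>2"
      by (simp add: sum.If_cases Int_def)
    also have "\<dots> \<le> ?K * (cmod (v $v q))\<^sup>2"
      using card_col_band[of n q L] by (intro mult_right_mono) auto
    finally show "(\<Sum>p<N_of n. if idiff n p q \<in> ibox L then (cmod (v $v q))\<^sup>2 else 0) \<le> ?K * (cmod (v $v q))\<^sup>2" .
  qed simp
  also have "\<dots> = (?K * M * vnorm v)\<^sup>2"
  proof -
    have "(vnorm v)\<^sup>2 = (\<Sum>q<N_of n. (cmod (v $v q))\<^sup>2)" using v by (simp add: vnorm_sq)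
    then show ?thesis
      unfolding power_mult_distrib sum_distrib_left[symmetric] by (simp add: power2_eq_square mult_ac)
  qed
  finally show "vnorm (X *\<^sub>v v) \<le> ?K * M * vnorm v"
    by (rule power2_le_imp_le) (simp add: M)
qed

lemma Op_band: "\<forall>k. k \<notin> ibox L \<longrightarrow> c k = (\<lambda>x. 0) \<Longrightarrow> p < N_of n \<Longrightarrow> q < N_of n \<Longrightarrow> idiff n p q \<notin> ibox L \<Longrightarrow> Op n c $$ (p, q) = 0"
  by (simp add: Op_index)

lemma nbound_Op:
  fixes c :: "int ^ 'd::{finite,linorder} \<Rightarrow> real ^ 'd::{finite,linorder} \<Rightarrow> complex"
  assumes "elem c" shows "\<exists>C>0. \<forall>n. nbound (Op n c) C"
proof -
  obtain L where L: "\<forall>k. k \<notin> ibox L \<longrightarrow> c k = (\<lambda>x. 0)" using elem_box[OF assms(1)] by blast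
  obtain M where M: "M > 0" "\<And>k x. x \<in> cbox 0 1 \<Longrightarrow> cmod (c k x) \<le> M" using elem_bounded[OF assms] by blast
  have "nbound (Op n c) (card (ibox L :: (int ^ 'd::{finite,linorder}) set) * M)" for n
    by (rule nbound_banded[OF Op_carrier Op_band[OF L]]) (use M gpt_in in \<open>auto simp: Op_index less_imp_le\<close>)
  then have "nbound (Op n c) (card (ibox L :: (int ^ 'd::{finite,linorder}) set) * M + 1)" for n by (rule nbound_mono) simp
  then show ?thesis using M(1) by (intro exI[of _ "card (ibox L :: (int ^ 'd::{finite,linorder}) set) * M + 1"]) (auto intro!: add_nonneg_pos)
qed

section \<open>Asymptotic calculus of elementary matrices\<close>

lemma small_square:
  fixes C e :: real
  assumes "C \<ge> 0" "e > 0" shows "\<exists>\<omega>>0. C * \<omega>\<^sup>2 \<le> e"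
\<comment> \<open>The bound by 1 makes the square no larger than the number itself, so a linear
  estimate suffices.\<close>
proof (intro exI[of _ "min 1 (e / (C + 1))"] conjI)
  let ?w = "min 1 (e / (C + 1))"
  show w: "0 < ?w" using assms by auto
  have "?w * ?w \<le> ?w * 1" using w by (intro mult_left_mono) auto
  then have "?w\<^sup>2 \<le> ?w" by (simp only: power2_eq_square mult_1_right)
  then have "C * ?w\<^sup>2 \<le> C * ?w" using assms by (intro mult_left_mono) auto
  also have "\<dots> \<le> C * (e / (C + 1))" using assms by (intro mult_left_mono) auto
  also have "\<dots> \<le> e" using assms by (simp add: field_simps)
  finally show "C * ?w\<^sup>2 \<le> e" .
qed

text \<open>Far from the boundary, \<open>idiff n p\<close> maps the indices in the band onto all of
  \<open>ibox L\<close>, so the sum in a matrix product is not cut off. Both coefficients are taken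
  at the same \<open>x\<close>; the change of grid point is estimated where this is applied.\<close>

lemma cconv_full_band:
  fixes n :: "nat ^ 'd::{finite,linorder}" and c c' :: "int ^ 'd::{finite,linorder} \<Rightarrow> real ^ 'd::{finite,linorder} \<Rightarrow> complex"
  assumes p: "p < N_of n" and far: "far_from_boundary L n (midx n p)"
    and L: "\<forall>k. k \<notin> ibox L \<longrightarrow> c k = (\<lambda>x. 0)"
  shows "cconv c c' (idiff n p q) x = (\<Sum>l | l < N_of n \<and> idiff n p l \<in> ibox L. c (idiff n p l) x * c' (idiff n l q) x)"
proof -
  let ?Q = "{l. l < N_of n \<and> idiff n p l \<in> ibox L}"
  have "bij_betw (idiff n p) ?Q (ibox L)"
    unfolding bij_betw_def
  proof
    show "inj_on (idiff n p) ?Q" by (rule inj_on_subset[OF inj_idiff]) auto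
    show "idiff n p ` ?Q = ibox L"
    proof
      show "ibox L \<subseteq> idiff n p ` ?Q"
      proof
        fix k :: "int ^ 'd::{finite,linorder}" assume k: "k \<in> ibox L"
        define i where "i = (\<chi> j. nat (int (midx n p $ j) - k $ j))"
        have b: "L < midx n p $ j" "midx n p $ j + L \<le> n $ j" "- int L \<le> k $ j" "k $ j \<le> int L" for j
          using far k by (auto simp: far_from_boundary_def ibox_def)
        have "1 \<le> i $ j \<and> i $ j \<le> n $ j" and ij: "int (i $ j) = int (midx n p $ j) - k $ j" for j
          using b[of j] by (auto simp: i_def)
        then have "i \<in> {1..n}" by (simp add: index_set_eq)
        then obtain l where l: "l < N_of n" "midx n l = i"
          using bij_betw_midx[of n] by (metis bij_betw_imp_surj_on imageE lessThan_iff)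
        have "idiff n p l = k" by (simp add: idiff_def l ij Finite_Cartesian_Product.vec_eq_iff)
        then show "k \<in> idiff n p ` ?Q" using l k by (intro image_eqI[of _ _ l]) auto
      qed
    qed auto
  qed
  then have "(\<Sum>k\<in>ibox L. c k x * c' (idiff n p q - k) x) = (\<Sum>l\<in>?Q. c (idiff n p l) x * c' (idiff n p q - idiff n p l) x)"
    by (rule sum.reindex_bij_betw[symmetric])
  moreover have "idiff n p q - idiff n p l = idiff n l q" for l
    using idiff_add[of n p l q] by (simp add: algebra_simps)
  ultimately show ?thesis by (simp add: cconv_eq[OF finite_ibox L])
qed

lemma gpt_close:
  fixes n :: "nat ^ 'd::{finite,linorder}"
  assumes "idiff n p l \<in> ibox L" "L / n $ j \<le> \<delta>"
  shows "\<bar>gpt n l $ j - gpt n p $ j\<bar> \<le> \<delta>"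
proof -
  have "\<bar>idiff n p l $ j\<bar> \<le> int L" using assms(1) by (auto simp: ibox_def abs_le_iff minus_le_iff)
  then have "\<bar>real (midx n l $ j) - real (midx n p $ j)\<bar> \<le> real L" by (simp add: idiff_def)
  then have "\<bar>real (midx n l $ j) - real (midx n p $ j)\<bar> / n $ j \<le> real L / n $ j" by (rule divide_right_mono) simp
  then show ?thesis using assms(2) by (simp add: gpt_def idx_div_def flip: diff_divide_distrib)
qed

context grid
begin

text \<open>Squared Frobenius norm of smaller order than the size. This tolerates bounded entries in
  a vanishing proportion of the rows of a band matrix, which a bound on the operator norm would
  not.\<close>

definition fnull :: "(nat \<Rightarrow> complex mat) \<Rightarrow> bool" where
  "fnull X \<longleftrightarrow> (\<lambda>n. frob (X n) / N_of (\<nn> n)) \<longlonglongrightarrow> 0"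

lemma fnullI:
  assumes "\<And>e :: real. e > 0 \<Longrightarrow> \<forall>\<^sub>F n in sequentially. frob (X n) \<le> e * N_of (\<nn> n)"
  shows "fnull X"
  unfolding fnull_def
proof (rule tendstoI, unfold dist_norm)
  fix e :: real assume e: "e > 0"
  show "\<forall>\<^sub>F n in sequentially. norm (frob (X n) / N_of (\<nn> n) - 0) < e"
    using assms[OF half_gt_zero[OF e]] eventually_N_pos
  proof eventually_elim
    case (elim n)
    then have "frob (X n) / N_of (\<nn> n) \<le> e / 2" by (simp add: field_simps)
    also have "e / 2 < e" using e by simp
    finally show ?case using frob_nonneg[of "X n"] by simp
  qed
qed

lemma fnullD:
  fixes e :: real
  assumes "fnull X" "e > 0"
  shows "\<forall>\<^sub>F n in sequentially. frob (X n) \<le> e * N_of (\<nn> n)"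
proof -
  have "\<forall>\<^sub>F n in sequentially. frob (X n) / N_of (\<nn> n) < e"
    using assms by (auto simp: fnull_def dest: order_tendstoD(2))
  then show ?thesis using eventually_N_pos by eventually_elim (simp add: field_simps)
qed

lemma fnull_le:
  assumes "fnull Y" "\<And>n. frob (X n) \<le> C * frob (Y n)" "C \<ge> 0"
  shows "fnull X"
proof (rule fnullI)
  fix e :: real assume e: "e > 0"
  have "e / (C + 1) > 0" using e assms(3) by simp
  from fnullD[OF assms(1) this]
  show "\<forall>\<^sub>F n in sequentially. frob (X n) \<le> e * N_of (\<nn> n)"
  proof eventually_elim
    case (elim n)
    have "frob (X n) \<le> C * frob (Y n)" by (rule assms(2))
    also have "\<dots> \<le> (C + 1) * frob (Y n)" using frob_nonneg[of "Y n"] by (simp add: algebra_simps)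
    also have "\<dots> \<le> (C + 1) * (e / (C + 1) * N_of (\<nn> n))" using elim assms(3) by (intro mult_left_mono) auto
    also have "\<dots> = e * N_of (\<nn> n)" using assms(3) by simp
    finally show ?case .
  qed
qed

lemma fnull_add:
  assumes "fnull X" "fnull Y" "\<And>n. X n \<in> carrier_mat (N_of (\<nn> n)) (N_of (\<nn> n))" "\<And>n. Y n \<in> carrier_mat (N_of (\<nn> n)) (N_of (\<nn> n))"
  shows "fnull (\<lambda>n. X n + Y n)"
proof (rule fnullI)
  fix e :: real assume "e > 0"
  then have e: "e / 4 > 0" by simp
  show "\<forall>\<^sub>F n in sequentially. frob (X n + Y n) \<le> e * N_of (\<nn> n)"
    using fnullD[OF assms(1) e] fnullD[OF assms(2) e]
  proof eventually_elim
    case (elim n)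
    then show ?case using frob_add_le[OF assms(3,4), of n] by simp
  qed
qed

text \<open>Two errors occur. Rows near the boundary have an incomplete convolution, but they are a
  vanishing proportion. In the other rows \<open>c'\<close> is sampled at \<open>gpt n l\<close>
  instead of \<open>gpt n p\<close>; inside the band these points are close, and uniform continuity
  applies.\<close>

lemma fnull_Op_mult:
  assumes c: "elem c" and c': "elem c'"
  shows "fnull (\<lambda>n. Op (\<nn> n) c * Op (\<nn> n) c' - Op (\<nn> n) (cconv c c'))"
proof (rule fnullI)
  fix e :: real assume e: "e > 0"
  obtain L where L: "\<forall>k. k \<notin> ibox L \<longrightarrow> c k = (\<lambda>x. 0)" using elem_box[OF c] by blast
  obtain L' where L': "\<forall>k. k \<notin> ibox L' \<longrightarrow> c' k = (\<lambda>x. 0)" using elem_box[OF c'] by blast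
  obtain M where M: "M > 0" "\<And>k x. x \<in> cbox 0 1 \<Longrightarrow> cmod (c k x) \<le> M" using elem_bounded[OF c] by blast
  obtain M' where M': "M' > 0" "\<And>k x. x \<in> cbox 0 1 \<Longrightarrow> cmod (c' k x) \<le> M'" using elem_bounded[OF c'] by blast
  define K where "K = real (card (ibox L :: (int ^ 'd::{finite,linorder}) set))"
  define K'' where "K'' = real (card (ibox (L + L') :: (int ^ 'd::{finite,linorder}) set))"
  have K0: "K \<ge> 0" "K'' \<ge> 0" by (auto simp: K_def K''_def)
  \<comment> \<open>Half of \<open>e\<close> is spent on the rows far from the boundary, through the
    oscillation \<open>\<omega>\<close>; the other half on the remaining rows, through the constant
    \<open>B\<close>.\<close>
  obtain \<omega> where w: "\<omega> > 0" "K'' * (K * M)\<^sup>2 * \<omega>\<^sup>2 \<le> e / 2" using small_square[of "K'' * (K * M)\<^sup>2" "e / 2"] e K0 by auto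
  obtain \<delta> where d: "\<delta> > 0" "\<And>k x y. x \<in> cbox 0 1 \<Longrightarrow> y \<in> cbox 0 1 \<Longrightarrow> (\<forall>j. \<bar>x $ j - y $ j\<bar> \<le> \<delta>) \<Longrightarrow> cmod (c' k x - c' k y) \<le> \<omega>"
    using elem_oscillation[OF c' w(1)] by blast
  have prod_bd: "cmod (c k x * c' k' y) \<le> M * M'" if "x \<in> cbox 0 1" "y \<in> cbox 0 1" for k k' x y
    unfolding norm_mult by (rule mult_mono[OF M(2)[OF that(1)] M'(2)[OF that(2)]]) (use M(1) in auto)
  define B where "B = K'' * (2 * K * M * M')\<^sup>2"
  have B0: "B \<ge> 0" using K0 by (simp add: B_def)
  have "\<forall>\<^sub>F n in sequentially. real (card {i \<in> {1..\<nn> n}. \<not> far_from_boundary L (\<nn> n) i}) / N_of (\<nn> n) < e / (2 * (B + 1))"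
    using e B0 by (intro order_tendstoD(2)[OF near_boundary_null]) auto
  then show "\<forall>\<^sub>F n in sequentially. frob (Op (\<nn> n) c * Op (\<nn> n) c' - Op (\<nn> n) (cconv c c')) \<le> e * N_of (\<nn> n)"
    using eventually_small[OF d(1), of L] eventually_N_pos
  proof eventually_elim
    case (elim n)
    let ?n = "\<nn> n"
    let ?N = "N_of ?n"
    let ?E = "Op ?n c * Op ?n c' - Op ?n (cconv c c')"
    let ?Q = "\<lambda>p. {l. l < ?N \<and> idiff ?n p l \<in> ibox L}"
    have E: "?E \<in> carrier_mat ?N ?N" by (intro minus_carrier_mat) simp
    have OO: "Op ?n c * Op ?n c' \<in> carrier_mat ?N ?N" by (rule mult_carrier_mat[OF Op_carrier Op_carrier])
    have Eidx: "?E $$ (p, q) = (\<Sum>l\<in>?Q p. c (idiff ?n p l) (gpt ?n p) * c' (idiff ?n l q) (gpt ?n l)) - cconv c c' (idiff ?n p q) (gpt ?n p)"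
      if p: "p < ?N" and q: "q < ?N" for p q
    proof -
      have "(Op ?n c * Op ?n c') $$ (p, q) = (\<Sum>l<?N. c (idiff ?n p l) (gpt ?n p) * c' (idiff ?n l q) (gpt ?n l))"
        by (subst mat_mult_index[OF Op_carrier Op_carrier p q]) (auto simp: Op_index p q)
      also have "\<dots> = (\<Sum>l\<in>?Q p. c (idiff ?n p l) (gpt ?n p) * c' (idiff ?n l q) (gpt ?n l))"
        by (rule sum.mono_neutral_right) (use L in auto)
      finally show ?thesis using p q OO by (simp add: Op_index del: index_mult_mat(1))
    qed
    \<comment> \<open>The first value is the sampling error of a complete row; the second bounds the
      entry of the product and that of \<open>Op (cconv c c')\<close> by \<open>K * M * M'\<close>
      each.\<close>
    define b where "b p = (if far_from_boundary L ?n (midx ?n p) then K * M * \<omega> else 2 * K * M * M')" for p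
    have Qc: "real (card (?Q p)) \<le> K" for p unfolding K_def using card_row_band[of ?n p L] by simp
    have fr: "frob ?E \<le> K'' * (\<Sum>p<?N. (b p)\<^sup>2)"
      unfolding K''_def
    proof (rule frob_banded[OF E])
      fix p q assume p: "p < ?N" and q: "q < ?N" and o: "idiff ?n p q \<notin> ibox (L + L')"
      have "c' (idiff ?n l q) = (\<lambda>x. 0)" if "l \<in> ?Q p" for l
        using that o ibox_add[of "idiff ?n p l" L "idiff ?n l q" L'] L' by (auto simp: idiff_add)
      then show "?E $$ (p, q) = 0" using cconv_outside[OF L L'] o by (simp add: Eidx[OF p q])
    next
      fix p q assume p: "p < ?N" and q: "q < ?N"
      note xp = gpt_in[OF p]
      show "cmod (?E $$ (p, q)) \<le> b p"
      proof (cases "far_from_boundary L ?n (midx ?n p)")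
        case True
        have eq: "?E $$ (p, q) = (\<Sum>l\<in>?Q p. c (idiff ?n p l) (gpt ?n p) * (c' (idiff ?n l q) (gpt ?n l) - c' (idiff ?n l q) (gpt ?n p)))"
          unfolding Eidx[OF p q] cconv_full_band[OF p True L] by (simp add: sum_subtractf right_diff_distrib)
        have "cmod (?E $$ (p, q)) \<le> (\<Sum>l\<in>?Q p. M * \<omega>)"
          unfolding eq
        proof (rule sum_norm_le)
          fix l assume l: "l \<in> ?Q p"
          have "cmod (c' (idiff ?n l q) (gpt ?n l) - c' (idiff ?n l q) (gpt ?n p)) \<le> \<omega>"
            using l elim(2) by (intro d(2) gpt_in p) (auto intro: gpt_close)
          then show "cmod (c (idiff ?n p l) (gpt ?n p) * (c' (idiff ?n l q) (gpt ?n l) - c' (idiff ?n l q) (gpt ?n p))) \<le> M * \<omega>"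
            using M w(1) M(2)[OF xp] by (simp add: norm_mult mult_mono)
        qed
        also have "\<dots> = card (?Q p) * (M * \<omega>)" by simp
        also have "\<dots> \<le> K * (M * \<omega>)" by (rule mult_right_mono[OF Qc]) (use M(1) w(1) in simp)
        finally show ?thesis using True by (simp add: b_def mult.assoc)
      next
        case False
        have "cmod (\<Sum>l\<in>?Q p. c (idiff ?n p l) (gpt ?n p) * c' (idiff ?n l q) (gpt ?n l)) \<le> (\<Sum>l\<in>?Q p. M * M')"
          by (rule sum_norm_le) (use prod_bd[OF xp gpt_in] in blast)
        also have "\<dots> = card (?Q p) * (M * M')" by simp
        also have "\<dots> \<le> K * (M * M')" by (rule mult_right_mono[OF Qc]) (use M(1) M'(1) in simp)
        finally have 1: "cmod (\<Sum>l\<in>?Q p. c (idiff ?n p l) (gpt ?n p) * c' (idiff ?n l q) (gpt ?n l)) \<le> K * (M * M')" .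
        have "cmod (cconv c c' (idiff ?n p q) (gpt ?n p)) \<le> (\<Sum>k\<in>(ibox L :: (int ^ 'd::{finite,linorder}) set). M * M')"
          unfolding cconv_eq[OF finite_ibox L] by (rule sum_norm_le) (rule prod_bd[OF xp xp])
        then have 2: "cmod (cconv c c' (idiff ?n p q) (gpt ?n p)) \<le> K * (M * M')" by (simp add: K_def)
        show ?thesis unfolding Eidx[OF p q] using False 1 2
          by (intro order_trans[OF norm_triangle_ineq4]) (simp add: b_def)
      qed
    qed
    have "(\<Sum>p<?N. (b p)\<^sup>2) \<le> (\<Sum>p<?N. (K * M * \<omega>)\<^sup>2 + (if far_from_boundary L ?n (midx ?n p) then 0 else (2 * K * M * M')\<^sup>2))"
      by (rule sum_mono) (auto simp: b_def)
    also have "\<dots> = ?N * (K * M * \<omega>)\<^sup>2 + card {p. p < ?N \<and> \<not> far_from_boundary L ?n (midx ?n p)} * (2 * K * M * M')\<^sup>2"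
      by (simp add: sum.distrib sum.If_cases Int_def Collect_neg_eq[symmetric])
    also have "card {p. p < ?N \<and> \<not> far_from_boundary L ?n (midx ?n p)} = card {i \<in> {1..?n}. \<not> far_from_boundary L ?n i}"
      by (rule card_midx)
    finally have "K'' * (\<Sum>p<?N. (b p)\<^sup>2) \<le> K'' * (?N * (K * M * \<omega>)\<^sup>2 + card {i \<in> {1..?n}. \<not> far_from_boundary L ?n i} * (2 * K * M * M')\<^sup>2)"
      using K0 by (intro mult_left_mono) auto
    also have "\<dots> = ?N * (K'' * (K * M)\<^sup>2 * \<omega>\<^sup>2) + card {i \<in> {1..?n}. \<not> far_from_boundary L ?n i} * B"
      by (simp add: B_def power_mult_distrib algebra_simps)
    also have "\<dots> \<le> ?N * (e / 2) + (e / (2 * (B + 1)) * ?N) * B"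
    proof (intro add_mono mult_left_mono mult_right_mono)
      show "real (card {i \<in> {1..?n}. \<not> far_from_boundary L ?n i}) \<le> e / (2 * (B + 1)) * ?N"
        using elim(1,3) by (simp add: divide_simps mult_ac split: if_splits)
    qed (use w B0 in auto)
    also have "\<dots> \<le> e * ?N"
    proof -
      have "e / (2 * (B + 1)) * B \<le> e / 2" using B0 e by (simp add: field_simps)
      then have "e / (2 * (B + 1)) * B * ?N \<le> e / 2 * ?N" by (rule mult_right_mono) simp
      moreover have "e / (2 * (B + 1)) * ?N * B = e / (2 * (B + 1)) * B * ?N" by (simp only: mult_ac)
      moreover have "?N * (e / 2) + e / 2 * ?N = e * ?N" by simp
      ultimately show ?thesis by argo
    qed
    finally show ?case using fr by linarith
  qed
qed

text \<open>The adjoint samples \<open>c\<close> at the column's grid point instead of the row's.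
  The comparison is entry by entry, so there is no sum to be cut off at the boundary and uniform
  continuity suffices.\<close>

lemma fnull_Op_adjoint:
  assumes c: "elem c"
  shows "fnull (\<lambda>n. mat_adjoint (Op (\<nn> n) c) - Op (\<nn> n) (cstar c))"
proof (rule fnullI)
  fix e :: real assume e: "e > 0"
  obtain L where L: "\<forall>k. k \<notin> ibox L \<longrightarrow> c k = (\<lambda>x. 0)" using elem_box[OF c] by blast
  define K where "K = real (card (ibox L :: (int ^ 'd::{finite,linorder}) set))"
  obtain \<omega> where w: "\<omega> > 0" "K * \<omega>\<^sup>2 \<le> e" using small_square[of K e] e by (auto simp: K_def)
  obtain \<delta> where d: "\<delta> > 0" "\<And>k x y. x \<in> cbox 0 1 \<Longrightarrow> y \<in> cbox 0 1 \<Longrightarrow> (\<forall>j. \<bar>x $ j - y $ j\<bar> \<le> \<delta>) \<Longrightarrow> cmod (c k x - c k y) \<le> \<omega>"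
    using elem_oscillation[OF c w(1)] by blast
  show "\<forall>\<^sub>F n in sequentially. frob (mat_adjoint (Op (\<nn> n) c) - Op (\<nn> n) (cstar c)) \<le> e * N_of (\<nn> n)"
    using eventually_small[OF d(1), of L]
  proof eventually_elim
    case (elim n)
    let ?n = "\<nn> n"
    let ?E = "mat_adjoint (Op ?n c) - Op ?n (cstar c)"
    have E: "?E \<in> carrier_mat (N_of ?n) (N_of ?n)" by (intro minus_carrier_mat) simp
    have Eidx: "?E $$ (p, q) = cnj (c (idiff ?n q p) (gpt ?n q) - c (idiff ?n q p) (gpt ?n p))"
      if "p < N_of ?n" "q < N_of ?n" for p q
      using that by (simp add: Op_index cstar_def idiff_swap[of ?n p q])
    have "frob ?E \<le> K * (\<Sum>p<N_of ?n. \<omega>\<^sup>2)"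
      unfolding K_def
    proof (rule frob_banded[OF E])
      fix p q assume p: "p < N_of ?n" and q: "q < N_of ?n" and o: "idiff ?n p q \<notin> ibox L"
      then have "idiff ?n q p \<notin> ibox L" by (metis ibox_minus idiff_swap)
      then show "?E $$ (p, q) = 0" using L unfolding Eidx[OF p q] by simp
    next
      fix p q assume p: "p < N_of ?n" and q: "q < N_of ?n" and o: "idiff ?n p q \<in> ibox L"
      show "cmod (?E $$ (p, q)) \<le> \<omega>"
        unfolding Eidx[OF p q] complex_mod_cnj
        by (intro d(2) gpt_in p q allI gpt_close[OF o]) (use elim in auto)
    qed
    also have "\<dots> = K * \<omega>\<^sup>2 * N_of ?n" by simp
    also have "\<dots> \<le> e * N_of ?n" using w(2) by (rule mult_right_mono) simp
    finally show ?case .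
  qed
qed

text \<open>The uniform norm bound makes this class closed under products: a Frobenius error stays
  negligible when multiplied by a bounded factor.\<close>

definition aelem :: "(nat \<Rightarrow> complex mat) \<Rightarrow> (int ^ 'd::{finite,linorder} \<Rightarrow> real ^ 'd::{finite,linorder} \<Rightarrow> complex) \<Rightarrow> bool" where
  "aelem A c \<longleftrightarrow> (\<forall>n. A n \<in> carrier_mat (N_of (\<nn> n)) (N_of (\<nn> n))) \<and> (\<exists>C>0. \<forall>n. nbound (A n) C) \<and>
    elem c \<and> fnull (\<lambda>n. A n - Op (\<nn> n) c)"

lemma aelem_Op: "elem c \<Longrightarrow> aelem (\<lambda>n. Op (\<nn> n) c) c"
proof -
  assume c: "elem c"
  have "frob (Op (\<nn> n) c - Op (\<nn> n) c) = 0" for n by (simp add: frob_def)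
  then have "fnull (\<lambda>n. Op (\<nn> n) c - Op (\<nn> n) c)" by (simp add: fnull_def)
  then show ?thesis using c nbound_Op[OF c] unfolding aelem_def by (metis Op_carrier)
qed

lemma aelem_adjoint: assumes "aelem A c" shows "aelem (\<lambda>n. mat_adjoint (A n)) (cstar c)"
proof -
  note A = assms[unfolded aelem_def]
  obtain C where C: "C > 0" "\<And>n. nbound (A n) C" using A by blast
  have Ac: "A n \<in> carrier_mat (N_of (\<nn> n)) (N_of (\<nn> n))" for n using A by blast
  have "fnull (\<lambda>n. mat_adjoint (A n - Op (\<nn> n) c))"
    using A by (simp add: fnull_def frob_adjoint)
  moreover have "fnull (\<lambda>n. mat_adjoint (Op (\<nn> n) c) - Op (\<nn> n) (cstar c))"
    using A by (intro fnull_Op_adjoint) blast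
  ultimately have "fnull (\<lambda>n. mat_adjoint (A n - Op (\<nn> n) c) + (mat_adjoint (Op (\<nn> n) c) - Op (\<nn> n) (cstar c)))"
    by (rule fnull_add) (intro mat_adjoint_carrier minus_carrier_mat Op_carrier)+
  moreover have "mat_adjoint (A n - Op (\<nn> n) c) + (mat_adjoint (Op (\<nn> n) c) - Op (\<nn> n) (cstar c))
    = mat_adjoint (A n) - Op (\<nn> n) (cstar c)" for n
    using Ac[of n] by (intro eq_matI) auto
  ultimately have "fnull (\<lambda>n. mat_adjoint (A n) - Op (\<nn> n) (cstar c))" by simp
  moreover have "nbound (mat_adjoint (A n)) C" for n using C by (intro nbound_adjoint) auto
  ultimately show ?thesis using A C(1) elem_cstar unfolding aelem_def by (meson mat_adjoint_carrier)
qed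

text \<open>The error of the product is the sum of \<open>(A - Op a) * B\<close>,
  \<open>Op a * (B - Op b)\<close> and the error of \<open>fnull_Op_mult\<close>.\<close>

lemma aelem_mult: assumes "aelem A a" "aelem B b" shows "aelem (\<lambda>n. A n * B n) (cconv a b)"
proof -
  note A = assms(1)[unfolded aelem_def] note B = assms(2)[unfolded aelem_def]
  let ?N = "\<lambda>n. N_of (\<nn> n)"
  obtain C where C: "C > 0" "\<And>n. nbound (A n) C" using A by blast
  obtain D where D: "D > 0" "\<And>n. nbound (B n) D" using B by blast
  obtain E where E: "E > 0" "\<And>n. nbound (Op (\<nn> n) a) E" using nbound_Op[of a] A by blast
  have Ac: "A n \<in> carrier_mat (?N n) (?N n)" and Bc: "B n \<in> carrier_mat (?N n) (?N n)" for n using A B by auto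
  have dA: "A n - Op (\<nn> n) a \<in> carrier_mat (?N n) (?N n)" and dB: "B n - Op (\<nn> n) b \<in> carrier_mat (?N n) (?N n)" for n
    by (auto intro!: minus_carrier_mat)
  have 1: "fnull (\<lambda>n. (A n - Op (\<nn> n) a) * B n)"
    by (rule fnull_le[of "\<lambda>n. A n - Op (\<nn> n) a" _ "D\<^sup>2"]) (use A D frob_mult_right[OF dA Bc] in auto)
  have 2: "fnull (\<lambda>n. Op (\<nn> n) a * (B n - Op (\<nn> n) b))"
    by (rule fnull_le[of "\<lambda>n. B n - Op (\<nn> n) b" _ "E\<^sup>2"]) (use B E frob_mult_left[OF Op_carrier dB] in auto)
  have 3: "fnull (\<lambda>n. Op (\<nn> n) a * Op (\<nn> n) b - Op (\<nn> n) (cconv a b))" using A B by (intro fnull_Op_mult) auto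
  note m = mult_carrier_mat
  have c12: "(A n - Op (\<nn> n) a) * B n + Op (\<nn> n) a * (B n - Op (\<nn> n) b) \<in> carrier_mat (?N n) (?N n)" for n
    by (intro add_carrier_mat m[OF Op_carrier dB])
  have "fnull (\<lambda>n. (A n - Op (\<nn> n) a) * B n + Op (\<nn> n) a * (B n - Op (\<nn> n) b)
      + (Op (\<nn> n) a * Op (\<nn> n) b - Op (\<nn> n) (cconv a b)))"
    by (intro fnull_add 1 2 3 c12 m[OF dA Bc] m[OF Op_carrier dB] minus_carrier_mat Op_carrier)
  moreover have "(A n - Op (\<nn> n) a) * B n + Op (\<nn> n) a * (B n - Op (\<nn> n) b)
      + (Op (\<nn> n) a * Op (\<nn> n) b - Op (\<nn> n) (cconv a b)) = A n * B n - Op (\<nn> n) (cconv a b)" for n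
  proof -
    have e1: "(A n - Op (\<nn> n) a) * B n = A n * B n - Op (\<nn> n) a * B n"
      by (rule minus_mult_distrib_mat[OF Ac Op_carrier Bc])
    have e2: "Op (\<nn> n) a * (B n - Op (\<nn> n) b) = Op (\<nn> n) a * B n - Op (\<nn> n) a * Op (\<nn> n) b"
      by (rule mult_minus_distrib_mat[OF Op_carrier Bc Op_carrier])
    show ?thesis unfolding e1 e2
      by (rule eq_matI) (use Ac[of n] Bc[of n] in \<open>auto simp del: index_mult_mat(1)\<close>)
  qed
  ultimately have "fnull (\<lambda>n. A n * B n - Op (\<nn> n) (cconv a b))" by simp
  moreover have "nbound (A n * B n) (C * D)" for n using C D by (intro nbound_mult[OF Ac Bc]) auto
  ultimately show ?thesis using A B C(1) D(1) elem_cconv[of a b] m[OF Ac Bc]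
    unfolding aelem_def by (auto intro!: exI[of _ "C * D"])
qed

primrec cpow :: "(int ^ 'd::{finite,linorder} \<Rightarrow> real ^ 'd::{finite,linorder} \<Rightarrow> complex) \<Rightarrow> nat \<Rightarrow> int ^ 'd::{finite,linorder} \<Rightarrow> real ^ 'd::{finite,linorder} \<Rightarrow> complex" where
  "cpow c 0 = cmono 0 (\<lambda>x. 1)"
| "cpow c (Suc k) = cconv (cpow c k) c"

lemma elem_cpow: "elem c \<Longrightarrow> elem (cpow c k)"
  by (induction k) (auto intro!: elem_cmono elem_cconv)

lemma symb_cpow: "elem c \<Longrightarrow> symb (cpow c k) z = symb c z ^ k"
  by (induction k) (cases z, auto simp: symb_cmono symb_cconv elem_cpow)

lemma Op_one: "Op n (cmono 0 (\<lambda>x. 1)) = 1\<^sub>m (N_of n)"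
proof (rule eq_matI)
  fix p q assume "p < dim_row (1\<^sub>m (N_of n) :: complex mat)" "q < dim_col (1\<^sub>m (N_of n) :: complex mat)"
  then have pq: "p < N_of n" "q < N_of n" by auto
  have "idiff n p q = 0 \<longleftrightarrow> p = q"
    using inj_on_eq_iff[OF inj_idiff[of n p], of q p] pq by auto
  then show "Op n (cmono 0 (\<lambda>x. 1)) $$ (p, q) = 1\<^sub>m (N_of n) $$ (p, q)"
    using pq by (simp add: Op_index cmono_def)
qed auto

lemma aelem_pow: assumes "aelem A c" shows "aelem (\<lambda>n. A n ^\<^sub>m k) (cpow c k)"
proof (induction k)
  case 0
  have "A n ^\<^sub>m 0 = Op (\<nn> n) (cmono 0 (\<lambda>x. 1))" for n
  proof -
    have "A n \<in> carrier_mat (N_of (\<nn> n)) (N_of (\<nn> n))" using assms by (simp add: aelem_def)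
    then show ?thesis by (simp add: Op_one)
  qed
  then show ?case using aelem_Op[OF elem_cmono, of "\<lambda>x. 1" 0] by simp
next
  case (Suc k)
  then show ?case using aelem_mult[OF Suc assms] by simp
qed

text \<open>The trace of \<open>Op\<close> is a Riemann sum of \<open>c 0\<close>. The trace of an
  \<open>N\<close> by \<open>N\<close> error is at most the square root of \<open>N\<close> times
  its squared Frobenius norm, which is of smaller order than \<open>N\<close>.\<close>

lemma trace_aelem:
  assumes "aelem A c"
  shows "(\<lambda>n. (\<Sum>p<N_of (\<nn> n). A n $$ (p, p)) / N_of (\<nn> n)) \<longlonglongrightarrow> integral (cbox 0 1) (c 0)"
proof -
  note A = assms[unfolded aelem_def]
  have Ac: "A n \<in> carrier_mat (N_of (\<nn> n)) (N_of (\<nn> n))" for n using A by blast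
  have Op: "(\<lambda>n. (\<Sum>p<N_of (\<nn> n). Op (\<nn> n) c $$ (p, p)) / N_of (\<nn> n)) \<longlonglongrightarrow> integral (cbox 0 1) (c 0)"
    using riemann_sums[OF elem_cont[of c 0]] A by (simp add: Op_index gpt_def)
  have "(\<lambda>n. (\<Sum>p<N_of (\<nn> n). (A n - Op (\<nn> n) c) $$ (p, p)) / N_of (\<nn> n)) \<longlonglongrightarrow> 0"
  proof (rule Lim_null_comparison)
    show "(\<lambda>n. sqrt (frob (A n - Op (\<nn> n) c) / N_of (\<nn> n))) \<longlonglongrightarrow> 0"
      using A tendsto_real_sqrt[of "\<lambda>n. frob (A n - Op (\<nn> n) c) / N_of (\<nn> n)" 0] by (simp add: fnull_def)
    show "\<forall>\<^sub>F n in sequentially. norm ((\<Sum>p<N_of (\<nn> n). (A n - Op (\<nn> n) c) $$ (p, p)) / N_of (\<nn> n)) \<le> sqrt (frob (A n - Op (\<nn> n) c) / N_of (\<nn> n))"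
      using eventually_N_pos
    proof eventually_elim
      case (elim n)
      let ?X = "A n - Op (\<nn> n) c" and ?N = "N_of (\<nn> n)"
      have X: "?X \<in> carrier_mat ?N ?N" by (intro minus_carrier_mat) simp
      have "(cmod (\<Sum>p<?N. ?X $$ (p, p)))\<^sup>2 \<le> (\<Sum>p<?N. cmod (?X $$ (p, p)))\<^sup>2"
        by (intro power_mono norm_sum) auto
      also have "\<dots> \<le> (\<Sum>p<?N. (cmod (?X $$ (p, p)))\<^sup>2) * card {..<?N}"
        by (rule sum_squared_le_sum_of_squares)
      also have "\<dots> \<le> (\<Sum>p<?N. \<Sum>q<?N. (cmod (?X $$ (p, q)))\<^sup>2) * card {..<?N}"
        by (intro mult_right_mono sum_mono member_le_sum) auto
      also have "\<dots> = frob ?X * ?N" using X by (simp add: frob_def)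
      finally have "(cmod (\<Sum>p<?N. ?X $$ (p, p)) / ?N)\<^sup>2 \<le> frob ?X / ?N"
        using elim by (simp add: power_divide field_simps power2_eq_square)
      then show ?case by (simp add: norm_divide real_le_rsqrt)
    qed
  qed
  from tendsto_add[OF this Op] have "(\<lambda>n. (\<Sum>p<N_of (\<nn> n). (A n - Op (\<nn> n) c) $$ (p, p)) / N_of (\<nn> n) + (\<Sum>p<N_of (\<nn> n). Op (\<nn> n) c $$ (p, p)) / N_of (\<nn> n)) \<longlonglongrightarrow> integral (cbox 0 1) (c 0)"
    by simp
  then show ?thesis using Ac by (simp add: add_divide_distrib[symmetric] sum.distrib[symmetric])
qed

end

section \<open>Singular value distribution of elementary matrices\<close>

abbreviation sdom :: "((real ^ 'd) \<times> (real ^ 'd)) set" where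
  "sdom \<equiv> cbox 0 1 \<times> freq_cube"

lemma sdom_cbox: "sdom = cbox (0, \<chi> j. - pi) (1, \<chi> j. pi)"
  by (simp add: cbox_Pair_eq)

lemma lmeasurable_sdom [simp]: "sdom \<in> lmeasurable"
  unfolding sdom_cbox by simp

lemma sets_sdom [simp]: "sdom \<in> sets lebesgue"
  by (rule fmeasurableD) simp

lemma finite_measure_sdom: "finite_measure (lebesgue_on sdom)"
  by (rule finite_measure_lebesgue_on) simp

lemma measure_cube: "measure lborel (cbox 0 1 :: (real ^ 'd) set) = 1"
proof -
  have "measure lborel (cbox 0 1 :: (real ^ 'd) set) = (\<Prod>i\<in>UNIV. (1 :: real ^ 'd) $ i - (0 :: real ^ 'd) $ i)"
    by (rule content_cbox_cart) (auto simp: interval_ne_empty_cart)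
  then show ?thesis by simp
qed

lemma measure_freq_box:
  assumes "a \<ge> 0"
  shows "measure lborel (cbox (\<chi> j. - a) (\<chi> j. a) :: (real ^ 'd) set) = (2 * a) ^ CARD('d)"
proof -
  have "measure lborel (cbox (\<chi> j. - a) (\<chi> j. a) :: (real ^ 'd) set) = (\<Prod>i\<in>(UNIV :: 'd set). (\<chi> j. a) $ i - (\<chi> j. - a) $ i)"
    by (rule content_cbox_cart) (use assms in \<open>auto simp: interval_ne_empty_cart\<close>)
  then show ?thesis by simp
qed

lemma measure_sub_box:
  assumes "a \<ge> 0"
  shows "measure lebesgue (cbox 0 1 \<times> cbox (\<chi> j. - a) (\<chi> j. a) :: ((real ^ 'd) \<times> (real ^ 'd)) set) = (2 * a) ^ CARD('d)"
  using assms by (simp add: cbox_Pair_eq[symmetric] content_Pair measure_cube measure_freq_box)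

lemma symb_measurable: "elem c \<Longrightarrow> symb c \<in> borel_measurable (lebesgue_on sdom)"
  by (intro continuous_imp_measurable_on_sets_lebesgue continuous_on_symb) auto

lemma sum_mset_poly:
  fixes f :: "'a \<Rightarrow> nat \<Rightarrow> real"
  shows "(\<Sum>x\<in>#S. \<Sum>i\<le>m. a i * f x i) = (\<Sum>i\<le>m. a i * (\<Sum>x\<in>#S. f x i))"
  by (induction S) (simp_all add: sum.distrib distrib_left)

lemma sum_mset_diff_le:
  fixes f g :: "'a \<Rightarrow> real"
  assumes "\<And>x. x \<in># S \<Longrightarrow> \<bar>f x - g x\<bar> \<le> e"
  shows "\<bar>(\<Sum>x\<in>#S. f x) - (\<Sum>x\<in>#S. g x)\<bar> \<le> e * size S"
  using assms
proof (induction S)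
  case (add x S)
  have "\<bar>f x - g x\<bar> \<le> e" "\<bar>(\<Sum>x\<in>#S. f x) - (\<Sum>x\<in>#S. g x)\<bar> \<le> e * size S" using add by auto
  then show ?case by (simp add: distrib_left)
qed simp

lemma size_filter_le_sum_mset:
  fixes h :: "'a \<Rightarrow> real"
  assumes "\<And>x. x \<in># S \<Longrightarrow> h x \<ge> 0" "\<And>x. x \<in># S \<Longrightarrow> P x \<Longrightarrow> h x \<ge> 1"
  shows "real (size (filter_mset P S)) \<le> (\<Sum>x\<in>#S. h x)"
  using assms
proof (induction S)
  case (add x S)
  then have "real (size (filter_mset P S)) \<le> (\<Sum>x\<in>#S. h x)" "h x \<ge> 0" "P x \<Longrightarrow> h x \<ge> 1" by auto
  then show ?case by auto
qed simp

lemma sum_mset_le_size_filter: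
  fixes h :: "'a \<Rightarrow> real"
  assumes "\<And>x. x \<in># S \<Longrightarrow> h x \<le> 1" "\<And>x. x \<in># S \<Longrightarrow> \<not> P x \<Longrightarrow> h x \<le> 0"
  shows "(\<Sum>x\<in>#S. h x) \<le> real (size (filter_mset P S))"
  using assms
proof (induction S)
  case (add x S)
  then have "(\<Sum>x\<in>#S. h x) \<le> real (size (filter_mset P S))" "h x \<le> 1" "\<not> P x \<Longrightarrow> h x \<le> 0" by auto
  then show ?case by auto
qed simp

lemma integral_of_real_continuous:
  fixes f :: "'a::euclidean_space \<Rightarrow> real"
  assumes "continuous_on (cbox a b) f"
  shows "integral (cbox a b) (\<lambda>x. complex_of_real (f x)) = of_real (integral (cbox a b) f)"
  using integral_linear[OF integrable_continuous[OF assms] bounded_linear_of_real[where 'a=complex]]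
  by (simp add: o_def)

context grid
begin

text \<open>The moments are normalised traces of powers of \<open>mat_adjoint A * A\<close>, a
  sequence with symbol \<open>h\<close>, the squared modulus of \<open>symb c\<close>.
  \<open>integral_symb\<close> rewrites the limit of the traces as an integral over the whole
  domain.\<close>

lemma singular_value_moments:
  assumes c: "elem c"
  shows "(\<lambda>n. (\<Sum>\<sigma>\<in>#singular_values (Op (\<nn> n) c). (\<sigma>\<^sup>2) ^ k) / N_of (\<nn> n))
    \<longlonglongrightarrow> integral sdom (\<lambda>z. ((cmod (symb c z))\<^sup>2) ^ k) / (2 * pi) ^ CARD('d::{finite,linorder})"
proof -
  define h where "h = cconv (cstar c) c"
  have h: "elem h" unfolding h_def using c by (intro elem_cconv elem_cstar)
  have H: "aelem (\<lambda>n. (mat_adjoint (Op (\<nn> n) c) * Op (\<nn> n) c) ^\<^sub>m k) (cpow h k)"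
    unfolding h_def by (intro aelem_pow aelem_mult aelem_adjoint aelem_Op c)
  have tr: "(\<Sum>p<N_of (\<nn> n). ((mat_adjoint (Op (\<nn> n) c) * Op (\<nn> n) c) ^\<^sub>m k) $$ (p, p))
    = of_real (\<Sum>\<sigma>\<in>#singular_values (Op (\<nn> n) c). (\<sigma>\<^sup>2) ^ k)" for n
    by (rule trace_power_singular_values) simp
  have "symb h z = of_real ((cmod (symb c z))\<^sup>2)" for z
    unfolding h_def symb_cconv[OF elem_cstar[OF c] c] symb_cstar[OF c] complex_norm_square by (rule mult.commute)
  then have sq: "symb (cpow h k) z = of_real (((cmod (symb c z))\<^sup>2) ^ k)" for z
    by (simp add: symb_cpow[OF h])
  have "continuous_on sdom (\<lambda>z. ((cmod (symb c z))\<^sup>2) ^ k)"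
    by (intro continuous_intros continuous_on_symb c)
  then have "complex_of_real (integral sdom (\<lambda>z. ((cmod (symb c z))\<^sup>2) ^ k)) = integral sdom (symb (cpow h k))"
    unfolding sq sdom_cbox by (subst integral_of_real_continuous[symmetric]) (auto intro!: integral_cong simp: sq)
  also have "\<dots> = of_real ((2 * pi) ^ CARD('d)) * integral (cbox 0 1) (cpow h k 0)"
    by (rule integral_symb) (rule elem_cpow[OF h])
  finally have I: "integral (cbox 0 1) (cpow h k 0) = of_real (integral sdom (\<lambda>z. ((cmod (symb c z))\<^sup>2) ^ k) / (2 * pi) ^ CARD('d))"
    by (simp add: field_simps)
  have "(\<lambda>n. complex_of_real ((\<Sum>\<sigma>\<in>#singular_values (Op (\<nn> n) c). (\<sigma>\<^sup>2) ^ k) / N_of (\<nn> n)))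
    \<longlonglongrightarrow> of_real (integral sdom (\<lambda>z. ((cmod (symb c z))\<^sup>2) ^ k) / (2 * pi) ^ CARD('d))"
    using trace_aelem[OF H] unfolding tr I by (simp only: of_real_divide of_real_of_nat_eq)
  then show ?thesis unfolding tendsto_of_real_iff .
qed

text \<open>Moments settle the case of polynomials, and Weierstrass approximation on a compact
  interval the general one. Three errors of \<open>e / 4\<close> each stay below
  \<open>e\<close>.\<close>

lemma singular_value_distribution:
  fixes g :: "real \<Rightarrow> real"
  assumes c: "elem c" and g: "continuous_on UNIV g"
  shows "(\<lambda>n. (\<Sum>\<sigma>\<in>#singular_values (Op (\<nn> n) c). g (\<sigma>\<^sup>2)) / N_of (\<nn> n))
    \<longlonglongrightarrow> integral sdom (\<lambda>z. g ((cmod (symb c z))\<^sup>2)) / (2 * pi) ^ CARD('d::{finite,linorder})"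
proof (rule tendstoI, unfold dist_norm real_norm_def)
  fix e :: real assume e: "e > 0"
  let ?V = "(2 * pi) ^ CARD('d)"
  have V: "?V > 0" by simp
  obtain B where B: "B > 0" "\<And>x \<theta>. x \<in> cbox 0 1 \<Longrightarrow> cmod (symb c (x, \<theta>)) \<le> B" using symb_bounded[OF c] by blast
  obtain C where C: "C > 0" "\<And>n. nbound (Op n c) C" using nbound_Op[OF c] by blast
  \<comment> \<open>One interval must contain both the squared singular values and the values of the
    squared symbol, so that the same polynomial serves on both sides.\<close>
  define R where "R = max (B\<^sup>2) (C\<^sup>2)"
  obtain p where p: "real_polynomial_function p" "\<And>x. x \<in> {0..R} \<Longrightarrow> \<bar>g x - p x\<bar> < e / 4"
    using Stone_Weierstrass_real_polynomial_function[of "{0..R}" g "e / 4"] e continuous_on_subset[OF g]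
    by (metis compact_Icc divide_pos_pos subset_UNIV zero_less_numeral)
  obtain a m where pa: "p = (\<lambda>x. \<Sum>i\<le>m. a i * x ^ i)" using p(1) real_polynomial_function_iff_sum by blast
  have pc: "continuous_on UNIV p" unfolding pa by (intro continuous_intros)
  have symR: "(cmod (symb c z))\<^sup>2 \<in> {0..R}" if "z \<in> sdom" for z
  proof -
    have "cmod (symb c z) \<le> B" using that B(2) by (cases z) auto
    then have "(cmod (symb c z))\<^sup>2 \<le> B\<^sup>2" by (rule power_mono) simp
    then show ?thesis by (simp add: R_def)
  qed
  have cont: "continuous_on sdom (\<lambda>z. q ((cmod (symb c z))\<^sup>2))" if "continuous_on UNIV q" for q :: "real \<Rightarrow> real"
    by (intro continuous_on_compose2[OF that] continuous_intros continuous_on_symb c) auto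
  have int: "(\<lambda>z. q ((cmod (symb c z))\<^sup>2)) integrable_on sdom" if "continuous_on UNIV q" for q :: "real \<Rightarrow> real"
    using cont[OF that] unfolding sdom_cbox by (rule integrable_continuous)
  let ?I = "\<lambda>q. integral sdom (\<lambda>z. q ((cmod (symb c z))\<^sup>2)) / ?V"
  let ?S = "\<lambda>q n. (\<Sum>\<sigma>\<in>#singular_values (Op (\<nn> n) c). q (\<sigma>\<^sup>2)) / N_of (\<nn> n)"
  have Idiff: "\<bar>?I g - ?I p\<bar> \<le> e / 4"
  proof -
    have "integral sdom (\<lambda>z. g ((cmod (symb c z))\<^sup>2)) - integral sdom (\<lambda>z. p ((cmod (symb c z))\<^sup>2))
      = integral sdom (\<lambda>z. g ((cmod (symb c z))\<^sup>2) - p ((cmod (symb c z))\<^sup>2))"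
      by (rule integral_diff[symmetric, OF int[OF g] int[OF pc]])
    moreover have "norm (integral sdom (\<lambda>z. g ((cmod (symb c z))\<^sup>2) - p ((cmod (symb c z))\<^sup>2))) \<le> e / 4 * measure lborel (sdom :: ((real ^ 'd::{finite,linorder}) \<times> (real ^ 'd::{finite,linorder})) set)"
      unfolding sdom_cbox
    proof (rule has_integral_bound)
      show "((\<lambda>z. g ((cmod (symb c z))\<^sup>2) - p ((cmod (symb c z))\<^sup>2)) has_integral
          integral (cbox (0, \<chi> j. - pi) (1, \<chi> j. pi)) (\<lambda>z. g ((cmod (symb c z))\<^sup>2) - p ((cmod (symb c z))\<^sup>2)))
          (cbox (0, \<chi> j. - pi) (1, \<chi> j. pi))"
        using integrable_diff[OF int[OF g] int[OF pc]] unfolding sdom_cbox by (rule integrable_integral)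
      show "\<And>z. z \<in> cbox (0, \<chi> j. - pi) (1, \<chi> j. pi) \<Longrightarrow> norm (g ((cmod (symb c z))\<^sup>2) - p ((cmod (symb c z))\<^sup>2)) \<le> e / 4"
        using p(2)[OF symR] by (simp add: sdom_cbox less_imp_le)
    qed (use e in simp)
    moreover have "measure lborel (sdom :: ((real ^ 'd::{finite,linorder}) \<times> (real ^ 'd::{finite,linorder})) set) = ?V"
      using measure_sub_box[of pi, where 'd='d] by (simp add: sdom_cbox)
    ultimately have "\<bar>integral sdom (\<lambda>z. g ((cmod (symb c z))\<^sup>2)) - integral sdom (\<lambda>z. p ((cmod (symb c z))\<^sup>2))\<bar> \<le> e / 4 * ?V" by simp
    then have "\<bar>integral sdom (\<lambda>z. g ((cmod (symb c z))\<^sup>2)) - integral sdom (\<lambda>z. p ((cmod (symb c z))\<^sup>2))\<bar> / ?V \<le> e / 4"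
      using V by (simp only: pos_divide_le_eq)
    then show ?thesis using V by (simp add: abs_divide flip: diff_divide_distrib)
  qed
  have Sdiff: "\<bar>?S g n - ?S p n\<bar> \<le> e / 4" if N: "N_of (\<nn> n) > 0" for n
  proof -
    have "\<bar>(\<Sum>\<sigma>\<in>#singular_values (Op (\<nn> n) c). g (\<sigma>\<^sup>2)) - (\<Sum>\<sigma>\<in>#singular_values (Op (\<nn> n) c). p (\<sigma>\<^sup>2))\<bar> \<le> e / 4 * size (singular_values (Op (\<nn> n) c))"
    proof (rule sum_mset_diff_le)
      fix \<sigma> assume s: "\<sigma> \<in># singular_values (Op (\<nn> n) c)"
      have "0 \<le> \<sigma>" "\<sigma> \<le> C" using singular_values_bounds[OF Op_carrier C(2) _ s] C(1) by auto
      then have "\<sigma>\<^sup>2 \<le> C\<^sup>2" by (intro power_mono)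
      then have "\<sigma>\<^sup>2 \<in> {0..R}" by (simp add: R_def)
      then show "\<bar>g (\<sigma>\<^sup>2) - p (\<sigma>\<^sup>2)\<bar> \<le> e / 4" using p(2) less_imp_le by blast
    qed
    then have "\<bar>(\<Sum>\<sigma>\<in>#singular_values (Op (\<nn> n) c). g (\<sigma>\<^sup>2)) - (\<Sum>\<sigma>\<in>#singular_values (Op (\<nn> n) c). p (\<sigma>\<^sup>2))\<bar> / N_of (\<nn> n) \<le> e / 4"
      using N by (simp add: size_singular_values[OF Op_carrier] pos_divide_le_eq)
    then show ?thesis by (simp add: abs_divide flip: diff_divide_distrib)
  qed
  have "?S p \<longlonglongrightarrow> ?I p"
  proof -
    have "(\<lambda>n. \<Sum>i\<le>m. a i * ((\<Sum>\<sigma>\<in>#singular_values (Op (\<nn> n) c). (\<sigma>\<^sup>2) ^ i) / N_of (\<nn> n)))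
      \<longlonglongrightarrow> (\<Sum>i\<le>m. a i * (integral sdom (\<lambda>z. ((cmod (symb c z))\<^sup>2) ^ i) / ?V))"
      by (intro tendsto_sum tendsto_mult tendsto_const singular_value_moments c)
    moreover have "(\<Sum>i\<le>m. a i * ((\<Sum>\<sigma>\<in>#singular_values (Op (\<nn> n) c). (\<sigma>\<^sup>2) ^ i) / N_of (\<nn> n))) = ?S p n" for n
      unfolding pa sum_mset_poly by (simp add: sum_divide_distrib)
    moreover have "(\<Sum>i\<le>m. a i * (integral sdom (\<lambda>z. ((cmod (symb c z))\<^sup>2) ^ i) / ?V)) = ?I p"
    proof -
      have "integral sdom (\<lambda>z. \<Sum>i\<le>m. a i * ((cmod (symb c z))\<^sup>2) ^ i) = (\<Sum>i\<le>m. integral sdom (\<lambda>z. a i * ((cmod (symb c z))\<^sup>2) ^ i))"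
        by (rule integral_sum) (auto intro!: int continuous_intros)
      then show ?thesis unfolding pa by (simp add: sum_divide_distrib)
    qed
    ultimately show ?thesis by simp
  qed
  then have "\<forall>\<^sub>F n in sequentially. \<bar>?S p n - ?I p\<bar> < e / 4"
    using e by (auto dest!: tendstoD[of _ _ _ "e / 4"] simp: dist_real_def)
  then show "\<forall>\<^sub>F n in sequentially. \<bar>?S g n - ?I g\<bar> < e"
    using eventually_N_pos
  proof eventually_elim
    case (elim n)
    then show ?case using Sdiff[of n] Idiff e by linarith
  qed
qed

text \<open>Applied to the square of \<open>s \<ge> 0\<close>, this continuous cutoff is 0 up to
  \<open>s = \<epsilon>\<close> and 1 from \<open>s = 2 * \<epsilon>\<close> on;
  \<open>3 * \<epsilon>\<^sup>2\<close> is the distance between the squares of the two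
  thresholds.\<close>

definition ramp :: "real \<Rightarrow> real \<Rightarrow> real" where
  "ramp \<epsilon> t = min 1 (max 0 ((t - \<epsilon>\<^sup>2) / (3 * \<epsilon>\<^sup>2)))"

lemma ramp_properties:
  fixes \<epsilon> :: real
  assumes e: "\<epsilon> > 0"
  shows "continuous_on UNIV (ramp \<epsilon>)" "0 \<le> ramp \<epsilon> t" "ramp \<epsilon> t \<le> 1"
    "0 \<le> s \<Longrightarrow> s \<le> \<epsilon> \<Longrightarrow> ramp \<epsilon> (s\<^sup>2) = 0" "2 * \<epsilon> \<le> s \<Longrightarrow> ramp \<epsilon> (s\<^sup>2) = 1"
proof -
  show "continuous_on UNIV (ramp \<epsilon>)" unfolding ramp_def[abs_def] by (intro continuous_intros) (use e in auto)
  show "0 \<le> ramp \<epsilon> t" "ramp \<epsilon> t \<le> 1" by (auto simp: ramp_def)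
  show "ramp \<epsilon> (s\<^sup>2) = 0" if "0 \<le> s" "s \<le> \<epsilon>"
  proof -
    have "s\<^sup>2 \<le> \<epsilon>\<^sup>2" using that by (intro power_mono) auto
    then have "(s\<^sup>2 - \<epsilon>\<^sup>2) / (3 * \<epsilon>\<^sup>2) \<le> 0" by (intro divide_nonpos_nonneg) auto
    then show ?thesis by (simp add: ramp_def)
  qed
  show "ramp \<epsilon> (s\<^sup>2) = 1" if "2 * \<epsilon> \<le> s"
  proof -
    have "(2 * \<epsilon>)\<^sup>2 \<le> s\<^sup>2" using that e by (intro power_mono) auto
    then have "(s\<^sup>2 - \<epsilon>\<^sup>2) / (3 * \<epsilon>\<^sup>2) \<ge> 1" using e by (simp add: power_mult_distrib)
    then show ?thesis by (simp add: ramp_def)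
  qed
qed

lemma integral_symb_Lebesgue:
  fixes g :: "real \<Rightarrow> real"
  assumes c: "elem c" and g: "continuous_on UNIV g"
  shows "integrable (lebesgue_on sdom) (\<lambda>z. g ((cmod (symb c z))\<^sup>2))"
    "integral\<^sup>L (lebesgue_on sdom) (\<lambda>z. g ((cmod (symb c z))\<^sup>2)) = integral sdom (\<lambda>z. g ((cmod (symb c z))\<^sup>2))"
proof -
  have cont: "continuous_on sdom (\<lambda>z. g ((cmod (symb c z))\<^sup>2))"
    by (intro continuous_on_compose2[OF g] continuous_intros continuous_on_symb c) auto
  then show I: "integrable (lebesgue_on sdom) (\<lambda>z. g ((cmod (symb c z))\<^sup>2))"
    unfolding sdom_cbox by (rule continuous_imp_integrable)
  show "integral\<^sup>L (lebesgue_on sdom) (\<lambda>z. g ((cmod (symb c z))\<^sup>2)) = integral sdom (\<lambda>z. g ((cmod (symb c z))\<^sup>2))"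
    by (rule lebesgue_integral_eq_integral[OF I]) simp
qed

text \<open>\<open>ramp\<close> lies between the indicators of the thresholds
  \<open>2 * \<epsilon>\<close> and \<open>\<epsilon>\<close>: the larger one bounds the count from
  above, the smaller one the integral. The factor 2 between the thresholds is the price of a
  continuous test function.\<close>

lemma sv_count_Op_upper:
  assumes c: "elem c" and e: "\<epsilon> > 0"
    and m: "measure (lebesgue_on sdom) {z \<in> sdom. \<epsilon> < cmod (symb c z)} < \<delta> * (2 * pi) ^ CARD('d::{finite,linorder})"
  shows "\<forall>\<^sub>F n in sequentially. real (sv_count (Op (\<nn> n) c) (2 * \<epsilon>)) \<le> \<delta> * N_of (\<nn> n)"
proof -
  interpret finite_measure "lebesgue_on (sdom :: ((real ^ 'd::{finite,linorder}) \<times> (real ^ 'd::{finite,linorder})) set)" by (rule finite_measure_sdom)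
  note [measurable] = symb_measurable[OF c]
  define g where "g = ramp \<epsilon>"
  note g = ramp_properties[OF e, folded g_def]
  let ?E = "{z \<in> sdom. \<epsilon> < cmod (symb c z)}"
  have E: "?E \<in> sets (lebesgue_on sdom)"
  proof -
    have "{z \<in> space (lebesgue_on sdom). \<epsilon> < cmod (symb c z)} \<in> sets (lebesgue_on sdom)" by measurable
    then show ?thesis by (simp add: space_restrict_space)
  qed
  have "integral\<^sup>L (lebesgue_on sdom) (\<lambda>z. g ((cmod (symb c z))\<^sup>2)) \<le> integral\<^sup>L (lebesgue_on sdom) (indicator ?E)"
  proof (rule integral_mono[OF integral_symb_Lebesgue(1)[OF c g(1)]])
    fix z :: "(real ^ 'd::{finite,linorder}) \<times> (real ^ 'd::{finite,linorder})" assume "z \<in> space (lebesgue_on sdom)"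
    then have "z \<in> sdom" by (simp add: space_restrict_space)
    then show "g ((cmod (symb c z))\<^sup>2) \<le> indicator ?E z"
      using g(3)[of "(cmod (symb c z))\<^sup>2"] g(4)[of "cmod (symb c z)"] by (auto simp: indicator_def)
  qed (use E in \<open>simp add: emeasure_finite less_top[symmetric]\<close>)
  then have "integral sdom (\<lambda>z. g ((cmod (symb c z))\<^sup>2)) \<le> measure (lebesgue_on sdom) ?E"
    using E sets.sets_into_space[OF E] by (simp add: integral_symb_Lebesgue(2)[OF c g(1)] Int_absorb2)
  then have "integral sdom (\<lambda>z. g ((cmod (symb c z))\<^sup>2)) / (2 * pi) ^ CARD('d) < \<delta>"
    using m by (simp add: pos_divide_less_eq)
  from order_tendstoD(2)[OF singular_value_distribution[OF c g(1)] this] eventually_N_pos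
  show ?thesis
  proof eventually_elim
    case (elim n)
    have "real (sv_count (Op (\<nn> n) c) (2 * \<epsilon>)) \<le> (\<Sum>\<sigma>\<in>#singular_values (Op (\<nn> n) c). g (\<sigma>\<^sup>2))"
      unfolding sv_count_def by (rule size_filter_le_sum_mset) (use g in auto)
    then show ?case using elim by (simp add: pos_divide_less_eq)
  qed
qed

text \<open>The same comparison with the roles exchanged: the count of singular values bounds the
  sum of the test function, and the integral bounds the measure.\<close>

lemma sv_count_Op_lower:
  fixes \<delta> :: real
  assumes c: "elem c" and e: "\<epsilon> > 0"
    and ev: "\<forall>\<^sub>F n in sequentially. real (sv_count (Op (\<nn> n) c) \<epsilon>) \<le> \<delta> * N_of (\<nn> n)"
  shows "measure (lebesgue_on sdom) {z \<in> sdom. 2 * \<epsilon> < cmod (symb c z)} \<le> \<delta> * (2 * pi) ^ CARD('d::{finite,linorder})"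
proof -
  interpret finite_measure "lebesgue_on (sdom :: ((real ^ 'd::{finite,linorder}) \<times> (real ^ 'd::{finite,linorder})) set)" by (rule finite_measure_sdom)
  note [measurable] = symb_measurable[OF c]
  define g where "g = ramp \<epsilon>"
  note g = ramp_properties[OF e, folded g_def]
  let ?E = "{z \<in> sdom. 2 * \<epsilon> < cmod (symb c z)}"
  have E: "?E \<in> sets (lebesgue_on sdom)"
  proof -
    have "{z \<in> space (lebesgue_on sdom). 2 * \<epsilon> < cmod (symb c z)} \<in> sets (lebesgue_on sdom)" by measurable
    then show ?thesis by (simp add: space_restrict_space)
  qed
  have "integral\<^sup>L (lebesgue_on sdom) (indicator ?E) \<le> integral\<^sup>L (lebesgue_on sdom) (\<lambda>z. g ((cmod (symb c z))\<^sup>2))"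
  proof (rule integral_mono[OF _ integral_symb_Lebesgue(1)[OF c g(1)]])
    fix z :: "(real ^ 'd::{finite,linorder}) \<times> (real ^ 'd::{finite,linorder})"
    show "indicator ?E z \<le> g ((cmod (symb c z))\<^sup>2)"
      using g(2)[of "(cmod (symb c z))\<^sup>2"] g(5)[of "cmod (symb c z)"] by (auto simp: indicator_def)
  qed (use E in \<open>simp add: emeasure_finite less_top[symmetric]\<close>)
  then have "measure (lebesgue_on sdom) ?E \<le> integral sdom (\<lambda>z. g ((cmod (symb c z))\<^sup>2))"
    using E sets.sets_into_space[OF E] by (simp add: integral_symb_Lebesgue(2)[OF c g(1)] Int_absorb2)
  moreover have "integral sdom (\<lambda>z. g ((cmod (symb c z))\<^sup>2)) / (2 * pi) ^ CARD('d) \<le> \<delta>"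
  proof (rule tendsto_upperbound[OF singular_value_distribution[OF c g(1)]])
    show "\<forall>\<^sub>F n in sequentially. (\<Sum>\<sigma>\<in>#singular_values (Op (\<nn> n) c). g (\<sigma>\<^sup>2)) / N_of (\<nn> n) \<le> \<delta>"
      using ev eventually_N_pos
    proof eventually_elim
      case (elim n)
      obtain C where C: "C > 0" "nbound (Op (\<nn> n) c) C" using nbound_Op[OF c] by blast
      have "(\<Sum>\<sigma>\<in>#singular_values (Op (\<nn> n) c). g (\<sigma>\<^sup>2)) \<le> real (sv_count (Op (\<nn> n) c) \<epsilon>)"
        unfolding sv_count_def
      proof (rule sum_mset_le_size_filter)
        fix \<sigma> assume "\<sigma> \<in># singular_values (Op (\<nn> n) c)" "\<not> \<epsilon> < \<sigma>"
        then show "g (\<sigma>\<^sup>2) \<le> 0"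
          using singular_values_bounds(1)[OF Op_carrier C(2)] C(1) g(4)[of \<sigma>] by simp
      qed (use g in auto)
      then show ?case using elim by (simp add: pos_divide_le_eq)
    qed
  qed simp
  ultimately show ?thesis by (simp add: pos_divide_le_eq)
qed

end

section \<open>Density of trigonometric symbols\<close>

text \<open>Trigonometric polynomials serve also in the space variable, although the cube is not a
  period: they are smooth, closed under products, and separate the points of a cube of side 1, which
  is shorter than their period.\<close>

definition telem :: "(int ^ 'd \<Rightarrow> real ^ 'd \<Rightarrow> complex) \<Rightarrow> bool" where
  "telem c \<longleftrightarrow> finite {k. c k \<noteq> (\<lambda>x. 0)} \<and> (\<forall>k. trig_poly (c k))"

lemma trig_poly_char_fun: "trig_poly (\<lambda>\<theta>. a * char_fun k \<theta>)"
  unfolding trig_poly_def by (intro exI[of _ "{k}"] exI[of _ "\<lambda>_. a"]) simp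

lemma trig_poly_const: "trig_poly (\<lambda>\<theta>. a)"
  using trig_poly_char_fun[of a 0] by simp

lemma trig_poly_add: assumes "trig_poly f" "trig_poly g" shows "trig_poly (\<lambda>\<theta>. f \<theta> + g \<theta>)"
proof -
  obtain K c where K: "finite K" "f = (\<lambda>\<theta>. \<Sum>k\<in>K. c k * char_fun k \<theta>)" using assms(1) unfolding trig_poly_def by blast
  obtain L b where L: "finite L" "g = (\<lambda>\<theta>. \<Sum>k\<in>L. b k * char_fun k \<theta>)" using assms(2) unfolding trig_poly_def by blast
  have 1: "(\<Sum>k\<in>K. c k * char_fun k \<theta>) = (\<Sum>k\<in>K \<union> L. (if k \<in> K then c k else 0) * char_fun k \<theta>)" for \<theta>
    by (rule sum.mono_neutral_cong_left) (use K L in auto)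
  have 2: "(\<Sum>k\<in>L. b k * char_fun k \<theta>) = (\<Sum>k\<in>K \<union> L. (if k \<in> L then b k else 0) * char_fun k \<theta>)" for \<theta>
    by (rule sum.mono_neutral_cong_left) (use K L in auto)
  have "(\<lambda>\<theta>. f \<theta> + g \<theta>) = (\<lambda>\<theta>. \<Sum>k\<in>K \<union> L. ((if k \<in> K then c k else 0) + (if k \<in> L then b k else 0)) * char_fun k \<theta>)"
    unfolding K(2) L(2) 1 2 by (simp only: sum.distrib distrib_right)
  then show ?thesis unfolding trig_poly_def using K(1) L(1)
    by (intro exI[of _ "K \<union> L"] exI[of _ "\<lambda>k. (if k \<in> K then c k else 0) + (if k \<in> L then b k else 0)"]) simp
qed

lemma trig_poly_sum: "finite I \<Longrightarrow> (\<And>i. i \<in> I \<Longrightarrow> trig_poly (f i)) \<Longrightarrow> trig_poly (\<lambda>\<theta>. \<Sum>i\<in>I. f i \<theta>)"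
  by (induction I rule: finite_induct) (auto intro: trig_poly_const trig_poly_add)

lemma trig_poly_mult: assumes "trig_poly f" "trig_poly g" shows "trig_poly (\<lambda>\<theta>. f \<theta> * g \<theta>)"
proof -
  obtain K c where K: "finite K" "f = (\<lambda>\<theta>. \<Sum>k\<in>K. c k * char_fun k \<theta>)" using assms(1) unfolding trig_poly_def by blast
  obtain L b where L: "finite L" "g = (\<lambda>\<theta>. \<Sum>k\<in>L. b k * char_fun k \<theta>)" using assms(2) unfolding trig_poly_def by blast
  have eq: "(\<lambda>\<theta>. f \<theta> * g \<theta>) = (\<lambda>\<theta>. \<Sum>k\<in>K. \<Sum>l\<in>L. (c k * b l) * char_fun (k + l) \<theta>)"
    unfolding K(2) L(2) sum_product by (intro ext sum.cong refl) (simp add: char_fun_mult[symmetric])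
  show ?thesis unfolding eq by (intro trig_poly_sum trig_poly_char_fun K L)
qed

lemma continuous_on_trig_poly: "trig_poly f \<Longrightarrow> continuous_on S f"
  unfolding trig_poly_def by (auto intro!: continuous_intros)

lemma telem_elem: "telem c \<Longrightarrow> elem c"
  unfolding telem_def elem_def using continuous_on_trig_poly by blast

lemma telem_cmono: "trig_poly a \<Longrightarrow> telem (cmono l a)"
  unfolding telem_def cmono_def using trig_poly_const[of 0] by (auto intro: finite_subset[of _ "{l}"])

lemma telem_cadd: assumes "telem c" "telem c'" shows "telem (cadd c c')"
  using elem_cadd[OF telem_elem[OF assms(1)] telem_elem[OF assms(2)]] assms
  unfolding telem_def elem_def cadd_def[abs_def] by (auto intro: trig_poly_add)

lemma telem_cconv: assumes "telem c" "telem c'" shows "telem (cconv c c')"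
proof -
  have "trig_poly (cconv c c' m)" for m
    unfolding cconv_def[abs_def] using assms by (intro trig_poly_sum trig_poly_mult) (auto simp: telem_def)
  then show ?thesis using elem_cconv[OF telem_elem[OF assms(1)] telem_elem[OF assms(2)]]
    unfolding telem_def elem_def by blast
qed

lemma char_fun_axis: "char_fun (axis j 1) \<theta> = cis (\<theta> $ j)"
proof -
  have "(\<Sum>i\<in>UNIV. of_int (axis j (1 :: int) $ i) * \<theta> $ i) = (\<Sum>i\<in>UNIV. if i = j then \<theta> $ j else 0)"
    by (rule sum.cong) (auto simp: axis_def)
  then show ?thesis by (simp add: char_fun_def cis_conv_exp)
qed

lemma char_fun_axis_minus: "char_fun (- axis j 1) \<theta> = cis (- \<theta> $ j)"
  using cnj_char_fun[of "axis j 1" \<theta>] by (simp add: char_fun_axis cis_cnj)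

lemma of_real_cos_cis: "complex_of_real (cos t) = 1 / 2 * cis t + 1 / 2 * cis (- t)"
  by (simp add: complex_eq_iff)

lemma of_real_sin_cis: "complex_of_real (sin t) = - \<i> / 2 * cis t + \<i> / 2 * cis (- t)"
  by (simp add: complex_eq_iff)

lemma trig_poly_cos: "trig_poly (\<lambda>x. complex_of_real (cos (x $ j)))"
  unfolding of_real_cos_cis char_fun_axis[symmetric] char_fun_axis_minus[symmetric]
  by (intro trig_poly_add trig_poly_char_fun)

lemma trig_poly_sin: "trig_poly (\<lambda>x. complex_of_real (sin (x $ j)))"
  unfolding of_real_sin_cis char_fun_axis[symmetric] char_fun_axis_minus[symmetric]
  by (intro trig_poly_add trig_poly_char_fun)

text \<open>The function algebra for the real Stone-Weierstrass theorem; complex targets are treated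
  by real and imaginary parts.\<close>

definition real_symbols :: "((real ^ 'd) \<times> (real ^ 'd) \<Rightarrow> real) set" where
  "real_symbols = {h. \<exists>c. telem c \<and> (\<forall>z. complex_of_real (h z) = symb c z)}"

lemma real_symbols_trig_x:
  assumes "trig_poly (\<lambda>x. complex_of_real (f x))" shows "(\<lambda>z. f (fst z)) \<in> real_symbols"
  unfolding real_symbols_def using telem_cmono[OF assms, of 0]
  by (intro CollectI exI[of _ "cmono 0 (\<lambda>x. complex_of_real (f x))"]) (auto simp: symb_cmono)

lemma real_symbols_trig_theta:
  "(\<lambda>z. cos (snd z $ j)) \<in> real_symbols" "(\<lambda>z. sin (snd z $ j)) \<in> real_symbols"
proof -
  have *: "telem (cadd (cmono (axis j 1) (\<lambda>x. a)) (cmono (- axis j 1) (\<lambda>x. b)))" for a b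
    by (intro telem_cadd telem_cmono trig_poly_const)
  have **: "symb (cadd (cmono (axis j 1) (\<lambda>x. a)) (cmono (- axis j 1) (\<lambda>x. b))) z = a * cis (snd z $ j) + b * cis (- snd z $ j)" for a b z
    by (cases z) (simp add: symb_cadd elem_cmono symb_cmono char_fun_axis char_fun_axis_minus)
  show "(\<lambda>z. cos (snd z $ j)) \<in> real_symbols"
    unfolding real_symbols_def
    by (intro CollectI exI[of _ "cadd (cmono (axis j 1) (\<lambda>x. 1 / 2)) (cmono (- axis j 1) (\<lambda>x. 1 / 2))"] conjI allI *)
       (unfold **, rule of_real_cos_cis)
  show "(\<lambda>z. sin (snd z $ j)) \<in> real_symbols"
    unfolding real_symbols_def
    by (intro CollectI exI[of _ "cadd (cmono (axis j 1) (\<lambda>x. - \<i> / 2)) (cmono (- axis j 1) (\<lambda>x. \<i> / 2))"] conjI allI *)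
       (unfold **, rule of_real_sin_cis)
qed

lemma cos_sin_separate:
  fixes a b :: real
  assumes "cos a = cos b" "sin a = sin b" "\<bar>a - b\<bar> < 2 * pi"
  shows "a = b"
proof -
  have "cos (a - b) = 1" using assms sin_cos_squared_add[of b] by (simp add: cos_diff power2_eq_square)
  then obtain n :: int where n: "a - b = of_int n * 2 * pi" using cos_one_2pi_int by blast
  then have "\<bar>of_int n :: real\<bar> * (2 * pi) < 1 * (2 * pi)" using assms(3) by (simp add: abs_mult)
  then have "\<bar>of_int n :: real\<bar> < 1" by (subst (asm) mult_less_cancel_right_pos) auto
  then have "n = 0" by linarith
  then show ?thesis using n by simp
qed

text \<open>Points are separated by the cosines and sines of the coordinates. The condition
  \<open>r < pi\<close> matters here: symbols are periodic in the frequency, so they cannot separate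
  the coordinate values \<open>-pi\<close> and \<open>pi\<close>.\<close>

lemma function_ring_real_symbols:
  assumes "0 \<le> r" "r < pi"
  shows "function_ring_on real_symbols (cbox 0 1 \<times> cbox (\<chi> j. - r) (\<chi> j. r) :: ((real ^ 'd) \<times> (real ^ 'd)) set)"
proof
  show "compact (cbox 0 1 \<times> cbox (\<chi> j. - r) (\<chi> j. r) :: ((real ^ 'd) \<times> (real ^ 'd)) set)"
    by (intro compact_Times compact_cbox)
  show "continuous_on (cbox 0 1 \<times> cbox (\<chi> j. - r) (\<chi> j. r)) f" if f: "f \<in> real_symbols" for f :: "(real ^ 'd) \<times> (real ^ 'd) \<Rightarrow> real"
  proof -
    obtain c where c: "telem c" "\<And>z. complex_of_real (f z) = symb c z" using f unfolding real_symbols_def by blast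
    have "f = (\<lambda>z. Re (symb c z))" by (rule ext) (simp flip: c(2))
    then show ?thesis using continuous_on_symb[OF telem_elem[OF c(1)]] by (simp add: continuous_on_Re)
  qed
  show "(\<lambda>z. f z + g z) \<in> real_symbols" if fg: "f \<in> real_symbols" "g \<in> real_symbols" for f g :: "(real ^ 'd) \<times> (real ^ 'd) \<Rightarrow> real"
  proof -
    obtain a where a: "telem a" "\<And>z. complex_of_real (f z) = symb a z" using fg(1) unfolding real_symbols_def by blast
    obtain b where b: "telem b" "\<And>z. complex_of_real (g z) = symb b z" using fg(2) unfolding real_symbols_def by blast
    have "complex_of_real (f z + g z) = symb (cadd a b) z" for z
      by (simp add: symb_cadd telem_elem a b)
    then show ?thesis unfolding real_symbols_def using telem_cadd[OF a(1) b(1)] by blast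
  qed
  show "(\<lambda>z. f z * g z) \<in> real_symbols" if fg: "f \<in> real_symbols" "g \<in> real_symbols" for f g :: "(real ^ 'd) \<times> (real ^ 'd) \<Rightarrow> real"
  proof -
    obtain a where a: "telem a" "\<And>z. complex_of_real (f z) = symb a z" using fg(1) unfolding real_symbols_def by blast
    obtain b where b: "telem b" "\<And>z. complex_of_real (g z) = symb b z" using fg(2) unfolding real_symbols_def by blast
    have "complex_of_real (f z * g z) = symb (cconv a b) z" for z
      by (simp add: symb_cconv telem_elem a b)
    then show ?thesis unfolding real_symbols_def using telem_cconv[OF a(1) b(1)] by blast
  qed
  show "(\<lambda>_. a) \<in> (real_symbols :: ((real ^ 'd) \<times> (real ^ 'd) \<Rightarrow> real) set)" for a
    using real_symbols_trig_x[of "\<lambda>_. a"] trig_poly_const by auto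
  fix z w :: "(real ^ 'd) \<times> (real ^ 'd)"
  assume zw: "z \<in> cbox 0 1 \<times> cbox (\<chi> j. - r) (\<chi> j. r)" "w \<in> cbox 0 1 \<times> cbox (\<chi> j. - r) (\<chi> j. r)" "z \<noteq> w"
  show "\<exists>f\<in>real_symbols. f z \<noteq> f w"
  proof (rule ccontr)
    assume "\<not> (\<exists>f\<in>real_symbols. f z \<noteq> f w)"
    then have eq: "f z = f w" if "f \<in> real_symbols" for f using that by blast
    have "fst z $ j = fst w $ j" for j
    proof (rule cos_sin_separate)
      show "cos (fst z $ j) = cos (fst w $ j)" using eq[OF real_symbols_trig_x[OF trig_poly_cos]] .
      show "sin (fst z $ j) = sin (fst w $ j)" using eq[OF real_symbols_trig_x[OF trig_poly_sin]] .
      have "0 \<le> fst z $ j" "fst z $ j \<le> 1" "0 \<le> fst w $ j" "fst w $ j \<le> 1" using zw by (auto simp: mem_box_cart)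
      then have "\<bar>fst z $ j - fst w $ j\<bar> \<le> 1" by linarith
      then show "\<bar>fst z $ j - fst w $ j\<bar> < 2 * pi" using pi_gt3 by linarith
    qed
    moreover have "snd z $ j = snd w $ j" for j
    proof (rule cos_sin_separate)
      show "cos (snd z $ j) = cos (snd w $ j)" using eq[OF real_symbols_trig_theta(1)] .
      show "sin (snd z $ j) = sin (snd w $ j)" using eq[OF real_symbols_trig_theta(2)] .
      have "- r \<le> snd z $ j" "snd z $ j \<le> r" "- r \<le> snd w $ j" "snd w $ j \<le> r" using zw by (auto simp: mem_box_cart)
      then show "\<bar>snd z $ j - snd w $ j\<bar> < 2 * pi" using assms by linarith
    qed
    ultimately have "z = w" by (simp add: prod_eq_iff Finite_Cartesian_Product.vec_eq_iff)
    then show False using zw(3) by simp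
  qed
qed

lemma continuous_approx_symb:
  fixes g :: "(real ^ 'd) \<times> (real ^ 'd) \<Rightarrow> complex"
  assumes g: "continuous_on (cbox 0 1 \<times> cbox (\<chi> j. - r) (\<chi> j. r)) g" and r: "0 \<le> r" "r < pi" and e: "\<epsilon> > 0"
  shows "\<exists>c. telem c \<and> (\<forall>z\<in>cbox 0 1 \<times> cbox (\<chi> j. - r) (\<chi> j. r). cmod (symb c z - g z) < \<epsilon>)"
proof -
  interpret function_ring_on real_symbols "cbox 0 1 \<times> cbox (\<chi> j. - r) (\<chi> j. r) :: ((real ^ 'd) \<times> (real ^ 'd)) set"
    by (rule function_ring_real_symbols[OF r])
  have e2: "\<epsilon> / 2 > 0" using e by simp
  obtain u where u: "u \<in> real_symbols" "\<forall>z\<in>cbox 0 1 \<times> cbox (\<chi> j. - r) (\<chi> j. r). \<bar>Re (g z) - u z\<bar> < \<epsilon> / 2"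
    using Stone_Weierstrass_basic[OF continuous_on_Re[OF g] e2] by blast
  obtain v where v: "v \<in> real_symbols" "\<forall>z\<in>cbox 0 1 \<times> cbox (\<chi> j. - r) (\<chi> j. r). \<bar>Im (g z) - v z\<bar> < \<epsilon> / 2"
    using Stone_Weierstrass_basic[OF continuous_on_Im[OF g] e2] by blast
  obtain a where a: "telem a" "\<And>z. complex_of_real (u z) = symb a z" using u(1) unfolding real_symbols_def by blast
  obtain b where b: "telem b" "\<And>z. complex_of_real (v z) = symb b z" using v(1) unfolding real_symbols_def by blast
  define i where "i = (cmono 0 (\<lambda>x. \<i>) :: int ^ 'd \<Rightarrow> real ^ 'd \<Rightarrow> complex)"
  have i: "telem i" unfolding i_def by (intro telem_cmono trig_poly_const)
  have ib: "telem (cconv i b)" by (intro telem_cconv i b)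
  have s: "symb (cadd a (cconv i b)) z = of_real (u z) + \<i> * of_real (v z)" for z
  proof -
    have "symb i z = \<i>" by (cases z) (simp add: i_def symb_cmono)
    then show ?thesis by (simp add: symb_cadd telem_elem a ib symb_cconv i b)
  qed
  have "cmod (symb (cadd a (cconv i b)) z - g z) < \<epsilon>" if z: "z \<in> cbox 0 1 \<times> cbox (\<chi> j. - r) (\<chi> j. r)" for z
  proof -
    have "cmod (symb (cadd a (cconv i b)) z - g z) \<le> \<bar>Re (symb (cadd a (cconv i b)) z - g z)\<bar> + \<bar>Im (symb (cadd a (cconv i b)) z - g z)\<bar>"
      by (rule cmod_le)
    also have "\<dots> = \<bar>Re (g z) - u z\<bar> + \<bar>Im (g z) - v z\<bar>" by (simp add: s)
    also have "\<dots> < \<epsilon>" using u(2) v(2) z by fastforce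
    finally show ?thesis .
  qed
  then show ?thesis using telem_cadd[OF a(1) ib] by blast
qed

text \<open>A measurable function is an almost everywhere limit of continuous ones. On a set of
  finite measure the convergence also holds in measure, by dominated convergence for the indicators
  of the exceptional sets.\<close>

lemma measurable_approx_continuous:
  fixes f :: "(real ^ 'd) \<times> (real ^ 'd) \<Rightarrow> complex"
  assumes f: "f \<in> borel_measurable (lebesgue_on sdom)" and e: "\<epsilon> > 0" "\<delta> > 0"
  shows "\<exists>g. continuous_on UNIV g \<and> measure (lebesgue_on sdom) {z \<in> sdom. \<epsilon> < cmod (g z - f z)} < \<delta>"
proof -
  let ?M = "lebesgue_on (sdom :: ((real ^ 'd) \<times> (real ^ 'd)) set)"
  interpret finite_measure ?M by (rule finite_measure_sdom)
  have "f measurable_on sdom" using f by (subst measurable_on_iff_borel_measurable) auto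
  then obtain N g where N: "negligible N" and g: "\<And>n. continuous_on UNIV (g n :: (real ^ 'd) \<times> (real ^ 'd) \<Rightarrow> complex)"
    and lim: "\<And>z. z \<notin> N \<Longrightarrow> (\<lambda>n. g n z) \<longlonglongrightarrow> (if z \<in> sdom then f z else 0)"
    unfolding measurable_on_def by blast
  have gm [measurable]: "g n \<in> borel_measurable ?M" for n
    by (rule continuous_imp_measurable_on_sets_lebesgue[OF continuous_on_subset[OF g]]) auto
  note [measurable] = f
  let ?E = "\<lambda>n. {z \<in> sdom. \<epsilon> < cmod (g n z - f z)}"
  have E: "?E n \<in> sets ?M" for n
  proof -
    have "{z \<in> space ?M. \<epsilon> < cmod (g n z - f z)} \<in> sets ?M" by measurable
    then show ?thesis by (simp add: space_restrict_space)
  qed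
  have "(\<lambda>n. integral\<^sup>L ?M (indicat_real (?E n))) \<longlonglongrightarrow> integral\<^sup>L ?M (\<lambda>z. 0)"
  proof (rule integral_dominated_convergence[where w = "\<lambda>_. 1"])
    have "N \<inter> sdom \<in> null_sets ?M"
    proof -
      have "N \<in> null_sets lebesgue" using N by (simp add: negligible_iff_null_sets)
      then have "N \<inter> sdom \<in> null_sets lebesgue" by (rule null_set_Int2) simp
      then show ?thesis by (subst null_sets_restrict_space) auto
    qed
    then show "AE z in ?M. (\<lambda>n. indicat_real (?E n) z) \<longlonglongrightarrow> 0"
    proof (rule AE_I')
      show "{z \<in> space ?M. \<not> (\<lambda>n. indicat_real (?E n) z) \<longlonglongrightarrow> 0} \<subseteq> N \<inter> sdom"
      proof
        fix z assume "z \<in> {z \<in> space ?M. \<not> (\<lambda>n. indicat_real (?E n) z) \<longlonglongrightarrow> 0}"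
        then have z: "z \<in> sdom" "\<not> (\<lambda>n. indicat_real (?E n) z) \<longlonglongrightarrow> 0" by (auto simp: space_restrict_space)
        have "z \<in> N"
        proof (rule ccontr)
          assume "z \<notin> N"
          then have "(\<lambda>n. g n z) \<longlonglongrightarrow> f z" using lim[of z] z(1) by simp
          then have "\<forall>\<^sub>F n in sequentially. dist (g n z) (f z) < \<epsilon>" using e(1) by (rule tendstoD)
          then have "\<forall>\<^sub>F n in sequentially. indicat_real (?E n) z = 0" by eventually_elim (simp add: dist_norm)
          then have "(\<lambda>n. indicat_real (?E n) z) \<longlonglongrightarrow> 0" by (rule tendsto_eventually)
          then show False using z(2) by contradiction
        qed
        then show "z \<in> N \<inter> sdom" using z(1) by simp
      qed
    qed
  qed (use E in auto)
  moreover have "integral\<^sup>L ?M (indicat_real (?E n)) = measure ?M (?E n)" for n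
    using sets.sets_into_space[OF E[of n]] by (simp add: Int_absorb2)
  ultimately have "(\<lambda>n. measure ?M (?E n)) \<longlonglongrightarrow> 0" by simp
  then have "\<forall>\<^sub>F n in sequentially. measure ?M (?E n) < \<delta>" using e(2) by (rule order_tendstoD(2))
  then obtain n where "measure ?M (?E n) < \<delta>" using eventually_happens'[OF sequentially_bot] by blast
  then show ?thesis using g by blast
qed

text \<open>Half of \<open>\<epsilon>\<close> goes to a continuous approximation, half to a
  trigonometric one on a slightly smaller frequency cube. The strip left out has measure
  \<open>(2 * pi) ^ CARD('d) - (2 * r) ^ CARD('d)\<close>, which tends to 0 as \<open>r\<close>
  tends to \<open>pi\<close>.\<close>

lemma symb_dense:
  fixes f :: "(real ^ 'd) \<times> (real ^ 'd) \<Rightarrow> complex"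
  assumes f: "f \<in> borel_measurable (lebesgue_on sdom)" and e: "\<epsilon> > 0"
  shows "\<exists>c. telem c \<and> measure (lebesgue_on sdom) {z \<in> sdom. \<epsilon> < cmod (symb c z - f z)} < \<epsilon>"
proof -
  let ?M = "lebesgue_on (sdom :: ((real ^ 'd) \<times> (real ^ 'd)) set)"
  interpret finite_measure ?M by (rule finite_measure_sdom)
  have e2: "\<epsilon> / 2 > 0" using e by simp
  obtain g where g: "continuous_on UNIV g" "measure ?M {z \<in> sdom. \<epsilon> / 2 < cmod (g z - f z)} < \<epsilon> / 2"
    using measurable_approx_continuous[OF f e2 e2] by blast
  have "((\<lambda>r. (2 * pi) ^ CARD('d) - (2 * r) ^ CARD('d)) \<longlongrightarrow> (2 * pi) ^ CARD('d) - (2 * pi) ^ CARD('d)) (at_left pi)"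
    by (intro tendsto_intros)
  then have "\<forall>\<^sub>F r in at_left pi. (2 * pi) ^ CARD('d) - (2 * r) ^ CARD('d) < \<epsilon> / 2"
    by (rule order_tendstoD(2)) (use e2 in simp)
  moreover have "\<forall>\<^sub>F r in at_left pi. r \<in> {0<..<pi}" by (rule eventually_at_left_real) simp
  ultimately have "\<forall>\<^sub>F r in at_left pi. r \<in> {0<..<pi} \<and> (2 * pi) ^ CARD('d) - (2 * r) ^ CARD('d) < \<epsilon> / 2" by eventually_elim blast
  then obtain r where r: "0 < r" "r < pi" "(2 * pi) ^ CARD('d) - (2 * r) ^ CARD('d) < \<epsilon> / 2"
    using eventually_happens'[OF trivial_limit_at_left_real, of _ pi] by (auto simp: greaterThanLessThan_iff)
  let ?T = "cbox 0 1 \<times> cbox (\<chi> j. - r) (\<chi> j. r) :: ((real ^ 'd) \<times> (real ^ 'd)) set"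
  obtain c where c: "telem c" "\<And>z. z \<in> ?T \<Longrightarrow> cmod (symb c z - g z) < \<epsilon> / 2"
    using continuous_approx_symb[OF continuous_on_subset[OF g(1) subset_UNIV] _ r(2) e2] r(1) less_imp_le by blast
  have gm: "g \<in> borel_measurable ?M"
    by (rule continuous_imp_measurable_on_sets_lebesgue[OF continuous_on_subset[OF g(1)]]) auto
  have sm: "symb c \<in> borel_measurable ?M" by (rule symb_measurable[OF telem_elem[OF c(1)]])
  note [measurable] = f gm sm
  have E: "{z \<in> sdom. \<epsilon> / 2 < cmod (g z - f z)} \<in> sets ?M"
  proof -
    have "{z \<in> space ?M. \<epsilon> / 2 < cmod (g z - f z)} \<in> sets ?M" by measurable
    then show ?thesis by (simp add: space_restrict_space)
  qed
  have Tsub: "?T \<subseteq> sdom"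
  proof -
    have "cbox (\<chi> j. - r) (\<chi> j. r) \<subseteq> (freq_cube :: (real ^ 'd) set)"
    proof
      fix x :: "real ^ 'd" assume "x \<in> cbox (\<chi> j. - r) (\<chi> j. r)"
      then have "- r \<le> x $ j" "x $ j \<le> r" for j by (auto simp: mem_box_cart)
      then have "- pi \<le> x $ j" "x $ j \<le> pi" for j using r(2) by (meson less_imp_le neg_le_iff_le order_trans)+
      then show "x \<in> freq_cube" by (simp add: mem_box_cart)
    qed
    then show ?thesis by auto
  qed
  have T: "?T \<in> lmeasurable" by (simp add: cbox_Pair_eq[symmetric])
  have DT: "sdom - ?T \<in> sets ?M" using T by (auto simp: sets_restrict_space_iff fmeasurableD)
  have "measure ?M (sdom - ?T) = measure lebesgue (sdom - ?T :: ((real ^ 'd) \<times> (real ^ 'd)) set)"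
    by (simp add: measure_restrict_space)
  also have "\<dots> = measure lebesgue (sdom :: ((real ^ 'd) \<times> (real ^ 'd)) set) - measure lebesgue ?T"
    by (rule measurable_measure_Diff[OF lmeasurable_sdom _ Tsub]) (use T in \<open>simp add: fmeasurableD\<close>)
  also have "\<dots> < \<epsilon> / 2" using r by (simp add: measure_sub_box)
  finally have mDT: "measure ?M (sdom - ?T) < \<epsilon> / 2" .
  have "measure ?M {z \<in> sdom. \<epsilon> < cmod (symb c z - f z)} \<le> measure ?M ({z \<in> sdom. \<epsilon> / 2 < cmod (g z - f z)} \<union> (sdom - ?T))"
  proof (rule finite_measure_mono)
    show "{z \<in> sdom. \<epsilon> < cmod (symb c z - f z)} \<subseteq> {z \<in> sdom. \<epsilon> / 2 < cmod (g z - f z)} \<union> (sdom - ?T)"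
    proof
      fix z assume z: "z \<in> {z \<in> sdom. \<epsilon> < cmod (symb c z - f z)}"
      show "z \<in> {z \<in> sdom. \<epsilon> / 2 < cmod (g z - f z)} \<union> (sdom - ?T)"
      proof (cases "z \<in> ?T")
        case True
        have "cmod (symb c z - f z) \<le> cmod (symb c z - g z) + cmod (g z - f z)"
          using norm_triangle_ineq[of "symb c z - g z" "g z - f z"] by simp
        then have "\<epsilon> / 2 < cmod (g z - f z)" using c(2)[OF True] z by auto
        then show ?thesis using z by blast
      qed (use z in blast)
    qed
  qed (use E DT in auto)
  also have "\<dots> \<le> measure ?M {z \<in> sdom. \<epsilon> / 2 < cmod (g z - f z)} + measure ?M (sdom - ?T)"
    by (rule measure_Un_le[OF E DT])
  also have "\<dots> < \<epsilon>" using g(2) mDT by simp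
  finally show ?thesis using c(1) by blast
qed

section \<open>GLT sequences\<close>

text \<open>The decomposition behind a.c.s. convergence. The rank bound is real, so that multiples
  of the size can be written without rounding.\<close>

definition splits :: "nat \<Rightarrow> complex mat \<Rightarrow> real \<Rightarrow> real \<Rightarrow> bool" where
  "splits n A M r \<longleftrightarrow> (\<exists>N\<in>carrier_mat n n. \<exists>R\<in>carrier_mat n n. \<exists>s. A = N + R \<and> nbound N M \<and> rank_le R s \<and> real s \<le> r)"

lemma splitsI:
  "N \<in> carrier_mat n n \<Longrightarrow> R \<in> carrier_mat n n \<Longrightarrow> nbound N M \<Longrightarrow> rank_le R s \<Longrightarrow> real s \<le> r \<Longrightarrow> splits n (N + R) M r"
  unfolding splits_def by blast

lemma splitsE:
  assumes "splits n A M r"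
  obtains N R s where "N \<in> carrier_mat n n" "R \<in> carrier_mat n n" "A = N + R" "nbound N M" "rank_le R s" "real s \<le> r"
  using assms unfolding splits_def by blast

lemma splits_mono: assumes "splits n A M r" "M \<le> M'" "r \<le> r'" shows "splits n A M' r'"
proof -
  obtain N R s where *: "N \<in> carrier_mat n n" "R \<in> carrier_mat n n" "A = N + R" "nbound N M" "rank_le R s" "real s \<le> r"
    using assms(1) by (rule splitsE)
  show ?thesis unfolding *(3) using *(6) assms(3) by (intro splitsI[OF *(1,2) nbound_mono[OF *(4) assms(2)] *(5)]) simp
qed

lemma splits_nbound: assumes "A \<in> carrier_mat n n" "nbound A M" shows "splits n A M 0"
  using splitsI[OF assms(1) zero_carrier_mat[of n n] assms(2) rank_le_zero[of n n 0], of 0] assms(1) by simp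

lemma splits_rank: assumes "A \<in> carrier_mat n n" "rank_le A s" shows "splits n A 0 s"
  using splitsI[OF zero_carrier_mat[of n n] assms(1) nbound_zero[of 0 n n] assms(2), of s] assms(1) by simp

lemma splits_add: assumes "splits n A M r" "splits n B M' r'" shows "splits n (A + B) (M + M') (r + r')"
proof -
  obtain N R s where 1: "N \<in> carrier_mat n n" "R \<in> carrier_mat n n" "A = N + R" "nbound N M" "rank_le R s" "real s \<le> r"
    using assms(1) by (rule splitsE)
  obtain N' R' s' where 2: "N' \<in> carrier_mat n n" "R' \<in> carrier_mat n n" "B = N' + R'" "nbound N' M'" "rank_le R' s'" "real s' \<le> r'"
    using assms(2) by (rule splitsE)
  have "A + B = (N + N') + (R + R')" unfolding 1(3) 2(3) using 1(1,2) 2(1,2) by (intro eq_matI) auto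
  moreover have "splits n ((N + N') + (R + R')) (M + M') (r + r')"
    using 1(6) 2(6) by (intro splitsI[of _ _ _ _ "s + s'"] nbound_add[OF 1(1) 2(1) 1(4) 2(4)] rank_le_add[OF 1(2) 2(2) 1(5) 2(5)] add_carrier_mat 2) auto
  ultimately show ?thesis by simp
qed

lemma splits_smult: assumes "splits n A M r" shows "splits n (c \<cdot>\<^sub>m A) (cmod c * M) r"
proof -
  obtain N R s where 1: "N \<in> carrier_mat n n" "R \<in> carrier_mat n n" "A = N + R" "nbound N M" "rank_le R s" "real s \<le> r"
    using assms(1) by (rule splitsE)
  have "c \<cdot>\<^sub>m A = c \<cdot>\<^sub>m N + c \<cdot>\<^sub>m R" unfolding 1(3) using 1(1,2) by (rule add_smult_distrib_left_mat)
  moreover have "splits n (c \<cdot>\<^sub>m N + c \<cdot>\<^sub>m R) (cmod c * M) r"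
    by (rule splitsI[OF _ _ nbound_smult[OF 1(4)] rank_le_smult[OF 1(5)] 1(6)]) (use 1 in auto)
  ultimately show ?thesis by simp
qed

text \<open>The product is \<open>N * N' + (R * B + N * R')\<close>. Leaving \<open>B\<close> whole
  in the second term gives two terms of small rank rather than three, so the rank bounds simply
  add.\<close>

lemma splits_mult:
  assumes "splits n A M r" "splits n B M' r'" "M \<ge> 0" shows "splits n (A * B) (M * M') (r + r')"
proof -
  obtain N R s where 1: "N \<in> carrier_mat n n" "R \<in> carrier_mat n n" "A = N + R" "nbound N M" "rank_le R s" "real s \<le> r"
    using assms(1) by (rule splitsE)
  obtain N' R' s' where 2: "N' \<in> carrier_mat n n" "R' \<in> carrier_mat n n" "B = N' + R'" "nbound N' M'" "rank_le R' s'" "real s' \<le> r'"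
    using assms(2) by (rule splitsE)
  have B: "B \<in> carrier_mat n n" unfolding 2(3) using 2(2) by simp
  note m = mult_carrier_mat
  have AB: "A * B = N * B + R * B" unfolding 1(3) by (rule add_mult_distrib_mat[OF 1(1,2) B])
  have NB: "N * B = N * N' + N * R'" unfolding 2(3) by (rule mult_add_distrib_mat[OF 1(1) 2(1,2)])
  note c = m[OF 1(1) 2(1)] m[OF 1(1) 2(2)] m[OF 1(2) B]
  have eq: "A * B = N * N' + (R * B + N * R')"
    unfolding AB NB assoc_add_mat[OF c] comm_add_mat[OF c(2,3)] ..
  show ?thesis
    unfolding eq
  proof (rule splitsI)
    show "nbound (N * N') (M * M')" by (rule nbound_mult[OF 1(1) 2(1) 1(4) 2(4) assms(3)])
    show "rank_le (R * B + N * R') (s + s')"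
      by (rule rank_le_add[OF c(3,2) rank_le_mult_right[OF 1(2) B 1(5)] rank_le_mult_left[OF 1(1) 2(2,5)]])
  qed (use c 1(6) 2(6) in auto)
qed

lemma splits_iff_sv_count:
  assumes "A \<in> carrier_mat n n" "\<epsilon> \<ge> 0"
  shows "splits n A \<epsilon> r \<longleftrightarrow> real (sv_count A \<epsilon>) \<le> r"
proof
  assume "splits n A \<epsilon> r"
  then obtain N R s where 1: "N \<in> carrier_mat n n" "R \<in> carrier_mat n n" "A = N + R" "nbound N \<epsilon>" "rank_le R s" "real s \<le> r"
    by (rule splitsE)
  then show "real (sv_count A \<epsilon>) \<le> r" using split_imp_sv_count_le[OF 1(1,2,4,5) assms(2)] by simp
next
  assume "real (sv_count A \<epsilon>) \<le> r"
  then show "splits n A \<epsilon> r" using sv_count_le_imp_split[OF assms order_refl] unfolding splits_def by blast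
qed

text \<open>The counterpart of \<open>splits\<close> for symbols: bounded by \<open>M\<close>
  outside a set of measure at most \<open>r\<close>. For \<open>M = r = \<epsilon>\<close> tending
  to 0 it expresses convergence to 0 in measure.\<close>

definition fsplits :: "((real ^ 'd) \<times> (real ^ 'd) \<Rightarrow> complex) \<Rightarrow> real \<Rightarrow> real \<Rightarrow> bool" where
  "fsplits f M r \<longleftrightarrow> f \<in> borel_measurable (lebesgue_on sdom) \<and> measure (lebesgue_on sdom) {z \<in> sdom. M < cmod (f z)} \<le> r"

lemma fsplits_sets: "f \<in> borel_measurable (lebesgue_on sdom) \<Longrightarrow> {z \<in> sdom. M < cmod (f z)} \<in> sets (lebesgue_on sdom)"
proof -
  assume [measurable]: "f \<in> borel_measurable (lebesgue_on sdom)"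
  have "{z \<in> space (lebesgue_on sdom). M < cmod (f z)} \<in> sets (lebesgue_on sdom)" by measurable
  then show ?thesis by (simp add: space_restrict_space)
qed

lemma fsplits_subset:
  assumes "fsplits f M r" "g \<in> borel_measurable (lebesgue_on sdom)"
    and "\<And>z. z \<in> sdom \<Longrightarrow> M' < cmod (g z) \<Longrightarrow> M < cmod (f z)" "r \<le> r'"
  shows "fsplits g M' r'"
proof -
  interpret finite_measure "lebesgue_on (sdom :: ((real ^ 'a) \<times> (real ^ 'a)) set)" by (rule finite_measure_sdom)
  have "measure (lebesgue_on sdom) {z \<in> sdom. M' < cmod (g z)} \<le> measure (lebesgue_on sdom) {z \<in> sdom. M < cmod (f z)}"
    using assms by (intro finite_measure_mono fsplits_sets) (auto simp: fsplits_def)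
  then show ?thesis using assms by (simp add: fsplits_def)
qed

lemma fsplits_mono: "fsplits f M r \<Longrightarrow> M \<le> M' \<Longrightarrow> r \<le> r' \<Longrightarrow> fsplits f M' r'"
  by (rule fsplits_subset[of f M r]) (auto simp: fsplits_def)

lemma fsplits_union:
  assumes "fsplits f M r" "fsplits g M' r'" "h \<in> borel_measurable (lebesgue_on sdom)"
    and "\<And>z. z \<in> sdom \<Longrightarrow> M'' < cmod (h z) \<Longrightarrow> M < cmod (f z) \<or> M' < cmod (g z)"
  shows "fsplits h M'' (r + r')"
proof -
  let ?M = "lebesgue_on (sdom :: ((real ^ 'a) \<times> (real ^ 'a)) set)"
  interpret finite_measure ?M by (rule finite_measure_sdom)
  have E: "{z \<in> sdom. M < cmod (f z)} \<in> sets ?M" "{z \<in> sdom. M' < cmod (g z)} \<in> sets ?M"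
    using assms by (auto intro!: fsplits_sets simp: fsplits_def)
  have "measure ?M {z \<in> sdom. M'' < cmod (h z)} \<le> measure ?M ({z \<in> sdom. M < cmod (f z)} \<union> {z \<in> sdom. M' < cmod (g z)})"
    by (rule finite_measure_mono) (use assms(4) E in auto)
  also have "\<dots> \<le> measure ?M {z \<in> sdom. M < cmod (f z)} + measure ?M {z \<in> sdom. M' < cmod (g z)}"
    by (rule measure_Un_le[OF E])
  also have "\<dots> \<le> r + r'" using assms by (simp add: fsplits_def)
  finally show ?thesis using assms(3) by (simp add: fsplits_def)
qed

lemma fsplits_add: assumes "fsplits f M r" "fsplits g M' r'" shows "fsplits (\<lambda>z. f z + g z) (M + M') (r + r')"
proof (rule fsplits_union[OF assms])
  show "(\<lambda>z. f z + g z) \<in> borel_measurable (lebesgue_on sdom)" using assms by (auto simp: fsplits_def)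
  show "M < cmod (f z) \<or> M' < cmod (g z)" if "M + M' < cmod (f z + g z)" for z
    using that norm_triangle_ineq[of "f z" "g z"] by linarith
qed

lemma fsplits_mult: assumes "fsplits f M r" "fsplits g M' r'" shows "fsplits (\<lambda>z. f z * g z) (M * M') (r + r')"
proof (rule fsplits_union[OF assms])
  show "(\<lambda>z. f z * g z) \<in> borel_measurable (lebesgue_on sdom)" using assms by (auto simp: fsplits_def)
  show "M < cmod (f z) \<or> M' < cmod (g z)" if "M * M' < cmod (f z * g z)" for z
  proof (rule ccontr)
    assume "\<not> (M < cmod (f z) \<or> M' < cmod (g z))"
    then have "cmod (f z) \<le> M" "cmod (g z) \<le> M'" by auto
    then have "cmod (f z) * cmod (g z) \<le> M * M'" by (intro mult_mono) (auto intro: order_trans[OF norm_ge_zero])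
    then show False using that by (simp add: norm_mult)
  qed
qed

lemma fsplits_bounded:
  assumes "f \<in> borel_measurable (lebesgue_on sdom)" "\<And>z. z \<in> sdom \<Longrightarrow> cmod (f z) \<le> M" shows "fsplits f M 0"
proof -
  have "{z \<in> sdom. M < cmod (f z)} = {}" using assms(2) by force
  then show ?thesis unfolding fsplits_def using assms(1) by (simp only: measure_empty) simp
qed

lemma two_pi_power_ge_1: "(1 :: real) \<le> (2 * pi) ^ n"
  using pi_gt3 by (intro one_le_power) simp

lemma mat_telescope:
  fixes A B C :: "complex mat"
  assumes "A \<in> carrier_mat n m" "B \<in> carrier_mat n m" "C \<in> carrier_mat n m"
  shows "(A - B) + (B - C) = A - C"
  by (rule eq_matI) (use assms in auto)

section \<open>GLT sequences by approximation\<close>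

context grid
begin

definition sq_le :: "(nat \<Rightarrow> complex mat) \<Rightarrow> real \<Rightarrow> real \<Rightarrow> bool" where
  "sq_le A M \<epsilon> \<longleftrightarrow> (\<forall>\<^sub>F n in sequentially. splits (N_of (\<nn> n)) (A n) M (\<epsilon> * N_of (\<nn> n)))"

lemma sq_le_mono: "sq_le A M \<epsilon> \<Longrightarrow> M \<le> M' \<Longrightarrow> \<epsilon> \<le> \<epsilon>' \<Longrightarrow> sq_le A M' \<epsilon>'"
  unfolding sq_le_def by (elim eventually_mono splits_mono) (auto intro: mult_right_mono)

lemma sq_le_add: assumes "sq_le A M r" "sq_le B M' r'" shows "sq_le (\<lambda>n. A n + B n) (M + M') (r + r')"
  using assms unfolding sq_le_def by eventually_elim (simp add: distrib_right splits_add)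

lemma sq_le_mult: assumes "sq_le A M r" "sq_le B M' r'" "M \<ge> 0" shows "sq_le (\<lambda>n. A n * B n) (M * M') (r + r')"
  using assms(1,2) unfolding sq_le_def by eventually_elim (simp add: distrib_right splits_mult assms(3))

lemma sq_le_smult: "sq_le A M r \<Longrightarrow> sq_le (\<lambda>n. c \<cdot>\<^sub>m A n) (cmod c * M) r"
  unfolding sq_le_def by (elim eventually_mono splits_smult)

lemma sq_le_nbound:
  "(\<And>n. A n \<in> carrier_mat (N_of (\<nn> n)) (N_of (\<nn> n))) \<Longrightarrow> (\<And>n. nbound (A n) M) \<Longrightarrow> sq_le A M 0"
  unfolding sq_le_def by (intro always_eventually allI) (simp add: splits_nbound)

text \<open>Once \<open>frob (X n)\<close> is at most the cube of \<open>\<epsilon>\<close> times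
  the size, Chebyshev's inequality leaves at most the proportion \<open>\<epsilon>\<close> of
  singular values above \<open>\<epsilon>\<close>.\<close>

lemma sq_le_fnull:
  assumes "fnull X" "\<And>n. X n \<in> carrier_mat (N_of (\<nn> n)) (N_of (\<nn> n))" "\<epsilon> > 0"
  shows "sq_le X \<epsilon> \<epsilon>"
proof -
  have "\<epsilon>\<^sup>2 * \<epsilon> > 0" using assms(3) by simp
  from fnullD[OF assms(1) this] show ?thesis unfolding sq_le_def
  proof eventually_elim
    case (elim n)
    have "\<epsilon>\<^sup>2 * sv_count (X n) \<epsilon> \<le> frob (X n)"
      by (rule sv_count_frob[OF assms(2)]) (use assms(3) in simp)
    also have "\<dots> \<le> \<epsilon>\<^sup>2 * (\<epsilon> * N_of (\<nn> n))" using elim by (simp only: mult.assoc)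
    finally have "real (sv_count (X n) \<epsilon>) \<le> \<epsilon> * N_of (\<nn> n)"
      by (rule mult_left_le_imp_le) (use assms(3) in simp)
    then show ?case using assms by (subst splits_iff_sv_count) auto
  qed
qed

text \<open>A version of \<open>glt\<close> with one \<open>\<epsilon>\<close> for norm, rank and
  measure and without an approximating sequence; \<open>glt_iff\<close> proves the
  equivalence.\<close>

definition glt' :: "(nat \<Rightarrow> complex mat) \<Rightarrow> ((real ^ 'd::{finite,linorder}) \<times> (real ^ 'd::{finite,linorder}) \<Rightarrow> complex) \<Rightarrow> bool" where
  "glt' A k \<longleftrightarrow> (\<forall>n. A n \<in> carrier_mat (N_of (\<nn> n)) (N_of (\<nn> n))) \<and> k \<in> borel_measurable (lebesgue_on sdom) \<and>
    (\<forall>\<epsilon>>0. \<exists>c. telem c \<and> sq_le (\<lambda>n. A n - Op (\<nn> n) c) \<epsilon> \<epsilon> \<and> fsplits (\<lambda>z. symb c z - k z) \<epsilon> \<epsilon>)"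

lemma glt'_carrier: "glt' A k \<Longrightarrow> A n \<in> carrier_mat (N_of (\<nn> n)) (N_of (\<nn> n))"
  by (simp add: glt'_def)

lemma glt'_measurable: "glt' A k \<Longrightarrow> k \<in> borel_measurable (lebesgue_on sdom)"
  by (simp add: glt'_def)

lemma glt'D:
  assumes "glt' A k" "\<epsilon> > 0"
  obtains c where "telem c" "elem c" "sq_le (\<lambda>n. A n - Op (\<nn> n) c) \<epsilon> \<epsilon>" "fsplits (\<lambda>z. symb c z - k z) \<epsilon> \<epsilon>"
  using assms telem_elem unfolding glt'_def by blast

definition cdiff :: "(int ^ 'd::{finite,linorder} \<Rightarrow> real ^ 'd::{finite,linorder} \<Rightarrow> complex) \<Rightarrow> (int ^ 'd::{finite,linorder} \<Rightarrow> real ^ 'd::{finite,linorder} \<Rightarrow> complex) \<Rightarrow> int ^ 'd::{finite,linorder} \<Rightarrow> real ^ 'd::{finite,linorder} \<Rightarrow> complex" where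
  "cdiff a b = cadd a (cscale (-1) b)"

lemma elem_cdiff: "elem a \<Longrightarrow> elem b \<Longrightarrow> elem (cdiff a b)"
  unfolding cdiff_def by (intro elem_cadd elem_cscale)

lemma symb_cdiff: "elem a \<Longrightarrow> elem b \<Longrightarrow> symb (cdiff a b) z = symb a z - symb b z"
  unfolding cdiff_def by (simp add: symb_cadd elem_cscale symb_cscale)

lemma Op_cdiff: "Op n (cdiff a b) = Op n a - Op n b"
  unfolding cdiff_def Op_cadd Op_cscale by (rule eq_matI) auto

text \<open>Doubling the norm bound comes from the two thresholds of \<open>ramp\<close>. Doubling
  the proportion makes the inequality on the measure strict, and the factor
  \<open>(2 * pi) ^ CARD('d)\<close> is harmless as it is at least 1.\<close>

lemma Op_sq_le:
  assumes c: "elem c" and f: "fsplits (symb c) \<epsilon> \<epsilon>" and e: "\<epsilon> > 0"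
  shows "sq_le (\<lambda>n. Op (\<nn> n) c) (2 * \<epsilon>) (2 * \<epsilon>)"
proof -
  have "\<epsilon> < 2 * \<epsilon> * 1" using e by simp
  also have "\<dots> \<le> 2 * \<epsilon> * (2 * pi) ^ CARD('d)" using e two_pi_power_ge_1 by (intro mult_left_mono) auto
  finally have "measure (lebesgue_on sdom) {z \<in> sdom. \<epsilon> < cmod (symb c z)} < 2 * \<epsilon> * (2 * pi) ^ CARD('d)"
    using f by (simp add: fsplits_def)
  from sv_count_Op_upper[OF c e this] show ?thesis
    unfolding sq_le_def by eventually_elim (use e in \<open>simp add: splits_iff_sv_count\<close>)
qed

text \<open>Allows merely continuous coefficients: \<open>symb_dense\<close> supplies a
  trigonometric symbol close in measure, and \<open>Op_sq_le\<close> makes the difference of the two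
  matrix sequences small.\<close>

lemma glt'I:
  assumes A: "\<And>n. A n \<in> carrier_mat (N_of (\<nn> n)) (N_of (\<nn> n))" and k: "k \<in> borel_measurable (lebesgue_on sdom)"
    and *: "\<And>\<epsilon>. \<epsilon> > 0 \<Longrightarrow> \<exists>c. elem c \<and> sq_le (\<lambda>n. A n - Op (\<nn> n) c) \<epsilon> \<epsilon> \<and> fsplits (\<lambda>z. symb c z - k z) \<epsilon> \<epsilon>"
  shows "glt' A k"
  unfolding glt'_def
proof (intro conjI allI impI A k)
  fix \<epsilon> :: real assume e: "\<epsilon> > 0"
  then have e4: "\<epsilon> / 4 > 0" by simp
  obtain c where c: "elem c" "sq_le (\<lambda>n. A n - Op (\<nn> n) c) (\<epsilon> / 4) (\<epsilon> / 4)" "fsplits (\<lambda>z. symb c z - k z) (\<epsilon> / 4) (\<epsilon> / 4)"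
    using *[OF e4] by blast
  obtain b where b: "telem b" "measure (lebesgue_on sdom) {z \<in> sdom. \<epsilon> / 4 < cmod (symb b z - symb c z)} < \<epsilon> / 4"
    using symb_dense[OF symb_measurable[OF c(1)] e4] by blast
  note be = telem_elem[OF b(1)]
  have d: "fsplits (\<lambda>z. symb b z - symb c z) (\<epsilon> / 4) (\<epsilon> / 4)"
    using b(2) symb_measurable[OF be] symb_measurable[OF c(1)] by (auto simp: fsplits_def)
  have "fsplits (symb (cdiff c b)) (\<epsilon> / 4) (\<epsilon> / 4)"
    by (rule fsplits_subset[OF d symb_measurable[OF elem_cdiff[OF c(1) be]]])
       (auto simp: symb_cdiff c(1) be norm_minus_commute)
  from Op_sq_le[OF elem_cdiff[OF c(1) be] this e4]
  have "sq_le (\<lambda>n. Op (\<nn> n) c - Op (\<nn> n) b) (\<epsilon> / 2) (\<epsilon> / 2)" by (simp add: Op_cdiff)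
  from sq_le_add[OF c(2) this] have "sq_le (\<lambda>n. A n - Op (\<nn> n) b) (\<epsilon> / 4 + \<epsilon> / 2) (\<epsilon> / 4 + \<epsilon> / 2)"
    by (simp add: mat_telescope[OF A Op_carrier Op_carrier])
  then have 1: "sq_le (\<lambda>n. A n - Op (\<nn> n) b) \<epsilon> \<epsilon>" by (rule sq_le_mono) (use e in auto)
  from fsplits_add[OF d c(3)] have "fsplits (\<lambda>z. symb b z - k z) (\<epsilon> / 4 + \<epsilon> / 4) (\<epsilon> / 4 + \<epsilon> / 4)" by simp
  then have "fsplits (\<lambda>z. symb b z - k z) \<epsilon> \<epsilon>" by (rule fsplits_mono) (use e in auto)
  with 1 b(1) show "\<exists>c. telem c \<and> sq_le (\<lambda>n. A n - Op (\<nn> n) c) \<epsilon> \<epsilon> \<and> fsplits (\<lambda>z. symb c z - k z) \<epsilon> \<epsilon>" by blast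
qed

lemma glt'_Op: assumes c: "elem c" shows "glt' (\<lambda>n. Op (\<nn> n) c) (symb c)"
proof (rule glt'I[OF Op_carrier symb_measurable[OF c]], intro exI conjI)
  fix \<epsilon> :: real assume e: "\<epsilon> > 0"
  have eq: "(\<lambda>n. Op (\<nn> n) c - Op (\<nn> n) c) = (\<lambda>n. 0\<^sub>m (N_of (\<nn> n)) (N_of (\<nn> n)))"
    by (rule ext, rule eq_matI) auto
  have "sq_le (\<lambda>n. Op (\<nn> n) c - Op (\<nn> n) c) \<epsilon> 0"
    unfolding eq by (rule sq_le_nbound) (use e in auto)
  then show "sq_le (\<lambda>n. Op (\<nn> n) c - Op (\<nn> n) c) \<epsilon> \<epsilon>"
    by (rule sq_le_mono) (use e in auto)
  show "fsplits (\<lambda>z. symb c z - symb c z) \<epsilon> \<epsilon>"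
    by (rule fsplits_mono[OF fsplits_bounded[of _ 0]]) (use e in auto)
qed (rule c)

lemma glt'_add: assumes A: "glt' A k" and B: "glt' B h" shows "glt' (\<lambda>n. A n + B n) (\<lambda>z. k z + h z)"
proof (rule glt'I)
  show "A n + B n \<in> carrier_mat (N_of (\<nn> n)) (N_of (\<nn> n))" for n using glt'_carrier[OF B] by simp
  show "(\<lambda>z. k z + h z) \<in> borel_measurable (lebesgue_on sdom)" using glt'_measurable[OF A] glt'_measurable[OF B] by simp
  fix \<epsilon> :: real assume "\<epsilon> > 0"
  then have e: "\<epsilon> / 2 > 0" by simp
  obtain a where a: "elem a" "sq_le (\<lambda>n. A n - Op (\<nn> n) a) (\<epsilon> / 2) (\<epsilon> / 2)" "fsplits (\<lambda>z. symb a z - k z) (\<epsilon> / 2) (\<epsilon> / 2)" by (rule glt'D[OF A e])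
  obtain b where b: "elem b" "sq_le (\<lambda>n. B n - Op (\<nn> n) b) (\<epsilon> / 2) (\<epsilon> / 2)" "fsplits (\<lambda>z. symb b z - h z) (\<epsilon> / 2) (\<epsilon> / 2)" by (rule glt'D[OF B e])
  have "(A n - Op (\<nn> n) a) + (B n - Op (\<nn> n) b) = A n + B n - Op (\<nn> n) (cadd a b)" for n
    unfolding Op_cadd using glt'_carrier[OF A, of n] glt'_carrier[OF B, of n] by (intro eq_matI) auto
  then have 1: "sq_le (\<lambda>n. A n + B n - Op (\<nn> n) (cadd a b)) \<epsilon> \<epsilon>" using sq_le_add[OF a(2) b(2)] by simp
  have "(\<lambda>z. (symb a z - k z) + (symb b z - h z)) = (\<lambda>z. symb (cadd a b) z - (k z + h z))"
    by (rule ext) (simp add: symb_cadd a b)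
  then have "fsplits (\<lambda>z. symb (cadd a b) z - (k z + h z)) \<epsilon> \<epsilon>" using fsplits_add[OF a(3) b(3)] by simp
  then show "\<exists>c. elem c \<and> sq_le (\<lambda>n. A n + B n - Op (\<nn> n) c) \<epsilon> \<epsilon> \<and> fsplits (\<lambda>z. symb c z - (k z + h z)) \<epsilon> \<epsilon>"
    using 1 elem_cadd[OF a(1) b(1)] by blast
qed

text \<open>A bounded elementary approximant and a small error show that both the sequence and its
  symbol are bounded up to small rank and small measure. Products need this, as neither is bounded
  outright.\<close>

lemma glt'_sparsely_bounded:
  assumes A: "glt' A k" and e: "\<epsilon> > 0"
  shows "\<exists>M>0. sq_le A M \<epsilon> \<and> fsplits k M \<epsilon>"
proof -
  obtain c where c: "elem c" "sq_le (\<lambda>n. A n - Op (\<nn> n) c) \<epsilon> \<epsilon>" "fsplits (\<lambda>z. symb c z - k z) \<epsilon> \<epsilon>" by (rule glt'D[OF A e])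
  obtain C where C: "C > 0" "\<And>n. nbound (Op n c) C" using nbound_Op[OF c(1)] by blast
  obtain B where B: "B > 0" "\<And>x \<theta>. x \<in> cbox 0 1 \<Longrightarrow> cmod (symb c (x, \<theta>)) \<le> B" using symb_bounded[OF c(1)] by blast
  have "(A n - Op (\<nn> n) c) + Op (\<nn> n) c = A n" for n
    using glt'_carrier[OF A, of n] by (intro eq_matI) auto
  then have 1: "sq_le A (\<epsilon> + C) \<epsilon>" using sq_le_add[OF c(2) sq_le_nbound[OF Op_carrier C(2)]] by simp
  have sB: "cmod (symb c z) \<le> B" if "z \<in> sdom" for z using B(2) that by (cases z) auto
  have 2: "fsplits k (\<epsilon> + B) \<epsilon>"
  proof (rule fsplits_subset[OF c(3) glt'_measurable[OF A]])
    fix z assume z: "z \<in> sdom" "\<epsilon> + B < cmod (k z)"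
    have "cmod (k z) \<le> cmod (symb c z) + cmod (symb c z - k z)"
      using norm_triangle_ineq4[of "symb c z" "symb c z - k z"] by simp
    then show "\<epsilon> < cmod (symb c z - k z)" using sB[OF z(1)] z(2) by linarith
  qed simp
  show ?thesis
    by (intro exI[of _ "\<epsilon> + B + C"] conjI sq_le_mono[OF 1] fsplits_mono[OF 2]) (use e B(1) C(1) in auto)
qed

text \<open>The error is the sum of \<open>A * (B - Op b)\<close>, \<open>(A - Op a) * Op b\<close>
  and the error of \<open>fnull_Op_mult\<close>. The order of choices matters: a bound
  \<open>M\<close> for \<open>A\<close>, then \<open>b\<close> with accuracy small against
  \<open>M\<close>, then a bound \<open>C\<close> for \<open>b\<close>, and only then
  \<open>a\<close> with accuracy small against \<open>C\<close>.\<close>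

lemma glt'_mult: assumes A: "glt' A k" and B: "glt' B h" shows "glt' (\<lambda>n. A n * B n) (\<lambda>z. k z * h z)"
proof (rule glt'I)
  note Ac = glt'_carrier[OF A] and Bc = glt'_carrier[OF B]
  note m = mult_carrier_mat
  show "A n * B n \<in> carrier_mat (N_of (\<nn> n)) (N_of (\<nn> n))" for n by (rule m[OF Ac Bc])
  show "(\<lambda>z. k z * h z) \<in> borel_measurable (lebesgue_on sdom)" using glt'_measurable[OF A] glt'_measurable[OF B] by simp
  fix \<epsilon> :: real assume e: "\<epsilon> > 0"
  then have e8: "\<epsilon> / 8 > 0" by simp
  obtain M where M: "M > 0" "sq_le A M (\<epsilon> / 8)" "fsplits k M (\<epsilon> / 8)" using glt'_sparsely_bounded[OF A e8] by blast
  define \<delta> where "\<delta> = min (\<epsilon> / 8) (\<epsilon> / (8 * M))"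
  have d: "\<delta> > 0" "\<delta> \<le> \<epsilon> / 8" "M * \<delta> \<le> \<epsilon> / 8"
  proof -
    have "M * \<delta> \<le> M * (\<epsilon> / (8 * M))" using M(1) by (intro mult_left_mono) (auto simp: \<delta>_def)
    then show "M * \<delta> \<le> \<epsilon> / 8" using M(1) by simp
  qed (use e M in \<open>auto simp: \<delta>_def\<close>)
  obtain b where b: "elem b" "sq_le (\<lambda>n. B n - Op (\<nn> n) b) \<delta> \<delta>" "fsplits (\<lambda>z. symb b z - h z) \<delta> \<delta>" by (rule glt'D[OF B d(1)])
  obtain C1 where C1: "C1 > 0" "\<And>n. nbound (Op n b) C1" using nbound_Op[OF b(1)] by blast
  obtain C2 where C2: "C2 > 0" "\<And>x \<theta>. x \<in> cbox 0 1 \<Longrightarrow> cmod (symb b (x, \<theta>)) \<le> C2" using symb_bounded[OF b(1)] by blast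
  define C where "C = max C1 C2"
  have C: "C > 0" "\<And>n. nbound (Op n b) C" "\<And>z. z \<in> sdom \<Longrightarrow> cmod (symb b z) \<le> C"
  proof -
    show "nbound (Op n b) C" for n unfolding C_def by (rule nbound_mono[OF C1(2) max.cobounded1])
    show "cmod (symb b z) \<le> C" if "z \<in> sdom" for z
      using C2(2) that by (cases z) (auto simp: C_def intro: order_trans[OF _ max.cobounded2])
  qed (use C1 in \<open>simp add: C_def\<close>)
  define \<eta> where "\<eta> = min (\<epsilon> / 8) (\<epsilon> / (8 * C))"
  have t: "\<eta> > 0" "\<eta> \<le> \<epsilon> / 8" "\<eta> * C \<le> \<epsilon> / 8"
  proof -
    have "\<eta> * C \<le> (\<epsilon> / (8 * C)) * C" using C(1) by (intro mult_right_mono) (auto simp: \<eta>_def)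
    then show "\<eta> * C \<le> \<epsilon> / 8" using C(1) by simp
  qed (use e C in \<open>auto simp: \<eta>_def\<close>)
  obtain a where a: "elem a" "sq_le (\<lambda>n. A n - Op (\<nn> n) a) \<eta> \<eta>" "fsplits (\<lambda>z. symb a z - k z) \<eta> \<eta>" by (rule glt'D[OF A t(1)])
  have dA: "A n - Op (\<nn> n) a \<in> carrier_mat (N_of (\<nn> n)) (N_of (\<nn> n))" for n by (intro minus_carrier_mat) simp
  have dB: "B n - Op (\<nn> n) b \<in> carrier_mat (N_of (\<nn> n)) (N_of (\<nn> n))" for n by (intro minus_carrier_mat) simp
  have 1: "sq_le (\<lambda>n. A n * (B n - Op (\<nn> n) b)) (M * \<delta>) (\<epsilon> / 8 + \<delta>)"
    by (rule sq_le_mult[OF M(2) b(2)]) (use M(1) in simp)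
  have 2: "sq_le (\<lambda>n. (A n - Op (\<nn> n) a) * Op (\<nn> n) b) (\<eta> * C) (\<eta> + 0)"
    by (rule sq_le_mult[OF a(2) sq_le_nbound[OF Op_carrier C(2)]]) (use t(1) in simp)
  have 3: "sq_le (\<lambda>n. Op (\<nn> n) a * Op (\<nn> n) b - Op (\<nn> n) (cconv a b)) (\<epsilon> / 8) (\<epsilon> / 8)"
    by (rule sq_le_fnull[OF fnull_Op_mult[OF a(1) b(1)] _ e8]) (intro minus_carrier_mat Op_carrier)
  have "A n * (B n - Op (\<nn> n) b) + (A n - Op (\<nn> n) a) * Op (\<nn> n) b + (Op (\<nn> n) a * Op (\<nn> n) b - Op (\<nn> n) (cconv a b))
    = A n * B n - Op (\<nn> n) (cconv a b)" for n
  proof -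
    have e1: "A n * (B n - Op (\<nn> n) b) = A n * B n - A n * Op (\<nn> n) b" by (rule mult_minus_distrib_mat[OF Ac Bc Op_carrier])
    have e2: "(A n - Op (\<nn> n) a) * Op (\<nn> n) b = A n * Op (\<nn> n) b - Op (\<nn> n) a * Op (\<nn> n) b"
      by (rule minus_mult_distrib_mat[OF Ac Op_carrier Op_carrier])
    show ?thesis unfolding e1 e2
      by (rule eq_matI) (use Ac[of n] Bc[of n] in \<open>auto simp del: index_mult_mat(1)\<close>)
  qed
  then have "sq_le (\<lambda>n. A n * B n - Op (\<nn> n) (cconv a b)) (M * \<delta> + \<eta> * C + \<epsilon> / 8) (\<epsilon> / 8 + \<delta> + (\<eta> + 0) + \<epsilon> / 8)"
    using sq_le_add[OF sq_le_add[OF 1 2] 3] by simp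
  then have S: "sq_le (\<lambda>n. A n * B n - Op (\<nn> n) (cconv a b)) \<epsilon> \<epsilon>"
    by (rule sq_le_mono) (use e d t in auto)
  have sm: "symb b \<in> borel_measurable (lebesgue_on sdom)" by (rule symb_measurable[OF b(1)])
  from fsplits_add[OF fsplits_mult[OF M(3) b(3)] fsplits_mult[OF a(3) fsplits_bounded[OF sm C(3)]]]
  have "fsplits (\<lambda>z. k z * (symb b z - h z) + (symb a z - k z) * symb b z) (M * \<delta> + \<eta> * C) (\<epsilon> / 8 + \<delta> + (\<eta> + 0))" .
  also have "(\<lambda>z. k z * (symb b z - h z) + (symb a z - k z) * symb b z) = (\<lambda>z. symb (cconv a b) z - k z * h z)"
    by (rule ext) (simp add: symb_cconv a b algebra_simps)
  finally have "fsplits (\<lambda>z. symb (cconv a b) z - k z * h z) \<epsilon> \<epsilon>"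
    by (rule fsplits_mono) (use e d t in auto)
  with S show "\<exists>c. elem c \<and> sq_le (\<lambda>n. A n * B n - Op (\<nn> n) c) \<epsilon> \<epsilon> \<and> fsplits (\<lambda>z. symb c z - k z * h z) \<epsilon> \<epsilon>"
    using elem_cconv[OF a(1) b(1)] by blast
qed

text \<open>The approximant has a symbol small up to \<open>2 * \<epsilon>\<close>, which
  \<open>Op_sq_le\<close> doubles; the distance to the approximant adds another
  \<open>\<epsilon>\<close>.\<close>

lemma glt'_upper:
  assumes A: "glt' A k" and e: "\<epsilon> > 0" and k: "fsplits k \<epsilon> \<epsilon>"
  shows "sq_le A (5 * \<epsilon>) (5 * \<epsilon>)"
proof -
  obtain c where c: "elem c" "sq_le (\<lambda>n. A n - Op (\<nn> n) c) \<epsilon> \<epsilon>" "fsplits (\<lambda>z. symb c z - k z) \<epsilon> \<epsilon>" by (rule glt'D[OF A e])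
  have "fsplits (symb c) (2 * \<epsilon>) (2 * \<epsilon>)" using fsplits_add[OF c(3) k] by simp
  from Op_sq_le[OF c(1) this] have "sq_le (\<lambda>n. Op (\<nn> n) c) (4 * \<epsilon>) (4 * \<epsilon>)" using e by simp
  from sq_le_add[OF c(2) this] have "sq_le (\<lambda>n. (A n - Op (\<nn> n) c) + Op (\<nn> n) c) (5 * \<epsilon>) (5 * \<epsilon>)" by simp
  moreover have "(A n - Op (\<nn> n) c) + Op (\<nn> n) c = A n" for n
    using glt'_carrier[OF A, of n] by (intro eq_matI) auto
  ultimately show ?thesis by simp
qed

text \<open>The converse of \<open>glt'_upper\<close>, again through an elementary approximant. The
  factor \<open>(2 * pi) ^ CARD('d)\<close> converts a proportion of the indices into a measure on
  the domain of symbols.\<close>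

lemma glt'_lower:
  assumes A: "glt' A k" and e: "\<epsilon> > 0" and s: "sq_le A \<epsilon> \<epsilon>"
  shows "fsplits k (5 * \<epsilon>) ((2 * (2 * pi) ^ CARD('d::{finite,linorder}) + 1) * \<epsilon>)"
proof -
  obtain c where c: "elem c" "sq_le (\<lambda>n. A n - Op (\<nn> n) c) \<epsilon> \<epsilon>" "fsplits (\<lambda>z. symb c z - k z) \<epsilon> \<epsilon>" by (rule glt'D[OF A e])
  have "Op (\<nn> n) c = A n + (-1) \<cdot>\<^sub>m (A n - Op (\<nn> n) c)" for n
    using glt'_carrier[OF A, of n] by (intro eq_matI) auto
  then have "sq_le (\<lambda>n. Op (\<nn> n) c) (2 * \<epsilon>) (2 * \<epsilon>)"
    using sq_le_add[OF s sq_le_smult[OF c(2), of "-1"]] by simp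
  then have "\<forall>\<^sub>F n in sequentially. real (sv_count (Op (\<nn> n) c) (2 * \<epsilon>)) \<le> 2 * \<epsilon> * N_of (\<nn> n)"
    unfolding sq_le_def by eventually_elim (use e in \<open>simp add: splits_iff_sv_count\<close>)
  from sv_count_Op_lower[OF c(1) _ this] e
  have "fsplits (symb c) (4 * \<epsilon>) (2 * \<epsilon> * (2 * pi) ^ CARD('d))"
    using symb_measurable[OF c(1)] by (simp add: fsplits_def)
  from fsplits_union[OF this c(3) glt'_measurable[OF A], of "5 * \<epsilon>"]
  have "fsplits k (5 * \<epsilon>) (2 * \<epsilon> * (2 * pi) ^ CARD('d) + \<epsilon>)"
  proof -
    have "4 * \<epsilon> < cmod (symb c z) \<or> \<epsilon> < cmod (symb c z - k z)" if "5 * \<epsilon> < cmod (k z)" for z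
      using that norm_triangle_ineq4[of "symb c z" "symb c z - k z"] by simp linarith
    then show ?thesis using fsplits_union[OF \<open>fsplits (symb c) _ _\<close> c(3) glt'_measurable[OF A], of "5 * \<epsilon>"] by blast
  qed
  then show ?thesis by (simp add: algebra_simps)
qed

end

lemma rank_le_mat_diag: "rank_le (mat_diag n f) (card {j. j < n \<and> f j \<noteq> 0})"
proof -
  let ?J = "{j. j < n \<and> f j \<noteq> 0}"
  have fJ: "finite ?J" by simp
  obtain h where h: "bij_betw h {0..<card ?J} ?J" using ex_bij_betw_nat_finite[OF fJ] by blast
  have "mat_diag n f $$ (i, j) = (\<Sum>t<card ?J. (if h t = i then f i else 0) * (if h t = j then 1 else 0))"
    if ij: "i < n" "j < n" for i j
  proof -
    have "(\<Sum>t<card ?J. (if h t = i then f i else 0) * (if h t = j then 1 else 0))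
      = (\<Sum>x\<in>?J. (if x = i then f i else 0) * (if x = j then 1 else 0))"
      using sum.reindex_bij_betw[OF h, of "\<lambda>x. (if x = i then f i else 0) * (if x = j then 1 else 0)"]
      by (simp add: atLeast0LessThan)
    also have "\<dots> = (\<Sum>x\<in>?J. if x = i then (if i = j then f i else 0) else 0)"
      by (intro sum.cong) auto
    also have "\<dots> = (if i = j then f i else 0)" unfolding sum.delta[OF fJ] using ij by auto
    also have "\<dots> = mat_diag n f $$ (i, j)" using ij by (simp add: mat_diag_def)
    finally show ?thesis by (rule sym)
  qed
  then show ?thesis unfolding rank_le_def
    by (intro exI[of _ "\<lambda>t i. if h t = i then f i else 0"] exI[of _ "\<lambda>t j. if h t = j then 1 else 0"] allI impI)
      (simp only: mat_diag_dim[THEN carrier_matD(1)] mat_diag_dim[THEN carrier_matD(2)])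
qed

section \<open>Existence of a sequence for every measurable symbol\<close>

context grid
begin

text \<open>
  Completeness: the matrices of a fast Cauchy sequence of symbols are glued along a slowly
  growing index \<open>t n\<close>.
\<close>

lemma glt'_exists:
  assumes k: "k \<in> borel_measurable (lebesgue_on sdom)"
  shows "\<exists>A. glt' A k"
proof -
  \<comment> \<open>Geometric accuracies, so that the errors of consecutive approximants are
    summable.\<close>
  define \<eta> :: "nat \<Rightarrow> real" where "\<eta> m = (1/2) ^ m" for m
  have eta: "\<eta> m > 0" "\<eta> (Suc m) = \<eta> m / 2" for m by (auto simp: \<eta>_def)
  have "\<exists>c. \<forall>m. telem (c m) \<and> measure (lebesgue_on sdom) {z \<in> sdom. \<eta> m < cmod (symb (c m) z - k z)} < \<eta> m"
    by (intro choice allI symb_dense[OF k eta(1)])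
  then obtain c where "\<forall>m. telem (c m) \<and> measure (lebesgue_on sdom) {z \<in> sdom. \<eta> m < cmod (symb (c m) z - k z)} < \<eta> m" ..
  then have c: "\<And>m. telem (c m)" "\<And>m. measure (lebesgue_on sdom) {z \<in> sdom. \<eta> m < cmod (symb (c m) z - k z)} < \<eta> m"
    by simp_all
  note ce = telem_elem[OF c(1)]
  have fs: "fsplits (\<lambda>z. symb (c m) z - k z) (\<eta> m) (\<eta> m)" for m
    using c(2)[of m] symb_measurable[OF ce[of m]] k by (auto simp: fsplits_def)
  have fs': "fsplits (\<lambda>z. k z - symb (c m) z) (\<eta> m) (\<eta> m)" for m
    by (rule fsplits_subset[OF fs[of m]]) (use symb_measurable[OF ce[of m]] k in \<open>auto simp: norm_minus_commute\<close>)
  have step: "sq_le (\<lambda>n. Op (\<nn> n) (c (Suc m)) - Op (\<nn> n) (c m)) (4 * \<eta> m) (4 * \<eta> m)" for m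
  proof -
    have "fsplits (\<lambda>z. (symb (c (Suc m)) z - k z) + (k z - symb (c m) z)) (\<eta> (Suc m) + \<eta> m) (\<eta> (Suc m) + \<eta> m)"
      by (rule fsplits_add[OF fs fs'])
    moreover have "(\<lambda>z. (symb (c (Suc m)) z - k z) + (k z - symb (c m) z)) = symb (cdiff (c (Suc m)) (c m))"
      by (rule ext) (simp add: symb_cdiff ce)
    ultimately have "fsplits (symb (cdiff (c (Suc m)) (c m))) (\<eta> (Suc m) + \<eta> m) (\<eta> (Suc m) + \<eta> m)" by simp
    then have "fsplits (symb (cdiff (c (Suc m)) (c m))) (2 * \<eta> m) (2 * \<eta> m)"
      by (rule fsplits_mono) (use eta[of m] in auto)
    from Op_sq_le[OF elem_cdiff[OF ce ce] this] show ?thesis using eta(1)[of m] by (simp add: Op_cdiff)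
  qed
  have "\<forall>m. \<exists>v. \<forall>n\<ge>v. splits (N_of (\<nn> n)) (Op (\<nn> n) (c (Suc m)) - Op (\<nn> n) (c m)) (4 * \<eta> m) (4 * \<eta> m * N_of (\<nn> n))"
    using step by (simp add: sq_le_def eventually_sequentially)
  from choice[OF this] obtain \<nu> where "\<forall>m. \<forall>n\<ge>\<nu> m. splits (N_of (\<nn> n)) (Op (\<nn> n) (c (Suc m)) - Op (\<nn> n) (c m)) (4 * \<eta> m) (4 * \<eta> m * N_of (\<nn> n))" ..
  then have nu: "\<And>m n. n \<ge> \<nu> m \<Longrightarrow> splits (N_of (\<nn> n)) (Op (\<nn> n) (c (Suc m)) - Op (\<nn> n) (c m)) (4 * \<eta> m) (4 * \<eta> m * N_of (\<nn> n))"
    by blast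
  \<comment> \<open>As \<open>\<eta>\<close> halves in each step, the error
    \<open>4 * \<eta> l\<close> equals \<open>8 * (\<eta> l - \<eta> (Suc l))\<close>, and the
    bounds telescope.\<close>
  have tel: "splits (N_of (\<nn> n)) (Op (\<nn> n) (c l) - Op (\<nn> n) (c m)) (8 * (\<eta> m - \<eta> l)) (8 * (\<eta> m - \<eta> l) * N_of (\<nn> n))"
    if "m \<le> l" "\<forall>j<l. \<nu> j \<le> n" for m l n
    using that
  proof (induction l rule: dec_induct)
    case base
    have eq: "Op (\<nn> n) (c m) - Op (\<nn> n) (c m) = 0\<^sub>m (N_of (\<nn> n)) (N_of (\<nn> n))" by (rule eq_matI) auto
    show ?case unfolding eq using splits_nbound[of "0\<^sub>m (N_of (\<nn> n)) (N_of (\<nn> n))" "N_of (\<nn> n)" 0] by simp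
  next
    case (step l)
    have "splits (N_of (\<nn> n)) ((Op (\<nn> n) (c (Suc l)) - Op (\<nn> n) (c l)) + (Op (\<nn> n) (c l) - Op (\<nn> n) (c m)))
      (4 * \<eta> l + 8 * (\<eta> m - \<eta> l)) (4 * \<eta> l * N_of (\<nn> n) + 8 * (\<eta> m - \<eta> l) * N_of (\<nn> n))"
      using step by (intro splits_add nu) auto
    moreover have "4 * \<eta> l + 8 * (\<eta> m - \<eta> l) = 8 * (\<eta> m - \<eta> (Suc l))" by (simp add: eta(2))
    moreover have "4 * \<eta> l * N_of (\<nn> n) + 8 * (\<eta> m - \<eta> l) * N_of (\<nn> n) = 8 * (\<eta> m - \<eta> (Suc l)) * N_of (\<nn> n)"
      by (simp add: eta(2) algebra_simps)
    ultimately show ?case by (simp add: mat_telescope[OF Op_carrier Op_carrier Op_carrier])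
  qed
  \<comment> \<open>The indices that can be reached through steps already valid at \<open>n\<close>.
    The condition \<open>m \<le> n\<close> makes the set finite, and 0 always belongs to it, so the
    maximum exists; for each \<open>m\<close> the maximum is eventually at least
    \<open>m\<close>.\<close>
  define T where "T n = {m. m \<le> n \<and> (\<forall>j<m. \<nu> j \<le> n)}" for n
  define t where "t n = Max (T n)" for n
  have finT: "finite (T n)" for n by (rule finite_subset[of _ "{..n}"]) (auto simp: T_def)
  have tT: "t n \<in> T n" for n unfolding t_def by (rule Max_in[OF finT]) (auto simp: T_def)
  define A where "A n = Op (\<nn> n) (c (t n))" for n
  have "glt' A k"
  proof (rule glt'I[OF _ k])
    show "A n \<in> carrier_mat (N_of (\<nn> n)) (N_of (\<nn> n))" for n by (simp add: A_def)
    fix \<epsilon> :: real assume e: "\<epsilon> > 0"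
    obtain m where "(1/2) ^ m < \<epsilon> / 8" using real_arch_pow_inv[of "\<epsilon> / 8" "1/2"] e by auto
    then have m: "8 * \<eta> m < \<epsilon>" by (simp add: \<eta>_def)
    have "\<forall>\<^sub>F n in sequentially. \<forall>j\<in>{..<m}. \<nu> j \<le> n"
      by (intro eventually_ball_finite ballI eventually_ge_at_top) simp
    then have "\<forall>\<^sub>F n in sequentially. splits (N_of (\<nn> n)) (A n - Op (\<nn> n) (c m)) \<epsilon> (\<epsilon> * N_of (\<nn> n))"
      using eventually_ge_at_top[of m]
    proof eventually_elim
      case (elim n)
      then have "m \<in> T n" by (simp add: T_def)
      then have mt: "m \<le> t n" unfolding t_def by (rule Max_ge[OF finT])
      have "8 * (\<eta> m - \<eta> (t n)) \<le> \<epsilon>" unfolding right_diff_distrib using m eta(1)[of "t n"] by linarith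
      then have le: "8 * (\<eta> m - \<eta> (t n)) * N_of (\<nn> n) \<le> \<epsilon> * N_of (\<nn> n)" "8 * (\<eta> m - \<eta> (t n)) \<le> \<epsilon>"
        by (auto intro: mult_right_mono)
      have "splits (N_of (\<nn> n)) (A n - Op (\<nn> n) (c m)) (8 * (\<eta> m - \<eta> (t n))) (8 * (\<eta> m - \<eta> (t n)) * N_of (\<nn> n))"
      proof -
        have "\<forall>j<t n. \<nu> j \<le> n" using tT[of n] unfolding T_def by blast
        from tel[OF mt this] show ?thesis unfolding A_def .
      qed
      from splits_mono[OF this le(2,1)] show ?case .
    qed
    moreover have "fsplits (\<lambda>z. symb (c m) z - k z) \<epsilon> \<epsilon>"
      by (rule fsplits_mono[OF fs[of m]]) (use m eta(1)[of m] in auto)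
    ultimately show "\<exists>c. elem c \<and> sq_le (\<lambda>n. A n - Op (\<nn> n) c) \<epsilon> \<epsilon> \<and> fsplits (\<lambda>z. symb c z - k z) \<epsilon> \<epsilon>"
      unfolding sq_le_def by (intro exI[of _ "c m"] conjI ce)
  qed
  then show ?thesis by blast
qed

section \<open>Grid points near a given set\<close>

lemma riemann_sums_real:
  fixes h :: "real ^ 'd::{finite,linorder} \<Rightarrow> real"
  assumes h: "continuous_on (cbox 0 1) h"
  shows "(\<lambda>n. (\<Sum>p<N_of (\<nn> n). h (gpt (\<nn> n) p)) / N_of (\<nn> n)) \<longlonglongrightarrow> integral (cbox 0 1) h"
proof -
  have "(\<lambda>n. (\<Sum>p<N_of (\<nn> n). complex_of_real (h (gpt (\<nn> n) p))) / N_of (\<nn> n)) \<longlonglongrightarrow> integral (cbox 0 1) (\<lambda>x. complex_of_real (h x))"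
    unfolding gpt_def by (rule riemann_sums) (intro continuous_intros h)
  then have "(\<lambda>n. complex_of_real ((\<Sum>p<N_of (\<nn> n). h (gpt (\<nn> n) p)) / N_of (\<nn> n))) \<longlonglongrightarrow> of_real (integral (cbox 0 1) h)"
    by (simp add: integral_of_real_continuous[OF h])
  then show ?thesis unfolding tendsto_of_real_iff .
qed

text \<open>Two grids are in use: \<open>diag_sampling\<close> evaluates at \<open>i / n\<close>,
  while restriction tests \<open>i / (n + 1)\<close>. Their points differ by at most
  \<open>1 / (n + 1)\<close> in each coordinate.\<close>

lemma eventually_grid_close:
  assumes "\<delta> > 0"
  shows "\<forall>\<^sub>F n in sequentially. \<forall>p<N_of (\<nn> n). dist (gpt (\<nn> n) p) (idx_div (midx (\<nn> n) p) (\<nn> n + 1)) < \<delta>"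
proof -
  have "\<delta> / (2 * CARD('d)) > 0" using assms by simp
  from eventually_small[OF this, of 1] show ?thesis
  proof eventually_elim
    case (elim n)
    show ?case
    proof (intro allI impI)
      fix p assume p: "p < N_of (\<nn> n)"
      let ?x = "gpt (\<nn> n) p" and ?y = "idx_div (midx (\<nn> n) p) (\<nn> n + 1)"
      have "\<bar>(?x - ?y) $ j\<bar> \<le> \<delta> / (2 * CARD('d))" for j
      proof -
        have n: "\<nn> n $ j > 0" "1 / \<nn> n $ j \<le> \<delta> / (2 * CARD('d))" using elim by auto
        have i: "midx (\<nn> n) p $ j \<le> \<nn> n $ j" using midx_in[OF p] by (auto simp: index_set_eq)
        have eq: "(?x - ?y) $ j = real (midx (\<nn> n) p $ j) / (real (\<nn> n $ j) * (real (\<nn> n $ j) + 1))"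
          using n(1) by (simp add: gpt_def idx_div_def field_simps)
        have "\<bar>(?x - ?y) $ j\<bar> = real (midx (\<nn> n) p $ j) / (real (\<nn> n $ j) * (real (\<nn> n $ j) + 1))"
          unfolding eq by simp
        also have "\<dots> \<le> real (\<nn> n $ j) / (real (\<nn> n $ j) * (real (\<nn> n $ j) + 1))"
          by (rule divide_right_mono) (use i in auto)
        also have "\<dots> = 1 / (real (\<nn> n $ j) + 1)" using n(1) by simp
        also have "\<dots> \<le> 1 / \<nn> n $ j" by (rule frac_le) (use n(1) in auto)
        finally show ?thesis using n(2) by linarith
      qed
      then have "(\<Sum>j\<in>UNIV. \<bar>(?x - ?y) $ j\<bar>) \<le> (\<Sum>j\<in>(UNIV :: 'd set). \<delta> / (2 * CARD('d)))" by (intro sum_mono)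
      then have "dist ?x ?y \<le> \<delta> / 2" unfolding dist_norm using norm_vec_le[of "?x - ?y"] by simp
      then show "dist ?x ?y < \<delta>" using assms by linarith
    qed
  qed
qed

text \<open>The continuous function \<open>h\<close> is 1 up to distance \<open>\<delta>\<close>
  from \<open>F\<close> and 0 beyond \<open>2 * \<delta>\<close>. Its Riemann sum bounds the count
  from above, and its integral is bounded by the measure of the larger neighbourhood.\<close>

lemma count_near_closed:
  fixes F :: "(real ^ 'd::{finite,linorder}) set"
  assumes d: "\<delta> > 0" and m: "measure lebesgue {x \<in> cbox 0 1. infdist x F \<le> 2 * \<delta>} < e"
  shows "\<forall>\<^sub>F n in sequentially. real (card {p. p < N_of (\<nn> n) \<and> infdist (gpt (\<nn> n) p) F \<le> \<delta>}) \<le> e * N_of (\<nn> n)"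
proof -
  let ?T = "{x \<in> cbox 0 1. infdist x F \<le> 2 * \<delta>}"
  define h where "h x = max 0 (min 1 (2 - infdist x F / \<delta>))" for x
  have hc: "continuous_on (cbox 0 1) h" unfolding h_def by (intro continuous_intros) (use d in auto)
  have "closed {x \<in> cbox 0 1. infdist x F \<le> 2 * \<delta>}" by (intro continuous_on_closed_Collect_le continuous_intros) auto
  then have "compact ?T" using bounded_subset[OF bounded_cbox, of ?T 0 1] by (auto simp: compact_eq_bounded_closed)
  then have T: "?T \<in> lmeasurable" by (rule lmeasurable_compact)
  have Tc: "?T \<inter> cbox 0 1 = ?T" by auto
  have "integral (cbox 0 1) h \<le> integral (cbox 0 1) (indicator ?T)"
  proof (rule integral_le)
    show "h integrable_on cbox 0 1" by (rule integrable_continuous[OF hc])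
    show "(indicator ?T :: _ \<Rightarrow> real) integrable_on cbox 0 1" using T by (simp add: integrable_on_indicator Tc)
    show "h x \<le> indicator ?T x" if "x \<in> cbox 0 1" for x
      using that d by (auto simp: h_def indicator_def field_simps)
  qed
  also have "\<dots> = measure lebesgue ?T" using integral_indicator[of ?T "cbox 0 1"] T by (simp add: Tc)
  finally have "integral (cbox 0 1) h < e" using m by linarith
  from order_tendstoD(2)[OF riemann_sums_real[OF hc] this] eventually_N_pos show ?thesis
  proof eventually_elim
    case (elim n)
    let ?C = "{p. p < N_of (\<nn> n) \<and> infdist (gpt (\<nn> n) p) F \<le> \<delta>}"
    have "real (card ?C) = (\<Sum>p\<in>?C. 1)" by simp
    also have "\<dots> \<le> (\<Sum>p\<in>?C. h (gpt (\<nn> n) p))"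
      using d by (intro sum_mono) (auto simp: h_def field_simps)
    also have "\<dots> \<le> (\<Sum>p<N_of (\<nn> n). h (gpt (\<nn> n) p))"
      by (rule sum_mono2) (auto simp: h_def)
    finally show ?case using elim by (simp add: pos_divide_less_eq)
  qed
qed

end

text \<open>A segment from a point of \<open>S\<close> to a point outside meets the
  frontier.\<close>

lemma infdist_frontier_le:
  fixes x y :: "'a::euclidean_space"
  assumes "x \<in> S" "y \<notin> S"
  shows "infdist x (frontier S) \<le> dist x y" "infdist y (frontier S) \<le> dist x y"
proof -
  have "closed_segment x y \<inter> frontier S \<noteq> {}"
    by (rule connected_Int_frontier) (use assms in auto)
  then obtain z where z: "z \<in> closed_segment x y" "z \<in> frontier S" by blast
  have "dist x z \<le> dist x y" "dist y z \<le> dist x y"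
    using dist_in_closed_segment[OF z(1)] by (auto simp: dist_commute)
  then show "infdist x (frontier S) \<le> dist x y" "infdist y (frontier S) \<le> dist x y"
    using infdist_le[OF z(2), of x] infdist_le[OF z(2), of y] by linarith+
qed

lemma measure_freq_cube: "measure lborel (freq_cube :: (real ^ 'd) set) = (2 * pi) ^ CARD('d)"
  using measure_freq_box[of pi, where 'd='d] by simp

lemma emeasure_lborel_Times:
  fixes A :: "'a::euclidean_space set" and B :: "'b::euclidean_space set"
  assumes "A \<in> sets borel" "B \<in> sets borel"
  shows "A \<times> B \<in> sets borel" "emeasure lborel (A \<times> B) = emeasure lborel A * emeasure lborel B"
proof -
  have "A \<times> B \<in> sets (borel \<Otimes>\<^sub>M borel)" using assms by simp
  then show "A \<times> B \<in> sets borel" unfolding borel_prod .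
  show "emeasure lborel (A \<times> B) = emeasure lborel A * emeasure lborel B"
    unfolding lborel_prod[symmetric] using assms by (intro lborel.emeasure_pair_measure_Times) auto
qed

section \<open>The projection onto the indices in \<open>\<Omega>\<close>\<close>

locale grid_domain = grid \<nn> for \<nn> :: "nat \<Rightarrow> nat ^ 'd::{finite,linorder}" +
  fixes \<Omega> :: "(real ^ 'd::{finite,linorder}) set"
  assumes sub: "\<Omega> \<subseteq> cbox 0 1" and pj: "peano_jordan \<Omega>" and pos: "emeasure lebesgue \<Omega> > 0"
begin

text \<open>The distance to the empty set is 0 by convention, so the neighbourhoods of the frontier
  used below shrink only if it has points.\<close>

lemma frontier_nonempty: "frontier \<Omega> \<noteq> {}"
proof
  assume "frontier \<Omega> = {}"
  then have "\<Omega> = {} \<or> \<Omega> = UNIV" by (simp add: frontier_eq_empty)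
  moreover have "\<Omega> \<noteq> {}" using pos by auto
  moreover have "\<Omega> \<noteq> UNIV" using sub bounded_subset[OF bounded_cbox sub] by (auto simp: not_bounded_UNIV)
  ultimately show False by blast
qed

text \<open>Closed neighbourhoods in the compact cube decrease to a part of the closed null
  frontier, and measure is continuous from above. The factor 4 accounts for a tolerance
  \<open>2 * \<delta>\<close> between grid points that \<open>count_near_closed\<close>
  doubles.\<close>

lemma thin_frontier:
  assumes "e > 0" shows "\<exists>\<delta>>0. measure lebesgue {x \<in> cbox 0 1. infdist x (frontier \<Omega>) \<le> 4 * \<delta>} < e"
proof -
  define T where "T j = {x \<in> cbox 0 1. infdist x (frontier \<Omega>) \<le> inverse (real (Suc j))}" for j
  have cT: "compact (T j)" for j
  proof -
    have "closed (T j)" unfolding T_def by (intro continuous_on_closed_Collect_le continuous_intros) auto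
    then show ?thesis using bounded_subset[OF bounded_cbox, of "T j" 0 1] by (auto simp: compact_eq_bounded_closed T_def)
  qed
  have "(\<lambda>j. measure lebesgue (T j)) \<longlonglongrightarrow> measure lebesgue (\<Inter>j. T j)"
  proof (rule Lim_measure_decseq)
    show "range T \<subseteq> sets lebesgue" using lmeasurable_compact[OF cT] by (auto intro: fmeasurableD)
    show "decseq T" unfolding decseq_def T_def by (auto intro: order_trans le_imp_inverse_le)
    show "emeasure lebesgue (T j) \<noteq> \<infinity>" for j using fmeasurableD2[OF lmeasurable_compact[OF cT]] by simp
  qed
  moreover have "measure lebesgue (\<Inter>j. T j) = 0"
  proof -
    have "(\<Inter>j. T j) \<subseteq> frontier \<Omega>"
    proof
      fix x assume x: "x \<in> (\<Inter>j. T j)"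
      have "infdist x (frontier \<Omega>) \<le> 0"
      proof (rule LIMSEQ_le_const[OF LIMSEQ_inverse_real_of_nat])
        show "\<exists>N. \<forall>j\<ge>N. infdist x (frontier \<Omega>) \<le> inverse (real (Suc j))" using x by (auto simp: T_def)
      qed
      then have "infdist x (frontier \<Omega>) = 0" using infdist_nonneg[of x "frontier \<Omega>"] by linarith
      then show "x \<in> frontier \<Omega>" using in_closed_iff_infdist_zero[OF frontier_closed frontier_nonempty] by blast
    qed
    moreover have "frontier \<Omega> \<in> null_sets lebesgue" using pj by (simp add: peano_jordan_def)
    ultimately have "(\<Inter>j. T j) \<in> null_sets lebesgue" by (meson null_sets_completion_subset)
    then show ?thesis by (simp add: measure_eq_0_null_sets)
  qed
  ultimately have "\<forall>\<^sub>F j in sequentially. measure lebesgue (T j) < e" using assms by (auto dest: order_tendstoD(2))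
  then obtain j where "measure lebesgue (T j) < e" using eventually_happens'[OF sequentially_bot] by blast
  then show ?thesis unfolding T_def by (intro exI[of _ "inverse (real (Suc j)) / 4"]) simp
qed

text \<open>\<open>\<Omega>\<close> is its open interior together with a subset of the null
  frontier. The product with the cube inherits this description, and completeness of Lebesgue
  measure gives measurability.\<close>

lemma sets_Omega_freq: "{z \<in> sdom. fst z \<in> \<Omega>} \<in> sets lebesgue"
proof -
  let ?F = "freq_cube :: (real ^ 'd::{finite,linorder}) set"
  have "frontier \<Omega> \<in> null_sets lborel"
    using pj frontier_closed[of \<Omega>] by (simp add: peano_jordan_def null_sets_completion_iff borel_closed)
  then have "emeasure lborel (frontier \<Omega> \<times> ?F) = 0"
    using emeasure_lborel_Times(2)[of "frontier \<Omega>" ?F] frontier_closed[of \<Omega>] by (auto simp: borel_closed)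
  then have "frontier \<Omega> \<times> ?F \<in> null_sets lborel"
    using emeasure_lborel_Times(1)[of "frontier \<Omega>" ?F] frontier_closed[of \<Omega>] by (auto simp: borel_closed)
  then have "frontier \<Omega> \<times> ?F \<in> null_sets lebesgue" by (rule null_sets_completionI)
  then have N: "(\<Omega> - interior \<Omega>) \<times> ?F \<in> sets lebesgue"
  proof -
    have "(\<Omega> - interior \<Omega>) \<times> ?F \<subseteq> frontier \<Omega> \<times> ?F" using closure_subset[of \<Omega>] by (auto simp: frontier_def)
    with \<open>frontier \<Omega> \<times> ?F \<in> null_sets lebesgue\<close> show ?thesis by (meson null_sets_completion_subset null_setsD2)
  qed
  have "interior \<Omega> \<times> ?F \<in> sets borel" by (rule emeasure_lborel_Times(1)) auto
  then have "interior \<Omega> \<times> ?F \<in> sets lebesgue" by simp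
  with N have "(interior \<Omega> \<times> ?F) \<union> ((\<Omega> - interior \<Omega>) \<times> ?F) \<in> sets lebesgue" by (intro sets.Un)
  moreover have "(interior \<Omega> \<times> ?F) \<union> ((\<Omega> - interior \<Omega>) \<times> ?F) = {z \<in> sdom. fst z \<in> \<Omega>}"
    using sub interior_subset[of \<Omega>] by auto
  ultimately show ?thesis by simp
qed

definition proj :: "nat \<Rightarrow> complex mat" where
  "proj n = mat_diag (N_of (\<nn> n)) (\<lambda>p. if idx_div (midx (\<nn> n) p) (\<nn> n + 1) \<in> \<Omega> then 1 else 0)"

lemma proj_carrier [simp]: "proj n \<in> carrier_mat (N_of (\<nn> n)) (N_of (\<nn> n))"
  by (simp add: proj_def)

lemma indicator_Omega_measurable: "(\<lambda>z. indicator \<Omega> (fst z) :: complex) \<in> borel_measurable (lebesgue_on sdom)"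
proof -
  have "(indicator {z \<in> sdom. fst z \<in> \<Omega>} :: _ \<Rightarrow> complex) \<in> borel_measurable (lebesgue_on sdom)"
    by (rule borel_measurable_indicator) (use sets_Omega_freq in \<open>auto simp: sets_restrict_space_iff\<close>)
  moreover have "(\<lambda>z. indicator \<Omega> (fst z) :: complex) \<in> borel_measurable (lebesgue_on sdom)
      \<longleftrightarrow> (indicator {z \<in> sdom. fst z \<in> \<Omega>} :: _ \<Rightarrow> complex) \<in> borel_measurable (lebesgue_on sdom)"
    by (rule measurable_cong) (auto simp: space_restrict_space indicator_def)
  ultimately show ?thesis by simp
qed

text \<open>The indicator is replaced by a continuous function of the space variable that differs
  from it only near the frontier. The corresponding diagonal matrices then differ in few positions,
  and the rank of a diagonal matrix is at most its number of nonzero entries.\<close>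

lemma glt'_proj: "glt' proj (\<lambda>z. indicator \<Omega> (fst z))"
proof (rule glt'I[OF proj_carrier indicator_Omega_measurable])
  fix \<epsilon> :: real assume e: "\<epsilon> > 0"
  let ?V = "(2 * pi) ^ CARD('d)" and ?F = "frontier \<Omega>"
  have V: "?V \<ge> 1" by (rule two_pi_power_ge_1)
  have "\<epsilon> / ?V > 0" using e by simp
  from thin_frontier[OF this] obtain \<delta> where d: "\<delta> > 0" and thin: "measure lebesgue {x \<in> cbox 0 1. infdist x ?F \<le> 4 * \<delta>} < \<epsilon> / ?V" by blast
  have "\<epsilon> / ?V \<le> \<epsilon>" using e V by (simp add: divide_le_eq mult_le_cancel_left1)
  then have thin': "measure lebesgue {x \<in> cbox 0 1. infdist x ?F \<le> 2 * (2 * \<delta>)} < \<epsilon>" using thin by simp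
  \<comment> \<open>Equal to 1 on \<open>\<Omega>\<close> and to 0 from distance
    \<open>\<delta>\<close> on, so it agrees with the indicator farther than \<open>\<delta>\<close>
    from the frontier.\<close>
  define g :: "real ^ 'd::{finite,linorder} \<Rightarrow> complex" where "g x = of_real (max 0 (1 - infdist x \<Omega> / \<delta>))" for x
  have gc: "continuous_on (cbox 0 1) g" unfolding g_def by (intro continuous_intros) (use d in auto)
  have ne: "\<Omega> \<noteq> {}" using pos by auto
  have gi: "g x = indicator \<Omega> x" if x: "\<delta> < infdist x ?F" for x
  proof (cases "x \<in> \<Omega>")
    case False
    have "\<delta> \<le> infdist x \<Omega>" unfolding infdist_notempty[OF ne]
    proof (rule cINF_greatest[OF ne])
      fix y assume "y \<in> \<Omega>"
      then show "\<delta> \<le> dist x y" using infdist_frontier_le(2)[OF _ False, of y] x by (simp add: dist_commute)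
    qed
    then show ?thesis using False d by (simp add: g_def indicator_def)
  qed (simp add: g_def)
  define c where "c = cmono 0 g"
  have c: "elem c" unfolding c_def by (rule elem_cmono[OF gc])
  have Opc: "Op (\<nn> n) c = mat_diag (N_of (\<nn> n)) (\<lambda>p. g (gpt (\<nn> n) p))" for n
  proof (rule eq_matI)
    fix p q assume "p < dim_row (mat_diag (N_of (\<nn> n)) (\<lambda>p. g (gpt (\<nn> n) p)))" "q < dim_col (mat_diag (N_of (\<nn> n)) (\<lambda>p. g (gpt (\<nn> n) p)))"
    then have pq: "p < N_of (\<nn> n)" "q < N_of (\<nn> n)" by (auto simp: mat_diag_def)
    have "idiff (\<nn> n) p q = 0 \<longleftrightarrow> p = q"
      using inj_on_eq_iff[OF inj_idiff[of "\<nn> n" p], of q p] pq by auto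
    then show "Op (\<nn> n) c $$ (p, q) = mat_diag (N_of (\<nn> n)) (\<lambda>p. g (gpt (\<nn> n) p)) $$ (p, q)"
      using pq by (simp add: Op_index c_def cmono_def mat_diag_def)
  qed (auto simp: mat_diag_def)
  have d2: "2 * \<delta> > 0" using d by simp
  have "sq_le (\<lambda>n. proj n - Op (\<nn> n) c) \<epsilon> \<epsilon>"
    unfolding sq_le_def using count_near_closed[OF d2 thin'] eventually_grid_close[OF d]
  proof (eventually_elim)
    case (elim n)
    let ?y = "\<lambda>p. idx_div (midx (\<nn> n) p) (\<nn> n + 1)"
    define f where "f p = (if ?y p \<in> \<Omega> then 1 else 0) - g (gpt (\<nn> n) p)" for p
    have eq: "proj n - Op (\<nn> n) c = mat_diag (N_of (\<nn> n)) f"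
      unfolding Opc proj_def f_def by (rule eq_matI) (auto simp: mat_diag_def)
    \<comment> \<open>Farther than \<open>2 * \<delta>\<close> from the frontier, the two grid
      points of an index are too close together to be separated by it, so the diagonal entries
      agree.\<close>
    have "infdist (gpt (\<nn> n) p) ?F \<le> 2 * \<delta>" if p: "p < N_of (\<nn> n)" "f p \<noteq> 0" for p
    proof (rule ccontr)
      assume "\<not> infdist (gpt (\<nn> n) p) ?F \<le> 2 * \<delta>"
      then have far: "2 * \<delta> < infdist (gpt (\<nn> n) p) ?F" by simp
      have close: "dist (gpt (\<nn> n) p) (?y p) < \<delta>" using elim(2) p(1) by blast
      have "g (gpt (\<nn> n) p) = indicator \<Omega> (gpt (\<nn> n) p)" by (rule gi) (use far d in simp)
      moreover have "gpt (\<nn> n) p \<in> \<Omega> \<longleftrightarrow> ?y p \<in> \<Omega>"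
      proof (rule ccontr)
        assume "\<not> ?thesis"
        then consider "gpt (\<nn> n) p \<in> \<Omega>" "?y p \<notin> \<Omega>" | "?y p \<in> \<Omega>" "gpt (\<nn> n) p \<notin> \<Omega>" by blast
        then show False
        proof cases
          case 1
          from infdist_frontier_le(1)[OF this] show False using far close d by linarith
        next
          case 2
          from infdist_frontier_le(2)[OF this] show False using far close d by (simp add: dist_commute)
        qed
      qed
      ultimately show False using p(2) by (simp add: f_def indicator_def split: if_splits)
    qed
    then have "card {p. p < N_of (\<nn> n) \<and> f p \<noteq> 0} \<le> card {p. p < N_of (\<nn> n) \<and> infdist (gpt (\<nn> n) p) ?F \<le> 2 * \<delta>}"
      by (intro card_mono) auto
    then have "real (card {p. p < N_of (\<nn> n) \<and> f p \<noteq> 0}) \<le> \<epsilon> * N_of (\<nn> n)" using elim(1) by linarith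
    then show ?case unfolding eq
      by (intro splits_mono[OF splits_rank[OF mat_diag_dim rank_le_mat_diag]]) (use e in auto)
  qed
  moreover have "fsplits (\<lambda>z. symb c z - indicator \<Omega> (fst z)) \<epsilon> \<epsilon>"
  proof -
    let ?T = "{x \<in> cbox 0 1. infdist x ?F \<le> \<delta>}" and ?Q = "freq_cube :: (real ^ 'd::{finite,linorder}) set"
    have "closed ?T" by (intro continuous_on_closed_Collect_le continuous_intros) auto
    then have cT: "compact ?T" using bounded_subset[OF bounded_cbox, of ?T 0 1] by (auto simp: compact_eq_bounded_closed)
    have cT4: "compact {x \<in> cbox 0 1. infdist x ?F \<le> 4 * \<delta>}"
    proof -
      have "closed {x \<in> cbox 0 1. infdist x ?F \<le> 4 * \<delta>}" by (intro continuous_on_closed_Collect_le continuous_intros) auto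
      then show ?thesis using bounded_subset[OF bounded_cbox, of "{x \<in> cbox 0 1. infdist x ?F \<le> 4 * \<delta>}" 0 1] by (auto simp: compact_eq_bounded_closed)
    qed
    have "measure lebesgue ?T \<le> measure lebesgue {x \<in> cbox 0 1. infdist x ?F \<le> 4 * \<delta>}"
      by (rule measure_mono_fmeasurable) (use d lmeasurable_compact[OF cT] lmeasurable_compact[OF cT4] in \<open>auto intro: fmeasurableD\<close>)
    then have mT: "measure lebesgue ?T < \<epsilon> / ?V" using thin by simp
    have Tb: "?T \<in> sets borel" using cT by (simp add: borel_compact)
    have mTF: "measure lborel (?T \<times> ?Q) = measure lborel ?T * ?V"
    proof -
      have "measure lborel (?T \<times> ?Q) = measure lborel ?T * measure lborel (freq_cube :: (real ^ 'd::{finite,linorder}) set)"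
        unfolding measure_def by (subst emeasure_lborel_Times(2)[OF Tb]) (simp_all add: enn2real_mult)
      then show ?thesis by (simp only: measure_freq_cube)
    qed
    \<comment> \<open>An auxiliary step function, larger than \<open>\<epsilon>\<close> exactly on
      the thin set that contains every point where symbol and indicator differ.\<close>
    have "fsplits (\<lambda>z. if z \<in> ?T \<times> ?Q then of_real (2 * \<epsilon>) else 0) \<epsilon> \<epsilon>"
      unfolding fsplits_def
    proof
      have TF: "?T \<times> ?Q \<in> sets borel" by (rule emeasure_lborel_Times(1)[OF Tb]) simp
      then have TFl: "?T \<times> ?Q \<in> sets (lebesgue_on sdom)" by (auto simp: sets_restrict_space_iff)
      then show "(\<lambda>z. if z \<in> ?T \<times> ?Q then complex_of_real (2 * \<epsilon>) else 0) \<in> borel_measurable (lebesgue_on sdom)"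
        by (intro measurable_If_set) (auto simp: space_restrict_space Int_absorb2 intro: sets.Int)
      have "{z \<in> sdom. \<epsilon> < cmod (if z \<in> ?T \<times> ?Q then complex_of_real (2 * \<epsilon>) else 0)} = ?T \<times> ?Q"
        using e by auto
      moreover have "measure (lebesgue_on sdom) (?T \<times> ?Q) = measure lborel (?T \<times> ?Q)"
        using TF by (subst measure_restrict_space) auto
      moreover have "measure lborel ?T = measure lebesgue ?T" using Tb by simp
      ultimately show "measure (lebesgue_on sdom) {z \<in> sdom. \<epsilon> < cmod (if z \<in> ?T \<times> ?Q then complex_of_real (2 * \<epsilon>) else 0)} \<le> \<epsilon>"
        using mTF mT V by (simp add: pos_less_divide_eq less_imp_le)
    qed
    then show ?thesis
    proof (rule fsplits_subset)
      show "(\<lambda>z. symb c z - indicator \<Omega> (fst z)) \<in> borel_measurable (lebesgue_on sdom)"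
        using symb_measurable[OF c] indicator_Omega_measurable by simp
      fix z :: "(real ^ 'd::{finite,linorder}) \<times> (real ^ 'd::{finite,linorder})"
      assume z: "z \<in> sdom" "\<epsilon> < cmod (symb c z - indicator \<Omega> (fst z))"
      have "symb c z = g (fst z)" by (cases z) (simp add: c_def symb_cmono)
      then have "infdist (fst z) ?F \<le> \<delta>" using gi[of "fst z"] z(2) e by (cases "\<delta> < infdist (fst z) ?F") auto
      then have "z \<in> ?T \<times> ?Q" using z(1) by (cases z) auto
      then show "\<epsilon> < cmod (if z \<in> ?T \<times> ?Q then complex_of_real (2 * \<epsilon>) else 0)" using e by simp
    qed simp
  qed
  ultimately show "\<exists>c. elem c \<and> sq_le (\<lambda>n. proj n - Op (\<nn> n) c) \<epsilon> \<epsilon> \<and> fsplits (\<lambda>z. symb c z - indicator \<Omega> (fst z)) \<epsilon> \<epsilon>"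
    using c by blast
qed

text \<open>A null frontier and positive measure give \<open>\<Omega>\<close> a ball. A tent
  function on half the radius has positive integral, and its Riemann sum bounds the number of
  selected indices from below; the other half of the radius absorbs the shift between the two
  grids.\<close>

lemma d_red_lower: "\<exists>\<kappa>. 0 < \<kappa> \<and> (\<forall>\<^sub>F n in sequentially. \<kappa> * real (N_of (\<nn> n)) \<le> real (d_red (\<nn> n) \<Omega>))"
proof -
  have "interior \<Omega> \<noteq> {}"
  proof
    assume "interior \<Omega> = {}"
    then have "\<Omega> \<subseteq> frontier \<Omega>" using closure_subset[of \<Omega>] by (auto simp: frontier_def)
    then have "emeasure lebesgue \<Omega> = 0"
      using pj unfolding peano_jordan_def by (meson null_setsD1 null_sets_completion_subset)
    then show False using pos by simp
  qed
  then obtain x0 where "x0 \<in> interior \<Omega>" by blast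
  then obtain r where r: "r > 0" "ball x0 r \<subseteq> \<Omega>" by (meson mem_interior)
  have x0: "x0 \<in> cbox 0 1" using r sub by (meson centre_in_ball subsetD)
  define g where "g x = max 0 (1 - dist x x0 / (r / 2))" for x
  have gc: "continuous_on (cbox 0 1) g" unfolding g_def by (intro continuous_intros) (use r in auto)
  have "box (0 :: real ^ 'd::{finite,linorder}) 1 \<noteq> {}" by (simp add: interval_ne_empty_cart)
  then have "integral (cbox 0 1) g \<noteq> 0"
    using integral_cbox_eq_0_iff[OF gc] x0 by (auto simp: g_def intro!: bexI[of _ x0])
  moreover have "integral (cbox 0 1) g \<ge> 0" by (rule integral_nonneg[OF integrable_continuous[OF gc]]) (simp add: g_def)
  ultimately have I: "integral (cbox 0 1) g / 2 < integral (cbox 0 1) g" "integral (cbox 0 1) g / 2 > 0" by auto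
  have "r / 2 > 0" using r(1) by simp
  from order_tendstoD(1)[OF riemann_sums_real[OF gc] I(1)] eventually_N_pos eventually_grid_close[OF this]
  have "\<forall>\<^sub>F n in sequentially. integral (cbox 0 1) g / 2 * N_of (\<nn> n) \<le> real (d_red (\<nn> n) \<Omega>)"
  proof eventually_elim
    case (elim n)
    let ?y = "\<lambda>p. idx_div (midx (\<nn> n) p) (\<nn> n + 1)"
    have "integral (cbox 0 1) g / 2 * N_of (\<nn> n) \<le> (\<Sum>p<N_of (\<nn> n). g (gpt (\<nn> n) p))"
      using elim(1,2) by (simp add: pos_less_divide_eq)
    also have "\<dots> \<le> (\<Sum>p<N_of (\<nn> n). if ?y p \<in> \<Omega> then 1 else 0)"
    proof (rule sum_mono)
      fix p assume "p \<in> {..<N_of (\<nn> n)}"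
      then have close: "dist (gpt (\<nn> n) p) (?y p) < r / 2" using elim(3) by simp
      show "g (gpt (\<nn> n) p) \<le> (if ?y p \<in> \<Omega> then 1 else 0)"
      proof (cases "?y p \<in> \<Omega>")
        case False
        have "dist (?y p) x0 \<ge> r"
        proof (rule ccontr)
          assume "\<not> dist (?y p) x0 \<ge> r"
          then have "?y p \<in> ball x0 r" by (simp add: dist_commute)
          with r(2) False show False by blast
        qed
        then have "dist (gpt (\<nn> n) p) x0 \<ge> r / 2" using close dist_triangle[of "?y p" x0 "gpt (\<nn> n) p"] dist_commute[of "?y p" "gpt (\<nn> n) p"] by linarith
        then have "1 \<le> dist (gpt (\<nn> n) p) x0 / (r / 2)" using r(1) by (simp add: le_divide_eq)
        then show ?thesis using False by (simp add: g_def)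
      qed (use r(1) in \<open>simp add: g_def\<close>)
    qed
    finally have le: "integral (cbox 0 1) g / 2 * N_of (\<nn> n) \<le> (\<Sum>p<N_of (\<nn> n). if ?y p \<in> \<Omega> then 1 else 0)" .
    have "{..<N_of (\<nn> n)} \<inter> {p. ?y p \<in> \<Omega>} = {p. p < N_of (\<nn> n) \<and> ?y p \<in> \<Omega>}" by auto
    then have "(\<Sum>p<N_of (\<nn> n). if ?y p \<in> \<Omega> then 1 else 0) = real (card {p. p < N_of (\<nn> n) \<and> ?y p \<in> \<Omega>})"
      unfolding sum.If_cases[OF finite_lessThan] by simp
    moreover have "card {p. p < N_of (\<nn> n) \<and> ?y p \<in> \<Omega>} = d_red (\<nn> n) \<Omega>"
      unfolding d_red_def by (rule card_midx[of "\<nn> n" "\<lambda>i. idx_div i (\<nn> n + 1) \<in> \<Omega>"])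
    ultimately show ?case using le by (simp only:)
  qed
  then show ?thesis by (intro exI[of _ "integral (cbox 0 1) g / 2"] conjI I(2))
qed

end

section \<open>Agreement with the definition of GLT sequences\<close>

lemma C_inf_on_continuous: assumes "C_inf_on S a" shows "continuous_on S a"
  using assms[unfolded C_inf_on_def, rule_format, of 0] by simp

lemma has_derivative_char_fun:
  "(char_fun k has_derivative (\<lambda>h. \<Sum>j\<in>UNIV. (h $ j) *\<^sub>R (\<i> * of_int (k $ j) * char_fun k x))) (at x within S)"
proof -
  let ?l = "\<lambda>\<theta>. (\<Sum>j\<in>UNIV. real_of_int (k $ j) * \<theta> $ j)"
  have "(?l has_derivative ?l) (at x within S)"
    by (intro has_derivative_sum has_derivative_mult_right bounded_linear.has_derivative[OF bounded_linear_vec_nth] has_derivative_ident)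
  then have "((\<lambda>\<theta>. \<i> * complex_of_real (?l \<theta>)) has_derivative (\<lambda>h. \<i> * complex_of_real (?l h))) (at x within S)"
    by (intro has_derivative_mult_right bounded_linear.has_derivative[OF bounded_linear_of_real])
  moreover have "(exp has_derivative (*) (exp z)) (at z)" for z :: complex
    using DERIV_exp[of z] by (simp add: has_field_derivative_def)
  ultimately have "((\<lambda>\<theta>. exp (\<i> * complex_of_real (?l \<theta>))) has_derivative
    (\<lambda>h. exp (\<i> * complex_of_real (?l x)) * (\<i> * complex_of_real (?l h)))) (at x within S)"
    by (rule has_derivative_compose)
  moreover have eq: "(\<lambda>\<theta>. exp (\<i> * complex_of_real (?l \<theta>))) = char_fun k"
    by (rule ext) (simp only: char_fun_def)
  moreover have eqx: "exp (\<i> * complex_of_real (?l x)) = char_fun k x" by (simp only: char_fun_def)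
  moreover have "exp (\<i> * complex_of_real (?l x)) * (\<i> * complex_of_real (?l h))
    = (\<Sum>j\<in>UNIV. (h $ j) *\<^sub>R (\<i> * of_int (k $ j) * char_fun k x))" for h
    unfolding eqx unfolding of_real_sum sum_distrib_left
    by (intro sum.cong refl) (simp add: scaleR_conv_of_real mult_ac)
  ultimately show ?thesis by simp
qed

text \<open>The partial derivatives are trigonometric sums with the same frequencies, so the
  induction on the order runs over all coefficients at once.\<close>

lemma C_k_on_trig_sum:
  assumes K: "finite K" shows "C_k_on m S (\<lambda>\<theta>. \<Sum>k\<in>K. c k * char_fun k \<theta>)"
proof (induction m arbitrary: c)
  case 0
  show ?case unfolding C_k_on.simps by (rule continuous_on_trig_poly) (use K in \<open>auto simp: trig_poly_def\<close>)
next
  case (Suc m)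
  have "((\<lambda>\<theta>. \<Sum>k\<in>K. c k * char_fun k \<theta>) has_derivative
    (\<lambda>h. \<Sum>j\<in>UNIV. (h $ j) *\<^sub>R (\<Sum>k\<in>K. (c k * (\<i> * of_int (k $ j))) * char_fun k x))) (at x within S)" for x
  proof -
    have "((\<lambda>\<theta>. \<Sum>k\<in>K. c k * char_fun k \<theta>) has_derivative
      (\<lambda>h. \<Sum>k\<in>K. c k * (\<Sum>j\<in>UNIV. (h $ j) *\<^sub>R (\<i> * of_int (k $ j) * char_fun k x)))) (at x within S)"
      by (intro has_derivative_sum has_derivative_mult_right has_derivative_char_fun)
    moreover have "(\<Sum>k\<in>K. c k * (\<Sum>j\<in>UNIV. (h $ j) *\<^sub>R (\<i> * of_int (k $ j) * char_fun k x)))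
      = (\<Sum>j\<in>UNIV. (h $ j) *\<^sub>R (\<Sum>k\<in>K. (c k * (\<i> * of_int (k $ j))) * char_fun k x))" for h
      unfolding sum_distrib_left scaleR_sum_right by (subst sum.swap) (simp add: mult.assoc)
    ultimately show ?thesis by simp
  qed
  then show ?case unfolding C_k_on.simps
    by (intro exI[of _ "\<lambda>j \<theta>. \<Sum>k\<in>K. (c k * (\<i> * of_int (k $ j))) * char_fun k \<theta>"] conjI allI ballI Suc)
qed

lemma C_inf_on_trig_poly: "trig_poly f \<Longrightarrow> C_inf_on S f"
  unfolding trig_poly_def C_inf_on_def using C_k_on_trig_sum by blast

lemma trig_poly_fourier:
  assumes "trig_poly f"
  obtains K where "finite K" "\<And>l. l \<notin> K \<Longrightarrow> fourier_coeff f l = 0" "\<And>\<theta>. f \<theta> = (\<Sum>k\<in>K. fourier_coeff f k * char_fun k \<theta>)"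
proof -
  obtain K c where K: "finite K" "f = (\<lambda>\<theta>. \<Sum>k\<in>K. c k * char_fun k \<theta>)" using assms unfolding trig_poly_def by blast
  have fc: "fourier_coeff f l = (if l \<in> K then c l else 0)" for l unfolding K(2) by (rule fourier_coeff_trig_sum[OF K(1)])
  show ?thesis
  proof (rule that[OF K(1)])
    show "f \<theta> = (\<Sum>k\<in>K. fourier_coeff f k * char_fun k \<theta>)" for \<theta>
      unfolding fc by (simp add: K(2))
  qed (simp add: fc)
qed

lemma fourier_coeff_char_fun: "fourier_coeff (char_fun k) l = (if l = k then 1 else 0)"
  using fourier_coeff_trig_sum[of "{k}" "\<lambda>_. 1" l] by simp

lemma diag_toeplitz_index:
  assumes "p < N_of n" "q < N_of n"
  shows "(diag_sampling n a * toeplitz n f) $$ (p, q) = a (gpt n p) * fourier_coeff f (idiff n p q)"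
proof -
  have "toeplitz n f \<in> carrier_mat (N_of n) (N_of n)" by (simp add: toeplitz_def)
  from mat_diag_mult_left[OF this] show ?thesis
    using assms by (simp add: diag_sampling_def toeplitz_def gpt_def idiff_def)
qed

text \<open>Fourier expansion of \<open>f\<close> turns a separated product into an elementary
  symbol, whose coefficients are exactly the entries computed in
  \<open>diag_toeplitz_index\<close>.\<close>

lemma elem_separated:
  assumes a: "continuous_on (cbox 0 1) a" and f: "trig_poly f"
  shows "elem (\<lambda>l x. a x * fourier_coeff f l)" "symb (\<lambda>l x. a x * fourier_coeff f l) (x, \<theta>) = a x * f \<theta>"
proof -
  obtain K where K: "finite K" "\<And>l. l \<notin> K \<Longrightarrow> fourier_coeff f l = 0" "\<And>\<theta>. f \<theta> = (\<Sum>k\<in>K. fourier_coeff f k * char_fun k \<theta>)"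
    by (rule trig_poly_fourier[OF f]) blast
  have "{l. (\<lambda>x. a x * fourier_coeff f l) \<noteq> (\<lambda>x. 0)} \<subseteq> K" using K(2) by force
  then show "elem (\<lambda>l x. a x * fourier_coeff f l)"
    unfolding elem_def using finite_subset[OF _ K(1)] by (intro conjI allI continuous_on_mult_right a) blast
  have "\<forall>k. k \<notin> K \<longrightarrow> (\<lambda>x. a x * fourier_coeff f k) = (\<lambda>x. 0)" using K(2) by simp
  from symb_eq[OF K(1) this] show "symb (\<lambda>l x. a x * fourier_coeff f l) (x, \<theta>) = a x * f \<theta>"
    unfolding K(3)[of \<theta>] by (simp add: sum_distrib_left mult.assoc)
qed

lemma elem_sum:
  fixes r :: nat
  assumes "\<And>i. i < r \<Longrightarrow> elem (e i)"
  shows "elem (\<lambda>l x. \<Sum>i<r. e i l x) \<and> symb (\<lambda>l x. \<Sum>i<r. e i l x) z = (\<Sum>i<r. symb (e i) z)"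
  using assms
proof (induction r)
  case 0
  show ?case by (cases z) (simp add: elem_def symb_def)
next
  case (Suc r)
  have eq: "(\<lambda>l x. \<Sum>i<Suc r. e i l x) = cadd (\<lambda>l x. \<Sum>i<r. e i l x) (e r)"
    by (intro ext) (simp add: cadd_def)
  have 1: "elem (\<lambda>l x. \<Sum>i<r. e i l x)" "symb (\<lambda>l x. \<Sum>i<r. e i l x) z = (\<Sum>i<r. symb (e i) z)" "elem (e r)"
    using Suc by auto
  show ?case unfolding eq using elem_cadd[OF 1(1,3)] symb_cadd[OF 1(1,3), of z] 1(2) by simp
qed

lemma measure_emeasure_sdom:
  fixes X :: "((real ^ 'd) \<times> (real ^ 'd)) set"
  assumes "X \<subseteq> sdom"
  shows "emeasure lebesgue X = ennreal (measure (lebesgue_on sdom) X)"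
proof -
  have "emeasure lebesgue X = emeasure (lebesgue_on sdom) X"
    using assms by (subst emeasure_restrict_space) auto
  also have "\<dots> = ennreal (measure (lebesgue_on sdom) X)"
    by (rule finite_measure.emeasure_eq_measure[OF finite_measure_sdom])
  finally show ?thesis .
qed

context grid
begin

text \<open>A single \<open>m\<close> for which norm, rank and measure errors all lie below
  \<open>\<epsilon>\<close> is enough. The sums of separated products become elementary symbols
  \<open>c m\<close> with merely continuous coefficients, as \<open>glt'I\<close> permits.\<close>

lemma glt_imp_glt':
  assumes "glt \<nn> A k" shows "glt' A k"
proof -
  have A: "A n \<in> carrier_mat (N_of (\<nn> n)) (N_of (\<nn> n))" for n
    using assms unfolding glt_def by blast
  have k: "k \<in> borel_measurable (lebesgue_on sdom)"
    using assms unfolding glt_def by blast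
  obtain r :: "nat \<Rightarrow> nat" and a f where af: "\<forall>m. \<forall>i<r m. C_inf_on (cbox 0 1) (a i m) \<and> trig_poly (f i m)"
    and conv: "conv_in_measure sdom (\<lambda>m (x, \<theta>). \<Sum>i<r m. a i m x * f i m \<theta>) k"
    and acs: "acs (\<lambda>n. N_of (\<nn> n)) (\<lambda>n m. mat (N_of (\<nn> n)) (N_of (\<nn> n))
            (\<lambda>pq. \<Sum>i<r m. (diag_sampling (\<nn> n) (a i m) * toeplitz (\<nn> n) (f i m)) $$ pq)) A"
    using assms unfolding glt_def by (elim exE conjE) (rule that)
  define e where "e m i l x = a i m x * fourier_coeff (f i m) l" for m i l x
  define c where "c m l x = (\<Sum>i<r m. e m i l x)" for m l x
  have e: "elem (e m i)" "symb (e m i) (x, \<theta>) = a i m x * f i m \<theta>" if i: "i < r m" for m i x \<theta>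
    using elem_separated[OF C_inf_on_continuous, of "a i m" "f i m"] af i unfolding e_def[abs_def] by auto
  have c: "elem (c m)" "symb (c m) z = (\<Sum>i<r m. symb (e m i) z)" for m z
    using elem_sum[of "r m" "e m" z] e(1)[of _ m] unfolding c_def[abs_def] by auto
  have symb_c: "(\<lambda>(x, \<theta>). \<Sum>i<r m. a i m x * f i m \<theta>) = symb (c m)" for m
    by (rule ext) (auto simp: c(2) e(2))
  have conv': "conv_in_measure sdom (\<lambda>m. symb (c m)) k" using conv unfolding symb_c .
  have Op_c: "mat (N_of (\<nn> n)) (N_of (\<nn> n))
      (\<lambda>pq. \<Sum>i<r m. (diag_sampling (\<nn> n) (a i m) * toeplitz (\<nn> n) (f i m)) $$ pq) = Op (\<nn> n) (c m)" for n m
    by (rule eq_matI) (auto simp: Op_index c_def e_def diag_toeplitz_index simp del: index_mult_mat(1))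
  obtain \<omega> s :: "nat \<Rightarrow> real" where lim: "\<omega> \<longlonglongrightarrow> 0" "s \<longlonglongrightarrow> 0"
    and NR: "\<forall>m. \<exists>n0. \<forall>n>n0. \<exists>N R. N \<in> carrier_mat (N_of (\<nn> n)) (N_of (\<nn> n)) \<and> R \<in> carrier_mat (N_of (\<nn> n)) (N_of (\<nn> n)) \<and>
         A n = Op (\<nn> n) (c m) + N + R \<and> spectral_norm N \<le> \<omega> m \<and> real (vec_space.rank (N_of (\<nn> n)) R) \<le> s m * real (N_of (\<nn> n))"
    using acs unfolding acs_def Op_c by (elim exE conjE) (rule that)
  show ?thesis
  proof (rule glt'I[OF A k])
    fix \<epsilon> :: real assume eps: "\<epsilon> > 0"
    have "(\<lambda>m. emeasure lebesgue {z \<in> sdom. cmod (symb (c m) z - k z) > \<epsilon>}) \<longlonglongrightarrow> 0"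
      using conv' eps unfolding conv_in_measure_def by blast
    then have "\<forall>\<^sub>F m in sequentially. emeasure lebesgue {z \<in> sdom. cmod (symb (c m) z - k z) > \<epsilon>} < ennreal \<epsilon>"
      by (rule order_tendstoD) (use eps in simp)
    then have "\<forall>\<^sub>F m in sequentially. emeasure lebesgue {z \<in> sdom. cmod (symb (c m) z - k z) > \<epsilon>} < ennreal \<epsilon> \<and> \<omega> m < \<epsilon> \<and> s m < \<epsilon>"
      using order_tendstoD(2)[OF lim(1) eps] order_tendstoD(2)[OF lim(2) eps] by eventually_elim simp
    then obtain m where m: "emeasure lebesgue {z \<in> sdom. cmod (symb (c m) z - k z) > \<epsilon>} < ennreal \<epsilon>" "\<omega> m < \<epsilon>" "s m < \<epsilon>"
      using eventually_happens'[OF sequentially_bot] by blast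
    have "fsplits (\<lambda>z. symb (c m) z - k z) \<epsilon> \<epsilon>" unfolding fsplits_def
    proof
      show "(\<lambda>z. symb (c m) z - k z) \<in> borel_measurable (lebesgue_on sdom)"
        by (intro borel_measurable_diff symb_measurable c(1) k)
      have "ennreal (measure (lebesgue_on sdom) {z \<in> sdom. \<epsilon> < cmod (symb (c m) z - k z)}) < ennreal \<epsilon>"
        using m(1) by (subst measure_emeasure_sdom[symmetric]) auto
      then show "measure (lebesgue_on sdom) {z \<in> sdom. \<epsilon> < cmod (symb (c m) z - k z)} \<le> \<epsilon>"
        using eps by (simp add: ennreal_less_iff)
    qed
    moreover obtain n0 where n0: "\<forall>n>n0. \<exists>N R. N \<in> carrier_mat (N_of (\<nn> n)) (N_of (\<nn> n)) \<and> R \<in> carrier_mat (N_of (\<nn> n)) (N_of (\<nn> n)) \<and>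
         A n = Op (\<nn> n) (c m) + N + R \<and> spectral_norm N \<le> \<omega> m \<and> real (vec_space.rank (N_of (\<nn> n)) R) \<le> s m * real (N_of (\<nn> n))"
      using NR[rule_format, of m] by (elim exE)
    have "sq_le (\<lambda>n. A n - Op (\<nn> n) (c m)) \<epsilon> \<epsilon>"
      unfolding sq_le_def using eventually_gt_at_top[of n0]
    proof eventually_elim
      case (elim n)
      then obtain N R where NR: "N \<in> carrier_mat (N_of (\<nn> n)) (N_of (\<nn> n))" "R \<in> carrier_mat (N_of (\<nn> n)) (N_of (\<nn> n))"
        "A n = Op (\<nn> n) (c m) + N + R" "spectral_norm N \<le> \<omega> m" "real (vec_space.rank (N_of (\<nn> n)) R) \<le> s m * real (N_of (\<nn> n))"
        using n0 by blast
      have "nbound N \<epsilon>" using NR(4) m(2) eps spectral_norm_le_iff[of \<epsilon> N] by simp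
      moreover have "real (vec_space.rank (N_of (\<nn> n)) R) \<le> \<epsilon> * N_of (\<nn> n)"
        by (rule order_trans[OF NR(5) mult_right_mono]) (use m(3) in auto)
      ultimately have "splits (N_of (\<nn> n)) (N + R) \<epsilon> (\<epsilon> * N_of (\<nn> n))"
        by (intro splitsI[OF NR(1,2) _ rank_le_rank[OF NR(2)]])
      moreover have "A n - Op (\<nn> n) (c m) = N + R" unfolding NR(3) using NR(1,2) by (intro eq_matI) auto
      ultimately show ?case by simp
    qed
    ultimately show "\<exists>c. elem c \<and> sq_le (\<lambda>n. A n - Op (\<nn> n) c) \<epsilon> \<epsilon> \<and> fsplits (\<lambda>z. symb c z - k z) \<epsilon> \<epsilon>"
      by (intro exI[of _ "c m"] conjI c(1))
  qed
qed

text \<open>Accuracies \<open>1 / (m + 1)\<close> produce the approximating sequence. A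
  trigonometric coefficient family is written as a sum of separated products, one for each frequency
  in its support.\<close>

lemma glt'_imp_glt:
  assumes A: "glt' A k" shows "glt \<nn> A k"
proof -
  define \<eta> where "\<eta> m = inverse (real (Suc m))" for m
  have eta: "\<eta> m > 0" "\<eta> \<longlonglongrightarrow> 0" for m
    unfolding \<eta>_def using LIMSEQ_inverse_real_of_nat by auto
  have "\<exists>c. \<forall>m. telem (c m) \<and> sq_le (\<lambda>n. A n - Op (\<nn> n) (c m)) (\<eta> m) (\<eta> m) \<and> fsplits (\<lambda>z. symb (c m) z - k z) (\<eta> m) (\<eta> m)"
    using A eta(1) unfolding glt'_def by (intro choice allI) blast
  then obtain c where c': "\<forall>m. telem (c m) \<and> sq_le (\<lambda>n. A n - Op (\<nn> n) (c m)) (\<eta> m) (\<eta> m) \<and> fsplits (\<lambda>z. symb (c m) z - k z) (\<eta> m) (\<eta> m)" ..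
  have c: "telem (c m)" "sq_le (\<lambda>n. A n - Op (\<nn> n) (c m)) (\<eta> m) (\<eta> m)" "fsplits (\<lambda>z. symb (c m) z - k z) (\<eta> m) (\<eta> m)" for m
    using c' by simp_all
  define K where "K m = {l. c m l \<noteq> (\<lambda>x. 0)}" for m
  have K: "finite (K m)" "trig_poly (c m l)" for m l using c(1)[of m] by (auto simp: telem_def K_def)
  define r where "r m = card (K m)" for m
  \<comment> \<open>Enumerates the support, because the definition of \<open>glt\<close> numbers its
    summands by \<open>i < r m\<close>.\<close>
  define h where "h m = (SOME h. bij_betw h {0..<card (K m)} (K m))" for m
  have h: "bij_betw (h m) {..<r m} (K m)" for m
    using someI_ex[OF ex_bij_betw_nat_finite[OF K(1)[of m]]] unfolding h_def r_def by (simp add: atLeast0LessThan)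
  have reindex: "(\<Sum>i<r m. g (h m i)) = (\<Sum>l\<in>K m. g l)" for m and g :: "_ \<Rightarrow> complex"
    by (rule sum.reindex_bij_betw[OF h])
  have symb_c: "(\<lambda>(x, \<theta>). \<Sum>i<r m. c m (h m i) x * char_fun (h m i) \<theta>) = symb (c m)" for m
    by (rule ext) (auto simp: symb_def K_def[symmetric] reindex[of "\<lambda>l. c m l _ * char_fun l _"])
  have Op_c: "mat (N_of (\<nn> n)) (N_of (\<nn> n))
      (\<lambda>pq. \<Sum>i<r m. (diag_sampling (\<nn> n) (c m (h m i)) * toeplitz (\<nn> n) (char_fun (h m i))) $$ pq) = Op (\<nn> n) (c m)" for n m
  proof (rule eq_matI)
    fix p q assume "p < dim_row (Op (\<nn> n) (c m))" "q < dim_col (Op (\<nn> n) (c m))"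
    then have pq: "p < N_of (\<nn> n)" "q < N_of (\<nn> n)" by auto
    let ?l = "idiff (\<nn> n) p q" and ?x = "gpt (\<nn> n) p"
    have "(\<Sum>i<r m. (diag_sampling (\<nn> n) (c m (h m i)) * toeplitz (\<nn> n) (char_fun (h m i))) $$ (p, q))
      = (\<Sum>i<r m. c m (h m i) ?x * (if ?l = h m i then 1 else 0))"
      by (intro sum.cong refl) (simp add: diag_toeplitz_index[OF pq] fourier_coeff_char_fun del: index_mult_mat(1))
    also have "\<dots> = (\<Sum>l\<in>K m. c m l ?x * (if ?l = l then 1 else 0))" by (rule reindex)
    also have "\<dots> = (\<Sum>l\<in>K m. if ?l = l then c m l ?x else 0)" by (intro sum.cong) auto
    also have "\<dots> = c m ?l ?x" unfolding sum.delta'[OF K(1)] by (auto simp: K_def)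
    also have "\<dots> = Op (\<nn> n) (c m) $$ (p, q)" by (simp add: Op_index pq)
    finally show "mat (N_of (\<nn> n)) (N_of (\<nn> n))
      (\<lambda>pq. \<Sum>i<r m. (diag_sampling (\<nn> n) (c m (h m i)) * toeplitz (\<nn> n) (char_fun (h m i))) $$ pq) $$ (p, q) = Op (\<nn> n) (c m) $$ (p, q)"
      using pq by (simp del: index_mult_mat(1))
  qed auto
  show ?thesis unfolding glt_def
  proof (intro conjI allI glt'_carrier[OF A] glt'_measurable[OF A])
    have tp: "trig_poly (char_fun l)" for l :: "int ^ 'd::{finite,linorder}" using trig_poly_char_fun[of 1 l] by simp
    have smooth: "\<forall>m. \<forall>i<r m. C_inf_on (cbox 0 1) (c m (h m i)) \<and> trig_poly (char_fun (h m i))"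
      by (intro allI impI conjI C_inf_on_trig_poly K tp)
    have conv: "conv_in_measure sdom (\<lambda>m. symb (c m)) k"
      unfolding conv_in_measure_def
    proof (intro allI impI)
      fix \<epsilon> :: real assume eps: "\<epsilon> > 0"
      have ub: "\<forall>\<^sub>F m in sequentially. emeasure lebesgue {z \<in> sdom. \<epsilon> < cmod (symb (c m) z - k z)} \<le> ennreal (\<eta> m)"
        using order_tendstoD(2)[OF eta(2) eps]
      proof eventually_elim
        case (elim m)
        have "fsplits (\<lambda>z. symb (c m) z - k z) \<epsilon> (\<eta> m)" by (rule fsplits_mono[OF c(3)]) (use elim in auto)
        then show ?case by (subst measure_emeasure_sdom) (auto simp: fsplits_def intro: ennreal_leI)
      qed
      have lim: "(\<lambda>m. ennreal (\<eta> m)) \<longlonglongrightarrow> 0" using tendsto_ennrealI[OF eta(2)] by simp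
      show "(\<lambda>m. emeasure lebesgue {z \<in> sdom. \<epsilon> < cmod (symb (c m) z - k z)}) \<longlonglongrightarrow> 0"
        by (rule tendsto_sandwich[OF _ ub tendsto_const lim]) simp
    qed
    have acs: "acs (\<lambda>n. N_of (\<nn> n)) (\<lambda>n m. Op (\<nn> n) (c m)) A"
      unfolding acs_def
    proof (intro exI[of _ \<eta>] conjI eta(2) allI)
      fix m
      obtain n0 where n0: "\<forall>n\<ge>n0. splits (N_of (\<nn> n)) (A n - Op (\<nn> n) (c m)) (\<eta> m) (\<eta> m * N_of (\<nn> n))"
        using c(2)[of m] unfolding sq_le_def eventually_sequentially by blast
      show "\<exists>n0. \<forall>n>n0. \<exists>N R. N \<in> carrier_mat (N_of (\<nn> n)) (N_of (\<nn> n)) \<and> R \<in> carrier_mat (N_of (\<nn> n)) (N_of (\<nn> n)) \<and>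
         A n = Op (\<nn> n) (c m) + N + R \<and> spectral_norm N \<le> \<eta> m \<and> real (vec_space.rank (N_of (\<nn> n)) R) \<le> \<eta> m * real (N_of (\<nn> n))"
      proof (intro exI[of _ n0] allI impI)
        fix n assume "n > n0"
        then have "splits (N_of (\<nn> n)) (A n - Op (\<nn> n) (c m)) (\<eta> m) (\<eta> m * N_of (\<nn> n))" using n0 by simp
        then obtain N R s where NR: "N \<in> carrier_mat (N_of (\<nn> n)) (N_of (\<nn> n))" "R \<in> carrier_mat (N_of (\<nn> n)) (N_of (\<nn> n))"
          "A n - Op (\<nn> n) (c m) = N + R" "nbound N (\<eta> m)" "rank_le R s" "real s \<le> \<eta> m * N_of (\<nn> n)"
          by (rule splitsE)
        have cA: "A n \<in> carrier_mat (N_of (\<nn> n)) (N_of (\<nn> n))" by (rule glt'_carrier[OF A])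
        have "Op (\<nn> n) (c m) + (A n - Op (\<nn> n) (c m)) = A n" using cA by (intro eq_matI) auto
        then have "A n = Op (\<nn> n) (c m) + N + R"
          unfolding NR(3) assoc_add_mat[OF Op_carrier NR(1,2)] by (rule sym)
        moreover have "spectral_norm N \<le> \<eta> m" using NR(4) spectral_norm_le_iff[of "\<eta> m" N] eta(1)[of m] by simp
        moreover have "real (vec_space.rank (N_of (\<nn> n)) R) \<le> \<eta> m * real (N_of (\<nn> n))"
          using rank_le_imp_rank[OF NR(2,5)] NR(6) by linarith
        ultimately show "\<exists>N R. N \<in> carrier_mat (N_of (\<nn> n)) (N_of (\<nn> n)) \<and> R \<in> carrier_mat (N_of (\<nn> n)) (N_of (\<nn> n)) \<and>
         A n = Op (\<nn> n) (c m) + N + R \<and> spectral_norm N \<le> \<eta> m \<and> real (vec_space.rank (N_of (\<nn> n)) R) \<le> \<eta> m * real (N_of (\<nn> n))"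
          by (intro exI[of _ N] exI[of _ R] conjI NR(1,2))
      qed
    qed
    show "\<exists>(r :: nat \<Rightarrow> nat) a f. (\<forall>m. \<forall>i<r m. C_inf_on (cbox 0 1) (a i m) \<and> trig_poly (f i m)) \<and>
       conv_in_measure sdom (\<lambda>m (x, \<theta>). \<Sum>i<r m. a i m x * f i m \<theta>) k \<and>
       acs (\<lambda>n. N_of (\<nn> n)) (\<lambda>n m. mat (N_of (\<nn> n)) (N_of (\<nn> n))
            (\<lambda>pq. \<Sum>i<r m. (diag_sampling (\<nn> n) (a i m) * toeplitz (\<nn> n) (f i m)) $$ pq)) A"
      using smooth conv[folded symb_c] acs[folded Op_c]
      by (intro exI[of _ r] exI[of _ "\<lambda>i m. c m (h m i)"] exI[of _ "\<lambda>i m. char_fun (h m i)"] conjI)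
  qed
qed

lemma glt_iff: "glt \<nn> A k \<longleftrightarrow> glt' A k"
  using glt_imp_glt' glt'_imp_glt by blast

lemma glt'_scalar: "glt' (\<lambda>n. a \<cdot>\<^sub>m 1\<^sub>m (N_of (\<nn> n))) (\<lambda>z. a)"
proof -
  define c where "c = cscale a (cmono (0 :: int ^ 'd::{finite,linorder}) (\<lambda>x. 1))"
  have e: "elem (cmono (0 :: int ^ 'd::{finite,linorder}) (\<lambda>x. 1))" by (rule elem_cmono) simp
  then have "elem c" unfolding c_def by (rule elem_cscale)
  from glt'_Op[OF this] have "glt' (\<lambda>n. a \<cdot>\<^sub>m 1\<^sub>m (N_of (\<nn> n))) (symb c)"
    unfolding c_def Op_cscale Op_one .
  moreover have "symb c = (\<lambda>z. a)"
  proof (rule ext)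
    fix z :: "(real ^ 'd::{finite,linorder}) \<times> (real ^ 'd::{finite,linorder})"
    show "symb c z = a" by (cases z) (simp add: c_def symb_cscale[OF e] symb_cmono char_fun_def)
  qed
  ultimately show ?thesis by (simp only:)
qed

lemma glt'_smult: assumes A: "glt' A k" shows "glt' (\<lambda>n. a \<cdot>\<^sub>m A n) (\<lambda>z. a * k z)"
proof -
  have eq: "a \<cdot>\<^sub>m 1\<^sub>m (N_of (\<nn> n)) * A n = a \<cdot>\<^sub>m A n" for n
    unfolding mult_smult_assoc_mat[OF one_carrier_mat glt'_carrier[OF A, of n]] left_mult_one_mat[OF glt'_carrier[OF A, of n]] ..
  show ?thesis using glt'_mult[OF glt'_scalar[of a] A] unfolding eq .
qed

end

section \<open>Principal submatrices\<close>

lemma nbound_isometry: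
  assumes V: "V \<in> carrier_mat n m" and iso: "mat_adjoint V * V = 1\<^sub>m m"
  shows "nbound V 1"
  unfolding nbound_def
proof
  fix v :: "complex Matrix.vec" assume "v \<in> carrier_vec (dim_col V)"
  then have v: "v \<in> carrier_vec m" using V by simp
  have Vv: "V *\<^sub>v v \<in> carrier_vec n" using V by (rule mult_mat_vec_carrier) (rule v)
  have "mat_adjoint V *\<^sub>v (V *\<^sub>v v) = (mat_adjoint V * V) *\<^sub>v v"
    by (rule assoc_mult_mat_vec[symmetric, OF mat_adjoint_carrier[OF V] V v])
  then have "mat_adjoint V *\<^sub>v (V *\<^sub>v v) = v" unfolding iso using v by simp
  then have "ip (V *\<^sub>v v) (V *\<^sub>v v) = ip v v" using ip_adjoint[OF V v Vv] by simp
  then have "(vnorm (V *\<^sub>v v))\<^sup>2 = (vnorm v)\<^sup>2" unfolding ip_self of_real_eq_iff .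
  then have "vnorm (V *\<^sub>v v) = vnorm v" by (rule power2_eq_imp_eq) auto
  then show "vnorm (V *\<^sub>v v) \<le> 1 * vnorm v" by simp
qed

text \<open>Multiplication by contractions on both sides increases neither norm nor rank, even when
  it changes the size. This covers restriction to a principal submatrix as well as extension by
  zeros.\<close>

lemma splits_conj:
  assumes X: "X \<in> carrier_mat m n" "nbound X 1" and Y: "Y \<in> carrier_mat n m" "nbound Y 1"
    and A: "splits n A M r" and M: "M \<ge> 0"
  shows "splits m (X * A * Y) M r"
proof -
  obtain N R s where 1: "N \<in> carrier_mat n n" "R \<in> carrier_mat n n" "A = N + R" "nbound N M" "rank_le R s" "real s \<le> r"
    using A by (rule splitsE)
  note XN = mult_carrier_mat[OF X(1) 1(1)] and XR = mult_carrier_mat[OF X(1) 1(2)]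
  have eq: "X * A * Y = X * N * Y + X * R * Y"
    unfolding 1(3) mult_add_distrib_mat[OF X(1) 1(1,2)] by (rule add_mult_distrib_mat[OF XN XR Y(1)])
  have "nbound (X * N) (1 * M)" by (rule nbound_mult[OF X(1) 1(1) X(2) 1(4)]) simp
  then have "nbound (X * N * Y) (1 * M * 1)" by (rule nbound_mult[OF XN Y(1) _ Y(2)]) (use M in simp)
  then have "nbound (X * N * Y) M" by simp
  then show ?thesis unfolding eq
    by (intro splitsI[OF mult_carrier_mat[OF XN Y(1)] mult_carrier_mat[OF XR Y(1)] _ _ 1(6)]
        rank_le_mult_right[OF XR Y(1)] rank_le_mult_left[OF X(1) 1(2,5)])
qed

text \<open>The columns are the unit vectors of the selected positions, so conjugation by this
  matrix extracts a submatrix.\<close>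

definition sel :: "nat \<Rightarrow> nat \<Rightarrow> (nat \<Rightarrow> nat) \<Rightarrow> complex mat" where
  "sel n d \<pi> = mat n d (\<lambda>(p, i). if p = \<pi> i then 1 else 0)"

lemma sel_carrier [simp]: "sel n d \<pi> \<in> carrier_mat n d"
  by (simp add: sel_def)

lemma adj_sel_mult:
  assumes A: "A \<in> carrier_mat n m" and i: "i < d" "\<pi> i < n" and q: "q < m"
  shows "(mat_adjoint (sel n d \<pi>) * A) $$ (i, q) = A $$ (\<pi> i, q)"
proof -
  have "(mat_adjoint (sel n d \<pi>) * A) $$ (i, q) = (\<Sum>l<n. mat_adjoint (sel n d \<pi>) $$ (i, l) * A $$ (l, q))"
    by (rule mat_mult_index[OF mat_adjoint_carrier[OF sel_carrier] A i(1) q])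
  also have "\<dots> = (\<Sum>l<n. if l = \<pi> i then A $$ (l, q) else 0)"
    using i by (intro sum.cong refl) (auto simp: sel_def)
  also have "\<dots> = A $$ (\<pi> i, q)" using i(2) by simp
  finally show ?thesis .
qed

lemma mult_sel:
  assumes A: "A \<in> carrier_mat m n" and i: "i < d" "\<pi> i < n" and p: "p < m"
  shows "(A * sel n d \<pi>) $$ (p, i) = A $$ (p, \<pi> i)"
proof -
  have "(A * sel n d \<pi>) $$ (p, i) = (\<Sum>l<n. A $$ (p, l) * sel n d \<pi> $$ (l, i))"
    by (rule mat_mult_index[OF A sel_carrier p i(1)])
  also have "\<dots> = (\<Sum>l<n. if l = \<pi> i then A $$ (p, l) else 0)"
    using i by (intro sum.cong refl) (auto simp: sel_def)
  also have "\<dots> = A $$ (p, \<pi> i)" using i(2) by simp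
  finally show ?thesis .
qed

lemma sel_isometry:
  assumes "\<And>i. i < d \<Longrightarrow> \<pi> i < n" "inj_on \<pi> {..<d}"
  shows "mat_adjoint (sel n d \<pi>) * sel n d \<pi> = 1\<^sub>m d"
proof (rule eq_matI)
  fix i j assume "i < dim_row (1\<^sub>m d :: complex mat)" "j < dim_col (1\<^sub>m d :: complex mat)"
  then have ij: "i < d" "j < d" by auto
  have "\<pi> i = \<pi> j \<longleftrightarrow> i = j" using inj_on_eq_iff[OF assms(2)] ij by simp
  then show "(mat_adjoint (sel n d \<pi>) * sel n d \<pi>) $$ (i, j) = 1\<^sub>m d $$ (i, j)"
    unfolding adj_sel_mult[where \<pi>=\<pi>, OF sel_carrier ij(1) assms(1)[OF ij(1)] ij(2)]
    using ij assms(1)[OF ij(1)] by (simp add: sel_def)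
qed (auto simp: sel_def)

lemma sel_proj:
  assumes pi: "bij_betw \<pi> {..<d} I"
  shows "sel n d \<pi> * mat_adjoint (sel n d \<pi>) = mat_diag n (\<lambda>p. if p \<in> I then 1 else 0)"
proof (rule eq_matI)
  fix p q assume "p < dim_row (mat_diag n (\<lambda>p. if p \<in> I then 1 else 0 :: complex))" "q < dim_col (mat_diag n (\<lambda>p. if p \<in> I then 1 else 0 :: complex))"
  then have pq: "p < n" "q < n" by (auto simp: mat_diag_def)
  have "finite I" using bij_betw_finite[OF pi] by simp
  have "(sel n d \<pi> * mat_adjoint (sel n d \<pi>)) $$ (p, q) = (\<Sum>i<d. sel n d \<pi> $$ (p, i) * mat_adjoint (sel n d \<pi>) $$ (i, q))"
    by (rule mat_mult_index[OF sel_carrier mat_adjoint_carrier[OF sel_carrier] pq])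
  also have "\<dots> = (\<Sum>i<d. if \<pi> i = p then (if p = q then 1 else 0) else 0)"
    using pq by (intro sum.cong refl) (auto simp: sel_def)
  also have "\<dots> = (\<Sum>x\<in>I. if x = p then (if p = q then 1 else 0) else 0)"
    by (rule sum.reindex_bij_betw[OF pi])
  also have "\<dots> = (if p \<in> I then (if p = q then 1 else 0) else 0)" by (rule sum.delta[OF \<open>finite I\<close>])
  finally show "(sel n d \<pi> * mat_adjoint (sel n d \<pi>)) $$ (p, q) = mat_diag n (\<lambda>p. if p \<in> I then 1 else 0) $$ (p, q)"
    using pq by (simp add: mat_diag_def)
qed (auto simp: sel_def mat_diag_def)

lemma assoc_mult_mat_dim:
  fixes A B C :: "complex mat"
  assumes "dim_col A = dim_row B" "dim_col B = dim_row C"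
  shows "A * B * C = A * (B * C)"
  by (rule assoc_mult_mat[of _ "dim_row A" "dim_col A" _ "dim_col B" _ "dim_col C"]) (use assms in auto)

section \<open>Zero-distributed sequences\<close>

lemma sum_mset_test_le:
  fixes f :: "real \<Rightarrow> real"
  assumes "\<And>x. f x \<le> 1" "\<And>x. \<epsilon> < x \<Longrightarrow> f x = 0"
  shows "(\<Sum>\<sigma>\<in>#M. f \<sigma>) + size (filter_mset (\<lambda>s. \<epsilon> < s) M) \<le> size M"
proof (induction M)
  case (add x M)
  then show ?case using assms(1)[of x] assms(2)[of x] by (cases "\<epsilon> < x") auto
qed simp

lemma complex_of_real_sum_mset: "of_real (\<Sum>\<sigma>\<in>#M. f \<sigma>) = (\<Sum>\<sigma>\<in>#M. complex_of_real (f \<sigma>))"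
  by (induction M) auto

lemma norm_sum_mset_diff_le:
  fixes F :: "real \<Rightarrow> complex"
  assumes "\<forall>\<sigma>\<in>#M. 0 \<le> \<sigma>" "\<And>x. 0 \<le> x \<Longrightarrow> x \<le> \<delta> \<Longrightarrow> cmod (F x - a) \<le> e" "\<And>x. cmod (F x - a) \<le> B" "e \<ge> 0"
  shows "cmod ((\<Sum>\<sigma>\<in>#M. F \<sigma>) - of_nat (size M) * a) \<le> e * size M + B * size (filter_mset (\<lambda>s. \<delta> < s) M)"
  using assms(1)
proof (induction M)
  case (add x M)
  have eq: "(\<Sum>\<sigma>\<in>#add_mset x M. F \<sigma>) - of_nat (size (add_mset x M)) * a = (F x - a) + ((\<Sum>\<sigma>\<in>#M. F \<sigma>) - of_nat (size M) * a)"
    by (simp add: algebra_simps)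
  have "cmod (F x - a) \<le> e + (if \<delta> < x then B else 0)"
    using assms(2)[of x] assms(3)[of x] assms(4) add.prems by (cases "\<delta> < x") auto
  moreover have "cmod ((\<Sum>\<sigma>\<in>#M. F \<sigma>) - of_nat (size M) * a) \<le> e * size M + B * size (filter_mset (\<lambda>s. \<delta> < s) M)"
    using add by auto
  ultimately have "cmod (F x - a) + cmod ((\<Sum>\<sigma>\<in>#M. F \<sigma>) - of_nat (size M) * a)
    \<le> e * size (add_mset x M) + B * size (filter_mset (\<lambda>s. \<delta> < s) (add_mset x M))"
    by (simp add: algebra_simps split: if_splits)
  then show ?case unfolding eq by (rule order_trans[OF norm_triangle_ineq])
qed simp

context grid_domain
begin

abbreviation dd :: "nat \<Rightarrow> nat" where "dd n \<equiv> d_red (\<nn> n) \<Omega>"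

abbreviation NN :: "nat \<Rightarrow> nat" where "NN n \<equiv> N_of (\<nn> n)"

lemma dd_le_NN: "dd n \<le> NN n"
  unfolding d_red_def card_index_set[symmetric] by (rule card_mono) auto

lemma eventually_dd_pos: "\<forall>\<^sub>F n in sequentially. dd n > 0"
proof -
  obtain \<kappa> where k: "0 < \<kappa>" "\<forall>\<^sub>F n in sequentially. \<kappa> * real (NN n) \<le> real (dd n)" using d_red_lower by blast
  from k(2) eventually_N_pos show ?thesis
  proof eventually_elim
    case (elim n)
    have "0 < \<kappa> * real (NN n)" using k(1) elim(2) by simp
    then have "0 < real (dd n)" using elim(1) by linarith
    then show ?case by simp
  qed
qed

text \<open>Both directions go through \<open>sv_count\<close>. A tent test function shows that few
  singular values exceed \<open>\<epsilon>\<close>; conversely, values near 0 contribute almost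
  \<open>F 0\<close>, and the few others have bounded effect.\<close>

lemma zero_distributed_iff:
  "zero_distributed \<nn> \<Omega> Z \<longleftrightarrow>
    (\<forall>n. Z n \<in> carrier_mat (dd n) (dd n)) \<and> (\<forall>\<epsilon>>0. \<forall>\<^sub>F n in sequentially. splits (dd n) (Z n) \<epsilon> (\<epsilon> * dd n))"
proof (cases "\<forall>n. Z n \<in> carrier_mat (dd n) (dd n)")
  case False
  then show ?thesis unfolding zero_distributed_def by blast
next
  case True
  then have Z: "Z n \<in> carrier_mat (dd n) (dd n)" for n by simp
  show ?thesis
  proof
    assume zd: "zero_distributed \<nn> \<Omega> Z"
    have spl: "\<forall>\<^sub>F n in sequentially. splits (dd n) (Z n) \<epsilon> (\<epsilon> * dd n)" if e: "\<epsilon> > 0" for \<epsilon>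
    proof -
      \<comment> \<open>The tent has height 1 at 0 and vanishes beyond \<open>\<epsilon>\<close>, so
        an average above \<open>1 - \<epsilon>\<close> leaves at most the proportion
        \<open>\<epsilon>\<close> of the singular values above \<open>\<epsilon>\<close>.\<close>
      define f where "f x = max 0 (1 - \<bar>x\<bar> / \<epsilon>)" for x :: real
      have cont: "continuous_on UNIV (\<lambda>x. complex_of_real (f x))" unfolding f_def by (intro continuous_intros) (use e in auto)
      have "{x. complex_of_real (f x) \<noteq> 0} \<subseteq> cball 0 \<epsilon>" using e by (auto simp: f_def max_def field_simps split: if_splits)
      then have "bounded {x. complex_of_real (f x) \<noteq> 0}" by (rule bounded_subset[OF bounded_cball])
      then have comp: "compact (closure {x. complex_of_real (f x) \<noteq> 0})"
        unfolding compact_eq_bounded_closed using bounded_closure closed_closure by blast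
      have "\<forall>F :: real \<Rightarrow> complex. continuous_on UNIV F \<longrightarrow> compact (closure {x. F x \<noteq> 0}) \<longrightarrow>
          (\<lambda>n. (\<Sum>\<sigma>\<in>#singular_values (Z n). F \<sigma>) / of_nat (dd n)) \<longlonglongrightarrow> F 0"
        using zd unfolding zero_distributed_def by (rule conjunct2)
      from spec[OF this, of "\<lambda>x. complex_of_real (f x)"] cont comp
      have "(\<lambda>n. (\<Sum>\<sigma>\<in>#singular_values (Z n). complex_of_real (f \<sigma>)) / of_nat (dd n)) \<longlonglongrightarrow> complex_of_real (f 0)"
        by (elim impE)
      then have "(\<lambda>n. complex_of_real ((\<Sum>\<sigma>\<in>#singular_values (Z n). f \<sigma>) / dd n)) \<longlonglongrightarrow> complex_of_real (f 0)"
        unfolding of_real_divide of_real_of_nat_eq complex_of_real_sum_mset .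
      then have "(\<lambda>n. (\<Sum>\<sigma>\<in>#singular_values (Z n). f \<sigma>) / dd n) \<longlonglongrightarrow> f 0" unfolding tendsto_of_real_iff .
      moreover have "1 - \<epsilon> < f 0" using e by (simp add: f_def)
      ultimately have "\<forall>\<^sub>F n in sequentially. 1 - \<epsilon> < (\<Sum>\<sigma>\<in>#singular_values (Z n). f \<sigma>) / dd n" by (rule order_tendstoD)
      then show ?thesis using eventually_dd_pos
      proof eventually_elim
        case (elim n)
        have "(\<Sum>\<sigma>\<in>#singular_values (Z n). f \<sigma>) + sv_count (Z n) \<epsilon> \<le> size (singular_values (Z n))"
          unfolding sv_count_def
        proof (rule sum_mset_test_le)
          show "f x \<le> 1" for x using e by (simp add: f_def)
          show "f x = 0" if "\<epsilon> < x" for x using that e by (simp add: f_def max_def field_simps)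
        qed
        then have "(\<Sum>\<sigma>\<in>#singular_values (Z n). f \<sigma>) + sv_count (Z n) \<epsilon> \<le> dd n" by (simp only: size_singular_values[OF Z])
        moreover have "(1 - \<epsilon>) * dd n < (\<Sum>\<sigma>\<in>#singular_values (Z n). f \<sigma>)"
          using elim by (simp add: pos_less_divide_eq)
        ultimately have "real (sv_count (Z n) \<epsilon>) \<le> \<epsilon> * dd n" by (simp add: left_diff_distrib)
        then show ?case using splits_iff_sv_count[OF Z] e by simp
      qed
    qed
    show "(\<forall>n. Z n \<in> carrier_mat (dd n) (dd n)) \<and> (\<forall>\<epsilon>>0. \<forall>\<^sub>F n in sequentially. splits (dd n) (Z n) \<epsilon> (\<epsilon> * dd n))"
      by (intro conjI allI impI Z spl)
  next
    assume *: "(\<forall>n. Z n \<in> carrier_mat (dd n) (dd n)) \<and> (\<forall>\<epsilon>>0. \<forall>\<^sub>F n in sequentially. splits (dd n) (Z n) \<epsilon> (\<epsilon> * dd n))"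
    have lim: "(\<lambda>n. (\<Sum>\<sigma>\<in>#singular_values (Z n). F \<sigma>) / of_nat (dd n)) \<longlonglongrightarrow> F 0"
      if F: "continuous_on UNIV F" "compact (closure {x. F x \<noteq> 0})" for F :: "real \<Rightarrow> complex"
    proof (rule tendstoI)
      fix e :: real assume e: "e > 0"
      have "bounded (F ` closure {x. F x \<noteq> 0})"
        by (intro compact_imp_bounded compact_continuous_image F(2) continuous_on_subset[OF F(1)]) simp
      then obtain B0 where B0: "\<forall>y\<in>F ` closure {x. F x \<noteq> 0}. cmod y \<le> B0" unfolding bounded_iff by blast
      \<comment> \<open>The maximum with 0 covers the points where \<open>F\<close> vanishes, since
        \<open>B0\<close> bounds \<open>F\<close> only on the closure of its nonzero set.\<close>
      define B where "B = max B0 0 + cmod (F 0)"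
      have FB: "cmod (F x - F 0) \<le> B" for x
      proof -
        have "cmod (F x) \<le> max B0 0"
        proof (cases "F x = 0")
          case False
          then have "x \<in> closure {x. F x \<noteq> 0}" using closure_subset[of "{x. F x \<noteq> 0}"] by blast
          then have "cmod (F x) \<le> B0" using B0 by blast
          then show ?thesis by simp
        qed simp
        then show ?thesis using norm_triangle_ineq4[of "F x" "F 0"] unfolding B_def by linarith
      qed
      have Bn: "B \<ge> 0" by (simp add: B_def)
      have "isCont F 0" using F(1) by (simp add: continuous_on_eq_continuous_at)
      moreover have "e / 2 > 0" using e by simp
      ultimately obtain \<eta> where eta: "\<eta> > 0" "\<forall>x. dist x 0 < \<eta> \<longrightarrow> dist (F x) (F 0) < e / 2"
        unfolding continuous_at_eps_delta by blast
      \<comment> \<open>The first term keeps singular values up to \<open>\<delta>\<close> in the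
        range where \<open>F\<close> is close to \<open>F 0\<close>; the second keeps
        \<open>B * \<delta>\<close>, the effect of the larger ones, below
        \<open>e / 2\<close>.\<close>
      define \<delta> where "\<delta> = min (\<eta> / 2) (e / (4 * (B + 1)))"
      have d: "\<delta> > 0" unfolding \<delta>_def using eta(1) e Bn by simp
      have "\<delta> \<le> e / (4 * (B + 1))" by (simp add: \<delta>_def)
      then have "\<delta> * (4 * (B + 1)) \<le> e" using Bn by (simp add: pos_le_divide_eq)
      then have Bd: "B * \<delta> < e / 2" using d e Bn by (simp add: algebra_simps)
      have near: "cmod (F x - F 0) \<le> e / 2" if "0 \<le> x" "x \<le> \<delta>" for x
        using eta that by (simp add: \<delta>_def dist_norm less_imp_le)
      have "\<forall>\<^sub>F n in sequentially. splits (dd n) (Z n) \<delta> (\<delta> * dd n)" using * d by blast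
      then show "\<forall>\<^sub>F n in sequentially. dist ((\<Sum>\<sigma>\<in>#singular_values (Z n). F \<sigma>) / of_nat (dd n)) (F 0) < e"
        using eventually_dd_pos
      proof eventually_elim
        case (elim n)
        let ?s = "\<Sum>\<sigma>\<in>#singular_values (Z n). F \<sigma>"
        have sv: "real (sv_count (Z n) \<delta>) \<le> \<delta> * dd n"
          using elim(1) splits_iff_sv_count[OF Z] d by simp
        have nn: "\<forall>\<sigma>\<in>#singular_values (Z n). 0 \<le> \<sigma>"
          using singular_values_bounds(1)[OF Z nbound_frob] by (simp add: frob_nonneg)
        have "cmod (?s - of_nat (size (singular_values (Z n))) * F 0)
          \<le> e / 2 * size (singular_values (Z n)) + B * sv_count (Z n) \<delta>"
          unfolding sv_count_def by (rule norm_sum_mset_diff_le[OF nn near FB]) (use e in auto)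
        then have "cmod (?s - of_nat (dd n) * F 0) \<le> e / 2 * dd n + B * sv_count (Z n) \<delta>"
          by (simp only: size_singular_values[OF Z])
        also have "\<dots> \<le> e / 2 * dd n + B * (\<delta> * dd n)"
          by (intro add_left_mono mult_left_mono sv Bn)
        also have "\<dots> = (e / 2 + B * \<delta>) * dd n" by (simp add: algebra_simps)
        also have "\<dots> < e * dd n" by (rule mult_strict_right_mono) (use Bd elim(2) in auto)
        finally have lt: "cmod (?s - of_nat (dd n) * F 0) < e * dd n" .
        have "?s / of_nat (dd n) - F 0 = (?s - of_nat (dd n) * F 0) / of_nat (dd n)"
          using elim(2) by (simp add: field_simps)
        then have "dist (?s / of_nat (dd n)) (F 0) = cmod (?s - of_nat (dd n) * F 0) / dd n"
          unfolding dist_norm by (simp add: norm_divide)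
        then show ?case using lt elim(2) by (simp add: pos_divide_less_eq)
      qed
    qed
    show "zero_distributed \<nn> \<Omega> Z" unfolding zero_distributed_def by (intro conjI allI impI Z lim)
  qed
qed

section \<open>Restriction as compression by an isometry\<close>

definition red_idx :: "nat \<Rightarrow> nat set" where
  "red_idx n = {p. p < NN n \<and> idx_div (midx (\<nn> n) p) (\<nn> n + 1) \<in> \<Omega>}"

lemma card_red_idx: "card (red_idx n) = dd n"
  unfolding red_idx_def d_red_def by (rule card_midx[of "\<nn> n" "\<lambda>i. idx_div i (\<nn> n + 1) \<in> \<Omega>"])

lemma finite_red_idx: "finite (red_idx n)"
  unfolding red_idx_def by simp

lemma bij_pick: "bij_betw (pick (red_idx n)) {..<dd n} (red_idx n)"
proof -
  have inj: "inj_on (pick (red_idx n)) {..<dd n}"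
  proof (rule inj_onI)
    fix i j assume ij: "i \<in> {..<dd n}" "j \<in> {..<dd n}" "pick (red_idx n) i = pick (red_idx n) j"
    show "i = j"
    proof (rule ccontr)
      assume "i \<noteq> j"
      then consider "i < j" | "j < i" by linarith
      then show False
      proof cases
        case 1
        have "pick (red_idx n) i < pick (red_idx n) j"
          by (rule pick_mono_le[OF _ 1]) (use ij in \<open>simp add: card_red_idx\<close>)
        then show False using ij(3) by simp
      next
        case 2
        have "pick (red_idx n) j < pick (red_idx n) i"
          by (rule pick_mono_le[OF _ 2]) (use ij in \<open>simp add: card_red_idx\<close>)
        then show False using ij(3) by simp
      qed
    qed
  qed
  have "pick (red_idx n) ` {..<dd n} \<subseteq> red_idx n"
    by (auto intro: pick_in_set_le simp: card_red_idx)
  moreover have "card (pick (red_idx n) ` {..<dd n}) = card (red_idx n)"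
    using card_image[OF inj] by (simp add: card_red_idx)
  ultimately have "pick (red_idx n) ` {..<dd n} = red_idx n" by (rule card_subset_eq[OF finite_red_idx])
  then show ?thesis using inj by (simp add: bij_betw_def)
qed

text \<open>The isometric embedding of the reduced index space. \<open>pick\<close> lists the
  selected positions in increasing order, which is the order that \<open>submatrix\<close>
  uses.\<close>

definition emb :: "nat \<Rightarrow> complex mat" where
  "emb n = sel (NN n) (dd n) (pick (red_idx n))"

lemma pick_less: "i < dd n \<Longrightarrow> pick (red_idx n) i < NN n"
  using bij_betw_apply[OF bij_pick, of i n] by (simp add: red_idx_def)

lemma emb_carrier [simp]: "emb n \<in> carrier_mat (NN n) (dd n)" "mat_adjoint (emb n) \<in> carrier_mat (dd n) (NN n)"
  by (simp_all add: emb_def)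

lemma emb_dim [simp]: "dim_row (emb n) = NN n" "dim_col (emb n) = dd n"
  by (rule carrier_matD[OF emb_carrier(1)])+

lemma emb_isometry: "mat_adjoint (emb n) * emb n = 1\<^sub>m (dd n)"
  unfolding emb_def by (rule sel_isometry[OF pick_less bij_betw_imp_inj_on[OF bij_pick]])

lemma emb_proj: "emb n * mat_adjoint (emb n) = proj n"
proof -
  have "emb n * mat_adjoint (emb n) = mat_diag (NN n) (\<lambda>p. if p \<in> red_idx n then 1 else 0)"
    unfolding emb_def by (rule sel_proj[OF bij_pick])
  also have "\<dots> = proj n" unfolding proj_def by (rule eq_matI) (auto simp: mat_diag_def red_idx_def)
  finally show ?thesis .
qed

lemma nbound_emb: "nbound (emb n) 1" "nbound (mat_adjoint (emb n)) 1"
  using nbound_isometry[OF emb_carrier(1) emb_isometry] nbound_adjoint by auto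

abbreviation restr :: "nat \<Rightarrow> complex mat \<Rightarrow> complex mat" where
  "restr n A \<equiv> restr_mat (\<nn> n) \<Omega> A"

text \<open>Written as a compression, restriction reduces to two identities:
  \<open>emb_isometry\<close> in one order of the factors and \<open>emb_proj\<close> in the
  other.\<close>

lemma restr_eq:
  assumes A: "A \<in> carrier_mat (NN n) (NN n)"
  shows "restr n A = mat_adjoint (emb n) * A * emb n"
proof -
  have set_eq: "{i. i < NN n \<and> i \<in> red_idx n} = red_idx n" by (auto simp: red_idx_def)
  have dims: "card {i. i < dim_row A \<and> i \<in> red_idx n} = dd n" "card {i. i < dim_col A \<and> i \<in> red_idx n} = dd n"
    using A set_eq card_red_idx by auto
  have r: "restr n A = submatrix A (red_idx n) (red_idx n)" unfolding restr_mat_def Let_def red_idx_def ..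
  have EA: "mat_adjoint (emb n) * A \<in> carrier_mat (dd n) (NN n)" by (rule mult_carrier_mat[OF emb_carrier(2) A])
  show ?thesis
  proof (rule eq_matI)
    fix i j assume "i < dim_row (mat_adjoint (emb n) * A * emb n)" "j < dim_col (mat_adjoint (emb n) * A * emb n)"
    then have ij: "i < dd n" "j < dd n" by auto
    have "(mat_adjoint (emb n) * A * emb n) $$ (i, j) = (mat_adjoint (emb n) * A) $$ (i, pick (red_idx n) j)"
      using mult_sel[where \<pi>="pick (red_idx n)", OF EA ij(2) pick_less[OF ij(2)] ij(1)] by (simp only: emb_def)
    also have "\<dots> = A $$ (pick (red_idx n) i, pick (red_idx n) j)"
      using adj_sel_mult[where \<pi>="pick (red_idx n)", OF A ij(1) pick_less[OF ij(1)] pick_less[OF ij(2)]] by (simp only: emb_def)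
    also have "\<dots> = restr n A $$ (i, j)" unfolding r by (rule submatrix_index[symmetric]) (use ij dims in auto)
    finally show "restr n A $$ (i, j) = (mat_adjoint (emb n) * A * emb n) $$ (i, j)" by (rule sym)
  qed (use dims in \<open>auto simp: r dim_submatrix\<close>)
qed

lemma restr_carrier: "A \<in> carrier_mat (NN n) (NN n) \<Longrightarrow> restr n A \<in> carrier_mat (dd n) (dd n)"
  by (simp only: restr_eq) (rule mult_carrier_mat[OF mult_carrier_mat[OF emb_carrier(2)] emb_carrier(1)])

lemma emb_cancel: "dim_row X = dd n \<Longrightarrow> mat_adjoint (emb n) * (emb n * X) = X"
proof -
  assume X: "dim_row X = dd n"
  have "mat_adjoint (emb n) * (emb n * X) = mat_adjoint (emb n) * emb n * X"
    by (rule assoc_mult_mat_dim[symmetric]) (use X in auto)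
  also have "\<dots> = X" unfolding emb_isometry using X by (intro left_mult_one_mat) auto
  finally show ?thesis .
qed

lemma restr_add:
  assumes A: "A \<in> carrier_mat (NN n) (NN n)" and B: "B \<in> carrier_mat (NN n) (NN n)"
  shows "restr n (A + B) = restr n A + restr n B"
  unfolding restr_eq[OF A] restr_eq[OF B] restr_eq[OF add_carrier_mat[OF B]] mult_add_distrib_mat[OF emb_carrier(2) A B]
  by (rule add_mult_distrib_mat[OF mult_carrier_mat[OF emb_carrier(2) A] mult_carrier_mat[OF emb_carrier(2) B] emb_carrier(1)])

lemma restr_smult:
  assumes A: "A \<in> carrier_mat (NN n) (NN n)"
  shows "restr n (a \<cdot>\<^sub>m A) = a \<cdot>\<^sub>m restr n A"
  unfolding restr_eq[OF A] restr_eq[OF smult_carrier_mat[OF A]] mult_smult_distrib[OF emb_carrier(2) A]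
  by (rule mult_smult_assoc_mat[OF mult_carrier_mat[OF emb_carrier(2) A] emb_carrier(1)])

lemma restr_one: "restr n (1\<^sub>m (NN n)) = 1\<^sub>m (dd n)"
  unfolding restr_eq[OF one_carrier_mat] right_mult_one_mat[OF emb_carrier(2)] by (rule emb_isometry)

text \<open>Between the two compressions stands \<open>emb n * mat_adjoint (emb n)\<close>, which is
  the projection and not the identity.\<close>

lemma restr_mult:
  assumes A: "A \<in> carrier_mat (NN n) (NN n)" and B: "B \<in> carrier_mat (NN n) (NN n)"
  shows "restr n A * restr n B = restr n (A * proj n * B)"
proof -
  have "A * proj n * B \<in> carrier_mat (NN n) (NN n)" by (intro mult_carrier_mat[OF mult_carrier_mat[OF A proj_carrier] B])
  note r = restr_eq[OF A] restr_eq[OF B] restr_eq[OF this]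
  show ?thesis unfolding r unfolding emb_proj[symmetric] using A B by (simp add: assoc_mult_mat_dim)
qed

text \<open>Extension by zeros outside the selected rows and columns: restriction undoes it by
  \<open>restr_ext\<close>, while the opposite composition compresses by the projection, as in
  \<open>ext_restr\<close>.\<close>

definition ext :: "nat \<Rightarrow> complex mat \<Rightarrow> complex mat" where
  "ext n Z = emb n * Z * mat_adjoint (emb n)"

lemma ext_carrier: "Z \<in> carrier_mat (dd n) (dd n) \<Longrightarrow> ext n Z \<in> carrier_mat (NN n) (NN n)"
  unfolding ext_def by (rule mult_carrier_mat[OF mult_carrier_mat[OF emb_carrier(1)] emb_carrier(2)])

lemma restr_ext:
  assumes Z: "Z \<in> carrier_mat (dd n) (dd n)" shows "restr n (ext n Z) = Z"
  unfolding restr_eq[OF ext_carrier[OF Z]] unfolding ext_def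
  using Z by (simp add: assoc_mult_mat_dim emb_cancel emb_isometry)

lemma ext_restr:
  assumes A: "A \<in> carrier_mat (NN n) (NN n)" shows "ext n (restr n A) = proj n * A * proj n"
  unfolding ext_def restr_eq[OF A] emb_proj[symmetric] using A by (simp add: assoc_mult_mat_dim)

lemma splits_restr: "splits (NN n) A M r \<Longrightarrow> M \<ge> 0 \<Longrightarrow> splits (dd n) (mat_adjoint (emb n) * A * emb n) M r"
  by (rule splits_conj[OF emb_carrier(2) nbound_emb(2) emb_carrier(1) nbound_emb(1)])

lemma splits_ext: "splits (dd n) Z M r \<Longrightarrow> M \<ge> 0 \<Longrightarrow> splits (NN n) (ext n Z) M r"
  unfolding ext_def by (rule splits_conj[OF emb_carrier(1) nbound_emb(1) emb_carrier(2) nbound_emb(2)])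

text \<open>The two sides allow ranks proportional to different sizes. One direction uses that the
  reduced size is at most the full one; the other uses the lower bound \<open>\<kappa>\<close> on
  their quotient and divides the tolerance accordingly.\<close>

lemma zero_distributed_iff_ext:
  assumes Z: "\<And>n. Z n \<in> carrier_mat (dd n) (dd n)"
  shows "zero_distributed \<nn> \<Omega> Z \<longleftrightarrow> (\<forall>\<epsilon>>0. sq_le (\<lambda>n. ext n (Z n)) \<epsilon> \<epsilon>)"
proof
  assume zd: "zero_distributed \<nn> \<Omega> Z"
  show "\<forall>\<epsilon>>0. sq_le (\<lambda>n. ext n (Z n)) \<epsilon> \<epsilon>"
  proof (intro allI impI)
    fix \<epsilon> :: real assume e: "\<epsilon> > 0"
    have "\<forall>\<^sub>F n in sequentially. splits (dd n) (Z n) \<epsilon> (\<epsilon> * dd n)"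
      using zd e unfolding zero_distributed_iff by blast
    then show "sq_le (\<lambda>n. ext n (Z n)) \<epsilon> \<epsilon>" unfolding sq_le_def
    proof eventually_elim
      case (elim n)
      have "splits (NN n) (ext n (Z n)) \<epsilon> (\<epsilon> * dd n)" using splits_ext[OF elim] e by simp
      then show ?case by (rule splits_mono) (use e dd_le_NN[of n] in auto)
    qed
  qed
next
  assume *: "\<forall>\<epsilon>>0. sq_le (\<lambda>n. ext n (Z n)) \<epsilon> \<epsilon>"
  obtain \<kappa> where k: "0 < \<kappa>" "\<forall>\<^sub>F n in sequentially. \<kappa> * real (NN n) \<le> real (dd n)" using d_red_lower by blast
  have spl: "\<forall>\<^sub>F n in sequentially. splits (dd n) (Z n) \<epsilon> (\<epsilon> * dd n)" if e: "\<epsilon> > 0" for \<epsilon>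
  proof -
    define \<delta> where "\<delta> = min \<epsilon> (\<epsilon> * \<kappa>)"
    have d: "\<delta> > 0" "\<delta> \<le> \<epsilon>" "\<delta> \<le> \<epsilon> * \<kappa>" using e k(1) by (auto simp: \<delta>_def)
    have "\<forall>\<^sub>F n in sequentially. splits (NN n) (ext n (Z n)) \<delta> (\<delta> * NN n)" using * d(1) unfolding sq_le_def by blast
    then show ?thesis using k(2)
    proof eventually_elim
      case (elim n)
      have "mat_adjoint (emb n) * ext n (Z n) * emb n = Z n"
        using restr_ext[OF Z] unfolding restr_eq[OF ext_carrier[OF Z]] .
      then have s: "splits (dd n) (Z n) \<delta> (\<delta> * NN n)" using splits_restr[OF elim(1)] d(1) by simp
      have "\<delta> * NN n \<le> \<epsilon> * \<kappa> * NN n" by (rule mult_right_mono[OF d(3)]) simp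
      also have "\<dots> \<le> \<epsilon> * dd n" using mult_left_mono[OF elim(2), of \<epsilon>] e by (simp add: mult.assoc)
      finally show ?case by (rule splits_mono[OF s d(2)])
    qed
  qed
  show "zero_distributed \<nn> \<Omega> Z" unfolding zero_distributed_iff by (intro conjI allI impI Z spl)
qed

end

section \<open>Sequences with vanishing symbol\<close>

context grid
begin

text \<open>Lowering the threshold enlarges the set where it is exceeded, so the measure for
  threshold \<open>\<epsilon>\<close> is at most every smaller \<open>\<delta>\<close> and hence 0.
  Countably many thresholds then exhaust the set where \<open>h\<close> is nonzero.\<close>

lemma fsplits_all_iff:
  assumes h: "h \<in> borel_measurable (lebesgue_on sdom)"
  shows "(\<forall>\<epsilon>>0. fsplits h \<epsilon> \<epsilon>) \<longleftrightarrow> (AE z in lebesgue_on sdom. h z = 0)"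
proof -
  let ?M = "lebesgue_on (sdom :: ((real ^ 'a) \<times> (real ^ 'a)) set)"
  interpret finite_measure ?M by (rule finite_measure_sdom)
  let ?S = "\<lambda>\<epsilon>. {z \<in> sdom. \<epsilon> < cmod (h z)}"
  have null_iff: "?S \<epsilon> \<in> null_sets ?M \<longleftrightarrow> measure ?M (?S \<epsilon>) = 0" for \<epsilon>
    using fsplits_sets[OF h] by (simp add: null_sets_def emeasure_eq_measure)
  show ?thesis
  proof
    assume *: "\<forall>\<epsilon>>0. fsplits h \<epsilon> \<epsilon>"
    have "measure ?M (?S \<epsilon>) = 0" if e: "\<epsilon> > 0" for \<epsilon>
    proof (rule ccontr)
      assume "measure ?M (?S \<epsilon>) \<noteq> 0"
      then have pos: "measure ?M (?S \<epsilon>) > 0" using measure_nonneg[of ?M "?S \<epsilon>"] by linarith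
      define \<delta> where "\<delta> = min \<epsilon> (measure ?M (?S \<epsilon>) / 2)"
      have d: "\<delta> > 0" "\<delta> \<le> \<epsilon>" "\<delta> < measure ?M (?S \<epsilon>)" using e pos by (auto simp: \<delta>_def)
      have "measure ?M (?S \<epsilon>) \<le> measure ?M (?S \<delta>)"
        by (rule finite_measure_mono) (use d(2) fsplits_sets[OF h] in auto)
      also have "\<dots> \<le> \<delta>" using * d(1) by (simp add: fsplits_def)
      finally show False using d(3) by simp
    qed
    then have "AE z in ?M. z \<notin> ?S (inverse (real (Suc m)))" for m
      using AE_iff_null_sets[OF fsplits_sets[OF h]] null_iff by simp
    then have "AE z in ?M. \<forall>m. z \<notin> ?S (inverse (real (Suc m)))" unfolding AE_all_countable by blast
    then show "AE z in ?M. h z = 0"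
    proof (rule AE_mp, intro AE_I2 impI)
      fix z assume z: "z \<in> space ?M" "\<forall>m. z \<notin> ?S (inverse (real (Suc m)))"
      have "cmod (h z) \<le> 0"
      proof (rule LIMSEQ_le_const[OF LIMSEQ_inverse_real_of_nat], intro exI allI impI)
        fix m show "cmod (h z) \<le> inverse (real (Suc m))" using z by (auto simp: space_restrict_space not_less)
      qed
      then show "h z = 0" by simp
    qed
  next
    assume *: "AE z in ?M. h z = 0"
    show "\<forall>\<epsilon>>0. fsplits h \<epsilon> \<epsilon>"
    proof (intro allI impI)
      fix \<epsilon> :: real assume e: "\<epsilon> > 0"
      have "AE z in ?M. z \<notin> ?S \<epsilon>" by (rule AE_mp[OF *], intro AE_I2 impI) (use e in auto)
      then have "measure ?M (?S \<epsilon>) = 0" using AE_iff_null_sets[OF fsplits_sets[OF h]] null_iff by simp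
      then show "fsplits h \<epsilon> \<epsilon>" using h e by (simp add: fsplits_def)
    qed
  qed
qed

text \<open>Injectivity at full size: with constants adjusted, \<open>glt'_upper\<close> and
  \<open>glt'_lower\<close> say that a sequence is small exactly when its symbol is small in
  measure.\<close>

lemma glt'_zero_iff:
  assumes A: "glt' A k"
  shows "(\<forall>\<epsilon>>0. sq_le A \<epsilon> \<epsilon>) \<longleftrightarrow> (AE z in lebesgue_on sdom. k z = 0)"
  unfolding fsplits_all_iff[OF glt'_measurable[OF A], symmetric]
proof (intro iffI allI impI)
  fix \<epsilon> :: real assume e: "\<epsilon> > 0" and *: "\<forall>\<epsilon>>0. fsplits k \<epsilon> \<epsilon>"
  then have "fsplits k (\<epsilon> / 5) (\<epsilon> / 5)" by simp
  from glt'_upper[OF A _ this] e show "sq_le A \<epsilon> \<epsilon>" by simp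
next
  fix \<epsilon> :: real assume e: "\<epsilon> > 0" and *: "\<forall>\<epsilon>>0. sq_le A \<epsilon> \<epsilon>"
  let ?C = "2 * (2 * pi) ^ CARD('d) + 1"
  have C: "?C > 0" using two_pi_power_ge_1[of "CARD('d)"] by linarith
  define \<delta> where "\<delta> = min (\<epsilon> / 5) (\<epsilon> / ?C)"
  have d: "\<delta> > 0" using e C by (simp add: \<delta>_def)
  have "fsplits k (5 * \<delta>) (?C * \<delta>)" by (rule glt'_lower[OF A d]) (use * d in blast)
  moreover have "5 * \<delta> \<le> \<epsilon>" by (simp add: \<delta>_def)
  moreover have "?C * \<delta> \<le> \<epsilon>"
  proof -
    have "\<delta> \<le> \<epsilon> / ?C" by (simp add: \<delta>_def)
    then show ?thesis using C by (simp add: pos_le_divide_eq mult.commute)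
  qed
  ultimately show "fsplits k \<epsilon> \<epsilon>" by (rule fsplits_mono)
qed

end

section \<open>Quotients of algebras\<close>

text \<open>\<open>FactAlg\<close> adds a scalar multiplication to a plain quotient ring; this
  transfers the ring laws to the larger record.\<close>

lemma ring_extend: assumes "ring P" shows "ring (ring.extend P e)"
proof -
  interpret P: ring P by fact
  have sel: "carrier (ring.extend P e) = carrier P" "mult (ring.extend P e) = mult P" "one (ring.extend P e) = one P"
    "zero (ring.extend P e) = zero P" "add (ring.extend P e) = add P"
    unfolding ring.extend_def by simp_all
  show ?thesis
  proof (rule ringI)
    show "abelian_group (ring.extend P e)"
    proof (rule abelian_groupI)
      fix x assume "x \<in> carrier (ring.extend P e)"
      then show "\<exists>y\<in>carrier (ring.extend P e). y \<oplus>\<^bsub>ring.extend P e\<^esub> x = \<zero>\<^bsub>ring.extend P e\<^esub>"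
        unfolding sel by (intro bexI[of _ "\<ominus>\<^bsub>P\<^esub> x"] P.l_neg P.a_inv_closed)
    qed (simp_all add: sel P.a_ac)
    show "Group.monoid (ring.extend P e)"
      by (rule monoidI) (simp_all add: sel P.m_assoc)
  qed (simp_all add: sel P.l_distr P.r_distr)
qed

lemma FactAlg_simps:
  "carrier (FactAlg A I) = a_rcosets\<^bsub>A\<^esub> I"
  "mult (FactAlg A I) = rcoset_mult A I"
  "one (FactAlg A I) = I +>\<^bsub>A\<^esub> \<one>\<^bsub>A\<^esub>"
  "zero (FactAlg A I) = I"
  "add (FactAlg A I) = set_add A"
  "smult (FactAlg A I) c X = (\<Union>x\<in>X. I +>\<^bsub>A\<^esub> (c \<odot>\<^bsub>A\<^esub> x))"
  by (simp_all add: FactAlg_def ring.defs module.defs FactRing_def)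

lemma FactAlg_carrier: "X \<in> carrier (FactAlg A I) \<longleftrightarrow> (\<exists>x\<in>carrier A. X = I +>\<^bsub>A\<^esub> x)"
  by (auto simp: FactAlg_simps A_RCOSETS_def')

lemma FactAlg_add:
  assumes "ideal I A" "x \<in> carrier A" "y \<in> carrier A"
  shows "(I +>\<^bsub>A\<^esub> x) \<oplus>\<^bsub>FactAlg A I\<^esub> (I +>\<^bsub>A\<^esub> y) = I +>\<^bsub>A\<^esub> (x \<oplus>\<^bsub>A\<^esub> y)"
proof -
  interpret ideal I A by fact
  show ?thesis using assms(2,3) by (simp add: FactAlg_simps a_rcos_sum)
qed

lemma FactAlg_mult:
  assumes "ideal I A" "x \<in> carrier A" "y \<in> carrier A"
  shows "(I +>\<^bsub>A\<^esub> x) \<otimes>\<^bsub>FactAlg A I\<^esub> (I +>\<^bsub>A\<^esub> y) = I +>\<^bsub>A\<^esub> (x \<otimes>\<^bsub>A\<^esub> y)"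
proof -
  interpret ideal I A by fact
  show ?thesis using assms(2,3) by (simp add: FactAlg_simps rcoset_mult_add)
qed

text \<open>The scalar multiple of a coset is a union over its representatives, and all members of
  this union coincide, because an ideal is closed under scalars.\<close>

lemma FactAlg_smult:
  assumes A: "assoc_algebra R A" and I: "ideal I A" and c: "c \<in> carrier R" and x: "x \<in> carrier A"
  shows "c \<odot>\<^bsub>FactAlg A I\<^esub> (I +>\<^bsub>A\<^esub> x) = I +>\<^bsub>A\<^esub> (c \<odot>\<^bsub>A\<^esub> x)"
proof -
  interpret A: assoc_algebra R A by fact
  interpret I: ideal I A by fact
  \<comment> \<open>A scalar multiple is the ring product with the scalar multiple of the unit, so
    the ideal property applies.\<close>
  have smI: "c \<odot>\<^bsub>A\<^esub> i \<in> I" if i: "i \<in> I" for i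
  proof -
    have ic: "i \<in> carrier A" using i by (rule I.a_Hcarr)
    have "(c \<odot>\<^bsub>A\<^esub> \<one>\<^bsub>A\<^esub>) \<otimes>\<^bsub>A\<^esub> i = c \<odot>\<^bsub>A\<^esub> i"
      using A.smult_mult_left[OF c _ ic, of "\<one>\<^bsub>A\<^esub>"] ic by simp
    moreover have "(c \<odot>\<^bsub>A\<^esub> \<one>\<^bsub>A\<^esub>) \<otimes>\<^bsub>A\<^esub> i \<in> I"
      by (rule I.I_l_closed[OF i]) (simp add: c)
    ultimately show ?thesis by simp
  qed
  have "(\<Union>y\<in>I +>\<^bsub>A\<^esub> x. I +>\<^bsub>A\<^esub> (c \<odot>\<^bsub>A\<^esub> y)) = (\<Union>y\<in>I +>\<^bsub>A\<^esub> x. I +>\<^bsub>A\<^esub> (c \<odot>\<^bsub>A\<^esub> x))"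
  proof (rule SUP_cong[OF refl])
    fix y assume y: "y \<in> I +>\<^bsub>A\<^esub> x"
    obtain i where i: "i \<in> I" "y = i \<oplus>\<^bsub>A\<^esub> x" using y by (auto simp: a_r_coset_def')
    have ic: "i \<in> carrier A" using i(1) by (rule I.a_Hcarr)
    have "c \<odot>\<^bsub>A\<^esub> y = c \<odot>\<^bsub>A\<^esub> i \<oplus>\<^bsub>A\<^esub> c \<odot>\<^bsub>A\<^esub> x"
      unfolding i(2) by (rule A.smult_r_distr[OF c ic x])
    moreover have "I +>\<^bsub>A\<^esub> (c \<odot>\<^bsub>A\<^esub> i \<oplus>\<^bsub>A\<^esub> c \<odot>\<^bsub>A\<^esub> x) = (I +>\<^bsub>A\<^esub> (c \<odot>\<^bsub>A\<^esub> i)) +>\<^bsub>A\<^esub> (c \<odot>\<^bsub>A\<^esub> x)"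
      by (rule A.a_coset_add_assoc[symmetric]) (use I.a_subset c ic x in auto)
    moreover have "I +>\<^bsub>A\<^esub> (c \<odot>\<^bsub>A\<^esub> i) = I" by (rule I.a_rcos_const[OF smI[OF i(1)]])
    ultimately show "I +>\<^bsub>A\<^esub> (c \<odot>\<^bsub>A\<^esub> y) = I +>\<^bsub>A\<^esub> (c \<odot>\<^bsub>A\<^esub> x)" by (simp only:)
  qed
  moreover have "I +>\<^bsub>A\<^esub> x \<noteq> {}" using I.a_rcos_self[OF x] by blast
  ultimately show ?thesis unfolding FactAlg_simps by (simp only: UN_constant if_False)
qed

lemma assoc_algebraI:
  assumes "module R A" "ring A"
    and "\<And>c x y. \<lbrakk>c \<in> carrier R; x \<in> carrier A; y \<in> carrier A\<rbrakk> \<Longrightarrow> (c \<odot>\<^bsub>A\<^esub> x) \<otimes>\<^bsub>A\<^esub> y = c \<odot>\<^bsub>A\<^esub> (x \<otimes>\<^bsub>A\<^esub> y)"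
    and "\<And>c x y. \<lbrakk>c \<in> carrier R; x \<in> carrier A; y \<in> carrier A\<rbrakk> \<Longrightarrow> x \<otimes>\<^bsub>A\<^esub> (c \<odot>\<^bsub>A\<^esub> y) = c \<odot>\<^bsub>A\<^esub> (x \<otimes>\<^bsub>A\<^esub> y)"
  shows "assoc_algebra R A"
  by (intro assoc_algebra.intro assoc_algebra_axioms.intro assms)

lemma assoc_algebra_FactAlg:
  fixes A :: "('c, 'a) module"
  assumes A: "assoc_algebra R A" and I: "ideal I A"
  shows "assoc_algebra R (FactAlg A I)"
proof -
  interpret A: assoc_algebra R A by fact
  interpret I: ideal I A by fact
  have cR: "cring R" using A by (simp add: assoc_algebra_def module_def)
  interpret R: cring R by fact
  have ringQ: "ring (FactAlg A I)" unfolding FactAlg_def by (rule ring_extend[OF I.quotient_is_ring])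
  note ops = FactAlg_add[OF I] FactAlg_mult[OF I] FactAlg_smult[OF A I]
  show ?thesis
  proof (rule assoc_algebraI[OF moduleI ringQ])
    show "cring R" by fact
    show "abelian_group (FactAlg A I)" by (rule ring.is_abelian_group[OF ringQ])
  qed (auto simp: FactAlg_carrier ops A.smult_l_distr A.smult_r_distr A.smult_assoc1 A.smult_mult_left A.smult_mult_right)
qed

lemma coset_eq_iff:
  assumes "ideal I A" "x \<in> carrier A" "y \<in> carrier A"
  shows "I +>\<^bsub>A\<^esub> x = I +>\<^bsub>A\<^esub> y \<longleftrightarrow> x \<oplus>\<^bsub>A\<^esub> (\<ominus>\<^bsub>A\<^esub> y) \<in> I"
proof -
  interpret I: ideal I A by fact
  have "x \<in> I +>\<^bsub>A\<^esub> y \<longleftrightarrow> x \<oplus>\<^bsub>A\<^esub> (\<ominus>\<^bsub>A\<^esub> y) \<in> I"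
    by (rule I.a_rcos_module[OF assms(3,2)])
  moreover have "x \<in> I +>\<^bsub>A\<^esub> y \<Longrightarrow> I +>\<^bsub>A\<^esub> y = I +>\<^bsub>A\<^esub> x"
    by (rule I.a_repr_independence'[OF _ assms(3)])
  moreover have "x \<in> I +>\<^bsub>A\<^esub> x" by (rule I.a_rcos_self[OF assms(2)])
  ultimately show ?thesis by auto
qed

text \<open>Lets a relation that respects sums and scalar multiples respect differences as
  well.\<close>

lemma minus_eq_smult:
  assumes "assoc_algebra R A" "x \<in> carrier A"
  shows "\<ominus>\<^bsub>A\<^esub> x = (\<ominus>\<^bsub>R\<^esub> \<one>\<^bsub>R\<^esub>) \<odot>\<^bsub>A\<^esub> x"
proof -
  interpret A: assoc_algebra R A by fact
  have "cring R" using assms(1) by (simp add: assoc_algebra_def module_def)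
  then interpret R: cring R .
  show ?thesis using A.smult_l_minus[of "\<one>\<^bsub>R\<^esub>" x] assms(2) by simp
qed

text \<open>An isomorphism theorem for a relation instead of a homomorphism, since an element of
  \<open>G\<close> is related to many functions. Every coset has a related representative, on which
  \<open>\<Phi>\<close> is known; applying \<open>ker\<close> to differences of related pairs gives
  injectivity.\<close>

lemma quotient_iso:
  fixes G :: "('c, 'a) module" and M :: "('c, 'b) module" and R :: "'c ring"
  assumes G: "assoc_algebra R G" and M: "assoc_algebra R M" and I: "ideal I M" and J: "ideal J G"
    and carr: "\<And>S. S \<in> carrier G \<longleftrightarrow> (\<exists>f. \<rho> S f)"
    and rhoM: "\<And>S f. \<rho> S f \<Longrightarrow> f \<in> carrier M"
    and onto: "\<And>f. f \<in> carrier M \<Longrightarrow> \<exists>S. \<rho> S f"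
    and mult: "\<And>S f T g. \<rho> S f \<Longrightarrow> \<rho> T g \<Longrightarrow> \<rho> (S \<otimes>\<^bsub>G\<^esub> T) (f \<otimes>\<^bsub>M\<^esub> g)"
    and add: "\<And>S f T g. \<rho> S f \<Longrightarrow> \<rho> T g \<Longrightarrow> \<rho> (S \<oplus>\<^bsub>G\<^esub> T) (f \<oplus>\<^bsub>M\<^esub> g)"
    and smult: "\<And>c S f. c \<in> carrier R \<Longrightarrow> \<rho> S f \<Longrightarrow> \<rho> (c \<odot>\<^bsub>G\<^esub> S) (c \<odot>\<^bsub>M\<^esub> f)"
    and one: "\<rho> \<one>\<^bsub>G\<^esub> \<one>\<^bsub>M\<^esub>"
    and ker: "\<And>S f. \<rho> S f \<Longrightarrow> S \<in> J \<longleftrightarrow> f \<in> I"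
    and Phi: "\<And>S f. \<rho> S f \<Longrightarrow> \<Phi> (J +>\<^bsub>G\<^esub> S) = I +>\<^bsub>M\<^esub> f"
  shows "\<Phi> \<in> alg_iso R (FactAlg G J) (FactAlg M I)"
proof -
  interpret G: assoc_algebra R G by fact
  interpret M: assoc_algebra R M by fact
  have "cring R" using G by (simp add: assoc_algebra_def module_def)
  then interpret R: cring R .
  have rhoG: "S \<in> carrier G" if "\<rho> S f" for S f using carr that by blast
  have X: "\<exists>S f. X = J +>\<^bsub>G\<^esub> S \<and> \<rho> S f" if "X \<in> carrier (FactAlg G J)" for X
    using that carr unfolding FactAlg_carrier by blast
  have eq: "J +>\<^bsub>G\<^esub> S = J +>\<^bsub>G\<^esub> T \<longleftrightarrow> I +>\<^bsub>M\<^esub> f = I +>\<^bsub>M\<^esub> g" if "\<rho> S f" "\<rho> T g" for S T f g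
  proof -
    have "\<rho> (\<ominus>\<^bsub>G\<^esub> T) (\<ominus>\<^bsub>M\<^esub> g)"
      unfolding minus_eq_smult[OF G rhoG[OF that(2)]] minus_eq_smult[OF M rhoM[OF that(2)]]
      by (rule smult[OF _ that(2)]) simp
    from ker[OF add[OF that(1) this]] show ?thesis
      using coset_eq_iff[OF J rhoG[OF that(1)] rhoG[OF that(2)]] coset_eq_iff[OF I rhoM[OF that(1)] rhoM[OF that(2)]]
      by (simp only:)
  qed
  have "\<Phi> \<in> ring_iso (FactAlg G J) (FactAlg M I)"
  proof (rule ring_iso_memI)
    show "\<Phi> X \<in> carrier (FactAlg M I)" if X': "X \<in> carrier (FactAlg G J)" for X
    proof -
      obtain S f where *: "X = J +>\<^bsub>G\<^esub> S" "\<rho> S f" using X[OF X'] by blast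
      show ?thesis unfolding *(1) Phi[OF *(2)] FactAlg_carrier using rhoM[OF *(2)] by blast
    qed
    show "\<Phi> (X \<otimes>\<^bsub>FactAlg G J\<^esub> Y) = \<Phi> X \<otimes>\<^bsub>FactAlg M I\<^esub> \<Phi> Y" if X': "X \<in> carrier (FactAlg G J)" and Y': "Y \<in> carrier (FactAlg G J)" for X Y
    proof -
      obtain S f where *: "X = J +>\<^bsub>G\<^esub> S" "\<rho> S f" using X[OF X'] by blast
      obtain T g where **: "Y = J +>\<^bsub>G\<^esub> T" "\<rho> T g" using X[OF Y'] by blast
      show ?thesis unfolding *(1) **(1) FactAlg_mult[OF J rhoG[OF *(2)] rhoG[OF **(2)]] Phi[OF mult[OF *(2) **(2)]]
          Phi[OF *(2)] Phi[OF **(2)] FactAlg_mult[OF I rhoM[OF *(2)] rhoM[OF **(2)]] ..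
    qed
    show "\<Phi> (X \<oplus>\<^bsub>FactAlg G J\<^esub> Y) = \<Phi> X \<oplus>\<^bsub>FactAlg M I\<^esub> \<Phi> Y" if X': "X \<in> carrier (FactAlg G J)" and Y': "Y \<in> carrier (FactAlg G J)" for X Y
    proof -
      obtain S f where *: "X = J +>\<^bsub>G\<^esub> S" "\<rho> S f" using X[OF X'] by blast
      obtain T g where **: "Y = J +>\<^bsub>G\<^esub> T" "\<rho> T g" using X[OF Y'] by blast
      show ?thesis unfolding *(1) **(1) FactAlg_add[OF J rhoG[OF *(2)] rhoG[OF **(2)]] Phi[OF add[OF *(2) **(2)]]
          Phi[OF *(2)] Phi[OF **(2)] FactAlg_add[OF I rhoM[OF *(2)] rhoM[OF **(2)]] ..
    qed
    show "\<Phi> \<one>\<^bsub>FactAlg G J\<^esub> = \<one>\<^bsub>FactAlg M I\<^esub>" unfolding FactAlg_simps by (rule Phi[OF one])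
    show "bij_betw \<Phi> (carrier (FactAlg G J)) (carrier (FactAlg M I))"
      unfolding bij_betw_def
    proof
      show "inj_on \<Phi> (carrier (FactAlg G J))"
      proof (rule inj_onI)
        fix X Y assume X': "X \<in> carrier (FactAlg G J)" and Y': "Y \<in> carrier (FactAlg G J)" and PXY: "\<Phi> X = \<Phi> Y"
        obtain S f where *: "X = J +>\<^bsub>G\<^esub> S" "\<rho> S f" using X[OF X'] by blast
        obtain T g where **: "Y = J +>\<^bsub>G\<^esub> T" "\<rho> T g" using X[OF Y'] by blast
        show "X = Y" using PXY eq[OF *(2) **(2)] unfolding *(1) **(1) Phi[OF *(2)] Phi[OF **(2)] by simp
      qed
      show "\<Phi> ` carrier (FactAlg G J) = carrier (FactAlg M I)"
      proof (intro subset_antisym subsetI)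
        fix Y assume "Y \<in> \<Phi> ` carrier (FactAlg G J)"
        then obtain X' where "X' \<in> carrier (FactAlg G J)" "Y = \<Phi> X'" by blast
        then obtain S f where *: "X' = J +>\<^bsub>G\<^esub> S" "\<rho> S f" "Y = \<Phi> X'" using X by blast
        show "Y \<in> carrier (FactAlg M I)" unfolding *(3,1) Phi[OF *(2)] FactAlg_carrier using rhoM[OF *(2)] by blast
      next
        fix Y assume "Y \<in> carrier (FactAlg M I)"
        then obtain f where f: "f \<in> carrier M" "Y = I +>\<^bsub>M\<^esub> f" unfolding FactAlg_carrier by blast
        then obtain S where S: "\<rho> S f" using onto by blast
        have "J +>\<^bsub>G\<^esub> S \<in> carrier (FactAlg G J)" unfolding FactAlg_carrier using rhoG[OF S] by blast
        then show "Y \<in> \<Phi> ` carrier (FactAlg G J)" unfolding f(2) Phi[OF S, symmetric] by (rule imageI)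
      qed
    qed
  qed
  moreover have "\<Phi> (c \<odot>\<^bsub>FactAlg G J\<^esub> X) = c \<odot>\<^bsub>FactAlg M I\<^esub> \<Phi> X"
    if c: "c \<in> carrier R" and X': "X \<in> carrier (FactAlg G J)" for c X
  proof -
    obtain S f where *: "X = J +>\<^bsub>G\<^esub> S" "\<rho> S f" using X[OF X'] by blast
    show ?thesis unfolding *(1) FactAlg_smult[OF G J c rhoG[OF *(2)]] Phi[OF smult[OF c *(2)]]
        Phi[OF *(2)] FactAlg_smult[OF M I c rhoM[OF *(2)]] ..
  qed
  ultimately show ?thesis unfolding alg_iso_def by blast
qed

section \<open>The scalars and the algebra of measurable functions\<close>

lemma cring_class_ring: "cring (class_ring :: complex ring)"
  using vec_module[where 'a=complex and n=1] unfolding module_def by (elim conjE)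

lemma assoc_algebra_meas_alg: "assoc_algebra class_ring (meas_alg D)"
proof -
  have ab: "abelian_group (meas_alg D)"
  proof (rule abelian_groupI)
    fix f assume "f \<in> carrier (meas_alg D)"
    then show "\<exists>g\<in>carrier (meas_alg D). g \<oplus>\<^bsub>meas_alg D\<^esub> f = \<zero>\<^bsub>meas_alg D\<^esub>"
      by (intro bexI[of _ "\<lambda>z. - f z"]) (auto simp: meas_alg_def)
  qed (auto simp: meas_alg_def fun_eq_iff)
  have mon: "Group.monoid (meas_alg D)" by (rule monoidI) (auto simp: meas_alg_def)
  have rg: "ring (meas_alg D)" by (rule ringI[OF ab mon]) (auto simp: meas_alg_def algebra_simps)
  have md: "module class_ring (meas_alg D)"
    by (rule moduleI[OF cring_class_ring ab]) (auto simp: meas_alg_def algebra_simps)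
  show ?thesis
    by (rule assoc_algebraI[OF md rg]) (auto simp: meas_alg_def)
qed

lemma meas_alg_minus: assumes "f \<in> carrier (meas_alg D)" shows "\<ominus>\<^bsub>meas_alg D\<^esub> f = (\<lambda>z. - f z)"
proof -
  interpret assoc_algebra class_ring "meas_alg D" by (rule assoc_algebra_meas_alg)
  show ?thesis
    by (rule minus_equality) (use assms in \<open>auto simp: meas_alg_def\<close>)
qed

lemma ideal_null_funs: "ideal (null_funs D) (meas_alg D)"
proof -
  interpret assoc_algebra class_ring "meas_alg D" by (rule assoc_algebra_meas_alg)
  show ?thesis
  proof (rule idealI[OF ring_axioms])
    show "subgroup (null_funs D) (add_monoid (meas_alg D))"
    proof (rule add.subgroupI)
      show "null_funs D \<subseteq> carrier (meas_alg D)" by (auto simp: null_funs_def meas_alg_def)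
      have "(\<lambda>z. 0) \<in> null_funs D" by (simp add: null_funs_def)
      then show "null_funs D \<noteq> {}" by blast
      show "\<ominus>\<^bsub>meas_alg D\<^esub> f \<in> null_funs D" if "f \<in> null_funs D" for f
        using that by (subst meas_alg_minus) (auto simp: null_funs_def meas_alg_def)
      show "f \<oplus>\<^bsub>meas_alg D\<^esub> g \<in> null_funs D" if "f \<in> null_funs D" "g \<in> null_funs D" for f g
        using that by (auto simp: null_funs_def meas_alg_def elim: eventually_elim2)
    qed
  qed (auto simp: null_funs_def meas_alg_def elim: eventually_mono)
qed

section \<open>The symbol map\<close>

context grid_domain
begin

abbreviation red_dom :: "((real ^ 'd::{finite,linorder}) \<times> (real ^ 'd::{finite,linorder})) set" where
  "red_dom \<equiv> \<Omega> \<times> freq_cube"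

lemma red_dom_subset: "red_dom \<subseteq> sdom"
  using sub by auto

lemma sets_red_dom: "red_dom \<in> sets lebesgue"
proof -
  have "{z \<in> sdom. fst z \<in> \<Omega>} = red_dom" using sub by auto
  then show ?thesis using sets_Omega_freq by (simp only:)
qed

text \<open>Extending the restricted sequence by zeros gives \<open>proj n * A n * proj n\<close>, a
  GLT sequence whose symbol is \<open>k\<close> cut off to \<open>\<Omega>\<close>; that symbol
  vanishes almost everywhere exactly when \<open>k\<close> does so on
  \<open>red_dom\<close>.\<close>

lemma zero_distributed_restr_iff:
  assumes A: "glt' A k"
  shows "zero_distributed \<nn> \<Omega> (\<lambda>n. restr n (A n)) \<longleftrightarrow> (AE z in lebesgue_on red_dom. k z = 0)"
proof -
  have "zero_distributed \<nn> \<Omega> (\<lambda>n. restr n (A n)) \<longleftrightarrow> (\<forall>\<epsilon>>0. sq_le (\<lambda>n. proj n * A n * proj n) \<epsilon> \<epsilon>)"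
    unfolding zero_distributed_iff_ext[OF restr_carrier[OF glt'_carrier[OF A]]] ext_restr[OF glt'_carrier[OF A]] ..
  also have "\<dots> \<longleftrightarrow> (AE z in lebesgue_on sdom. indicator \<Omega> (fst z) * k z * indicator \<Omega> (fst z) = 0)"
    by (rule glt'_zero_iff[OF glt'_mult[OF glt'_mult[OF glt'_proj A] glt'_proj]])
  also have "\<dots> \<longleftrightarrow> (AE z in lebesgue. z \<in> sdom \<longrightarrow> indicator \<Omega> (fst z) * k z * indicator \<Omega> (fst z) = 0)"
    by (rule AE_restrict_space_iff) simp
  also have "\<dots> \<longleftrightarrow> (AE z in lebesgue. z \<in> red_dom \<longrightarrow> k z = 0)"
    by (rule AE_cong) (use sub in \<open>auto simp: indicator_def\<close>)
  also have "\<dots> \<longleftrightarrow> (AE z in lebesgue_on red_dom. k z = 0)"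
    by (rule AE_restrict_space_iff[symmetric]) (use sets_red_dom in simp)
  finally show ?thesis .
qed

text \<open>
  Functions that agree with a reduced symbol on \<open>red_dom\<close> are admitted because the product of
  restrictions has the symbol \<open>k * indicator \<Omega> * h\<close>, which equals \<open>k * h\<close> only there.
\<close>

definition rho :: "(nat \<Rightarrow> complex mat) \<Rightarrow> ((real ^ 'd::{finite,linorder}) \<times> (real ^ 'd::{finite,linorder}) \<Rightarrow> complex) \<Rightarrow> bool" where
  "rho S f \<longleftrightarrow> (\<exists>A k. glt' A k \<and> S = (\<lambda>n. restr n (A n)) \<and> (\<forall>z\<in>red_dom. f z = k z))"

lemma reduced_glt_iff: "reduced_glt \<nn> \<Omega> S k \<longleftrightarrow> (\<exists>A. glt' A k \<and> S = (\<lambda>n. restr n (A n)))"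
  unfolding reduced_glt_def glt_iff ..

lemma rhoI: "glt' A k \<Longrightarrow> (\<And>n. S n = restr n (A n)) \<Longrightarrow> (\<And>z. z \<in> red_dom \<Longrightarrow> f z = k z) \<Longrightarrow> rho S f"
  unfolding rho_def by blast

lemma rhoE:
  assumes "rho S f"
  obtains A k where "glt' A k" "\<And>n. S n = restr n (A n)" "\<And>z. z \<in> red_dom \<Longrightarrow> f z = k z"
    "\<And>n. A n \<in> carrier_mat (NN n) (NN n)"
  using assms glt'_carrier unfolding rho_def by blast

lemma reduced_glt_rho: "reduced_glt \<nn> \<Omega> S k \<Longrightarrow> rho S k"
  unfolding reduced_glt_iff rho_def by blast

lemma rho_reduced: assumes "rho S f" shows "\<exists>k. reduced_glt \<nn> \<Omega> S k"
  using assms unfolding reduced_glt_iff rho_def by blast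

lemma rho_carrier: assumes "rho S f" shows "S n \<in> carrier_mat (dd n) (dd n)"
proof -
  obtain A k where *: "\<And>n. S n = restr n (A n)" "\<And>n. A n \<in> carrier_mat (NN n) (NN n)"
    using assms by (rule rhoE) blast
  show ?thesis unfolding *(1) by (rule restr_carrier[OF *(2)])
qed

lemma rho_measurable: assumes "rho S f" shows "f \<in> borel_measurable (lebesgue_on red_dom)"
proof -
  obtain A k where *: "glt' A k" "\<And>z. z \<in> red_dom \<Longrightarrow> f z = k z" using assms by (rule rhoE) blast
  have "k \<in> borel_measurable (lebesgue_on red_dom)"
    by (rule measurable_restrict_mono[OF glt'_measurable[OF *(1)] red_dom_subset])
  moreover have "f \<in> borel_measurable (lebesgue_on red_dom) \<longleftrightarrow> k \<in> borel_measurable (lebesgue_on red_dom)"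
    by (rule measurable_cong) (use *(2) in \<open>simp add: space_restrict_space\<close>)
  ultimately show ?thesis by simp
qed

lemma rho_add: assumes "rho S f" "rho T g" shows "rho (\<lambda>n. S n + T n) (\<lambda>z. f z + g z)"
proof -
  obtain A k where A: "glt' A k" "\<And>n. S n = restr n (A n)" "\<And>z. z \<in> red_dom \<Longrightarrow> f z = k z" "\<And>n. A n \<in> carrier_mat (NN n) (NN n)"
    by (rule rhoE[OF assms(1)]) blast
  obtain B h where B: "glt' B h" "\<And>n. T n = restr n (B n)" "\<And>z. z \<in> red_dom \<Longrightarrow> g z = h z" "\<And>n. B n \<in> carrier_mat (NN n) (NN n)"
    by (rule rhoE[OF assms(2)]) blast
  show ?thesis
  proof (rule rhoI[OF glt'_add[OF A(1) B(1)]])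
    show "S n + T n = restr n (A n + B n)" for n unfolding restr_add[OF A(4) B(4)] A(2) B(2) ..
    show "f z + g z = k z + h z" if "z \<in> red_dom" for z using A(3)[OF that] B(3)[OF that] by simp
  qed
qed

lemma rho_mult: assumes "rho S f" "rho T g" shows "rho (\<lambda>n. S n * T n) (\<lambda>z. f z * g z)"
proof -
  obtain A k where A: "glt' A k" "\<And>n. S n = restr n (A n)" "\<And>z. z \<in> red_dom \<Longrightarrow> f z = k z" "\<And>n. A n \<in> carrier_mat (NN n) (NN n)"
    by (rule rhoE[OF assms(1)]) blast
  obtain B h where B: "glt' B h" "\<And>n. T n = restr n (B n)" "\<And>z. z \<in> red_dom \<Longrightarrow> g z = h z" "\<And>n. B n \<in> carrier_mat (NN n) (NN n)"
    by (rule rhoE[OF assms(2)]) blast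
  show ?thesis
  proof (rule rhoI[OF glt'_mult[OF glt'_mult[OF A(1) glt'_proj] B(1)]])
    show "S n * T n = restr n (A n * proj n * B n)" for n unfolding restr_mult[OF A(4) B(4), symmetric] A(2) B(2) ..
    show "f z * g z = k z * indicator \<Omega> (fst z) * h z" if "z \<in> red_dom" for z
      using A(3)[OF that] B(3)[OF that] that by (auto simp: indicator_def)
  qed
qed

lemma rho_smult: assumes "rho S f" shows "rho (\<lambda>n. a \<cdot>\<^sub>m S n) (\<lambda>z. a * f z)"
proof -
  obtain A k where A: "glt' A k" "\<And>n. S n = restr n (A n)" "\<And>z. z \<in> red_dom \<Longrightarrow> f z = k z" "\<And>n. A n \<in> carrier_mat (NN n) (NN n)"
    by (rule rhoE[OF assms(1)]) blast
  show ?thesis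
  proof (rule rhoI[OF glt'_smult[OF A(1)]])
    show "a \<cdot>\<^sub>m S n = restr n (a \<cdot>\<^sub>m A n)" for n unfolding restr_smult[OF A(4)] A(2) ..
    show "a * f z = a * k z" if "z \<in> red_dom" for z using A(3)[OF that] by simp
  qed
qed

lemma rho_scalar: "rho (\<lambda>n. a \<cdot>\<^sub>m 1\<^sub>m (dd n)) (\<lambda>z. a)"
proof (rule rhoI[OF glt'_scalar[of a]])
  show "a \<cdot>\<^sub>m 1\<^sub>m (dd n) = restr n (a \<cdot>\<^sub>m 1\<^sub>m (NN n))" for n
    unfolding restr_smult[OF one_carrier_mat] restr_one ..
qed simp

lemma rho_one: "rho (\<lambda>n. 1\<^sub>m (dd n)) (\<lambda>z. 1)"
proof -
  have "(\<lambda>n. (1 :: complex) \<cdot>\<^sub>m 1\<^sub>m (dd n)) = (\<lambda>n. 1\<^sub>m (dd n))" by (rule ext, rule eq_matI) auto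
  with rho_scalar[of 1] show ?thesis by (simp only:)
qed

lemma rho_zero: "rho (\<lambda>n. 0\<^sub>m (dd n) (dd n)) (\<lambda>z. 0)"
proof -
  have "(\<lambda>n. (0 :: complex) \<cdot>\<^sub>m 1\<^sub>m (dd n)) = (\<lambda>n. 0\<^sub>m (dd n) (dd n))" by (rule ext, rule eq_matI) auto
  with rho_scalar[of 0] show ?thesis by (simp only:)
qed

text \<open>Extension by zero keeps the function measurable, as \<open>red_dom\<close> is
  measurable, and \<open>glt'_exists\<close> then gives a sequence at full size to restrict.\<close>

lemma rho_onto: assumes f: "f \<in> borel_measurable (lebesgue_on red_dom)" shows "\<exists>S. rho S f"
proof -
  have "(\<lambda>z. if z \<in> red_dom then f z else 0) \<in> borel_measurable lebesgue"
    by (rule borel_measurable_if_I[OF f sets_red_dom])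
  then have "(\<lambda>z. if z \<in> red_dom then f z else 0) \<in> borel_measurable (lebesgue_on sdom)"
    by (rule measurable_restrict_space1)
  then obtain A where A: "glt' A (\<lambda>z. if z \<in> red_dom then f z else 0)" using glt'_exists by blast
  have "rho (\<lambda>n. restr n (A n)) f" by (rule rhoI[OF A]) auto
  then show ?thesis by (intro exI[of _ "\<lambda>n. restr n (A n)"])
qed

text \<open>Any symbol of \<open>S\<close> may be used for the test, since related functions agree
  with it at every point of \<open>red_dom\<close>.\<close>

lemma rho_kernel: assumes "rho S f" shows "S \<in> Z_ideal \<nn> \<Omega> \<longleftrightarrow> f \<in> null_funs red_dom"
proof -
  obtain A k where A: "glt' A k" "\<And>n. S n = restr n (A n)" "\<And>z. z \<in> red_dom \<Longrightarrow> f z = k z" "\<And>n. A n \<in> carrier_mat (NN n) (NN n)"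
    by (rule rhoE[OF assms(1)]) blast
  have "S = (\<lambda>n. restr n (A n))" by (rule ext) (rule A(2))
  then have "S \<in> Z_ideal \<nn> \<Omega> \<longleftrightarrow> (AE z in lebesgue_on red_dom. k z = 0)"
    unfolding Z_ideal_def mem_Collect_eq by (simp only: zero_distributed_restr_iff[OF A(1)])
  also have "\<dots> \<longleftrightarrow> (AE z in lebesgue_on red_dom. f z = 0)"
    by (rule AE_cong) (use A(3) in \<open>simp add: space_restrict_space\<close>)
  also have "\<dots> \<longleftrightarrow> f \<in> null_funs red_dom" using rho_measurable[OF assms] by (simp add: null_funs_def)
  finally show ?thesis .
qed

text \<open>A zero-distributed sequence does not come as a restriction, so it has to be shown to be
  a reduced GLT sequence: its extension by zeros is small, hence GLT with symbol 0, and restricts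
  back to it.\<close>

lemma zero_distributed_rho: assumes zd: "zero_distributed \<nn> \<Omega> Z" shows "rho Z (\<lambda>z. 0)"
proof -
  have Z: "Z n \<in> carrier_mat (dd n) (dd n)" for n using zd unfolding zero_distributed_iff by blast
  have sq: "\<forall>\<epsilon>>0. sq_le (\<lambda>n. ext n (Z n)) \<epsilon> \<epsilon>" using zd unfolding zero_distributed_iff_ext[OF Z] .
  define c :: "int ^ 'd::{finite,linorder} \<Rightarrow> real ^ 'd::{finite,linorder} \<Rightarrow> complex" where "c = (\<lambda>l x. 0)"
  have c: "elem c" by (simp add: elem_def c_def)
  have symb_c: "symb c = (\<lambda>z. 0)" by (rule ext) (auto simp: symb_def c_def)
  have eq: "ext n (Z n) - Op (\<nn> n) c = ext n (Z n)" for n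
    using ext_carrier[OF Z, of n] by (intro eq_matI) (auto simp: Op_index c_def)
  have "glt' (\<lambda>n. ext n (Z n)) (\<lambda>z. 0)"
  proof (rule glt'I[OF ext_carrier[OF Z]])
    fix \<epsilon> :: real assume e: "\<epsilon> > 0"
    have "fsplits (\<lambda>z. symb c z - 0) \<epsilon> \<epsilon>" unfolding symb_c
      by (rule fsplits_mono[OF fsplits_bounded[of _ 0]]) (use e in auto)
    moreover have "sq_le (\<lambda>n. ext n (Z n) - Op (\<nn> n) c) \<epsilon> \<epsilon>" unfolding eq using sq e by blast
    ultimately show "\<exists>c. elem c \<and> sq_le (\<lambda>n. ext n (Z n) - Op (\<nn> n) c) \<epsilon> \<epsilon> \<and> fsplits (\<lambda>z. symb c z - 0) \<epsilon> \<epsilon>"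
      by (intro exI[of _ c] conjI c)
  qed simp
  then show ?thesis by (rule rhoI) (simp_all add: restr_ext[OF Z])
qed

section \<open>The algebra of reduced GLT sequences and its ideal\<close>

lemma G_alg_simps:
  "carrier (G_alg \<nn> \<Omega>) = {S. \<exists>f. rho S f}"
  "S \<otimes>\<^bsub>G_alg \<nn> \<Omega>\<^esub> T = (\<lambda>n. S n * T n)" "S \<oplus>\<^bsub>G_alg \<nn> \<Omega>\<^esub> T = (\<lambda>n. S n + T n)"
  "\<one>\<^bsub>G_alg \<nn> \<Omega>\<^esub> = (\<lambda>n. 1\<^sub>m (dd n))" "\<zero>\<^bsub>G_alg \<nn> \<Omega>\<^esub> = (\<lambda>n. 0\<^sub>m (dd n) (dd n))"
  "a \<odot>\<^bsub>G_alg \<nn> \<Omega>\<^esub> S = (\<lambda>n. a \<cdot>\<^sub>m S n)"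
proof -
  have "{S. \<exists>k. reduced_glt \<nn> \<Omega> S k} = {S. \<exists>f. rho S f}" using reduced_glt_rho rho_reduced by blast
  then show "carrier (G_alg \<nn> \<Omega>) = {S. \<exists>f. rho S f}" by (simp add: G_alg_def)
qed (simp_all add: G_alg_def)

lemma G_alg_mat: "S \<in> carrier (G_alg \<nn> \<Omega>) \<Longrightarrow> S n \<in> carrier_mat (dd n) (dd n)"
  using rho_carrier unfolding G_alg_simps by blast

lemma G_alg_closed:
  assumes "S \<in> carrier (G_alg \<nn> \<Omega>)" "T \<in> carrier (G_alg \<nn> \<Omega>)"
  shows "S \<otimes>\<^bsub>G_alg \<nn> \<Omega>\<^esub> T \<in> carrier (G_alg \<nn> \<Omega>)" "S \<oplus>\<^bsub>G_alg \<nn> \<Omega>\<^esub> T \<in> carrier (G_alg \<nn> \<Omega>)"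
    "a \<odot>\<^bsub>G_alg \<nn> \<Omega>\<^esub> S \<in> carrier (G_alg \<nn> \<Omega>)"
  using assms rho_mult rho_add rho_smult unfolding G_alg_simps mem_Collect_eq by blast+

lemma mat_smult_minus_add:
  fixes M :: "complex mat"
  assumes "M \<in> carrier_mat n m" shows "(-1) \<cdot>\<^sub>m M + M = 0\<^sub>m n m" "M + (-1) \<cdot>\<^sub>m M = 0\<^sub>m n m"
  using assms by (auto intro!: eq_matI)

lemma assoc_algebra_G_alg: "assoc_algebra class_ring (G_alg \<nn> \<Omega>)"
proof -
  let ?G = "G_alg \<nn> \<Omega>"
  note c = G_alg_mat
  have ab: "abelian_group ?G"
  proof (rule abelian_groupI)
    show "S \<oplus>\<^bsub>?G\<^esub> T \<in> carrier ?G" if "S \<in> carrier ?G" "T \<in> carrier ?G" for S T by (rule G_alg_closed(2)[OF that])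
    show "\<zero>\<^bsub>?G\<^esub> \<in> carrier ?G" unfolding G_alg_simps using rho_zero by blast
    show "S \<oplus>\<^bsub>?G\<^esub> T \<oplus>\<^bsub>?G\<^esub> U = S \<oplus>\<^bsub>?G\<^esub> (T \<oplus>\<^bsub>?G\<^esub> U)" if "S \<in> carrier ?G" "T \<in> carrier ?G" "U \<in> carrier ?G" for S T U
      unfolding G_alg_simps by (rule ext) (rule assoc_add_mat[OF c[OF that(1)] c[OF that(2)] c[OF that(3)]])
    show "S \<oplus>\<^bsub>?G\<^esub> T = T \<oplus>\<^bsub>?G\<^esub> S" if "S \<in> carrier ?G" "T \<in> carrier ?G" for S T
      unfolding G_alg_simps by (rule ext) (rule comm_add_mat[OF c[OF that(1)] c[OF that(2)]])
    show "\<zero>\<^bsub>?G\<^esub> \<oplus>\<^bsub>?G\<^esub> S = S" if "S \<in> carrier ?G" for S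
      unfolding G_alg_simps by (rule ext) (rule left_add_zero_mat[OF c[OF that]])
    show "\<exists>T\<in>carrier ?G. T \<oplus>\<^bsub>?G\<^esub> S = \<zero>\<^bsub>?G\<^esub>" if S: "S \<in> carrier ?G" for S
    proof (rule bexI[OF _ G_alg_closed(3)[OF S S, of "-1"]])
      show "((-1) \<odot>\<^bsub>?G\<^esub> S) \<oplus>\<^bsub>?G\<^esub> S = \<zero>\<^bsub>?G\<^esub>"
        unfolding G_alg_simps by (rule ext) (rule mat_smult_minus_add(1)[OF c[OF S]])
    qed
  qed
  have mon: "Group.monoid ?G"
  proof (rule monoidI)
    show "S \<otimes>\<^bsub>?G\<^esub> T \<in> carrier ?G" if "S \<in> carrier ?G" "T \<in> carrier ?G" for S T by (rule G_alg_closed(1)[OF that])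
    show "\<one>\<^bsub>?G\<^esub> \<in> carrier ?G" unfolding G_alg_simps using rho_one by blast
    show "S \<otimes>\<^bsub>?G\<^esub> T \<otimes>\<^bsub>?G\<^esub> U = S \<otimes>\<^bsub>?G\<^esub> (T \<otimes>\<^bsub>?G\<^esub> U)" if "S \<in> carrier ?G" "T \<in> carrier ?G" "U \<in> carrier ?G" for S T U
      unfolding G_alg_simps by (rule ext) (rule assoc_mult_mat[OF c[OF that(1)] c[OF that(2)] c[OF that(3)]])
    show "\<one>\<^bsub>?G\<^esub> \<otimes>\<^bsub>?G\<^esub> S = S" if "S \<in> carrier ?G" for S
      unfolding G_alg_simps by (rule ext) (rule left_mult_one_mat[OF c[OF that]])
    show "S \<otimes>\<^bsub>?G\<^esub> \<one>\<^bsub>?G\<^esub> = S" if "S \<in> carrier ?G" for S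
      unfolding G_alg_simps by (rule ext) (rule right_mult_one_mat[OF c[OF that]])
  qed
  have rg: "ring ?G"
  proof (rule ringI[OF ab mon])
    show "(S \<oplus>\<^bsub>?G\<^esub> T) \<otimes>\<^bsub>?G\<^esub> U = S \<otimes>\<^bsub>?G\<^esub> U \<oplus>\<^bsub>?G\<^esub> T \<otimes>\<^bsub>?G\<^esub> U" if "S \<in> carrier ?G" "T \<in> carrier ?G" "U \<in> carrier ?G" for S T U
      unfolding G_alg_simps by (rule ext) (rule add_mult_distrib_mat[OF c[OF that(1)] c[OF that(2)] c[OF that(3)]])
    show "U \<otimes>\<^bsub>?G\<^esub> (S \<oplus>\<^bsub>?G\<^esub> T) = U \<otimes>\<^bsub>?G\<^esub> S \<oplus>\<^bsub>?G\<^esub> U \<otimes>\<^bsub>?G\<^esub> T" if "S \<in> carrier ?G" "T \<in> carrier ?G" "U \<in> carrier ?G" for S T U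
      unfolding G_alg_simps by (rule ext) (rule mult_add_distrib_mat[OF c[OF that(3)] c[OF that(1)] c[OF that(2)]])
  qed
  have md: "module class_ring ?G"
  proof (rule moduleI[OF cring_class_ring ab])
    show "a \<odot>\<^bsub>?G\<^esub> S \<in> carrier ?G" if "S \<in> carrier ?G" for a S by (rule G_alg_closed(3)[OF that that])
    show "(a \<oplus>\<^bsub>class_ring\<^esub> b) \<odot>\<^bsub>?G\<^esub> S = a \<odot>\<^bsub>?G\<^esub> S \<oplus>\<^bsub>?G\<^esub> b \<odot>\<^bsub>?G\<^esub> S" if "S \<in> carrier ?G" for a b S
      unfolding G_alg_simps using add_smult_distrib_right_mat[OF c[OF that]] by (intro ext) simp
    show "a \<odot>\<^bsub>?G\<^esub> (S \<oplus>\<^bsub>?G\<^esub> T) = a \<odot>\<^bsub>?G\<^esub> S \<oplus>\<^bsub>?G\<^esub> a \<odot>\<^bsub>?G\<^esub> T" if "S \<in> carrier ?G" "T \<in> carrier ?G" for a S T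
      unfolding G_alg_simps by (rule ext) (rule add_smult_distrib_left_mat[OF c[OF that(1)] c[OF that(2)]])
    show "(a \<otimes>\<^bsub>class_ring\<^esub> b) \<odot>\<^bsub>?G\<^esub> S = a \<odot>\<^bsub>?G\<^esub> (b \<odot>\<^bsub>?G\<^esub> S)" for a b S
      unfolding G_alg_simps by (rule ext, rule eq_matI) auto
    show "\<one>\<^bsub>class_ring\<^esub> \<odot>\<^bsub>?G\<^esub> S = S" for S
      unfolding G_alg_simps by (rule ext, rule eq_matI) auto
  qed
  show ?thesis
  proof (rule assoc_algebraI[OF md rg])
    show "(a \<odot>\<^bsub>?G\<^esub> S) \<otimes>\<^bsub>?G\<^esub> T = a \<odot>\<^bsub>?G\<^esub> (S \<otimes>\<^bsub>?G\<^esub> T)" if "S \<in> carrier ?G" "T \<in> carrier ?G" for a S T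
      unfolding G_alg_simps by (rule ext) (rule mult_smult_assoc_mat[OF c[OF that(1)] c[OF that(2)]])
    show "S \<otimes>\<^bsub>?G\<^esub> (a \<odot>\<^bsub>?G\<^esub> T) = a \<odot>\<^bsub>?G\<^esub> (S \<otimes>\<^bsub>?G\<^esub> T)" if "S \<in> carrier ?G" "T \<in> carrier ?G" for a S T
      unfolding G_alg_simps by (rule ext) (rule mult_smult_distrib[OF c[OF that(1)] c[OF that(2)]])
  qed
qed

lemma Z_ideal_rho: "S \<in> Z_ideal \<nn> \<Omega> \<Longrightarrow> rho S (\<lambda>z. 0)"
  unfolding Z_ideal_def by (simp add: zero_distributed_rho)

lemma null_funs_zero: "(\<lambda>z. 0) \<in> null_funs D"
  by (simp add: null_funs_def)

text \<open>Every closure property is computed on symbols: members of the ideal are related to the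
  zero function, sums and products with it remain zero, and \<open>rho_kernel\<close> leads back to
  the ideal.\<close>

lemma ideal_Z_ideal: "ideal (Z_ideal \<nn> \<Omega>) (G_alg \<nn> \<Omega>)"
proof -
  let ?G = "G_alg \<nn> \<Omega>" and ?Z = "Z_ideal \<nn> \<Omega>"
  interpret G: assoc_algebra class_ring ?G by (rule assoc_algebra_G_alg)
  have zero: "S \<in> ?Z" if "rho S f" "\<And>z. f z = 0" for S f
  proof -
    have "f = (\<lambda>z. 0)" using that(2) by (rule ext)
    then show ?thesis using rho_kernel[OF that(1)] null_funs_zero by simp
  qed
  show ?thesis
  proof (rule idealI[OF G.ring_axioms])
    show "subgroup ?Z (add_monoid ?G)"
    proof (rule G.add.subgroupI)
      show "?Z \<subseteq> carrier ?G" unfolding G_alg_simps using Z_ideal_rho by blast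
      show "?Z \<noteq> {}" using zero[OF rho_zero] by blast
      show "\<ominus>\<^bsub>?G\<^esub> S \<in> ?Z" if S: "S \<in> ?Z" for S
      proof -
        have "S \<in> carrier ?G" unfolding G_alg_simps using Z_ideal_rho[OF S] by blast
        from minus_eq_smult[OF assoc_algebra_G_alg this] show ?thesis
          unfolding G_alg_simps using zero[OF rho_smult[OF Z_ideal_rho[OF S]]] by simp
      qed
      show "S \<oplus>\<^bsub>?G\<^esub> T \<in> ?Z" if "S \<in> ?Z" "T \<in> ?Z" for S T
        unfolding G_alg_simps by (rule zero[OF rho_add[OF that[THEN Z_ideal_rho]]]) simp
    qed
    show "S \<otimes>\<^bsub>?G\<^esub> T \<in> ?Z" if S: "S \<in> ?Z" and T: "T \<in> carrier ?G" for S T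
    proof -
      obtain g where "rho T g" using T unfolding G_alg_simps by blast
      from rho_mult[OF Z_ideal_rho[OF S] this] show ?thesis unfolding G_alg_simps by (rule zero) simp
    qed
    show "T \<otimes>\<^bsub>?G\<^esub> S \<in> ?Z" if S: "S \<in> ?Z" and T: "T \<in> carrier ?G" for S T
    proof -
      obtain g where "rho T g" using T unfolding G_alg_simps by blast
      from rho_mult[OF this Z_ideal_rho[OF S]] show ?thesis unfolding G_alg_simps by (rule zero) simp
    qed
  qed
qed

text \<open>Subtracting the two relations shows that \<open>f - g\<close> is related to the zero
  sequence, so \<open>rho_kernel\<close> makes it a null function.\<close>

lemma rho_unique:
  assumes "rho S f" "rho S g"
  shows "null_funs red_dom +>\<^bsub>meas_alg red_dom\<^esub> f = null_funs red_dom +>\<^bsub>meas_alg red_dom\<^esub> g"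
proof -
  have m: "f \<in> carrier (meas_alg red_dom)" "g \<in> carrier (meas_alg red_dom)"
    using rho_measurable[OF assms(1)] rho_measurable[OF assms(2)] by (simp_all add: meas_alg_def)
  have "(\<lambda>n. S n + (-1) \<cdot>\<^sub>m S n) = (\<lambda>n. 0\<^sub>m (dd n) (dd n))"
    by (rule ext) (rule mat_smult_minus_add(2)[OF rho_carrier[OF assms(1)]])
  then have "rho (\<lambda>n. 0\<^sub>m (dd n) (dd n)) (\<lambda>z. f z + (-1) * g z)"
    using rho_add[OF assms(1) rho_smult[OF assms(2), of "-1"]] by (simp only:)
  then have "(\<lambda>z. f z + (-1) * g z) \<in> null_funs red_dom"
    using rho_kernel[OF rho_zero] rho_kernel null_funs_zero by blast
  then have "f \<oplus>\<^bsub>meas_alg red_dom\<^esub> (\<ominus>\<^bsub>meas_alg red_dom\<^esub> g) \<in> null_funs red_dom"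
    unfolding meas_alg_minus[OF m(2)] by (simp add: meas_alg_def)
  then show ?thesis using coset_eq_iff[OF ideal_null_funs m] by blast
qed

text \<open>All symbols of all members of the coset lie in one class, so the union in
  \<open>symbol_map\<close> collapses to it; it is not an empty union, because \<open>S\<close> is a
  member and has a symbol.\<close>

lemma symbol_map_coset:
  assumes S: "rho S f"
  shows "symbol_map \<nn> \<Omega> (Z_ideal \<nn> \<Omega> +>\<^bsub>G_alg \<nn> \<Omega>\<^esub> S) = null_funs red_dom +>\<^bsub>meas_alg red_dom\<^esub> f"
proof -
  interpret Z: ideal "Z_ideal \<nn> \<Omega>" "G_alg \<nn> \<Omega>" by (rule ideal_Z_ideal)
  have "ae_class \<Omega> k = null_funs red_dom +>\<^bsub>meas_alg red_dom\<^esub> f"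
    if T: "T \<in> Z_ideal \<nn> \<Omega> +>\<^bsub>G_alg \<nn> \<Omega>\<^esub> S" and k: "reduced_glt \<nn> \<Omega> T k" for T k
  proof -
    obtain Z where Z: "Z \<in> Z_ideal \<nn> \<Omega>" "T = (\<lambda>n. Z n + S n)" using T unfolding a_r_coset_def' G_alg_simps by blast
    have "rho T f" unfolding Z(2) using rho_add[OF Z_ideal_rho[OF Z(1)] S] by simp
    from rho_unique[OF reduced_glt_rho[OF k] this] show ?thesis unfolding ae_class_def .
  qed
  moreover have "S \<in> Z_ideal \<nn> \<Omega> +>\<^bsub>G_alg \<nn> \<Omega>\<^esub> S"
  proof -
    have "S \<in> carrier (G_alg \<nn> \<Omega>)" unfolding G_alg_simps using S by blast
    then show ?thesis by (rule Z.a_rcos_self)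
  qed
  moreover obtain k where "reduced_glt \<nn> \<Omega> S k" using rho_reduced[OF S] by blast
  ultimately show ?thesis unfolding symbol_map_def by blast
qed

end

text \<open>As \<open>symbol_map\<close> is defined by a union, the isomorphism is accompanied by
  its value: the class of \<open>S\<close> goes to the class of any reduced symbol of
  \<open>S\<close>. The conjuncts on algebras and on the ideal ensure that \<open>alg_iso\<close> is
  applied to genuine algebras.\<close>

theorem lemma4p4:
  fixes \<nn> :: "nat \<Rightarrow> nat ^ 'd::{finite,linorder}"
    and \<Omega> :: "(real ^ 'd::{finite,linorder}) set"
  assumes "filterlim (\<lambda>n. Min (range (\<lambda>j. \<nn> n $ j))) at_top sequentially"
    and "\<Omega> \<subseteq> cbox 0 1"
    and "peano_jordan \<Omega>"
    and "emeasure lebesgue \<Omega> > 0"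
  shows "assoc_algebra class_ring (G_alg \<nn> \<Omega>)
    \<and> ideal (Z_ideal \<nn> \<Omega>) (G_alg \<nn> \<Omega>)
    \<and> assoc_algebra class_ring (FactAlg (G_alg \<nn> \<Omega>) (Z_ideal \<nn> \<Omega>))
    \<and> assoc_algebra class_ring (M_alg \<Omega>)
    \<and> (\<forall>S k. reduced_glt \<nn> \<Omega> S k \<longrightarrow>
          symbol_map \<nn> \<Omega> (Z_ideal \<nn> \<Omega> +>\<^bsub>G_alg \<nn> \<Omega>\<^esub> S) = ae_class \<Omega> k)
    \<and> symbol_map \<nn> \<Omega> \<in>
        alg_iso class_ring (FactAlg (G_alg \<nn> \<Omega>) (Z_ideal \<nn> \<Omega>)) (M_alg \<Omega>)"
proof -
  interpret grid_domain \<nn> \<Omega>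
    by (intro grid_domain.intro grid.intro grid_domain_axioms.intro assms)
  have "symbol_map \<nn> \<Omega> \<in> alg_iso class_ring (FactAlg (G_alg \<nn> \<Omega>) (Z_ideal \<nn> \<Omega>)) (FactAlg (meas_alg red_dom) (null_funs red_dom))"
  \<comment> \<open>The relation \<open>rho\<close> replaces \<open>reduced_glt\<close> here because
    only \<open>rho\<close> is closed under the pointwise product of symbols as stated.\<close>
  proof (rule quotient_iso[where \<rho>=rho, OF assoc_algebra_G_alg assoc_algebra_meas_alg ideal_null_funs ideal_Z_ideal])
    show "S \<in> carrier (G_alg \<nn> \<Omega>) \<longleftrightarrow> (\<exists>f. rho S f)" for S unfolding G_alg_simps by simp
    show "f \<in> carrier (meas_alg red_dom)" if "rho S f" for S f using rho_measurable[OF that] by (simp add: meas_alg_def)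
    show "\<exists>S. rho S f" if "f \<in> carrier (meas_alg red_dom)" for f using rho_onto[of f] that by (simp add: meas_alg_def)
    show "rho (S \<otimes>\<^bsub>G_alg \<nn> \<Omega>\<^esub> T) (f \<otimes>\<^bsub>meas_alg red_dom\<^esub> g)" if "rho S f" "rho T g" for S f T g
      using rho_mult[OF that] unfolding G_alg_simps by (simp add: meas_alg_def)
    show "rho (S \<oplus>\<^bsub>G_alg \<nn> \<Omega>\<^esub> T) (f \<oplus>\<^bsub>meas_alg red_dom\<^esub> g)" if "rho S f" "rho T g" for S f T g
      using rho_add[OF that] unfolding G_alg_simps by (simp add: meas_alg_def)
    show "rho (a \<odot>\<^bsub>G_alg \<nn> \<Omega>\<^esub> S) (a \<odot>\<^bsub>meas_alg red_dom\<^esub> f)" if "rho S f" for a S f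
      using rho_smult[OF that, of a] unfolding G_alg_simps by (simp add: meas_alg_def)
    show "rho \<one>\<^bsub>G_alg \<nn> \<Omega>\<^esub> \<one>\<^bsub>meas_alg red_dom\<^esub>"
      using rho_one unfolding G_alg_simps by (simp add: meas_alg_def)
  qed (fact rho_kernel symbol_map_coset)+
  moreover have "symbol_map \<nn> \<Omega> (Z_ideal \<nn> \<Omega> +>\<^bsub>G_alg \<nn> \<Omega>\<^esub> S) = ae_class \<Omega> k" if "reduced_glt \<nn> \<Omega> S k" for S k
    using symbol_map_coset[OF reduced_glt_rho[OF that]] unfolding ae_class_def .
  ultimately show ?thesis
    unfolding M_alg_def
    by (intro conjI allI impI assoc_algebra_G_alg ideal_Z_ideal assoc_algebra_meas_alg ideal_null_funs
        assoc_algebra_FactAlg)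
qed

end
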